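(* Let $s>\frac d2$, $\sigma\ge 2$, $M\ge 1$, $T>0$ and $0<c<2\pi$. There exist constants $C$, $K_0$ and $\tau_0>0$, depending only on $s,\sigma,M,T,d$ and $c$, such that the following holds. Assume that the exact solution $(\psi,u,\dot u)$ of the Zakharov system $$i\partial_t\psi=-\Delta\psi+u\psi,\qquad \partial_t u=\dot u,\qquad \partial_t\dot u=\Delta u+\Delta|\psi|^2$$ on $\mathbb{T}^d$ satisfies $$\|\psi(t)\|_{s+2+\sigma}+|\!|\!|(u(t),\dot u(t))|\!|\!|_{s+\sigma}\le M\qquad\text{for } 0\le t-t_0\le T.$$ Then, for every time step-size $0<\tau\le\tau_0$ and every spatial discretization parameter $K\ge K_0$ satisfying the CFL-type restriction $d\,\tau K^2\le c$, the numerical solution $(\psi_n^K,u_n^K,\dot u_n^K)$ of the Lie--Trotter splitting (defined in the context) satisfies $$\|\psi(t_n)-\psi_n^K\|_{s+2}+|\!|\!|(u(t_n),\dot u(t_n))-(u_n^K,\dot u_n^K)|\!|\!|_{s}\le C(\tau+K^{-\sigma})\qquad\text{for } 0\le t_n-t_0=n\tau\le T.$$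
   Context: Notation: $\mathbb{T}^d=\mathbb{R}^d/(2\pi\mathbb{Z}^d)$; $\psi(t)=\psi(\cdot,t)$ is complex-valued, $u(t),\dot u(t)$ are real-valued functions on $\mathbb{T}^d$. For $v(x)=\sum_{j\in\mathbb{Z}^d}v_j e^{ij\cdot x}$ put $\|v\|_s=\big(\sum_{j}\max(|j|,1)^{2s}|v_j|^2\big)^{1/2}$, where $|j|^2=j_1^2+\dots+j_d^2$; $H^s=H^s(\mathbb{T}^d)$ is the corresponding Sobolev space. On $H^{s+1}\times H^s$ use $|\!|\!|(v,\dot v)|\!|\!|_s=(\|v\|_{s+1}^2+\|\dot v\|_s^2)^{1/2}$. $\Omega$ is the operator multiplying the $j$th Fourier coefficient by $|j|$ (so $\Omega^2=-\Delta$); functions of $\Omega$ act as Fourier multipliers; $\mathrm{sinc}(\xi)=\sin(\xi)/\xi$, $\mathrm{sinc}(0)=1$. For an integer $K\ge1$ let $\mathcal K=\{-K,\dots,K-1\}^d$; trigonometric polynomials of degree $K$ are $\sum_{j\in\mathcal K}v_je^{ij\cdot x}$; $\mathcal I(v)$ is the unique trigonometric polynomial of degree $K$ agreeing with $v$ at the points $x_k=k\pi/K$, $k\in\mathcal K$. Lie--Trotter splitting with time step-size $\tau$: with $t_n=t_0+n\tau$ and $$R(\tau)=\begin{pmatrix}\cos(\tau\Omega)&\tau\,\mathrm{sinc}(\tau\Omega)\\-\Omega\sin(\tau\Omega)&\cos(\tau\Omega)\end{pmatrix},$$ set $\psi_0^K=\mathcal I(\psi(t_0))$, $u_0^K=\mathcal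 I(u(t_0))$, $\dot u_0^K=\mathcal I(\dot u(t_0))$ and, for $n\ge0$, $$v_{n+1}^K=\mathrm{sinc}(\tau\Omega)u_n^K+\tfrac12\tau\,\mathrm{sinc}(\tfrac12\tau\Omega)^2\dot u_n^K+(\mathrm{sinc}(\tau\Omega)-1)\mathcal I(|\psi_n^K|^2),$$ $$\psi_{n+1}^K=e^{-i\tau\Omega^2}\mathcal I\big(e^{-i\tau v_{n+1}^K}\psi_n^K\big),\qquad \begin{pmatrix}u_{n+1}^K\\\dot u_{n+1}^K\end{pmatrix}=R(\tau)\begin{pmatrix}u_n^K\\\dot u_n^K\end{pmatrix}+(R(\tau)-1)\begin{pmatrix}\mathcal I(|\psi_n^K|^2)\\0\end{pmatrix}.$$ *)

theory Defs
  imports "HOL-Analysis.Analysis" "HOL-Probability.Sinc_Integral"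
begin

text \<open>Functions on the torus \<open>\<real>\<^sup>d / (2 \<pi> \<int>\<^sup>d)\<close> are functions on \<open>real ^ 'd\<close> that are
  \<open>2 \<pi>\<close>-periodic in every coordinate; the space dimension is \<open>CARD('d)\<close>.\<close>

definition freq :: "int ^ 'd \<Rightarrow> real ^ 'd::finite"
  where "freq j = (\<chi> i. of_int (j $ i))"

definition torus_fun :: "(real ^ 'd::finite \<Rightarrow> 'a) \<Rightarrow> bool"
  where "torus_fun v \<longleftrightarrow> (\<forall>x (j :: int ^ 'd). v (x + (2 * pi) *\<^sub>R freq j) = v x)"

definition torus_cell :: "(real ^ 'd::finite) set"
  where "torus_cell = cbox 0 (\<chi> i. 2 * pi)"

definition expi :: "int ^ 'd \<Rightarrow> real ^ 'd::finite \<Rightarrow> complex"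
  where "expi j x = cis (freq j \<bullet> x)"

definition fourier_coeff :: "(real ^ 'd::finite \<Rightarrow> complex) \<Rightarrow> int ^ 'd \<Rightarrow> complex"
  where "fourier_coeff v j =
    (LINT x:torus_cell|lebesgue. v x * cnj (expi j x)) / of_real ((2 * pi) ^ CARD('d))"

definition sobolev_density :: "real \<Rightarrow> (real ^ 'd::finite \<Rightarrow> complex) \<Rightarrow> int ^ 'd \<Rightarrow> real"
  where "sobolev_density s v j =
    max (norm (freq j)) 1 powr (2 * s) * (cmod (fourier_coeff v j))\<^sup>2"

text \<open>Elements of the Sobolev space are square-integrable functions, so this is \<open>H\<^sup>s\<close> for
  \<open>s \<ge> 0\<close> only. \<open>sobolev_norm s v\<close> is the norm of \<open>v\<close> only if \<open>v \<in> sobolev_space s\<close>: an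
  \<open>infsum\<close> that does not converge is 0.\<close>

definition sobolev_space :: "real \<Rightarrow> (real ^ 'd::finite \<Rightarrow> complex) set"
  where "sobolev_space s = {v. torus_fun v \<and> v \<in> borel_measurable lebesgue \<and>
    set_integrable lebesgue torus_cell (\<lambda>x. (cmod (v x))\<^sup>2) \<and>
    sobolev_density s v summable_on UNIV}"

definition sobolev_norm :: "real \<Rightarrow> (real ^ 'd::finite \<Rightarrow> complex) \<Rightarrow> real"
  where "sobolev_norm s v = sqrt (\<Sum>\<^sub>\<infinity>j. sobolev_density s v j)"

definition energy_space ::
    "real \<Rightarrow> ((real ^ 'd::finite \<Rightarrow> complex) \<times> (real ^ 'd \<Rightarrow> complex)) set"
  where "energy_space s = sobolev_space (s + 1) \<times> sobolev_space s"

definition energy_norm ::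
    "real \<Rightarrow> (real ^ 'd::finite \<Rightarrow> complex) \<times> (real ^ 'd \<Rightarrow> complex) \<Rightarrow> real"
  where "energy_norm s = (\<lambda>(v, v'). sqrt ((sobolev_norm (s + 1) v)\<^sup>2 + (sobolev_norm s v')\<^sup>2))"

text \<open>The Fourier multiplier \<open>\<phi>(\<Omega>)\<close>.\<close>

definition multiplier ::
    "(real \<Rightarrow> complex) \<Rightarrow> (real ^ 'd::finite \<Rightarrow> complex) \<Rightarrow> real ^ 'd \<Rightarrow> complex"
  where "multiplier \<phi> v x = (\<Sum>\<^sub>\<infinity>j. \<phi> (norm (freq j)) * fourier_coeff v j * expi j x)"

definition partial ::
    "'d \<Rightarrow> (real ^ 'd::finite \<Rightarrow> 'a::real_normed_vector) \<Rightarrow> real ^ 'd \<Rightarrow> 'a"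
  where "partial i f x = frechet_derivative f (at x) (axis i 1)"

definition laplacian ::
    "(real ^ 'd::finite \<Rightarrow> 'a::real_normed_vector) \<Rightarrow> real ^ 'd \<Rightarrow> 'a"
  where "laplacian f x = (\<Sum>i\<in>UNIV. partial i (partial i f) x)"

primrec C_k :: "nat \<Rightarrow> (real ^ 'd::finite \<Rightarrow> 'a::real_normed_vector) \<Rightarrow> bool"
  where
    "C_k 0 f \<longleftrightarrow> continuous_on UNIV f"
  | "C_k (Suc k) f \<longleftrightarrow> (\<forall>x. f differentiable at x) \<and> (\<forall>i. C_k k (partial i f))"

text \<open>Classical solutions on the time interval \<open>{a..b}\<close>, with one-sided time derivatives at
  the end points. The regularity in space selects the continuous representatives: it is
  implied for those in \<open>H\<^bsup>s+2+\<sigma>\<^esup> \<times> H\<^bsup>s+1+\<sigma>\<^esup> \<times> H\<^bsup>s+\<sigma>\<^esup>\<close> with \<open>s > d/2\<close> and \<open>\<sigma> \<ge> 2\<close>.\<close>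

definition zakharov_solution ::
    "real \<Rightarrow> real \<Rightarrow> (real \<Rightarrow> real ^ 'd::finite \<Rightarrow> complex) \<Rightarrow> (real \<Rightarrow> real ^ 'd \<Rightarrow> real) \<Rightarrow>
      (real \<Rightarrow> real ^ 'd \<Rightarrow> real) \<Rightarrow> bool"
  where "zakharov_solution a b \<psi> u u' \<longleftrightarrow>
    (\<forall>t\<in>{a..b}.
       torus_fun (\<psi> t) \<and> torus_fun (u t) \<and> torus_fun (u' t) \<and>
       C_k 2 (\<psi> t) \<and> C_k 2 (u t) \<and> C_k 0 (u' t) \<and>
       (\<forall>x. (\<lambda>r. \<psi> r x) differentiable at t within {a..b} \<and>
            \<i> * vector_derivative (\<lambda>r. \<psi> r x) (at t within {a..b}) =
              - laplacian (\<psi> t) x + of_real (u t x) * \<psi> t x \<and>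
            ((\<lambda>r. u r x) has_real_derivative u' t x) (at t within {a..b}) \<and>
            ((\<lambda>r. u' r x) has_real_derivative
              laplacian (u t) x + laplacian (\<lambda>y. (cmod (\<psi> t y))\<^sup>2) x) (at t within {a..b})))"

definition modes :: "nat \<Rightarrow> (int ^ 'd::finite) set"
  where "modes K = {j. \<forall>i. - int K \<le> j $ i \<and> j $ i < int K}"

definition trig_poly :: "nat \<Rightarrow> (real ^ 'd::finite \<Rightarrow> complex) \<Rightarrow> bool"
  where "trig_poly K v \<longleftrightarrow> (\<exists>a. v = (\<lambda>x. \<Sum>j\<in>modes K. a j * expi j x))"

definition grid_point :: "nat \<Rightarrow> int ^ 'd \<Rightarrow> real ^ 'd::finite"
  where "grid_point K k = (pi / real K) *\<^sub>R freq k"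

definition interp ::
    "nat \<Rightarrow> (real ^ 'd::finite \<Rightarrow> complex) \<Rightarrow> real ^ 'd \<Rightarrow> complex"
  where "interp K v =
    (THE p. trig_poly K p \<and> (\<forall>k\<in>modes K. p (grid_point K k) = v (grid_point K k)))"

text \<open>The wave propagator \<open>R(\<tau>)\<close> acting on pairs.\<close>

definition wave_R ::
    "real \<Rightarrow> (real ^ 'd::finite \<Rightarrow> complex) \<times> (real ^ 'd \<Rightarrow> complex) \<Rightarrow>
      (real ^ 'd \<Rightarrow> complex) \<times> (real ^ 'd \<Rightarrow> complex)"
  where "wave_R \<tau> = (\<lambda>(u, u').
    ((\<lambda>x. multiplier (\<lambda>\<omega>. cos (\<tau> * \<omega>)) u x + \<tau> * multiplier (\<lambda>\<omega>. sinc (\<tau> * \<omega>)) u' x),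
     (\<lambda>x. multiplier (\<lambda>\<omega>. - \<omega> * sin (\<tau> * \<omega>)) u x + multiplier (\<lambda>\<omega>. cos (\<tau> * \<omega>)) u' x)))"

text \<open>All components of the numerical solution are complex-valued: an interpolant of a
  real-valued function contains the modes with \<open>j\<^sub>i = -K\<close> but not those with \<open>j\<^sub>i = K\<close>,
  hence need not be real away from the grid points.\<close>

definition lt_step ::
    "real \<Rightarrow> nat \<Rightarrow>
      (real ^ 'd::finite \<Rightarrow> complex) \<times> (real ^ 'd \<Rightarrow> complex) \<times> (real ^ 'd \<Rightarrow> complex) \<Rightarrow>
      (real ^ 'd \<Rightarrow> complex) \<times> (real ^ 'd \<Rightarrow> complex) \<times> (real ^ 'd \<Rightarrow> complex)"
  where "lt_step \<tau> K = (\<lambda>(\<psi>, u, u').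
    let w = interp K (\<lambda>x. of_real ((cmod (\<psi> x))\<^sup>2));
        v = (\<lambda>x. multiplier (\<lambda>\<omega>. sinc (\<tau> * \<omega>)) u x
                 + \<tau> / 2 * multiplier (\<lambda>\<omega>. (sinc (\<tau> * \<omega> / 2))\<^sup>2) u' x
                 + multiplier (\<lambda>\<omega>. sinc (\<tau> * \<omega>) - 1) w x);
        (a, a') = wave_R \<tau> (u, u');
        (b, b') = wave_R \<tau> (w, \<lambda>x. 0)
    in (multiplier (\<lambda>\<omega>. exp (- \<i> * \<tau> * \<omega>\<^sup>2)) (interp K (\<lambda>x. exp (- \<i> * \<tau> * v x) * \<psi> x)),
        (\<lambda>x. a x + (b x - w x)),
        (\<lambda>x. a' x + b' x)))"

primrec lie_trotter ::
    "real \<Rightarrow> nat \<Rightarrow>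
      (real ^ 'd::finite \<Rightarrow> complex) \<times> (real ^ 'd \<Rightarrow> complex) \<times> (real ^ 'd \<Rightarrow> complex) \<Rightarrow> nat \<Rightarrow>
      (real ^ 'd \<Rightarrow> complex) \<times> (real ^ 'd \<Rightarrow> complex) \<times> (real ^ 'd \<Rightarrow> complex)"
  where
    "lie_trotter \<tau> K z 0 = (case z of (\<psi>, u, u') \<Rightarrow> (interp K \<psi>, interp K u, interp K u'))"
  | "lie_trotter \<tau> K z (Suc n) = lt_step \<tau> K (lie_trotter \<tau> K z n)"

end

theory Submission
  imports Defs
begin

text \<open>Each step of the splitting makes a local error of size \<open>\<tau> \<eta>\<close>, where
  \<open>\<eta> = \<tau> + K\<^sup>-\<^sup>\<sigma>\<close>, and the difficulty is stability. The potential of the Schroedinger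
  part is controlled in \<open>H\<^sup>s\<close> only, whereas a direct estimate of
  \<open>exp(i \<tau> \<Delta>) I(exp(-i \<tau> v) \<psi>)\<close> in \<open>H\<^sup>s\<^sup>+\<^sup>2\<close> needs \<open>v\<close> in \<open>H\<^sup>s\<^sup>+\<^sup>2\<close>; on the other hand the
  wave part contains \<open>\<Delta> |\<psi>|\<^sup>2\<close> and needs the error of \<open>\<psi>\<close> in \<open>H\<^sup>s\<^sup>+\<^sup>2\<close>. An estimate that treats
  the two components separately loses derivatives.

  The loss is repaired by trading derivatives in space for differences in time. With the spectral
  truncation of the exact solution as reference, the error of \<open>\<psi>\<close> satisfies
  \<open>e\<^sub>n\<^sub>+\<^sub>1 = exp(i \<tau> \<Delta>) (e\<^sub>n + \<tau> g\<^sub>n) + d\<^sub>n\<close>, where \<open>d\<^sub>n\<close> is the defect and \<open>g\<^sub>n\<close> is Lipschitz in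
  the errors with respect to the norm of \<open>H\<^sup>s\<close>. Hence \<open>(exp(i \<tau> \<Delta>) - 1) e\<^sub>n\<close> is expressed by
  \<open>D\<^sub>n = (e\<^sub>n\<^sub>+\<^sub>1 - e\<^sub>n) / \<tau>\<close>, \<open>g\<^sub>n\<close> and \<open>d\<^sub>n\<close>. The step-size restriction keeps \<open>\<tau> |j|\<^sup>2\<close> in
  \<open>[0, c]\<close> with \<open>c < 2 \<pi>\<close> on all modes, so that \<open>|exp(-i \<tau> |j|\<^sup>2) - 1|\<close> is bounded below by a multiple
  of \<open>\<tau> |j|\<^sup>2\<close>: there are no numerical resonances, and the norm of \<open>e\<^sub>n\<close> in \<open>H\<^sup>s\<^sup>+\<^sup>2\<close> is bounded by
  norms in \<open>H\<^sup>s\<close> of \<open>D\<^sub>n\<close>, \<open>e\<^sub>n\<close>, \<open>g\<^sub>n\<close> and \<open>d\<^sub>n / \<tau>\<close> (\<open>gnorm_cfl\<close>, \<open>psi_error_strong\<close>). The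
  differences \<open>D\<^sub>n\<close> are estimated in \<open>H\<^sup>s\<close> from the differenced recursion. It contains the time
  increment of the error of the potential, again in \<open>H\<^sup>s\<close> only, and this increment is of size
  \<open>\<tau>\<close> times the error because the wave group of one step differs from the identity by a multiple
  of \<open>\<tau>\<close> at the expense of one derivative (\<open>potential_error_increment\<close>, \<open>nonlinearity_error_increment\<close>).

  Altogether \<open>\<epsilon>\<^sub>n\<close>, the sum of the norms of \<open>D\<^sub>n\<close> and \<open>e\<^sub>n\<close> in \<open>H\<^sup>s\<close> and of the energy norm of
  the wave error, satisfies \<open>\<epsilon>\<^sub>n\<^sub>+\<^sub>1 \<le> \<epsilon>\<^sub>n + \<tau> c (\<epsilon>\<^sub>n + \<eta>)\<close> as long as \<open>\<epsilon>\<^sub>n \<le> 1\<close>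
  (\<open>error_recursion\<close>). By Gronwall's inequality \<open>\<epsilon>\<^sub>n\<close> is of size \<open>\<eta>\<close>, and for small \<open>\<eta>\<close>
  this keeps \<open>\<epsilon>\<^sub>n \<le> 1\<close> (\<open>error_bootstrap\<close>, \<open>grid_error_bound\<close>).

  The differenced recursion requires that the increments of the defects over one time step are of
  size \<open>\<tau>\<^sup>2 \<eta>\<close> (\<open>psi_defect_difference\<close>). This follows from bounds on first and second differences
  in time of the exact solution, which a mean value inequality gives from the differential equations
  of its Fourier coefficients (\<open>psi_lipschitz\<close>, \<open>psi_second_difference\<close>); each time derivative
  of \<open>\<psi>\<close> costs two derivatives in space, and \<open>\<sigma> \<ge> 2\<close> is what makes the count work.

  The analysis takes place on Fourier coefficients. Discrete Sobolev norms are
  submultiplicative for \<open>s > d/2\<close> (\<open>gnorm_mult\<close>), which gives the product estimate in the full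
  Sobolev space as a limit of fine grids (\<open>H_bound_mult\<close>) and estimates for exponentials by power
  series (\<open>gnorm_exp_tail\<close>); interpolation errors are aliasing sums (\<open>interpolation_error\<close>). The
  passage between functions and coefficients rests on the density of trigonometric polynomials in the
  continuous functions on the torus (\<open>tpoly_dense\<close>, \<open>fourier_inversion\<close>).\<close>

section \<open>Continuous functions on the torus\<close>

abbreviation fc where "fc \<equiv> fourier_coeff"

definition ctorus :: "(real ^ 'd::finite \<Rightarrow> complex) \<Rightarrow> bool"
  where "ctorus f \<longleftrightarrow> torus_fun f \<and> continuous_on UNIV f"

lemma freq_add: "freq (j + k) = freq j + freq k" by (simp add: freq_def vec_eq_iff)
lemma freq_minus: "freq (- k) = - freq k" by (simp add: freq_def vec_eq_iff)
lemma freq_0 [simp]: "freq 0 = 0" by (simp add: freq_def vec_eq_iff)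
lemma freq_inner: "freq j \<bullet> x = (\<Sum>i\<in>UNIV. of_int (j $ i) * x $ i)"
  by (simp add: inner_vec_def freq_def)
lemma freq_inner_freq_Ints: "freq j \<bullet> freq k \<in> \<int>"
  by (simp add: inner_vec_def freq_def Ints_sum)

lemma expi_add: "expi (j + k) x = expi j x * expi k x"
  by (simp add: expi_def freq_add inner_add_left cis_mult)
lemma expi_add_arg: "expi j (x + y) = expi j x * expi j y"
  by (simp add: expi_def inner_add_right cis_mult)
lemma expi_0 [simp]: "expi 0 x = 1" by (simp add: expi_def)
lemma expi_minus: "expi (- j) x = cnj (expi j x)"
  by (simp add: expi_def freq_minus cis_cnj)
lemma expi_diff: "expi (j - k) x = expi j x * cnj (expi k x)"
  using expi_add[of j "-k" x] by (simp add: expi_minus)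
lemma norm_expi [simp]: "norm (expi j x) = 1" by (simp add: expi_def)
lemma expi_cnj_self [simp]: "expi j x * cnj (expi j x) = 1"
  by (simp flip: expi_diff)
lemma continuous_expi [continuous_intros]: "continuous_on A (expi j)"
  unfolding expi_def by (intro continuous_intros)

lemma cis_2pi_Ints: "n \<in> \<int> \<Longrightarrow> cis (2 * pi * n) = 1"
  by (metis cis_multiple_2pi)

lemma torus_fun_expi: "torus_fun (expi j)"
  unfolding torus_fun_def expi_def
  by (simp add: inner_add_right cis_2pi_Ints freq_inner_freq_Ints flip: cis_mult)

lemma ctorus_expi [simp]: "ctorus (expi j)"
  by (simp add: ctorus_def torus_fun_expi continuous_expi)
lemma ctorus_const [simp]: "ctorus (\<lambda>x. c)"
  by (simp add: ctorus_def torus_fun_def)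
lemma ctorus_add: "ctorus f \<Longrightarrow> ctorus g \<Longrightarrow> ctorus (\<lambda>x. f x + g x)"
  by (auto simp: ctorus_def torus_fun_def intro: continuous_intros)
lemma ctorus_diff: "ctorus f \<Longrightarrow> ctorus g \<Longrightarrow> ctorus (\<lambda>x. f x - g x)"
  by (auto simp: ctorus_def torus_fun_def intro: continuous_intros)
lemma ctorus_mult: "ctorus f \<Longrightarrow> ctorus g \<Longrightarrow> ctorus (\<lambda>x. f x * g x)"
  by (auto simp: ctorus_def torus_fun_def intro: continuous_intros)
lemma ctorus_minus: "ctorus f \<Longrightarrow> ctorus (\<lambda>x. - f x)"
  by (auto simp: ctorus_def torus_fun_def intro: continuous_intros)
lemma ctorus_cnj: "ctorus f \<Longrightarrow> ctorus (\<lambda>x. cnj (f x))"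
  by (auto simp: ctorus_def torus_fun_def intro: continuous_intros)
lemma ctorus_sum: "(\<And>i. i \<in> I \<Longrightarrow> ctorus (f i)) \<Longrightarrow> ctorus (\<lambda>x. \<Sum>i\<in>I. f i x)"
  by (induction I rule: infinite_finite_induct) (auto intro: ctorus_add)
lemma ctorus_shift:
  assumes "ctorus f" shows "ctorus (\<lambda>x. f (x + a))"
proof -
  have "f (x + (2 * pi) *\<^sub>R freq j + a) = f (x + a)" for x j
    using assms unfolding ctorus_def torus_fun_def by (metis add.assoc add.commute)
  moreover have "continuous_on UNIV (\<lambda>x. f (x + a))"
    using assms unfolding ctorus_def
    by (auto intro!: continuous_on_compose2[of UNIV f] continuous_intros)
  ultimately show ?thesis unfolding ctorus_def torus_fun_def by blast
qed

lemma ctorus_set_integrable: "ctorus f \<Longrightarrow> set_integrable lebesgue torus_cell f"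
  unfolding torus_cell_def ctorus_def
  by (metis absolutely_integrable_continuous continuous_on_subset subset_UNIV)

lemma torus_cell_rep: "\<exists>j. x + (2*pi) *\<^sub>R freq j \<in> torus_cell"
proof -
  let ?j = "\<chi> i. - \<lfloor>x $ i / (2*pi)\<rfloor>"
  have "0 \<le> x $ i - 2 * pi * of_int \<lfloor>x $ i / (2*pi)\<rfloor> \<and> x $ i - 2 * pi * of_int \<lfloor>x $ i / (2*pi)\<rfloor> \<le> 2 * pi" for i
  proof -
    have "of_int \<lfloor>x $ i / (2*pi)\<rfloor> \<le> x $ i / (2*pi)" "x $ i / (2*pi) \<le> of_int \<lfloor>x $ i / (2*pi)\<rfloor> + 1"
      by linarith+
    then have "of_int \<lfloor>x $ i / (2*pi)\<rfloor> * (2 * pi) \<le> x $ i" "x $ i \<le> (of_int \<lfloor>x $ i / (2*pi)\<rfloor> + 1) * (2 * pi)"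
      using pos_le_divide_eq[of "2*pi"] pos_divide_le_eq[of "2*pi"] pi_gt_zero by (metis mult_pos_pos zero_less_numeral)+
    then show ?thesis
      by (simp add: algebra_simps)
  qed
  then have "x + (2*pi) *\<^sub>R freq ?j \<in> torus_cell"
    by (auto simp: torus_cell_def mem_box_cart freq_def algebra_simps)
  then show ?thesis ..
qed

lemma ctorus_bounded:
  assumes "ctorus f" obtains B where "B > 0" "\<And>x. norm (f x) \<le> B"
proof -
  have "compact (f ` torus_cell)"
    using assms unfolding torus_cell_def ctorus_def
    by (intro compact_continuous_image) (auto intro: continuous_on_subset)
  then obtain B where "B > 0" "\<forall>y\<in>f ` torus_cell. norm y \<le> B"
    using compact_imp_bounded bounded_pos by metis
  moreover have "f x \<in> f ` torus_cell" for x
    using torus_cell_rep[of x] assms unfolding ctorus_def torus_fun_def by (metis image_eqI)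
  ultimately show ?thesis using that by blast
qed

section \<open>Orthogonality of the exponentials\<close>

lemma lborel_integral_prod:
  fixes f :: "'a::euclidean_space \<Rightarrow> real \<Rightarrow> complex"
  assumes "\<And>b. b \<in> Basis \<Longrightarrow> integrable lborel (f b)"
  shows "integral\<^sup>L lborel (\<lambda>x::'a. \<Prod>b\<in>Basis. f b (x \<bullet> b)) = (\<Prod>b\<in>Basis. integral\<^sup>L lborel (f b))"
proof -
  interpret product_sigma_finite "\<lambda>_::'a. lborel :: real measure" ..
  have [measurable]: "f b \<in> borel_measurable borel" if "b \<in> Basis" for b
    using assms[OF that] by auto
  have m: "(\<lambda>f::'a\<Rightarrow>real. \<Sum>b\<in>Basis. f b *\<^sub>R b) \<in> measurable (\<Pi>\<^sub>M b\<in>Basis. lborel) borel"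
    by measurable
  have "integral\<^sup>L lborel (\<lambda>x::'a. \<Prod>b\<in>Basis. f b (x \<bullet> b)) =
     integral\<^sup>L (\<Pi>\<^sub>M b\<in>Basis. lborel) (\<lambda>x. \<Prod>b\<in>Basis. f b ((\<Sum>c\<in>Basis. x c *\<^sub>R c) \<bullet> b))"
    by (subst lborel_eq, subst integral_distr[OF m]) (auto intro!: borel_measurable_prod)
  also have "\<dots> = integral\<^sup>L (\<Pi>\<^sub>M b\<in>Basis. lborel) (\<lambda>x. \<Prod>b\<in>Basis. f b (x b))"
    by (intro Bochner_Integration.integral_cong prod.cong) (auto)
  also have "\<dots> = (\<Prod>b\<in>Basis. integral\<^sup>L lborel (f b))"
    by (intro product_integral_prod assms) auto
  finally show ?thesis .
qed

lemma integral_cis_period: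
  fixes m :: int
  assumes "m \<noteq> 0"
  shows "integral\<^sup>L lborel (\<lambda>t::real. indicator {0..2*pi} t *\<^sub>R cis (of_int m * t)) = 0"
proof -
  have "integral\<^sup>L lborel (\<lambda>t::real. indicator {0..2*pi} t *\<^sub>R cis (of_int m * t)) =
     (\<lambda>t. cis (of_int m * t) / (\<i> * of_int m)) (2 * pi) - (\<lambda>t. cis (of_int m * t) / (\<i> * of_int m)) 0"
  proof (rule integral_FTC_Icc)
    fix x
    have "((\<lambda>z. exp (\<i> * of_int m * z) / (\<i> * of_int m)) has_field_derivative exp (\<i> * of_int m * of_real x)) (at (of_real x))"
      using assms by (auto intro!: derivative_eq_intros)
    from has_vector_derivative_real_field[OF this, of "{0..2*pi}"]
    show "((\<lambda>t. cis (of_int m * t) / (\<i> * of_int m)) has_vector_derivative cis (of_int m * x)) (at x within {0..2*pi})"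
      by (simp add: cis_conv_exp mult.assoc)
  qed (auto intro!: continuous_intros)
  also have "\<dots> = 0"
    using cis_multiple_2pi[of "of_int m"] by (simp add: mult.commute)
  finally show ?thesis .
qed

lemma Basis_vec_eq: "(Basis :: (real ^ 'd) set) = (\<lambda>i. axis i 1) ` UNIV"
  by (auto simp: Basis_vec_def)

lemma prod_Basis_vec: "(\<Prod>b\<in>(Basis :: (real ^ 'd) set). f b) = (\<Prod>i\<in>UNIV. f (axis i 1))"
  unfolding Basis_vec_eq by (subst prod.reindex) (auto simp: inj_on_def axis_eq_axis)

text \<open>The integral factorizes over the coordinates, and a factor with nonzero frequency is an
  integral over full periods.\<close>

lemma torus_cell_integral_expi:
  "(LINT x:torus_cell|lebesgue. expi j x) = (if j = 0 then of_real ((2*pi) ^ CARD('d::finite)) else 0)"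
  for j :: "int ^ 'd"
proof -
  let ?f = "\<lambda>b::real^'d. \<lambda>t. indicator {0..2*pi} t *\<^sub>R cis ((freq j \<bullet> b) * t)"
  have ind: "indicator torus_cell x = (\<Prod>b\<in>Basis. indicator {0..2*pi} (x \<bullet> b) :: real)" for x :: "real^'d"
    by (auto simp: torus_cell_def mem_box_cart prod_Basis_vec inner_axis indicator_def)
  have cisp: "cis (\<Sum>b\<in>A. g b) = (\<Prod>b\<in>A. cis (g b))" for g :: "real^'d \<Rightarrow> real" and A
    by (induction A rule: infinite_finite_induct) (auto simp: cis_mult[symmetric])
  have "(LINT x:torus_cell|lebesgue. expi j x) = integral\<^sup>L lborel (\<lambda>x. indicator torus_cell x *\<^sub>R expi j x)"
    unfolding set_lebesgue_integral_def
    by (rule integral_completion)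
       (use borel_measurable_continuous_onI[OF continuous_expi[of UNIV j]] in
          \<open>auto simp: torus_cell_def intro!: borel_measurable_scaleR\<close>)
  also have "(\<lambda>x. indicator torus_cell x *\<^sub>R expi j x) = (\<lambda>x. \<Prod>b\<in>Basis. ?f b (x \<bullet> b))"
  proof
    fix x :: "real^'d"
    have "expi j x = (\<Prod>b\<in>Basis. cis ((freq j \<bullet> b) * (x \<bullet> b)))"
      by (simp add: expi_def euclidean_inner[of "freq j" x] cisp)
    then show "indicator torus_cell x *\<^sub>R expi j x = (\<Prod>b\<in>Basis. ?f b (x \<bullet> b))"
      by (simp add: ind scaleR_conv_of_real prod.distrib)
  qed
  also have "integral\<^sup>L lborel \<dots> = (\<Prod>b\<in>Basis. integral\<^sup>L lborel (?f b))"
  proof (rule lborel_integral_prod)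
    fix b :: "real^'d"
    show "integrable lborel (?f b)"
      by (rule borel_integrable_compact) (auto intro!: continuous_intros)
  qed
  also have "\<dots> = (\<Prod>i\<in>UNIV. integral\<^sup>L lborel (\<lambda>t. indicator {0..2*pi} t *\<^sub>R cis (of_int (j $ i) * t)))"
    by (simp add: prod_Basis_vec inner_axis freq_def)
  also have "\<dots> = (if j = 0 then of_real ((2*pi) ^ CARD('d)) else 0)"
  proof (cases "j = 0")
    case True
    then show ?thesis by (simp add: scaleR_conv_of_real)
  next
    case False
    then obtain i where "j $ i \<noteq> 0" by (auto simp: vec_eq_iff)
    then show ?thesis using False integral_cis_period[of "j $ i"]
      by (intro trans[OF prod_zero]) auto
  qed
  finally show ?thesis .
qed

section \<open>Fourier coefficients of continuous functions\<close>

lemma ctorus_mult_expi: "ctorus f \<Longrightarrow> ctorus (\<lambda>x. f x * cnj (expi j x))"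
  by (intro ctorus_mult ctorus_cnj) auto

lemma fc_add: "ctorus f \<Longrightarrow> ctorus g \<Longrightarrow> fc (\<lambda>x. f x + g x) j = fc f j + fc g j"
  unfolding fourier_coeff_def
  by (simp add: ring_distribs add_divide_distrib set_integral_add ctorus_set_integrable ctorus_mult_expi)

lemma fc_cmult: "fc (\<lambda>x. c * f x) j = c * fc f j"
  unfolding fourier_coeff_def by (simp add: mult.assoc)

lemma fc_minus: "fc (\<lambda>x. - f x) j = - fc f j"
  using fc_cmult[of "-1" f j] by simp

lemma fc_diff: "ctorus f \<Longrightarrow> ctorus g \<Longrightarrow> fc (\<lambda>x. f x - g x) j = fc f j - fc g j"
  using fc_add[of f "\<lambda>x. - g x"] by (simp add: fc_minus ctorus_minus)

lemma fc_0 [simp]: "fc (\<lambda>x. 0) j = 0" using fc_cmult[of 0 "\<lambda>x. 0"] by simp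

lemma fc_sum: "(\<And>i. i \<in> I \<Longrightarrow> ctorus (f i)) \<Longrightarrow> fc (\<lambda>x. \<Sum>i\<in>I. f i x) j = (\<Sum>i\<in>I. fc (f i) j)"
  by (induction I rule: infinite_finite_induct) (auto simp: fc_add ctorus_sum)

lemma fc_expi: "fc (expi k) j = (if k = j then 1 else 0)"
  unfolding fourier_coeff_def
  by (simp add: torus_cell_integral_expi flip: expi_diff)

lemma fc_trig: "finite F \<Longrightarrow> fc (\<lambda>x. \<Sum>k\<in>F. a k * expi k x) j = (if j \<in> F then a j else 0)"
  by (subst fc_sum) (auto simp: fc_cmult fc_expi ctorus_mult if_distrib cong: if_cong)

lemma fc_cnj: "fc (\<lambda>x. cnj (f x)) j = cnj (fc f (- j))"
proof -
  have "(LINT x:torus_cell|lebesgue. cnj (f x) * cnj (expi j x)) = cnj (LINT x:torus_cell|lebesgue. f x * cnj (expi (-j) x))"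
    unfolding set_lebesgue_integral_def
    by (subst Bochner_Integration.integral_cnj[symmetric]) (auto simp: expi_minus intro!: Bochner_Integration.integral_cong)
  then show ?thesis by (simp add: fourier_coeff_def)
qed

text \<open>Dominated convergence on the cell. It turns limits of difference quotients, in space and in
  time, and limits of partial Fourier sums into limits of coefficients.\<close>

lemma fc_tendsto:
  assumes "\<And>n. ctorus (f n)" "ctorus g" "\<And>x. (\<lambda>n. f n x) \<longlonglongrightarrow> g x" "\<And>n x. norm (f n x) \<le> B"
  shows "(\<lambda>n. fc (f n) j) \<longlonglongrightarrow> fc g j"
proof -
  have "(\<lambda>n. LINT x:torus_cell|lebesgue. f n x * cnj (expi j x)) \<longlonglongrightarrow> (LINT x:torus_cell|lebesgue. g x * cnj (expi j x))"
    unfolding set_lebesgue_integral_def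
  proof (rule integral_dominated_convergence)
    show "(\<lambda>x. indicator torus_cell x *\<^sub>R (g x * cnj (expi j x))) \<in> borel_measurable lebesgue"
      using ctorus_set_integrable[OF ctorus_mult_expi[OF assms(2), of j]] unfolding set_integrable_def by auto
    show "(\<lambda>x. indicator torus_cell x *\<^sub>R (f n x * cnj (expi j x))) \<in> borel_measurable lebesgue" for n
      using ctorus_set_integrable[OF ctorus_mult_expi[OF assms(1)[of n], of j]] unfolding set_integrable_def by auto
    show "integrable lebesgue (\<lambda>x. indicator torus_cell x *\<^sub>R B)"
      unfolding torus_cell_def
      using absolutely_integrable_continuous[OF continuous_on_const, of 0 "\<chi> i. 2 * pi" B]
      unfolding set_integrable_def by auto
    show "AE x in lebesgue. (\<lambda>n. indicator torus_cell x *\<^sub>R (f n x * cnj (expi j x))) \<longlonglongrightarrow> indicator torus_cell x *\<^sub>R (g x * cnj (expi j x))"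
      by (intro AE_I2 tendsto_intros assms)
    show "AE x in lebesgue. norm (indicator torus_cell x *\<^sub>R (f n x * cnj (expi j x))) \<le> indicator torus_cell x *\<^sub>R B" for n
      using assms(4) by (intro AE_I2) (auto simp: indicator_def norm_mult)
  qed
  then show ?thesis unfolding fourier_coeff_def by (intro tendsto_intros) auto
qed

lemma fc_bound:
  fixes f :: "real ^ 'd::finite \<Rightarrow> complex"
  assumes f: "ctorus f" and B: "\<And>x. norm (f x) \<le> B"
  shows "norm (fc f j) \<le> B"
proof -
  let ?g = "\<lambda>x. f x * cnj (expi j x)"
  have i: "set_integrable lebesgue torus_cell ?g"
    by (intro ctorus_set_integrable ctorus_mult_expi f)
  have B0: "0 \<le> B" using B[of 0] norm_ge_zero order_trans by blast
  have "norm (integral torus_cell ?g) \<le> B * measure lborel (torus_cell :: (real ^ 'd) set)"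
    using set_lebesgue_integral_eq_integral(1)[OF i] B0 B unfolding torus_cell_def
    by (intro has_integral_bound[OF B0 integrable_integral]) (auto simp: norm_mult)
  also have "measure lborel (torus_cell :: (real ^ 'd) set) = (2*pi) ^ CARD('d)"
    unfolding torus_cell_def by (subst content_cbox_cart) (auto simp: interval_ne_empty_cart)
  finally have "norm (integral torus_cell ?g) / (2*pi) ^ CARD('d) \<le> B"
    by (simp add: pos_divide_le_eq)
  then show ?thesis
    unfolding fourier_coeff_def set_lebesgue_integral_eq_integral(2)[OF i]
    by (simp add: norm_divide norm_mult norm_power)
qed

section \<open>Density of trigonometric polynomials and Fourier inversion\<close>

text \<open>Trigonometric polynomials of arbitrary degree. Closure under sums, without reference to a
  finite set of frequencies, lets structural induction prove closure under products.\<close>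

inductive tpoly :: "(real ^ 'd::finite \<Rightarrow> complex) \<Rightarrow> bool" where
  monomial: "tpoly (\<lambda>x. c * expi j x)"
| sum: "tpoly f \<Longrightarrow> tpoly g \<Longrightarrow> tpoly (\<lambda>x. f x + g x)"

lemma tpoly_ctorus: "tpoly f \<Longrightarrow> ctorus f"
  by (induction rule: tpoly.induct) (auto intro: ctorus_add ctorus_mult)

lemma tpoly_monomial_mult: "tpoly f \<Longrightarrow> tpoly (\<lambda>x. c * expi j x * f x)"
proof (induction rule: tpoly.induct)
  case (monomial d k)
  have "(\<lambda>x. c * expi j x * (d * expi k x)) = (\<lambda>x. (c * d) * expi (j + k) x)"
    by (simp add: expi_add mult_ac)
  then show ?case by (metis tpoly.monomial)
next
  case (sum f g)
  then show ?case by (auto simp: ring_distribs intro: tpoly.sum)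
qed

lemma tpoly_mult: "tpoly f \<Longrightarrow> tpoly g \<Longrightarrow> tpoly (\<lambda>x. f x * g x)"
  by (induction rule: tpoly.induct) (auto simp: distrib_right intro: tpoly.sum tpoly_monomial_mult)

lemma tpoly_const: "tpoly (\<lambda>x. c)"
  using tpoly.monomial[of c 0] by simp

lemma tpoly_cmult: "tpoly f \<Longrightarrow> tpoly (\<lambda>x. c * f x)"
  using tpoly_mult[OF tpoly_const[of c]] .

lemma tpoly_setsum: "(\<And>i. i \<in> I \<Longrightarrow> tpoly (f i)) \<Longrightarrow> tpoly (\<lambda>x. \<Sum>i\<in>I. f i x)"
  by (induction I rule: infinite_finite_induct) (auto intro: tpoly.sum tpoly_const)

text \<open>The embedding of the torus into \<open>\<complex>\<^sup>d\<close>. Its image is compact, so polynomial approximation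
  applies there.\<close>

definition circle_map :: "real ^ 'd \<Rightarrow> complex ^ 'd"
  where "circle_map x = (\<chi> i. cis (x $ i))"

text \<open>The coordinates of \<open>circle_map\<close> are sines and cosines, hence combinations of exponentials
  with frequencies \<open>\<plusminus>1\<close> in one coordinate.\<close>

lemma tpoly_real_polynomial:
  "real_polynomial_function p \<Longrightarrow> tpoly (\<lambda>x :: real ^ 'd::finite. of_real (p (circle_map x)))"
proof (induction rule: real_polynomial_function.induct)
  case (linear f)
  interpret bounded_linear f by fact
  have e: "cis (x $ i) = expi (axis i 1) x" for x :: "real ^ 'd" and i
    by (simp add: expi_def freq_inner axis_def if_distrib if_distribR cong: if_cong)
  have c: "tpoly (\<lambda>x :: real ^ 'd. of_real (cos (x $ i)))" for i
  proof -
    have "complex_of_real (cos (x $ i)) = 1/2 * expi (axis i 1) x + 1/2 * expi (- axis i 1) x" for x :: "real ^ 'd"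
      by (simp add: expi_minus flip: e) (simp add: complex_eq_iff)
    then show ?thesis by (simp only:) (intro tpoly.intros)
  qed
  have s: "tpoly (\<lambda>x :: real ^ 'd. of_real (sin (x $ i)))" for i
  proof -
    have "complex_of_real (sin (x $ i)) = (-\<i>/2) * expi (axis i 1) x + (\<i>/2) * expi (- axis i 1) x" for x :: "real ^ 'd"
      by (simp add: expi_minus flip: e) (simp add: complex_eq_iff)
    then show ?thesis by (simp only:) (intro tpoly.intros)
  qed
  have b: "tpoly (\<lambda>x :: real ^ 'd. of_real (circle_map x \<bullet> b))" if "b \<in> Basis" for b
  proof -
    from that obtain i u where b: "b = axis i u" "u \<in> Basis" by (auto simp: Basis_vec_def)
    then consider "u = 1" | "u = \<i>" by (auto simp: Basis_complex_def)
    then show ?thesis using c[of i] s[of i]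
      by cases (auto simp: b inner_axis circle_map_def inner_complex_def)
  qed
  have fy: "f y = (\<Sum>b\<in>Basis. (y \<bullet> b) * f b)" for y
  proof -
    have "f y = f (\<Sum>b\<in>Basis. (y \<bullet> b) *\<^sub>R b)" by (simp only: euclidean_representation)
    then show ?thesis by (simp only: sum scaleR real_scaleR_def)
  qed
  have "complex_of_real (f (circle_map x)) = (\<Sum>b\<in>Basis. of_real (f b) * of_real (circle_map x \<bullet> b))" for x
    by (subst fy) (simp add: mult.commute)
  then show ?case by (simp only:) (intro tpoly_setsum tpoly_cmult b)
next
  case (const c)
  show ?case by (rule tpoly_const)
next
  case (add f g)
  then show ?case by (auto intro: tpoly.sum)
next
  case (mult f g)
  then show ?case by (auto intro: tpoly_mult)
qed

lemma circle_map_eq: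
  assumes "circle_map x = circle_map y"
  shows "\<exists>j. x = y + (2*pi) *\<^sub>R freq j"
proof -
  have "\<exists>n::int. x $ i = y $ i + 2 * pi * n" for i
  proof -
    have "cis (x $ i) = cis (y $ i)"
      using assms by (metis circle_map_def vec_lambda_beta)
    then have "sin (x $ i) = sin (y $ i) \<and> cos (x $ i) = cos (y $ i)"
      by (metis cis.sel)
    then show ?thesis by (simp add: sin_cos_eq_iff)
  qed
  then obtain n where n: "\<And>i. x $ i = y $ i + 2 * pi * of_int (n i)" by metis
  show ?thesis
    by (rule exI[of _ "\<chi> i. n i"]) (simp add: vec_eq_iff n freq_def)
qed

text \<open>Stone-Weierstrass: a continuous function on the torus factors through \<open>circle_map\<close>, and the
  factor is continuous on the compact image because \<open>circle_map\<close> maps closed subsets of the cell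
  to closed sets.\<close>

lemma tpoly_dense:
  fixes f :: "real ^ 'd::finite \<Rightarrow> complex"
  assumes f: "ctorus f" and e: "e > 0"
  obtains p where "tpoly p" "\<And>x. norm (f x - p x) < e"
proof -
  let ?E = "circle_map :: real ^ 'd \<Rightarrow> complex ^ 'd"
  have contE: "continuous_on A ?E" for A
    unfolding circle_map_def by (intro continuous_intros)
  have compE: "compact (?E ` C)" if "compact C" for C
    by (intro compact_continuous_image contE that)
  have fE: "f x = f y" if "?E x = ?E y" for x y
    using circle_map_eq[OF that] f by (auto simp: ctorus_def torus_fun_def)
  define T where "T = ?E ` torus_cell"
  have T: "compact T" unfolding T_def torus_cell_def by (intro compE) simp
  \<comment> \<open>Any preimage in the cell will do: \<open>f\<close> takes the same value at all of them.\<close>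
  define F where "F = (\<lambda>z. f (SOME x. x \<in> torus_cell \<and> ?E x = z))"
  have FE: "F (?E x) = f x" if "x \<in> torus_cell" for x
  proof -
    have "\<exists>y. y \<in> torus_cell \<and> ?E y = ?E x" using that by blast
    from someI_ex[OF this] show ?thesis unfolding F_def by (intro fE) auto
  qed
  have "continuous_on T F"
    unfolding continuous_on_closed_vimage[OF compact_imp_closed[OF T]]
  proof (intro allI impI)
    fix B :: "complex set" assume B: "closed B"
    have "F -` B \<inter> T = ?E ` (f -` B \<inter> torus_cell)"
      unfolding T_def using FE by auto
    moreover have "compact (f -` B \<inter> torus_cell)"
      using f B unfolding ctorus_def torus_cell_def
      by (intro closed_Int_compact closed_vimage) auto
    ultimately show "closed (F -` B \<inter> T)"
      using compE compact_imp_closed by metis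
  qed
  from Stone_Weierstrass_polynomial_function[OF T this e]
  obtain g where g: "polynomial_function g" "\<And>z. z \<in> T \<Longrightarrow> norm (F z - g z) < e" by blast
  define p where "p = (\<lambda>x. of_real (Re (g (?E x))) + \<i> * of_real (Im (g (?E x))))"
  have "real_polynomial_function (Re \<circ> g)" "real_polynomial_function (Im \<circ> g)"
    using g(1) bounded_linear_Re bounded_linear_Im unfolding polynomial_function_def by auto
  from this[THEN tpoly_real_polynomial] have trig: "tpoly p"
    unfolding p_def o_def by (intro tpoly.sum tpoly_cmult)
  have "norm (f x - p x) < e" for x
  proof -
    obtain j where j: "x + (2*pi) *\<^sub>R freq j \<in> torus_cell" (is "?y \<in> _") using torus_cell_rep by blast
    have "f x = f ?y" "p x = p ?y"
      using f tpoly_ctorus[OF trig] unfolding ctorus_def torus_fun_def by metis+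
    moreover have "norm (f ?y - p ?y) < e"
      using g(2)[of "?E ?y"] FE[OF j] j unfolding T_def p_def by (auto simp: complex_eq[symmetric])
    ultimately show ?thesis by simp
  qed
  with trig that show ?thesis by blast
qed

text \<open>If all coefficients vanish, \<open>h\<close> is orthogonal to trigonometric polynomials and, by density,
  to itself.\<close>

lemma fc_zero_imp_zero:
  fixes h :: "real ^ 'd::finite \<Rightarrow> complex"
  assumes h: "ctorus h" and z: "\<And>j. fc h j = 0"
  shows "h x = 0"
proof -
  obtain B where B: "B > 0" "\<And>x. norm (h x) \<le> B" using ctorus_bounded[OF h] by blast
  have zp: "ctorus p \<and> fc (\<lambda>x. h x * cnj (p x)) 0 = 0" if "tpoly p" for p
    using that
  proof (induction rule: tpoly.induct)
    case (monomial c j)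
    have "fc (\<lambda>x. cnj c * (h x * cnj (expi j x))) 0 = cnj c * fc h j"
      by (subst fc_cmult) (simp add: fourier_coeff_def)
    then show ?case by (simp add: z mult_ac ctorus_mult)
  next
    case (sum f g)
    have "fc (\<lambda>x. h x * cnj (f x) + h x * cnj (g x)) 0 = 0"
      using sum by (subst fc_add) (auto intro!: ctorus_mult h ctorus_cnj)
    then show ?case using sum by (simp add: ring_distribs ctorus_add)
  qed
  have "norm (fc (\<lambda>x. h x * cnj (h x)) 0) \<le> e" if e: "e > 0" for e
  proof -
    obtain p where p: "tpoly p" "\<And>x. norm (h x - p x) < e / B"
      by (rule tpoly_dense[OF h, of "e / B"]) (use e B in auto)
    have "fc (\<lambda>x. h x * cnj (h x)) 0 = fc (\<lambda>x. h x * cnj (h x - p x) + h x * cnj (p x)) 0"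
      by (simp add: algebra_simps)
    also have "\<dots> = fc (\<lambda>x. h x * cnj (h x - p x)) 0"
      using zp[OF p(1)] by (subst fc_add) (auto intro!: ctorus_mult h ctorus_cnj ctorus_diff)
    also have "norm \<dots> \<le> B * (e / B)"
    proof (rule fc_bound)
      show "norm (h x * cnj (h x - p x)) \<le> B * (e / B)" for x
        using B p(2)[of x] unfolding norm_mult complex_mod_cnj
        by (intro mult_mono) (auto intro: less_imp_le)
      show "ctorus (\<lambda>x. h x * cnj (h x - p x))"
        using zp[OF p(1)] by (intro ctorus_mult ctorus_cnj ctorus_diff h) auto
    qed
    finally show ?thesis using B by simp
  qed
  then have "norm (fc (\<lambda>x. h x * cnj (h x)) 0) \<le> 0"
    by (rule field_le_epsilon) simp
  then have "fc (\<lambda>x. h x * cnj (h x)) 0 = 0" by simp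
  moreover have hh: "ctorus (\<lambda>x. h x * cnj (h x))" by (intro ctorus_mult h ctorus_cnj)
  ultimately have "integral torus_cell (\<lambda>x. h x * cnj (h x)) = 0"
    unfolding fourier_coeff_def by (simp add: set_lebesgue_integral_eq_integral(2)[OF ctorus_set_integrable])
  moreover have "(\<lambda>x. h x * cnj (h x)) = (\<lambda>x. complex_of_real ((cmod (h x))\<^sup>2))"
    by (simp add: complex_norm_square[symmetric])
  moreover have "integral torus_cell (Re \<circ> (\<lambda>x. h x * cnj (h x))) = Re (integral torus_cell (\<lambda>x. h x * cnj (h x)))"
    by (intro integral_linear bounded_linear_Re set_lebesgue_integral_eq_integral(1) ctorus_set_integrable hh)
  ultimately have "integral torus_cell (\<lambda>x. (cmod (h x))\<^sup>2) = 0" by (simp add: o_def)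
  moreover have "continuous_on torus_cell (\<lambda>x. (cmod (h x))\<^sup>2)"
    using h unfolding ctorus_def by (intro continuous_intros) (auto intro: continuous_on_subset)
  ultimately have *: "\<forall>x\<in>torus_cell. (cmod (h x))\<^sup>2 = 0"
    unfolding torus_cell_def
    by (subst (asm) integral_cbox_eq_0_iff) (auto simp: interval_ne_empty_cart)
  obtain j where "x + (2*pi) *\<^sub>R freq j \<in> torus_cell" using torus_cell_rep by blast
  with * h show ?thesis unfolding ctorus_def torus_fun_def by force
qed

lemma finite_modes [simp]: "finite (modes K :: (int ^ 'd::finite) set)"
proof -
  have "modes K \<subseteq> vec_lambda ` (Pi\<^sub>E UNIV (\<lambda>_::'d. {- int K..<int K}))"
  proof
    fix j :: "int ^ 'd" assume "j \<in> modes K"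
    then have "vec_nth j \<in> Pi\<^sub>E UNIV (\<lambda>_::'d. {- int K..<int K})" by (auto simp: modes_def)
    then show "j \<in> vec_lambda ` (Pi\<^sub>E UNIV (\<lambda>_::'d. {- int K..<int K}))"
      by (metis image_eqI vec_nth_inverse)
  qed
  then show ?thesis by (rule finite_subset) (intro finite_imageI finite_PiE; simp)
qed

lemma finite_subset_modes:
  assumes "finite (F :: (int ^ 'd::finite) set)"
  obtains K0 where "K0 \<ge> 1" "\<And>K. K \<ge> K0 \<Longrightarrow> F \<subseteq> modes K"
proof -
  define K0 where "K0 = Suc (Suc (nat (\<Sum>j\<in>F. \<Sum>i\<in>UNIV. \<bar>j $ i\<bar>)))"
  have *: "\<bar>j $ i\<bar> \<le> int K0 - 2" if "j \<in> F" for j i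
  proof -
    have "\<bar>j $ i\<bar> \<le> (\<Sum>i\<in>UNIV. \<bar>j $ i\<bar>)" by (intro member_le_sum) auto
    also have "\<dots> \<le> (\<Sum>j\<in>F. \<Sum>i\<in>UNIV. \<bar>j $ i\<bar>)"
      using that assms by (intro member_le_sum) (auto intro: sum_nonneg)
    finally have "\<bar>j $ i\<bar> \<le> (\<Sum>j\<in>F. \<Sum>i\<in>UNIV. \<bar>j $ i\<bar>)" .
    moreover have "0 \<le> (\<Sum>j\<in>F. \<Sum>i\<in>UNIV. \<bar>j $ i\<bar>)" by (intro sum_nonneg) auto
    ultimately show ?thesis by (simp add: K0_def)
  qed
  have "F \<subseteq> modes K" if "K \<ge> K0" for K
  proof
    fix j assume "j \<in> F"
    have "\<bar>j $ i\<bar> \<le> int K - 2" for i using *[OF \<open>j \<in> F\<close>, of i] that by linarith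
    then have "- int K \<le> j $ i \<and> j $ i < int K" for i by (smt (verit))
    then show "j \<in> modes K" by (simp add: modes_def)
  qed
  then show ?thesis using that[of K0] by (auto simp: K0_def)
qed

lemma filterlim_modes: "filterlim modes (finite_subsets_at_top UNIV) sequentially"
  unfolding filterlim_finite_subsets_at_top
proof safe
  fix F :: "(int ^ 'd::finite) set" assume "finite F"
  then obtain K0 where "\<And>K. K \<ge> K0 \<Longrightarrow> F \<subseteq> modes K" by (rule finite_subset_modes) blast
  then show "\<forall>\<^sub>F y in sequentially. finite (modes y) \<and> F \<subseteq> modes y \<and> modes y \<subseteq> UNIV"
    unfolding eventually_sequentially by (intro exI[of _ K0]) auto
qed

text \<open>The series converges uniformly to a continuous function with the same coefficients as \<open>f\<close>,
  and coefficients determine a continuous function.\<close>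

lemma fourier_inversion:
  fixes f :: "real ^ 'd::finite \<Rightarrow> complex"
  assumes f: "ctorus f" and s: "(\<lambda>j. cmod (fc f j)) summable_on UNIV"
  shows "((\<lambda>j. fc f j * expi j x) has_sum f x) UNIV"
proof -
  define S where "S = (\<lambda>x. \<Sum>\<^sub>\<infinity>j. fc f j * expi j x)"
  have ul: "uniform_limit UNIV (\<lambda>F x. \<Sum>j\<in>F. fc f j * expi j x) S (finite_subsets_at_top UNIV)"
    unfolding S_def by (rule Weierstrass_m_test_general[OF _ s]) (auto simp: norm_mult)
  have hs: "((\<lambda>j. fc f j * expi j x) has_sum S x) UNIV" for x
    unfolding S_def has_sum_def
    using tendsto_uniform_limitI[OF ul, of x] by (simp add: S_def)
  have fin: "ctorus (\<lambda>x. \<Sum>j\<in>F. fc f j * expi j x)" for F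
    by (intro ctorus_sum ctorus_mult) auto
  have S: "ctorus S"
  proof -
    have "continuous_on UNIV S"
      by (rule uniform_limit_theorem[OF _ ul]) (use fin in \<open>auto simp: ctorus_def\<close>)
    moreover have "torus_fun S"
      unfolding S_def torus_fun_def
      by (intro allI infsum_cong) (use torus_fun_expi in \<open>auto simp: torus_fun_def\<close>)
    ultimately show ?thesis by (simp add: ctorus_def)
  qed
  have l1: "(\<lambda>n. fc (\<lambda>x. \<Sum>j\<in>modes n. fc f j * expi j x) k) \<longlonglongrightarrow> fc S k" for k
  proof (rule fc_tendsto[OF fin S])
    show "(\<lambda>n. \<Sum>j\<in>modes n. fc f j * expi j x) \<longlonglongrightarrow> S x" for x
      using hs[of x] filterlim_modes unfolding has_sum_def by (rule filterlim_compose)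
    show "norm (\<Sum>j\<in>modes n. fc f j * expi j x) \<le> (\<Sum>\<^sub>\<infinity>j. cmod (fc f j))" for n x
      by (rule order_trans[OF sum_norm_le finite_sum_le_infsum[OF s]]) (auto simp: norm_mult)
  qed
  have l2: "\<forall>\<^sub>F n in sequentially. fc (\<lambda>x. \<Sum>j\<in>modes n. fc f j * expi j x) k = fc f k" for k
  proof -
    obtain K0 where "\<And>K. K \<ge> K0 \<Longrightarrow> {k} \<subseteq> modes K"
      by (rule finite_subset_modes[of "{k}"]) auto
    then show ?thesis unfolding eventually_sequentially by (intro exI[of _ K0]) (auto simp: fc_trig)
  qed
  have "fc S k = fc f k" for k
    by (rule LIMSEQ_unique[OF l1 tendsto_eventually[OF l2]])
  then have "f x - S x = 0"
    by (intro fc_zero_imp_zero[of "\<lambda>x. f x - S x"]) (auto simp: fc_diff f S ctorus_diff)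
  with hs[of x] show ?thesis by simp
qed

section \<open>Fourier coefficients of derivatives\<close>

lemma has_vector_derivative_iff_slope:
  "(f has_vector_derivative D) (at x within S) \<longleftrightarrow>
   ((\<lambda>y. (f y - f x) /\<^sub>R (y - x)) \<longlongrightarrow> D) (at x within S)"
proof -
  have *: "norm ((1 / norm (y - x)) *\<^sub>R (f y - (f x + (y - x) *\<^sub>R D))) = norm ((f y - f x) /\<^sub>R (y - x) - D)"
    if "y \<noteq> x" for y
  proof -
    have "(f y - f x) /\<^sub>R (y - x) - D = (f y - (f x + (y - x) *\<^sub>R D)) /\<^sub>R (y - x)"
      using that by (simp add: scaleR_diff_right scaleR_add_right)
    then show ?thesis by (simp add: divide_inverse)
  qed
  have "((\<lambda>y. norm ((1 / norm (y - x)) *\<^sub>R (f y - (f x + (y - x) *\<^sub>R D)))) \<longlongrightarrow> 0) (at x within S)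
     \<longleftrightarrow> ((\<lambda>y. norm ((f y - f x) /\<^sub>R (y - x) - D)) \<longlongrightarrow> 0) (at x within S)"
    by (intro Lim_cong_within refl) (use * in auto)
  then show ?thesis
    unfolding has_vector_derivative_def has_derivative_within tendsto_norm_zero_iff LIM_zero_iff
    by (simp add: bounded_linear_scaleR_left)
qed

text \<open>Evident for exponentials; the general case follows by density, which avoids moving the cell
  under the integral.\<close>

lemma fc_shift:
  assumes f: "ctorus f"
  shows "fc (\<lambda>x. f (x + a)) j = expi j a * fc f j"
proof -
  have trig: "fc (\<lambda>x. p (x + a)) j = expi j a * fc p j" if "tpoly p" for p
    using that
  proof (induction rule: tpoly.induct)
    case (monomial c k)
    have "(\<lambda>x. c * expi k (x + a)) = (\<lambda>x. (c * expi k a) * expi k x)"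
      by (simp add: expi_add_arg mult_ac)
    then show ?case by (auto simp only: fc_cmult) (simp add: fc_expi)
  next
    case (sum f g)
    then show ?case by (simp add: fc_add ctorus_shift tpoly_ctorus ring_distribs)
  qed
  have "norm (fc (\<lambda>x. f (x + a)) j - expi j a * fc f j) \<le> e" if e: "e > 0" for e
  proof -
    obtain p where p: "tpoly p" "\<And>x. norm (f x - p x) < e / 2"
      by (rule tpoly_dense[OF f, of "e/2"]) (use e in auto)
    have "norm (fc (\<lambda>x. f (x + a) - p (x + a)) j) \<le> e / 2" "norm (fc (\<lambda>x. f x - p x) j) \<le> e / 2"
      using p(2) ctorus_shift[OF f, of a] ctorus_shift[OF tpoly_ctorus[OF p(1)], of a] f tpoly_ctorus[OF p(1)]
      by (intro fc_bound ctorus_diff; auto intro: less_imp_le)+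
    moreover have eq: "fc (\<lambda>x. f (x + a)) j - expi j a * fc f j =
        fc (\<lambda>x. f (x + a) - p (x + a)) j - expi j a * fc (\<lambda>x. f x - p x) j"
      by (simp add: fc_diff ctorus_shift f tpoly_ctorus p trig algebra_simps)
    moreover have "norm (fc (\<lambda>x. f (x + a) - p (x + a)) j - expi j a * fc (\<lambda>x. f x - p x) j)
        \<le> norm (fc (\<lambda>x. f (x + a) - p (x + a)) j) + norm (fc (\<lambda>x. f x - p x) j)"
      by (rule order_trans[OF norm_triangle_ineq4]) (simp add: norm_mult)
    ultimately show ?thesis unfolding eq by linarith
  qed
  then have "norm (fc (\<lambda>x. f (x + a)) j - expi j a * fc f j) \<le> 0"
    by (rule field_le_epsilon) simp
  then show ?thesis by simp
qed

lemma partial_along_line: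
  fixes f :: "real ^ 'd::finite \<Rightarrow> 'a::real_normed_vector"
  assumes "\<And>x. f differentiable at x"
  shows "((\<lambda>t. f (x + t *\<^sub>R axis i 1)) has_vector_derivative partial i f (x + t *\<^sub>R axis i 1)) (at t)"
proof -
  let ?D = "frechet_derivative f (at (x + t *\<^sub>R axis i 1))"
  have d: "(f has_derivative ?D) (at (x + t *\<^sub>R axis i 1))"
    using assms frechet_derivative_works by blast
  have "((\<lambda>t. x + t *\<^sub>R axis i 1) has_derivative (\<lambda>h. h *\<^sub>R axis i 1)) (at t)"
    by (auto intro!: derivative_eq_intros)
  from has_derivative_compose[OF this d]
  have "((\<lambda>t. f (x + t *\<^sub>R axis i 1)) has_derivative (\<lambda>h. ?D (h *\<^sub>R axis i 1))) (at t)" .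
  then show ?thesis
    using linear_cmul[OF has_derivative_linear[OF d]] by (simp add: has_vector_derivative_def partial_def)
qed

lemma torus_fun_partial:
  fixes f :: "real ^ 'd::finite \<Rightarrow> 'a::real_normed_vector"
  assumes "torus_fun f" "\<And>x. f differentiable at x"
  shows "torus_fun (partial i f)"
  unfolding torus_fun_def partial_def
proof (intro allI)
  fix x :: "real ^ 'd" and j :: "int ^ 'd"
  let ?p = "(2 * pi) *\<^sub>R freq j"
  have d: "(f has_derivative frechet_derivative f (at (x + ?p))) (at (x + ?p))"
    using assms(2) frechet_derivative_works by blast
  have "((\<lambda>y. y + ?p) has_derivative (\<lambda>h. h)) (at x)" by (auto intro!: derivative_eq_intros)
  from has_derivative_compose[OF this d] have "(f has_derivative frechet_derivative f (at (x + ?p))) (at x)"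
    using assms(1) by (simp add: torus_fun_def)
  from frechet_derivative_at[OF this]
  show "frechet_derivative f (at (x + ?p)) (axis i 1) = frechet_derivative f (at x) (axis i 1)" by simp
qed

text \<open>Difference quotients in space have the coefficients given by \<open>fc_shift\<close> and are bounded by the
  maximum of the partial derivative, so dominated convergence applies.\<close>

lemma fc_partial:
  fixes f :: "real ^ 'd::finite \<Rightarrow> complex"
  assumes f: "ctorus f" and d: "\<And>x. f differentiable at x" and c: "continuous_on UNIV (partial i f)"
  shows "ctorus (partial i f)" "fc (partial i f) j = \<i> * of_int (j $ i) * fc f j"
proof -
  show p: "ctorus (partial i f)"
    using f c torus_fun_partial[OF _ d] by (auto simp: ctorus_def)
  obtain B where B: "B > 0" "\<And>x. norm (partial i f x) \<le> B" using ctorus_bounded[OF p] by blast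
  define h where "h = (\<lambda>n. inverse (real (Suc n)))"
  have h: "h n > 0" "h n \<noteq> 0" for n by (auto simp: h_def)
  have h0: "h \<longlonglongrightarrow> 0" unfolding h_def by (rule LIMSEQ_inverse_real_of_nat)
  have h0': "filterlim h (at 0) sequentially"
    using h0 h by (auto simp: filterlim_at)
  define q where "q = (\<lambda>n x. of_real (1 / h n) * (f (x + h n *\<^sub>R axis i 1) - f x))"
  have q: "q n x = (f (x + h n *\<^sub>R axis i 1) - f x) /\<^sub>R h n" for n x
    by (simp add: q_def scaleR_conv_of_real divide_inverse)
  have lim: "(\<lambda>n. fc (q n) j) \<longlonglongrightarrow> fc (partial i f) j"
  proof (rule fc_tendsto[OF _ p])
    show "ctorus (q n)" for n unfolding q_def by (intro ctorus_mult ctorus_const ctorus_diff ctorus_shift[OF f] f)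
    show "(\<lambda>n. q n x) \<longlonglongrightarrow> partial i f x" for x
      using filterlim_compose[OF partial_along_line[OF d, of x i 0, unfolded has_vector_derivative_iff_slope] h0']
      by (simp add: q)
    show "norm (q n x) \<le> B" for n x
    proof -
      have "\<exists>t\<in>{0<..<h n}. norm (f (x + h n *\<^sub>R axis i 1) - f (x + 0 *\<^sub>R axis i 1))
          \<le> norm ((h n - 0) *\<^sub>R partial i f (x + t *\<^sub>R axis i 1))"
      proof (rule mvt_general)
        show "continuous_on {0..h n} (\<lambda>t. f (x + t *\<^sub>R axis i 1))"
          by (intro continuous_at_imp_continuous_on ballI has_vector_derivative_continuous[OF partial_along_line[OF d]])
        show "((\<lambda>t. f (x + t *\<^sub>R axis i 1)) has_derivative (\<lambda>r. r *\<^sub>R partial i f (x + t *\<^sub>R axis i 1))) (at t)" for t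
          using partial_along_line[OF d, of x i t] by (simp add: has_vector_derivative_def)
      qed (use h in auto)
      then obtain t where "norm (f (x + h n *\<^sub>R axis i 1) - f x) \<le> h n * norm (partial i f (x + t *\<^sub>R axis i 1))"
        using h[of n] by auto
      also have "\<dots> \<le> h n * B" using B h[of n] by (intro mult_left_mono) auto
      finally have "norm (f (x + h n *\<^sub>R axis i 1) - f x) / h n \<le> B"
        using h[of n] by (simp add: pos_divide_le_eq mult.commute)
      moreover have "norm (q n x) = norm (f (x + h n *\<^sub>R axis i 1) - f x) / h n"
        unfolding q norm_scaleR using h[of n] by (simp add: divide_inverse mult.commute)
      ultimately show ?thesis by simp
    qed
  qed
  have "fc (q n) j = ((expi j (h n *\<^sub>R axis i 1) - 1) /\<^sub>R h n) * fc f j" for n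
    unfolding q_def fc_cmult fc_diff[OF ctorus_shift[OF f] f] fc_shift[OF f]
    by (simp add: left_diff_distrib right_diff_distrib scaleR_conv_of_real divide_inverse)
  moreover have "(\<lambda>n. ((expi j (h n *\<^sub>R axis i 1) - 1) /\<^sub>R h n) * fc f j) \<longlonglongrightarrow> \<i> * of_int (j $ i) * fc f j"
  proof (intro tendsto_mult tendsto_const)
    have e: "expi j (t *\<^sub>R axis i 1) = exp (\<i> * of_int (j $ i) * of_real t)" for t
      by (simp add: expi_def cis_conv_exp inner_axis freq_def mult_ac)
    have "((\<lambda>z. exp (\<i> * of_int (j $ i) * z)) has_field_derivative \<i> * of_int (j $ i)) (at (of_real 0))"
      by (auto intro!: derivative_eq_intros)
    from has_vector_derivative_real_field[OF this, of UNIV]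
    have "((\<lambda>t. (exp (\<i> * of_int (j $ i) * of_real t) - 1) /\<^sub>R t) \<longlongrightarrow> \<i> * of_int (j $ i)) (at 0)"
      by (simp add: has_vector_derivative_iff_slope)
    from filterlim_compose[OF this h0']
    show "(\<lambda>n. (expi j (h n *\<^sub>R axis i 1) - 1) /\<^sub>R h n) \<longlonglongrightarrow> \<i> * of_int (j $ i)" by (simp add: e)
  qed
  ultimately show "fc (partial i f) j = \<i> * of_int (j $ i) * fc f j"
    using LIMSEQ_unique[OF lim] by simp
qed

lemma C_2_iff:
  "C_k 2 f \<longleftrightarrow> (\<forall>x. f differentiable at x) \<and> (\<forall>i x. partial i f differentiable at x) \<and>
     (\<forall>i j. continuous_on UNIV (partial j (partial i f)))"
  by (auto simp: numeral_2_eq_2)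

lemma differentiable_imp_continuous_UNIV: "(\<And>x. f differentiable at x) \<Longrightarrow> continuous_on UNIV f"
  by (simp add: continuous_on_eq_continuous_at differentiable_imp_continuous_within)

lemma fc_laplacian:
  fixes f :: "real ^ 'd::finite \<Rightarrow> complex"
  assumes "torus_fun f" "C_k 2 f"
  shows "ctorus (laplacian f)" "fc (laplacian f) j = - (norm (freq j))\<^sup>2 * fc f j"
proof -
  note C = assms(2)[unfolded C_2_iff]
  have f: "ctorus f" using assms C differentiable_imp_continuous_UNIV by (auto simp: ctorus_def)
  have p: "ctorus (partial i f)" "fc (partial i f) j = \<i> * of_int (j $ i) * fc f j" for i j
    using fc_partial[OF f] C differentiable_imp_continuous_UNIV by blast+
  have pp: "ctorus (partial i (partial i f))"
    "fc (partial i (partial i f)) j = \<i> * of_int (j $ i) * fc (partial i f) j" for i j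
    using fc_partial[OF p(1)] C by blast+
  show "ctorus (laplacian f)"
    unfolding laplacian_def by (intro ctorus_sum pp)
  have n0: "(norm (freq j))\<^sup>2 = (\<Sum>i\<in>UNIV. of_int (j $ i) ^ 2)"
    by (simp only: power2_norm_eq_inner freq_inner) (simp add: freq_def power2_eq_square)
  have "(of_real (norm (freq j)) :: complex)\<^sup>2 = of_real ((norm (freq j))\<^sup>2)" by simp
  also have "\<dots> = (\<Sum>i\<in>UNIV. of_int (j $ i) ^ 2)" unfolding n0 by simp
  finally have n: "(of_real (norm (freq j)) :: complex)\<^sup>2 = (\<Sum>i\<in>UNIV. of_int (j $ i) ^ 2)" .
  show "fc (laplacian f) j = - (norm (freq j))\<^sup>2 * fc f j"
    unfolding laplacian_def using p pp
    by (simp add: fc_sum sum_distrib_right sum_distrib_left mult_ac sum_negf n power2_eq_square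
        n[unfolded power2_eq_square])
qed

section \<open>Weighted sequence norms\<close>

definition wt :: "int ^ 'd::finite \<Rightarrow> real" where "wt j = max (norm (freq j)) 1"

lemma wt_ge1 [simp]: "1 \<le> wt j" by (simp add: wt_def)
lemma wt_pos [simp]: "0 < wt j" using wt_ge1[of j] by linarith
lemma wt_nonneg [simp]: "0 \<le> wt j" using wt_pos[of j] by (rule less_imp_le)
lemma wt_nz [simp]: "wt j \<noteq> 0" using wt_pos[of j] by linarith
lemma wt_minus [simp]: "wt (- j) = wt j" by (simp add: wt_def freq_minus)

text \<open>The weighted \<open>\<ell>\<^sup>2\<close> norm over a set of frequencies. It is used with finite sets: \<open>modes K\<close>
  gives Sobolev norms of trigonometric polynomials, and bounds that are uniform over all finite sets
  express Sobolev norms of functions.\<close>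

definition wnorm :: "real \<Rightarrow> (int ^ 'd::finite) set \<Rightarrow> (int ^ 'd \<Rightarrow> complex) \<Rightarrow> real"
  where "wnorm r A a = L2_set (\<lambda>j. wt j powr r * cmod (a j)) A"

lemma wnorm_nonneg [simp]: "0 \<le> wnorm r A a" by (simp add: wnorm_def)

lemma wnorm_mono: "(\<And>j. j \<in> A \<Longrightarrow> wt j powr r * cmod (a j) \<le> wt j powr q * cmod (b j)) \<Longrightarrow> wnorm r A a \<le> wnorm q A b"
  unfolding wnorm_def by (rule L2_set_mono) auto

lemma wnorm_cong: "(\<And>j. j \<in> A \<Longrightarrow> cmod (a j) = cmod (b j)) \<Longrightarrow> wnorm r A a = wnorm r A b"
  unfolding wnorm_def by (rule L2_set_cong) auto

lemma wnorm_add: "wnorm r A (\<lambda>j. a j + b j) \<le> wnorm r A a + wnorm r A b"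
proof -
  have "wnorm r A (\<lambda>j. a j + b j) \<le> L2_set (\<lambda>j. wt j powr r * cmod (a j) + wt j powr r * cmod (b j)) A"
    unfolding wnorm_def by (rule L2_set_mono) (auto simp flip: distrib_left intro!: mult_left_mono norm_triangle_ineq)
  also have "\<dots> \<le> wnorm r A a + wnorm r A b" unfolding wnorm_def by (rule L2_set_triangle_ineq)
  finally show ?thesis .
qed

lemma wnorm_cmult: "wnorm r A (\<lambda>j. c * a j) = cmod c * wnorm r A a"
  unfolding wnorm_def by (subst L2_set_right_distrib) (auto simp: norm_mult mult_ac)

lemma wnorm_minus [simp]: "wnorm r A (\<lambda>j. - a j) = wnorm r A a" by (simp add: wnorm_def)

lemma wnorm_diff: "wnorm r A (\<lambda>j. a j - b j) \<le> wnorm r A a + wnorm r A b"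
  using wnorm_add[of r A a "\<lambda>j. - b j"] by simp

lemma wnorm_le_exp: "r \<le> q \<Longrightarrow> wnorm r A a \<le> wnorm q A a"
  by (rule wnorm_mono) (auto intro!: mult_right_mono powr_mono)

lemma wnorm_subset: "finite B \<Longrightarrow> A \<subseteq> B \<Longrightarrow> wnorm r A a \<le> wnorm r B a"
  unfolding wnorm_def L2_set_def by (intro real_sqrt_le_mono sum_mono2) auto

text \<open>A Fourier multiplier of order \<open>q\<close> costs \<open>q\<close> derivatives; negative \<open>q\<close> is allowed.\<close>

lemma wnorm_multiplier:
  assumes "\<And>j. j \<in> A \<Longrightarrow> cmod (a j) \<le> c * wt j powr q * cmod (b j)" "0 \<le> c"
  shows "wnorm r A a \<le> c * wnorm (r + q) A b"
proof -
  have "wnorm r A a \<le> wnorm (r + q) A (\<lambda>j. of_real c * b j)"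
  proof (rule wnorm_mono)
    fix j assume "j \<in> A"
    then have "wt j powr r * cmod (a j) \<le> wt j powr r * (c * wt j powr q * cmod (b j))"
      by (intro mult_left_mono assms) auto
    then show "wt j powr r * cmod (a j) \<le> wt j powr (r + q) * cmod (of_real c * b j)"
      using assms(2) by (simp add: powr_add norm_mult mult_ac)
  qed
  then show ?thesis using assms(2) by (simp add: wnorm_cmult)
qed

lemma wnorm_multiplier0:
  assumes "\<And>j. j \<in> A \<Longrightarrow> cmod (a j) \<le> c * cmod (b j)" "0 \<le> c"
  shows "wnorm r A a \<le> c * wnorm r A b"
  using wnorm_multiplier[of A a c 0 b r] assms by simp

lemma wnorm_tendsto:
  assumes "\<And>j. j \<in> A \<Longrightarrow> ((\<lambda>n. a n j) \<longlongrightarrow> b j) G"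
  shows "((\<lambda>n. wnorm r A (a n)) \<longlongrightarrow> wnorm r A b) G"
  unfolding wnorm_def L2_set_def by (intro tendsto_intros assms)

lemma sum_modes_prod:
  fixes f :: "int \<Rightarrow> real"
  shows "(\<Sum>j\<in>(modes N :: (int ^ 'd::finite) set). \<Prod>i\<in>UNIV. f (j $ i)) = (\<Sum>m\<in>{- int N..<int N}. f m) ^ CARD('d)"
proof -
  have "(\<Sum>m\<in>{- int N..<int N}. f m) ^ CARD('d) = (\<Prod>i\<in>(UNIV::'d set). \<Sum>m\<in>{- int N..<int N}. f m)" by simp
  also have "\<dots> = (\<Sum>g\<in>Pi\<^sub>E UNIV (\<lambda>_. {- int N..<int N}). \<Prod>i\<in>(UNIV::'d set). f (g i))"
    by (rule prod_sum_PiE) auto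
  also have "\<dots> = (\<Sum>j\<in>(modes N :: (int ^ 'd) set). \<Prod>i\<in>UNIV. f (j $ i))"
    by (rule sum.reindex_bij_witness[of _ vec_nth vec_lambda]) (auto simp: modes_def PiE_def)
  finally show ?thesis by simp
qed

text \<open>The square of the weight \<open>wt j powr (- r)\<close> is at most the product over \<open>i\<close> of
  \<open>max 1 \<bar>j\<^sub>i\<bar>\<close> to the power \<open>- 2 r / d\<close>, so the sum is bounded by the \<open>d\<close>-th power of a
  convergent one-dimensional sum.\<close>

lemma weights_square_summable:
  assumes r: "r > real CARD('d::finite) / 2"
  shows "\<exists>Z\<ge>1. \<forall>F :: (int ^ 'd) set. finite F \<longrightarrow> L2_set (\<lambda>j. wt j powr (- r)) F \<le> Z"
proof -
  define d where "d = CARD('d)"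
  have d0: "0 < d" by (simp add: d_def)
  define p where "p = 2 * r / d"
  have p: "p > 1" using r d0 by (simp add: p_def d_def field_simps)
  define f where "f = (\<lambda>m::int. max 1 (real_of_int \<bar>m\<bar>) powr (- p))"
  have summ: "summable (\<lambda>n. real n powr (-p))" using p by (simp add: summable_real_powr_iff)
  define B where "B = 2 * (1 + (\<Sum>n. real n powr (-p)))"
  have fn: "f (int n) \<le> (if n = 0 then 1 else 0) + real n powr (-p)" for n
    by (auto simp: f_def max_def)
  have half: "(\<Sum>n\<le>N. f (int n)) \<le> B / 2" for N
  proof -
    have "(\<Sum>n\<le>N. f (int n)) \<le> (\<Sum>n\<le>N. (if n = 0 then 1 else 0) + real n powr (-p))" by (intro sum_mono fn)
    also have "\<dots> = 1 + (\<Sum>n\<le>N. real n powr (-p))" by (simp add: sum.distrib)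
    also have "(\<Sum>n\<le>N. real n powr (-p)) \<le> (\<Sum>n. real n powr (-p))"
      using sum_le_suminf[OF summ, of "{..N}"] by simp
    finally show ?thesis by (simp add: B_def)
  qed
  have fnn: "0 \<le> f m" for m by (simp add: f_def)
  have one: "(\<Sum>m\<in>{- int N..<int N}. f m) \<le> B" for N
  proof -
    have "{- int N..<int N} \<subseteq> int ` {..N} \<union> (\<lambda>n. - int n) ` {..N}"
    proof
      fix m assume "m \<in> {- int N..<int N}"
      then show "m \<in> int ` {..N} \<union> (\<lambda>n. - int n) ` {..N}"
        by (cases m rule: int_cases2) auto
    qed
    then have "(\<Sum>m\<in>{- int N..<int N}. f m) \<le> (\<Sum>m\<in>int ` {..N} \<union> (\<lambda>n. - int n) ` {..N}. f m)"
      by (intro sum_mono2) (auto simp: fnn)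
    also have "\<dots> \<le> (\<Sum>m\<in>int ` {..N}. f m) + (\<Sum>m\<in>(\<lambda>n. - int n) ` {..N}. f m)"
      by (simp add: sum_Un fnn sum_nonneg)
    also have "\<dots> = (\<Sum>n\<le>N. f (int n)) + (\<Sum>n\<le>N. f (- int n))"
      by (simp add: sum.reindex inj_on_def)
    also have "(\<lambda>n. f (- int n)) = (\<lambda>n. f (int n))" by (simp add: f_def)
    also have "(\<Sum>n\<le>N. f (int n)) + (\<Sum>n\<le>N. f (int n)) \<le> B" using half[of N] by simp
    finally show ?thesis .
  qed
  have w: "(wt j powr (- r))\<^sup>2 \<le> (\<Prod>i\<in>UNIV. f (j $ i))" for j :: "int ^ 'd"
  proof -
    have "wt j powr (- p) \<le> f (j $ i)" for i
    proof -
      have "real_of_int \<bar>j $ i\<bar> \<le> norm (freq j)"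
        using component_le_norm_cart[of "freq j" i] by (simp add: freq_def)
      then have "max 1 (real_of_int \<bar>j $ i\<bar>) \<le> wt j" by (auto simp: wt_def)
      then show ?thesis unfolding f_def using p by (intro powr_mono2') auto
    qed
    then have "(\<Prod>i\<in>(UNIV::'d set). wt j powr (- p)) \<le> (\<Prod>i\<in>UNIV. f (j $ i))"
      by (intro prod_mono) auto
    moreover have "(\<Prod>i\<in>(UNIV::'d set). wt j powr (- p)) = (wt j powr (-r))\<^sup>2"
      using d0 by (simp add: powr_power p_def flip: d_def)
    ultimately show ?thesis by simp
  qed
  have B0: "0 \<le> B" using one[of 0] by simp
  define Z where "Z = max 1 (sqrt (B ^ d))"
  have "L2_set (\<lambda>j. wt j powr (- r)) F \<le> Z" if F: "finite F" for F :: "(int ^ 'd) set"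
  proof -
    obtain N where N: "F \<subseteq> modes N" by (rule finite_subset_modes[OF F]) auto
    have "(\<Sum>j\<in>F. (wt j powr (- r))\<^sup>2) \<le> (\<Sum>j\<in>F. \<Prod>i\<in>UNIV. f (j $ i))" by (intro sum_mono w)
    also have "\<dots> \<le> (\<Sum>j\<in>(modes N :: (int ^ 'd) set). \<Prod>i\<in>UNIV. f (j $ i))"
      by (rule sum_mono2) (use N in \<open>auto intro: prod_nonneg fnn\<close>)
    also have "\<dots> \<le> B ^ d" unfolding sum_modes_prod d_def
      by (intro power_mono one sum_nonneg fnn)
    finally show ?thesis unfolding L2_set_def Z_def by (simp add: le_max_iff_disj)
  qed
  then show ?thesis by (intro exI[of _ Z]) (auto simp: Z_def)
qed

text \<open>The type argument carries the dimension, which \<open>r\<close> does not determine.\<close>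

definition weight_const :: "'d::finite itself \<Rightarrow> real \<Rightarrow> real"
  where "weight_const _ r = (SOME Z. Z \<ge> 1 \<and> (\<forall>F :: (int ^ 'd) set. finite F \<longrightarrow> L2_set (\<lambda>j. wt j powr (- r)) F \<le> Z))"

lemma weight_const:
  assumes "r > real CARD('d::finite) / 2"
  shows "weight_const TYPE('d) r \<ge> 1" "finite (F :: (int ^ 'd) set) \<Longrightarrow> L2_set (\<lambda>j. wt j powr (- r)) F \<le> weight_const TYPE('d) r"
proof -
  have "\<exists>Z. Z \<ge> 1 \<and> (\<forall>F :: (int ^ 'd) set. finite F \<longrightarrow> L2_set (\<lambda>j. wt j powr (- r)) F \<le> Z)"
    using weights_square_summable[OF assms] by blast
  from someI_ex[OF this] show "weight_const TYPE('d) r \<ge> 1"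
    "finite (F :: (int ^ 'd) set) \<Longrightarrow> L2_set (\<lambda>j. wt j powr (- r)) F \<le> weight_const TYPE('d) r"
    unfolding weight_const_def by auto
qed

text \<open>Cauchy-Schwarz with the weights: for \<open>r > d/2\<close> the norm of \<open>H\<^sup>r\<close> dominates absolute
  convergence of the Fourier series.\<close>

lemma sum_le_wnorm:
  fixes a :: "int ^ 'd::finite \<Rightarrow> complex"
  assumes "r > real CARD('d) / 2" "finite F"
  shows "(\<Sum>j\<in>F. cmod (a j)) \<le> weight_const TYPE('d) r * wnorm r F a"
proof -
  have "(\<Sum>j\<in>F. cmod (a j)) = (\<Sum>j\<in>F. \<bar>wt j powr (- r)\<bar> * \<bar>wt j powr r * cmod (a j)\<bar>)"
    by (intro sum.cong refl) (simp add: abs_mult powr_minus field_simps)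
  also have "\<dots> \<le> L2_set (\<lambda>j. wt j powr (- r)) F * wnorm r F a" unfolding wnorm_def by (rule L2_set_mult_ineq)
  also have "\<dots> \<le> weight_const TYPE('d) r * wnorm r F a" by (intro mult_right_mono weight_const assms) auto
  finally show ?thesis .
qed

lemma powr_add_le:
  fixes a b r :: real
  assumes "0 < a" "0 < b" "0 \<le> r"
  shows "(a + b) powr r \<le> 2 powr r * (a powr r + b powr r)"
proof -
  have "(a + b) powr r \<le> (2 * max a b) powr r" using assms by (intro powr_mono2) auto
  also have "\<dots> = 2 powr r * (max a b) powr r" using assms by (simp add: powr_mult)
  also have "(max a b) powr r \<le> a powr r + b powr r" by (auto simp: max_def)
  finally show ?thesis by simp
qed

section \<open>Residues of frequencies\<close>

text \<open>The representative in \<open>modes K\<close> of a frequency modulo \<open>2 K\<close>. In each component it has the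
  smallest absolute value in its class.\<close>

definition residue :: "nat \<Rightarrow> int ^ 'd \<Rightarrow> int ^ 'd::finite"
  where "residue K k = (\<chi> i. (k $ i + int K) mod (2 * int K) - int K)"

definition mode_cong :: "nat \<Rightarrow> int ^ 'd \<Rightarrow> int ^ 'd::finite \<Rightarrow> bool"
  where "mode_cong K j k \<longleftrightarrow> (\<forall>i. 2 * int K dvd j $ i - k $ i)"

lemma mode_cong_refl [simp]: "mode_cong K j j" by (simp add: mode_cong_def)
lemma mode_cong_sym: "mode_cong K j k \<Longrightarrow> mode_cong K k j"
  unfolding mode_cong_def by (metis dvd_minus_iff minus_diff_eq)
lemma mode_cong_trans: "mode_cong K j k \<Longrightarrow> mode_cong K k l \<Longrightarrow> mode_cong K j l"
  unfolding mode_cong_def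
proof
  fix i assume "\<forall>i. 2 * int K dvd j $ i - k $ i" "\<forall>i. 2 * int K dvd k $ i - l $ i"
  then have "2 * int K dvd (j $ i - k $ i) + (k $ i - l $ i)" by (simp only: dvd_add)
  then show "2 * int K dvd j $ i - l $ i" by simp
qed

lemma residue_in_modes [simp]: "K \<ge> 1 \<Longrightarrow> residue K k \<in> modes K"
proof -
  assume "K \<ge> 1"
  then have "0 \<le> x mod (2 * int K)" "x mod (2 * int K) < 2 * int K" for x
    by simp_all
  from this[of "k $ i + int K" for i] show ?thesis by (simp add: residue_def modes_def)
qed

lemma mode_cong_residue: "mode_cong K (residue K k) k"
  unfolding mode_cong_def
proof
  fix i
  have "(k $ i + int K) mod (2 * int K) - int K - k $ i = - (2 * int K * ((k $ i + int K) div (2 * int K)))"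
    by (simp add: minus_div_mult_eq_mod [symmetric] algebra_simps)
  then show "2 * int K dvd residue K k $ i - k $ i" by (simp add: residue_def)
qed

lemma residue_cong: "mode_cong K j k \<Longrightarrow> residue K j = residue K k"
proof -
  assume "mode_cong K j k"
  then have "(j $ i + int K) mod (2 * int K) = (k $ i + int K) mod (2 * int K)" for i
    unfolding mode_cong_def by (metis add_diff_cancel_right mod_eq_dvd_iff)
  then show ?thesis by (simp add: residue_def)
qed

lemma modes_mode_cong_eq:
  assumes "j \<in> modes K" "k \<in> modes K" "mode_cong K j k"
  shows "j = k"
proof -
  have "j $ i = k $ i" for i
  proof -
    have "2 * int K dvd j $ i - k $ i" "\<bar>j $ i - k $ i\<bar> < 2 * int K"
      using assms unfolding mode_cong_def modes_def by (auto simp: abs_less_iff) (smt (verit))+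
    then show ?thesis by (metis dvd_imp_le_int eq_iff_diff_eq_0 linorder_not_le abs_of_nonneg of_nat_0_le_iff
          zero_le_mult_iff zero_le_numeral)
  qed
  then show ?thesis by (simp add: vec_eq_iff)
qed

lemma residue_modes [simp]: "K \<ge> 1 \<Longrightarrow> k \<in> modes K \<Longrightarrow> residue K k = k"
  by (rule modes_mode_cong_eq[of _ K]) (auto intro: mode_cong_residue)

lemma wt_mono: "(\<And>i. \<bar>j $ i\<bar> \<le> \<bar>k $ i\<bar>) \<Longrightarrow> wt j \<le> wt k"
proof -
  assume *: "\<And>i. \<bar>j $ i\<bar> \<le> \<bar>k $ i\<bar>"
  have "norm (freq j) \<le> norm (freq k)"
  proof (rule norm_le_componentwise_cart)
    fix i show "norm (freq j $ i) \<le> norm (freq k $ i)"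
      using *[of i] by (simp add: freq_def flip: of_int_abs)
  qed
  then show ?thesis by (auto simp: wt_def)
qed

lemma wt_residue_le:
  assumes "K \<ge> 1" shows "wt (residue K k) \<le> wt k"
proof (rule wt_mono)
  fix i
  show "\<bar>residue K k $ i\<bar> \<le> \<bar>k $ i\<bar>"
  proof (cases "- int K \<le> k $ i \<and> k $ i < int K")
    case True
    then have "(k $ i + int K) mod (2 * int K) = k $ i + int K" by (intro mod_pos_pos_trivial) auto
    then show ?thesis by (simp add: residue_def)
  next
    case False
    then have "int K \<le> \<bar>k $ i\<bar>" by linarith
    moreover have "\<bar>residue K k $ i\<bar> \<le> int K"
    proof -
      have "- int K \<le> residue K k $ i" "residue K k $ i < int K"
        using residue_in_modes[OF assms, of k] by (auto simp: modes_def)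
      then show ?thesis by linarith
    qed
    ultimately show ?thesis by linarith
  qed
qed

lemma wt_add: "wt (j + k) \<le> wt j + wt k"
proof -
  have "norm (freq (j + k)) \<le> norm (freq j) + norm (freq k)" unfolding freq_add by (rule norm_triangle_ineq)
  then show ?thesis by (auto simp: wt_def)
qed

lemma mode_cong_add: "mode_cong K j j' \<Longrightarrow> mode_cong K k k' \<Longrightarrow> mode_cong K (j + k) (j' + k')"
  unfolding mode_cong_def
proof
  fix i assume "\<forall>i. 2 * int K dvd j $ i - j' $ i" "\<forall>i. 2 * int K dvd k $ i - k' $ i"
  then have "2 * int K dvd (j $ i - j' $ i) + (k $ i - k' $ i)" by (simp only: dvd_add)
  then show "2 * int K dvd (j + k) $ i - (j' + k') $ i" by (simp add: algebra_simps)
qed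

lemma mode_cong_diff: "mode_cong K j j' \<Longrightarrow> mode_cong K k k' \<Longrightarrow> mode_cong K (j - k) (j' - k')"
  unfolding mode_cong_def
proof
  fix i assume "\<forall>i. 2 * int K dvd j $ i - j' $ i" "\<forall>i. 2 * int K dvd k $ i - k' $ i"
  then have "2 * int K dvd (j $ i - j' $ i) - (k $ i - k' $ i)" by (simp add: dvd_diff)
  then show "2 * int K dvd (j - k) $ i - (j' - k') $ i" by (simp add: algebra_simps)
qed

text \<open>The residue of a sum is the residue of the sum of the residues, and passing to residues does
  not increase weights. This subadditivity is what makes the discrete Sobolev norms
  submultiplicative.\<close>

lemma wt_residue_add: "K \<ge> 1 \<Longrightarrow> wt (residue K (j + k)) \<le> wt (residue K j) + wt (residue K k)"
proof -
  assume K: "K \<ge> 1"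
  have "residue K (j + k) = residue K (residue K j + residue K k)"
    by (intro residue_cong mode_cong_add mode_cong_sym[OF mode_cong_residue])
  then show ?thesis
    using wt_residue_le[OF K, of "residue K j + residue K k"] wt_add[of "residue K j" "residue K k"] by simp
qed

lemma wt_residue_minus: "K \<ge> 1 \<Longrightarrow> wt (residue K (- k)) = wt (residue K k)"
proof -
  assume K: "K \<ge> 1"
  have "wt (residue K (- k)) \<le> wt (residue K k)" for k :: "int ^ 'd::finite"
  proof -
    have "mode_cong K (- k) (- residue K k)"
      using mode_cong_diff[OF mode_cong_refl[of K 0] mode_cong_sym[OF mode_cong_residue[of K k]]] by simp
    then have "residue K (- k) = residue K (- residue K k)" by (rule residue_cong)
    then show ?thesis using wt_residue_le[OF K, of "- residue K k"] by simp
  qed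
  from this[of k] this[of "- k"] show ?thesis by simp
qed

definition mode_periodic :: "nat \<Rightarrow> (int ^ 'd::finite \<Rightarrow> 'a) \<Rightarrow> bool"
  where "mode_periodic K F \<longleftrightarrow> (\<forall>j k. mode_cong K j k \<longrightarrow> F j = F k)"

text \<open>A map that is injective modulo \<open>2 K\<close> permutes the finitely many residue classes.\<close>

lemma sum_modes_reindex:
  fixes g :: "int ^ 'd::finite \<Rightarrow> int ^ 'd" and F :: "int ^ 'd \<Rightarrow> 'a::comm_monoid_add"
  assumes K: "K \<ge> 1" and F: "mode_periodic K F"
    and g: "\<And>m m'. mode_cong K (g m) (g m') \<Longrightarrow> mode_cong K m m'"
  shows "(\<Sum>m\<in>modes K. F (g m)) = (\<Sum>m\<in>modes K. F m)"
proof -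
  have inj: "inj_on (\<lambda>m. residue K (g m)) (modes K)"
  proof (rule inj_onI)
    fix m m' assume m: "m \<in> modes K" "m' \<in> modes K" "residue K (g m) = residue K (g m')"
    then have "mode_cong K (g m) (g m')" by (metis mode_cong_residue mode_cong_sym mode_cong_trans)
    then show "m = m'" using g m modes_mode_cong_eq by blast
  qed
  have "(\<lambda>m. residue K (g m)) ` modes K = modes K"
    by (rule endo_inj_surj) (use K inj in auto)
  with inj have "bij_betw (\<lambda>m. residue K (g m)) (modes K) (modes K)" by (simp add: bij_betw_def)
  from sum.reindex_bij_betw[OF this, of F]
  have "(\<Sum>m\<in>modes K. F (residue K (g m))) = (\<Sum>m\<in>modes K. F m)" .
  moreover have "F (residue K (g m)) = F (g m)" for m
    using F mode_cong_residue unfolding mode_periodic_def by blast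
  ultimately show ?thesis by simp
qed

lemma sum_modes_shift: "K \<ge> 1 \<Longrightarrow> mode_periodic K F \<Longrightarrow> (\<Sum>m\<in>modes K. F (m - p)) = (\<Sum>m\<in>modes K. F m)"
  by (rule sum_modes_reindex) (auto simp: mode_cong_def)

lemma sum_modes_reflect: "K \<ge> 1 \<Longrightarrow> mode_periodic K F \<Longrightarrow> (\<Sum>m\<in>modes K. F (p - m)) = (\<Sum>m\<in>modes K. F m)"
  by (rule sum_modes_reindex) (auto simp: mode_cong_def dvd_diff_commute)

section \<open>The discrete Fourier transform and the discrete algebra\<close>

text \<open>The coefficients are defined for all frequencies, not only those in \<open>modes K\<close>. Being
  \<open>2 K\<close>-periodic in \<open>k\<close>, they turn products into cyclic convolutions without case distinctions.\<close>

definition dft :: "nat \<Rightarrow> (real ^ 'd::finite \<Rightarrow> complex) \<Rightarrow> int ^ 'd \<Rightarrow> complex"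
  where "dft K f k = (\<Sum>m\<in>modes K. f (grid_point K m) * cnj (expi k (grid_point K m))) / of_nat (card (modes K :: (int ^ 'd) set))"

definition synth :: "nat \<Rightarrow> (int ^ 'd::finite \<Rightarrow> complex) \<Rightarrow> real ^ 'd \<Rightarrow> complex"
  where "synth K a x = (\<Sum>j\<in>modes K. a j * expi j x)"

lemma modes_nonempty: "K \<ge> 1 \<Longrightarrow> (modes K :: (int ^ 'd::finite) set) \<noteq> {}"
  using residue_in_modes[of K 0] by blast

lemma expi_grid_commute: "expi k (grid_point K m) = expi m (grid_point K k)"
  by (simp add: expi_def grid_point_def inner_commute)

lemma expi_grid_per:
  assumes K: "K \<ge> 1" and "mode_cong K m m'"
  shows "expi k (grid_point K m) = expi k (grid_point K m')"
proof -
  from assms(2) have "\<forall>i. \<exists>q. m $ i - m' $ i = 2 * int K * q" by (auto simp: mode_cong_def dvd_def)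
  then obtain q where q: "\<And>i. m $ i - m' $ i = 2 * int K * q i" by metis
  have m: "m $ i = m' $ i + 2 * int K * q i" for i using q[of i] by linarith
  have "grid_point K m = grid_point K m' + (2 * pi) *\<^sub>R freq (\<chi> i. q i)"
    using K by (simp add: grid_point_def freq_def vec_eq_iff m field_simps)
  then show ?thesis using torus_fun_expi[of k] by (simp add: torus_fun_def)
qed

lemma expi_grid_per_freq:
  "K \<ge> 1 \<Longrightarrow> mode_cong K k k' \<Longrightarrow> expi k (grid_point K m) = expi k' (grid_point K m)"
  using expi_grid_per[of K k k' m] by (simp add: expi_grid_commute[of _ K m])

lemma dft_per: "K \<ge> 1 \<Longrightarrow> mode_cong K k k' \<Longrightarrow> dft K f k = dft K f k'"
  by (simp add: dft_def expi_grid_per_freq[of K k k'])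

text \<open>A shift by one grid point in direction \<open>i\<close> permutes the grid up to periodicity and multiplies
  the sum by \<open>exp(i \<pi> k\<^sub>i / K)\<close>, which is different from \<open>1\<close> for a suitable \<open>i\<close> unless \<open>k\<close> is
  congruent to \<open>0\<close>.\<close>

lemma sum_expi_grid:
  fixes k :: "int ^ 'd::finite"
  assumes K: "K \<ge> 1"
  shows "(\<Sum>m\<in>modes K. expi k (grid_point K m)) =
     (if mode_cong K k 0 then of_nat (card (modes K :: (int ^ 'd) set)) else 0)"
proof (cases "mode_cong K k 0")
  case True
  then show ?thesis using expi_grid_per_freq[OF K True] by simp
next
  case False
  then obtain i where i: "\<not> 2 * int K dvd k $ i" by (auto simp: mode_cong_def)
  let ?F = "\<lambda>m. expi k (grid_point K m)"
  define z where "z = expi k (grid_point K (axis i 1))"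
  have "mode_periodic K ?F" unfolding mode_periodic_def using expi_grid_per[OF K] by blast
  from sum_modes_shift[OF K this, of "- axis i 1"]
  have "(\<Sum>m\<in>modes K. ?F m) = (\<Sum>m\<in>modes K. ?F (m + axis i 1))" by simp
  also have "\<dots> = (\<Sum>m\<in>modes K. z * ?F m)"
    by (intro sum.cong refl) (simp add: grid_point_def freq_add scaleR_add_right expi_add_arg z_def)
  also have "\<dots> = z * (\<Sum>m\<in>modes K. ?F m)" by (rule sum_distrib_left[symmetric])
  finally have *: "(\<Sum>m\<in>modes K. ?F m) = z * (\<Sum>m\<in>modes K. ?F m)" .
  have "(1 - z) * (\<Sum>m\<in>modes K. ?F m) = (\<Sum>m\<in>modes K. ?F m) - z * (\<Sum>m\<in>modes K. ?F m)"
    by (simp only: left_diff_distrib mult_1)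
  also have "\<dots> = 0" by (subst *[symmetric]) (rule diff_self)
  finally have "(1 - z) * (\<Sum>m\<in>modes K. ?F m) = 0" .
  moreover have "z \<noteq> 1"
  proof
    assume "z = 1"
    have zz: "z = cis (pi * of_int (k $ i) / K)"
      by (simp add: z_def expi_def grid_point_def freq_def inner_vec_def axis_def if_distrib if_distribR
          mult_ac cong: if_cong)
    have "cos (pi * of_int (k $ i) / K) = 1"
      using \<open>z = 1\<close> unfolding zz by (metis cis.sel(1) one_complex.sel(1))
    then obtain n :: int where "pi * of_int (k $ i) / K = of_int n * 2 * pi"
      by (auto simp: cos_one_2pi_int)
    then have "of_int (k $ i) = real_of_int (2 * int K * n)" using K by (simp add: field_simps)
    then have "k $ i = 2 * int K * n" by (simp only: of_int_eq_iff)
    with i show False by simp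
  qed
  ultimately show ?thesis using False by simp
qed

lemma dft_expi: "K \<ge> 1 \<Longrightarrow> dft K (expi j) k = (if mode_cong K j k then 1 else 0)"
proof -
  assume K: "K \<ge> 1"
  have "mode_cong K (j - k) 0 \<longleftrightarrow> mode_cong K j k" by (simp add: mode_cong_def)
  then show ?thesis
    using sum_expi_grid[OF K, of "j - k"] modes_nonempty[OF K, where 'd='a] by (simp add: dft_def expi_diff)
qed

lemma dft_add: "dft K (\<lambda>x. f x + g x) k = dft K f k + dft K g k"
  by (simp add: dft_def ring_distribs sum.distrib add_divide_distrib)
lemma dft_diff: "dft K (\<lambda>x. f x - g x) k = dft K f k - dft K g k"
  by (simp add: dft_def ring_distribs sum_subtractf diff_divide_distrib)
lemma dft_cmult: "dft K (\<lambda>x. c * f x) k = c * dft K f k"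
  by (simp add: dft_def sum_distrib_left mult_ac)
lemma dft_minus: "dft K (\<lambda>x. - f x) k = - dft K f k"
  by (simp add: dft_def sum_negf)
lemma dft_0 [simp]: "dft K (\<lambda>x. 0) k = 0" by (simp add: dft_def)
lemma dft_sum: "dft K (\<lambda>x. \<Sum>i\<in>I. f i x) k = (\<Sum>i\<in>I. dft K (f i) k)"
  by (induction I rule: infinite_finite_induct) (auto simp: dft_add)
lemma dft_cong: "(\<And>m. m \<in> modes K \<Longrightarrow> f (grid_point K m) = g (grid_point K m)) \<Longrightarrow> dft K f k = dft K g k"
  by (simp add: dft_def)

lemma dft_cnj: "dft K (\<lambda>x. cnj (f x)) k = cnj (dft K f (- k))"
  by (simp add: dft_def expi_minus)

lemma dft_synth: "K \<ge> 1 \<Longrightarrow> k \<in> modes K \<Longrightarrow> dft K (synth K a) k = a k"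
proof -
  assume K: "K \<ge> 1" and k: "k \<in> modes K"
  have "dft K (synth K a) k = (\<Sum>j\<in>modes K. a j * dft K (expi j) k)"
    unfolding synth_def dft_sum dft_cmult ..
  also have "\<dots> = (\<Sum>j\<in>modes K. if j = k then a j else 0)"
    using modes_mode_cong_eq[OF _ k] by (intro sum.cong refl) (auto simp: dft_expi[OF K])
  finally show ?thesis using k by simp
qed

lemma dft_inversion:
  assumes K: "K \<ge> 1" and m: "m \<in> modes K"
  shows "synth K (dft K f) (grid_point K m) = f (grid_point K m)"
proof -
  let ?c = "of_nat (card (modes K :: (int ^ 'a) set)) :: complex"
  have c: "?c \<noteq> 0" using modes_nonempty[OF K, where 'd='a] by simp
  have k: "(\<Sum>k\<in>modes K. cnj (expi k (grid_point K n)) * expi k (grid_point K m)) = (if n = m then ?c else 0)"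
    if "n \<in> modes K" for n
  proof -
    have "(\<Sum>k\<in>modes K. cnj (expi k (grid_point K n)) * expi k (grid_point K m)) = (\<Sum>k\<in>modes K. expi (m - n) (grid_point K k))"
      by (intro sum.cong refl) (simp add: expi_diff expi_grid_commute[of _ K m] expi_grid_commute[of _ K n] mult.commute)
    moreover have "mode_cong K (m - n) 0 \<longleftrightarrow> n = m"
      using modes_mode_cong_eq[OF m that] by (auto simp: mode_cong_def)
    ultimately show ?thesis by (simp add: sum_expi_grid[OF K])
  qed
  have "synth K (dft K f) (grid_point K m) =
     (\<Sum>k\<in>modes K. \<Sum>n\<in>modes K. f (grid_point K n) / ?c * (cnj (expi k (grid_point K n)) * expi k (grid_point K m)))"
    by (simp add: synth_def dft_def sum_distrib_right sum_distrib_left sum_divide_distrib divide_inverse mult_ac)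
  also have "\<dots> = (\<Sum>n\<in>modes K. f (grid_point K n) / ?c * (\<Sum>k\<in>modes K. cnj (expi k (grid_point K n)) * expi k (grid_point K m)))"
    by (subst sum.swap) (simp add: sum_distrib_left)
  also have "\<dots> = (\<Sum>n\<in>modes K. f (grid_point K n) / ?c * (if n = m then ?c else 0))"
    by (intro sum.cong refl) (simp add: k)
  also have "\<dots> = f (grid_point K m)" using m c by (simp add: if_distrib cong: if_cong)
  finally show ?thesis .
qed

lemma synth_cong: "(\<And>j. j \<in> modes K \<Longrightarrow> a j = b j) \<Longrightarrow> synth K a = synth K b"
  by (auto simp: synth_def fun_eq_iff)

text \<open>Uniqueness of the interpolant holds because \<open>dft\<close> recovers the coefficients of a trigonometric
  polynomial from its values on the grid.\<close>

lemma interp_eq_synth: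
  assumes K: "K \<ge> 1"
  shows "interp K f = synth K (dft K f)"
  unfolding interp_def
proof (rule the_equality)
  show "trig_poly K (synth K (dft K f)) \<and> (\<forall>k\<in>modes K. synth K (dft K f) (grid_point K k) = f (grid_point K k))"
    using dft_inversion[OF K] by (auto simp: trig_poly_def synth_def fun_eq_iff)
next
  fix p assume p: "trig_poly K p \<and> (\<forall>k\<in>modes K. p (grid_point K k) = f (grid_point K k))"
  then obtain a where a: "p = synth K a" by (auto simp: trig_poly_def synth_def fun_eq_iff)
  have "dft K p k = dft K f k" for k using p by (intro dft_cong) auto
  then have "a k = dft K f k" if "k \<in> modes K" for k
    using dft_synth[OF K that, of a] by (simp add: a)
  then show "p = synth K (dft K f)" unfolding a by (rule synth_cong)
qed

lemma dft_mult:
  assumes K: "K \<ge> 1"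
  shows "dft K (\<lambda>x. f x * g x) k = (\<Sum>p\<in>modes K. dft K f p * dft K g (k - p))"
proof -
  have "dft K (\<lambda>x. f x * g x) k = dft K (\<lambda>x. \<Sum>p\<in>modes K. dft K f p * (expi p x * g x)) k"
    by (rule dft_cong) (simp add: dft_inversion[OF K, of _ f, symmetric] synth_def sum_distrib_right sum_distrib_left mult_ac)
  also have "\<dots> = (\<Sum>p\<in>modes K. dft K f p * dft K (\<lambda>x. expi p x * g x) k)"
    by (simp add: dft_sum dft_cmult)
  also have "\<dots> = (\<Sum>p\<in>modes K. dft K f p * dft K g (k - p))"
    by (intro sum.cong refl) (simp add: dft_def expi_diff mult_ac)
  finally show ?thesis .
qed

text \<open>The norm in \<open>H\<^sup>r\<close> of the interpolant of \<open>f\<close>, which depends only on the values of \<open>f\<close> on the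
  grid. As a seminorm on all functions it makes it unnecessary to write interpolation operators in
  estimates of products and exponentials.\<close>

definition gnorm :: "nat \<Rightarrow> real \<Rightarrow> (real ^ 'd::finite \<Rightarrow> complex) \<Rightarrow> real"
  where "gnorm K r f = wnorm r (modes K) (dft K f)"

lemma gnorm_nonneg [simp]: "0 \<le> gnorm K r f" by (simp add: gnorm_def)
lemma gnorm_add: "gnorm K r (\<lambda>x. f x + g x) \<le> gnorm K r f + gnorm K r g"
  unfolding gnorm_def dft_add by (rule wnorm_add)
lemma gnorm_diff: "gnorm K r (\<lambda>x. f x - g x) \<le> gnorm K r f + gnorm K r g"
  unfolding gnorm_def dft_diff by (rule wnorm_diff)
lemma gnorm_cmult: "gnorm K r (\<lambda>x. c * f x) = cmod c * gnorm K r f"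
  unfolding gnorm_def dft_cmult by (rule wnorm_cmult)
lemma gnorm_minus [simp]: "gnorm K r (\<lambda>x. - f x) = gnorm K r f"
  unfolding gnorm_def dft_minus by simp
lemma gnorm_le_exp: "r \<le> q \<Longrightarrow> gnorm K r f \<le> gnorm K q f"
  unfolding gnorm_def by (rule wnorm_le_exp)

lemma L2_set_sum: "L2_set (\<lambda>k. \<Sum>p\<in>P. f p k) A \<le> (\<Sum>p\<in>P. L2_set (f p) A)"
proof (induction P rule: infinite_finite_induct)
  case (insert p P)
  then show ?case using L2_set_triangle_ineq[of "f p" "\<lambda>k. \<Sum>p\<in>P. f p k" A] by simp
qed (auto simp: L2_set_0')

text \<open>Minkowski's inequality, with the invariance of periodic sums under shifts.\<close>

lemma discrete_young:
  assumes K: "K \<ge> 1" and y: "mode_periodic K y" and x: "\<And>p. 0 \<le> x p"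
  shows "L2_set (\<lambda>k. \<Sum>p\<in>modes K. x p * y (k - p)) (modes K) \<le> (\<Sum>p\<in>modes K. x p) * L2_set y (modes K)"
proof -
  have s: "L2_set (\<lambda>k. x p * y (k - p)) (modes K) = x p * L2_set y (modes K)" for p
  proof -
    have "mode_periodic K (\<lambda>m. (y m)\<^sup>2)" using y unfolding mode_periodic_def by metis
    from sum_modes_shift[OF K this, of p] show ?thesis
      using x[of p] by (subst L2_set_right_distrib[symmetric]) (auto simp: L2_set_def)
  qed
  have "L2_set (\<lambda>k. \<Sum>p\<in>modes K. x p * y (k - p)) (modes K) \<le> (\<Sum>p\<in>modes K. L2_set (\<lambda>k. x p * y (k - p)) (modes K))"
    by (rule L2_set_sum)
  also have "\<dots> = (\<Sum>p\<in>modes K. x p) * L2_set y (modes K)" by (simp add: s sum_distrib_right)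
  finally show ?thesis .
qed

text \<open>The factor \<open>2 powr r\<close> comes from distributing the weight over the two factors of a product, the
  factor \<open>2\<close> from the two resulting terms, and \<open>weight_const\<close> from summing one factor absolutely.\<close>

definition alg_const :: "'d::finite itself \<Rightarrow> real \<Rightarrow> real"
  where "alg_const t r = 2 * 2 powr r * weight_const t r"

lemma alg_const_ge1: "r > real CARD('d::finite) / 2 \<Longrightarrow> 1 \<le> alg_const TYPE('d) r"
proof -
  assume r: "r > real CARD('d::finite) / 2"
  then have "0 \<le> r" by (smt (verit) divide_nonneg_nonneg of_nat_0_le_iff)
  then have "1 \<le> 2 powr r" by (simp add: ge_one_powr_ge_zero)
  then have "1 * 1 \<le> 2 powr r * weight_const TYPE('d) r" using weight_const(1)[OF r] by (intro mult_mono) auto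
  then show ?thesis by (simp add: alg_const_def)
qed

text \<open>The coefficients of a product are a cyclic convolution. By subadditivity of the weight of
  residues, the weight falls on one of the factors, while the other one is absolutely summable.\<close>

lemma gnorm_mult:
  fixes f g :: "real ^ 'd::finite \<Rightarrow> complex"
  assumes K: "K \<ge> 1" and r: "r > real CARD('d) / 2"
  shows "gnorm K r (\<lambda>x. f x * g x) \<le> alg_const TYPE('d) r * gnorm K r f * gnorm K r g"
proof -
  have r0: "0 \<le> r" using r by (smt (verit) divide_nonneg_nonneg of_nat_0_le_iff)
  \<comment> \<open>The weight is extended periodically from \<open>modes K\<close> to all frequencies.\<close>
  define W where "W = (\<lambda>k :: int ^ 'd. wt (residue K k) powr r)"
  define a where "a = (\<lambda>k. cmod (dft K f k))"
  define b where "b = (\<lambda>k. cmod (dft K g k))"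
  have perW: "mode_periodic K W" unfolding mode_periodic_def W_def using residue_cong by metis
  have pera: "mode_periodic K a" "mode_periodic K b" unfolding mode_periodic_def a_def b_def using dft_per[OF K] by metis+
  have per: "mode_periodic K (\<lambda>k. W k * a k)" "mode_periodic K (\<lambda>k. W k * b k)" using perW pera unfolding mode_periodic_def by metis+
  have nonneg: "0 \<le> W k" "0 \<le> a k" "0 \<le> b k" for k by (auto simp: W_def a_def b_def)
  have Wm: "wt k powr r = W k" if "k \<in> modes K" for k using that K by (simp add: W_def)
  have Wk: "W k \<le> 2 powr r * (W p + W (k - p))" for k p
  proof -
    have "W k \<le> (wt (residue K p) + wt (residue K (k - p))) powr r"
      unfolding W_def using wt_residue_add[OF K, of p "k - p"] r0 by (intro powr_mono2) auto
    also have "\<dots> \<le> 2 powr r * (W p + W (k - p))"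
      unfolding W_def by (rule powr_add_le) (use r0 in auto)
    finally show ?thesis .
  qed
  have l2: "L2_set (\<lambda>k. W k * a k) (modes K) = gnorm K r f" "L2_set (\<lambda>k. W k * b k) (modes K) = gnorm K r g"
    unfolding gnorm_def wnorm_def a_def b_def by (intro L2_set_cong; simp add: Wm)+
  have l1: "(\<Sum>p\<in>modes K. a p) \<le> weight_const TYPE('d) r * gnorm K r f" "(\<Sum>p\<in>modes K. b p) \<le> weight_const TYPE('d) r * gnorm K r g"
    unfolding a_def b_def gnorm_def by (intro sum_le_wnorm[OF r]; simp)+
  define S1 where "S1 = (\<lambda>k. \<Sum>p\<in>modes K. b p * (W (k - p) * a (k - p)))"
  define S2 where "S2 = (\<lambda>k. \<Sum>p\<in>modes K. a p * (W (k - p) * b (k - p)))"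
  have S1: "(\<Sum>p\<in>modes K. (W p * a p) * b (k - p)) = S1 k" for k
  proof -
    have "mode_periodic K (\<lambda>p. (W p * a p) * b (k - p))"
      unfolding mode_periodic_def using per(1) pera(2) mode_cong_diff[OF mode_cong_refl[of K k]] unfolding mode_periodic_def by metis
    from sum_modes_reflect[OF K this, of k, symmetric] show ?thesis by (simp add: S1_def mult_ac)
  qed
  have "gnorm K r (\<lambda>x. f x * g x) \<le> L2_set (\<lambda>k. 2 powr r * (S1 k + S2 k)) (modes K)"
    unfolding gnorm_def wnorm_def
  proof (rule L2_set_mono)
    fix k :: "int ^ 'd" assume k: "k \<in> modes K"
    have "cmod (dft K (\<lambda>x. f x * g x) k) \<le> (\<Sum>p\<in>modes K. a p * b (k - p))"
      unfolding dft_mult[OF K] a_def b_def by (rule order_trans[OF norm_sum]) (simp add: norm_mult)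
    then have "wt k powr r * cmod (dft K (\<lambda>x. f x * g x) k) \<le> W k * (\<Sum>p\<in>modes K. a p * b (k - p))"
      unfolding Wm[OF k] using nonneg by (intro mult_left_mono)
    also have "\<dots> \<le> (\<Sum>p\<in>modes K. 2 powr r * (W p + W (k - p)) * (a p * b (k - p)))"
      unfolding sum_distrib_left using Wk nonneg by (intro sum_mono mult_right_mono) auto
    also have "\<dots> = 2 powr r * ((\<Sum>p\<in>modes K. (W p * a p) * b (k - p)) + S2 k)"
      by (simp add: S2_def sum_distrib_left ring_distribs sum.distrib mult_ac)
    finally show "wt k powr r * cmod (dft K (\<lambda>x. f x * g x) k) \<le> 2 powr r * (S1 k + S2 k)" by (simp add: S1)
  qed auto
  also have "\<dots> = 2 powr r * L2_set (\<lambda>k. S1 k + S2 k) (modes K)" by (subst L2_set_right_distrib) auto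
  also have "\<dots> \<le> 2 powr r * (L2_set S1 (modes K) + L2_set S2 (modes K))"
    by (intro mult_left_mono L2_set_triangle_ineq) auto
  also have "\<dots> \<le> 2 powr r * ((weight_const TYPE('d) r * gnorm K r g) * gnorm K r f + (weight_const TYPE('d) r * gnorm K r f) * gnorm K r g)"
  proof (intro mult_left_mono add_mono)
    show "L2_set S1 (modes K) \<le> (weight_const TYPE('d) r * gnorm K r g) * gnorm K r f"
      unfolding S1_def using nonneg l1
      by (intro order_trans[OF discrete_young[OF K per(1), of b]]) (auto simp: l2 intro!: mult_right_mono)
    show "L2_set S2 (modes K) \<le> (weight_const TYPE('d) r * gnorm K r f) * gnorm K r g"
      unfolding S2_def using nonneg l1
      by (intro order_trans[OF discrete_young[OF K per(2), of a]]) (auto simp: l2 intro!: mult_right_mono)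
  qed auto
  also have "\<dots> = alg_const TYPE('d) r * gnorm K r f * gnorm K r g" by (simp add: alg_const_def)
  finally show ?thesis .
qed

text \<open>The set \<open>modes K\<close> is not symmetric under negation, but it is so modulo \<open>2 K\<close>, and the
  weights of residues respect this symmetry.\<close>

lemma gnorm_cnj: "K \<ge> 1 \<Longrightarrow> gnorm K r (\<lambda>x. cnj (f x)) = gnorm K r f"
proof -
  assume K: "K \<ge> 1"
  let ?F = "\<lambda>k. (wt (residue K k) powr r * cmod (dft K f k))\<^sup>2"
  have "mode_periodic K ?F" unfolding mode_periodic_def using residue_cong dft_per[OF K] by metis
  from sum_modes_reflect[OF K this, of 0]
  have "(\<Sum>k\<in>modes K. ?F (- k)) = (\<Sum>k\<in>modes K. ?F k)" by simp
  then have "(\<Sum>k\<in>modes K. (wt k powr r * cmod (dft K f (- k)))\<^sup>2) = (\<Sum>k\<in>modes K. (wt k powr r * cmod (dft K f k))\<^sup>2)"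
    using K by (simp add: wt_residue_minus)
  then show ?thesis by (simp add: gnorm_def wnorm_def L2_set_def dft_cnj)
qed

section \<open>Bounds in Sobolev spaces and products\<close>

text \<open>A bound for the norm of a continuous function in \<open>H\<^sup>r\<close>. As a predicate it includes membership
  in the space, whereas the value of an infinite sum carries information only if the sum converges.\<close>

definition H_bound :: "real \<Rightarrow> (real ^ 'd::finite \<Rightarrow> complex) \<Rightarrow> real \<Rightarrow> bool"
  where "H_bound r f B \<longleftrightarrow> ctorus f \<and> (\<forall>F. finite F \<longrightarrow> wnorm r F (fc f) \<le> B)"

lemma H_bound_ctorus: "H_bound r f B \<Longrightarrow> ctorus f" by (simp add: H_bound_def)
lemma H_bound_wnorm: "H_bound r f B \<Longrightarrow> wnorm r (modes K) (fc f) \<le> B" by (simp add: H_bound_def)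
lemma H_bound_nonneg: "H_bound r f B \<Longrightarrow> 0 \<le> B"
  unfolding H_bound_def by (metis finite.emptyI wnorm_nonneg order_trans)
lemma H_bound_mono: "H_bound q f B \<Longrightarrow> r \<le> q \<Longrightarrow> B \<le> B' \<Longrightarrow> H_bound r f B'"
  unfolding H_bound_def using wnorm_le_exp order_trans by meson
lemma H_bound_add: "H_bound r f A \<Longrightarrow> H_bound r g B \<Longrightarrow> H_bound r (\<lambda>x. f x + g x) (A + B)"
proof -
  assume h: "H_bound r f A" "H_bound r g B"
  have "fc (\<lambda>x. f x + g x) = (\<lambda>j. fc f j + fc g j)" using h by (auto simp: H_bound_def fc_add)
  then show ?thesis
    using h unfolding H_bound_def by (auto simp: ctorus_add intro!: order_trans[OF wnorm_add] add_mono)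
qed
lemma H_bound_cnj: "H_bound r f A \<Longrightarrow> H_bound r (\<lambda>x. cnj (f x)) A"
proof -
  assume h: "H_bound r f A"
  have "wnorm r F (fc (\<lambda>x. cnj (f x))) = wnorm r (uminus ` F) (fc f)" if "finite F" for F
    by (simp add: wnorm_def L2_set_def fc_cnj sum.reindex inj_on_def)
  then show ?thesis using h by (auto simp: H_bound_def ctorus_cnj)
qed

lemma H_bound_summable:
  fixes f :: "real ^ 'd::finite \<Rightarrow> complex"
  assumes "H_bound r f B" and r: "r > real CARD('d) / 2"
  shows "(\<lambda>j. cmod (fc f j)) summable_on UNIV" "finite F \<Longrightarrow> (\<Sum>j\<in>F. cmod (fc f j)) \<le> weight_const TYPE('d) r * B"
proof -
  have *: "(\<Sum>j\<in>F. cmod (fc f j)) \<le> weight_const TYPE('d) r * B" if "finite F" for F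
  proof -
    have "(\<Sum>j\<in>F. cmod (fc f j)) \<le> weight_const TYPE('d) r * wnorm r F (fc f)" by (rule sum_le_wnorm[OF r that])
    also have "\<dots> \<le> weight_const TYPE('d) r * B" using assms(1) that weight_const(1)[OF r] by (intro mult_left_mono) (auto simp: H_bound_def)
    finally show ?thesis .
  qed
  then show "finite F \<Longrightarrow> (\<Sum>j\<in>F. cmod (fc f j)) \<le> weight_const TYPE('d) r * B" .
  show "(\<lambda>j. cmod (fc f j)) summable_on UNIV"
    by (rule nonneg_bdd_above_summable_on) (auto intro!: bdd_aboveI2 *)
qed

lemma ctorus_synth [simp]: "ctorus (synth K a)"
  unfolding synth_def by (intro ctorus_sum ctorus_mult) auto

lemma fc_synth: "fc (synth K a) j = (if j \<in> modes K then a j else 0)"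
  unfolding synth_def by (simp add: fc_trig)

lemma fourier_partial_sums:
  fixes f :: "real ^ 'd::finite \<Rightarrow> complex"
  assumes h: "H_bound r f B" and r: "r > real CARD('d) / 2"
  shows "(\<lambda>n. synth n (fc f) x) \<longlonglongrightarrow> f x" "cmod (synth n (fc f) x) \<le> weight_const TYPE('d) r * B"
    "cmod (f x) \<le> weight_const TYPE('d) r * B"
proof -
  show 1: "(\<lambda>n. synth n (fc f) x) \<longlonglongrightarrow> f x"
    using fourier_inversion[OF H_bound_ctorus[OF h] H_bound_summable(1)[OF h r], of x] filterlim_modes
    unfolding has_sum_def synth_def by (rule filterlim_compose)
  show 2: "cmod (synth n (fc f) x) \<le> weight_const TYPE('d) r * B" for n
    unfolding synth_def using H_bound_summable(2)[OF h r, of "modes n"]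
    by (intro order_trans[OF norm_sum]) (simp add: norm_mult)
  show "cmod (f x) \<le> weight_const TYPE('d) r * B"
    by (rule Lim_norm_ubound[OF _ 1]) (use 2 in auto)
qed

text \<open>No aliasing: the grid resolves all frequencies of \<open>f\<close>.\<close>

lemma dft_eq_fc:
  assumes K: "K \<ge> 1" and f: "f = (\<lambda>x. \<Sum>p\<in>P. c p * expi (h p) x)" and h: "\<And>p. p \<in> P \<Longrightarrow> h p \<in> modes K" and k: "k \<in> modes K"
  shows "dft K f k = fc f k"
proof -
  have "dft K f k = (\<Sum>p\<in>P. c p * dft K (expi (h p)) k)" unfolding f dft_sum dft_cmult ..
  also have "\<dots> = (\<Sum>p\<in>P. c p * fc (expi (h p)) k)"
    using modes_mode_cong_eq[OF h k] by (intro sum.cong refl) (auto simp: dft_expi[OF K] fc_expi)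
  also have "\<dots> = fc f k" unfolding f by (subst fc_sum) (auto simp: fc_cmult ctorus_mult)
  finally show ?thesis .
qed

text \<open>The product of two Fourier partial sums over \<open>modes n\<close> has frequencies in \<open>modes (2 * n)\<close>,
  so its discrete norm on the grid of size \<open>2 * n\<close> is its Sobolev norm and \<open>gnorm_mult\<close> applies.
  The constant does not depend on \<open>n\<close>, and the coefficients converge.\<close>

lemma H_bound_mult:
  fixes f g :: "real ^ 'd::finite \<Rightarrow> complex"
  assumes f: "H_bound r f A" and g: "H_bound r g B" and r: "r > real CARD('d) / 2"
  shows "H_bound r (\<lambda>x. f x * g x) (alg_const TYPE('d) r * A * B)"
  unfolding H_bound_def
proof (intro conjI allI impI)
  show fg: "ctorus (\<lambda>x. f x * g x)" using f g by (auto simp: H_bound_def intro: ctorus_mult)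
  fix F :: "(int ^ 'd) set" assume F: "finite F"
  obtain N where N: "N \<ge> 1" "\<And>n. n \<ge> N \<Longrightarrow> F \<subseteq> modes n" using finite_subset_modes[OF F] by blast
  define fn where "fn = (\<lambda>n. synth n (fc f))"
  define gn where "gn = (\<lambda>n. synth n (fc g))"
  have bound: "wnorm r F (fc (\<lambda>x. fn n x * gn n x)) \<le> alg_const TYPE('d) r * A * B" if n: "n \<ge> N" for n
  proof -
    have n1: "1 \<le> 2 * n" "n \<ge> 1" using n N by auto
    have m2: "(modes n :: (int ^ 'd) set) \<subseteq> modes (2 * n)" unfolding modes_def by auto (smt (verit))+
    have dfn: "gnorm (2 * n) r (synth n (fc h)) \<le> H" if h: "H_bound r h H" for h :: "real ^ 'd \<Rightarrow> complex" and H
    proof -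
      have "dft (2 * n) (synth n (fc h)) k = fc (synth n (fc h)) k" if "k \<in> modes (2 * n)" for k
        by (rule dft_eq_fc[OF n1(1), where P = "modes n" and c = "fc h" and h = "\<lambda>p. p"]) (use m2 that in \<open>auto simp: synth_def fun_eq_iff\<close>)
      then have "gnorm (2 * n) r (synth n (fc h)) \<le> wnorm r (modes (2 * n)) (fc h)"
        unfolding gnorm_def by (intro wnorm_mono) (auto simp: fc_synth)
      then show ?thesis using H_bound_wnorm[OF h, of "2 * n"] by simp
    qed
    have "dft (2 * n) (\<lambda>x. fn n x * gn n x) k = fc (\<lambda>x. fn n x * gn n x) k" if k: "k \<in> modes (2 * n)" for k
    proof (rule dft_eq_fc[OF n1(1) _ _ k])
      show "(\<lambda>x. fn n x * gn n x) = (\<lambda>x. \<Sum>p\<in>modes n \<times> modes n. (fc f (fst p) * fc g (snd p)) * expi (fst p + snd p) x)"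
        by (simp add: fn_def gn_def synth_def sum_product sum.cartesian_product expi_add mult_ac case_prod_unfold fun_eq_iff)
      show "fst p + snd p \<in> modes (2 * n)" if "p \<in> modes n \<times> modes n" for p :: "(int ^ 'd) \<times> (int ^ 'd)"
        using that unfolding modes_def by (auto simp: mem_Times_iff) (smt (verit))+
    qed
    moreover have "F \<subseteq> modes (2 * n)" using N(2)[OF n] m2 by blast
    ultimately have "wnorm r F (fc (\<lambda>x. fn n x * gn n x)) \<le> wnorm r (modes (2 * n)) (fc (\<lambda>x. fn n x * gn n x))"
        and "wnorm r (modes (2 * n)) (fc (\<lambda>x. fn n x * gn n x)) = gnorm (2 * n) r (\<lambda>x. fn n x * gn n x)"
      unfolding gnorm_def by (auto intro!: wnorm_subset wnorm_cong)
    moreover have "gnorm (2 * n) r (\<lambda>x. fn n x * gn n x) \<le> alg_const TYPE('d) r * gnorm (2 * n) r (fn n) * gnorm (2 * n) r (gn n)"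
      by (rule gnorm_mult[OF n1(1) r])
    moreover have "alg_const TYPE('d) r * gnorm (2 * n) r (fn n) * gnorm (2 * n) r (gn n) \<le> alg_const TYPE('d) r * A * B"
      using dfn[OF f] dfn[OF g] alg_const_ge1[OF r] H_bound_nonneg[OF f] H_bound_nonneg[OF g] unfolding fn_def gn_def
      by (intro mult_mono mult_nonneg_nonneg) auto
    ultimately show ?thesis by linarith
  qed
  have "(\<lambda>n. wnorm r F (fc (\<lambda>x. fn n x * gn n x))) \<longlonglongrightarrow> wnorm r F (fc (\<lambda>x. f x * g x))"
  proof (rule wnorm_tendsto, rule fc_tendsto[OF _ fg])
    show "ctorus (\<lambda>x. fn n x * gn n x)" for n unfolding fn_def gn_def by (intro ctorus_mult) auto
    show "(\<lambda>n. fn n x * gn n x) \<longlonglongrightarrow> f x * g x" for x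
      unfolding fn_def gn_def by (intro tendsto_mult fourier_partial_sums[OF f r] fourier_partial_sums[OF g r])
    show "cmod (fn n x * gn n x) \<le> (weight_const TYPE('d) r * A) * (weight_const TYPE('d) r * B)" for n x
      unfolding fn_def gn_def norm_mult
      using fourier_partial_sums(2)[OF f r, of n x] fourier_partial_sums(2)[OF g r, of n x]
      by (intro mult_mono) (auto intro: order_trans[OF norm_ge_zero])
  qed
  then show "wnorm r F (fc (\<lambda>x. f x * g x)) \<le> alg_const TYPE('d) r * A * B"
    by (rule tendsto_upperbound) (use bound in \<open>auto simp: eventually_sequentially\<close>)
qed

section \<open>Interpolation error\<close>

lemma wt_modes_le:
  fixes k :: "int ^ 'd::finite"
  assumes "K \<ge> 1" "k \<in> modes K"
  shows "wt k \<le> real CARD('d) * real K"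
proof -
  have "norm (freq k) \<le> (\<Sum>i\<in>UNIV. \<bar>freq k $ i\<bar>)" by (rule norm_le_l1_cart)
  also have "\<dots> \<le> (\<Sum>i\<in>(UNIV::'d set). real K)"
  proof (rule sum_mono)
    fix i
    have "- int K \<le> k $ i" "k $ i < int K" using assms(2) by (auto simp: modes_def)
    then have "\<bar>k $ i\<bar> \<le> int K" by linarith
    then have "real_of_int \<bar>k $ i\<bar> \<le> real_of_int (int K)" by (simp only: of_int_le_iff)
    then show "\<bar>freq k $ i\<bar> \<le> real K" by (simp add: freq_def)
  qed
  finally have "norm (freq k) \<le> real CARD('d) * real K" by simp
  moreover have "1 * 1 \<le> real CARD('d) * real K" using assms(1) by (intro mult_mono) (auto simp: Suc_le_eq)
  ultimately show ?thesis by (simp add: wt_def)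
qed

lemma wt_eq_norm: "m \<noteq> 0 \<Longrightarrow> wt m = norm (freq m)"
proof -
  assume "m \<noteq> 0"
  then obtain i where "m $ i \<noteq> 0" by (auto simp: vec_eq_iff)
  then have "1 \<le> real_of_int \<bar>m $ i\<bar>" by simp
  also have "\<dots> \<le> norm (freq m)" using component_le_norm_cart[of "freq m" i] by (simp add: freq_def)
  finally show ?thesis by (simp add: wt_def)
qed

definition interp_const :: "'d::finite itself \<Rightarrow> real \<Rightarrow> real \<Rightarrow> real"
  where "interp_const t r q = real CARD('d) powr r * weight_const t q"

text \<open>The interpolant collects, at each frequency \<open>k\<close> of the grid, the coefficients of all
  frequencies \<open>j\<close> congruent to \<open>k\<close> modulo \<open>2 K\<close>. Those with \<open>j \<noteq> k\<close> have weight at least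
  \<open>K\<close> times the weight of \<open>(j - k) / (2 K)\<close>, so Cauchy-Schwarz bounds their sum by
  \<open>K powr (- (r + \<sigma>))\<close> times the part of the norm that belongs to the class of \<open>k\<close>; the classes
  are disjoint. The weight \<open>wt k powr r\<close> contributes at most a multiple of \<open>K powr r\<close>. The estimate is
  proved for Fourier partial sums first, which converge at the grid points.\<close>

lemma interpolation_error:
  fixes f :: "real ^ 'd::finite \<Rightarrow> complex"
  assumes K: "K \<ge> 1" and r: "0 \<le> r" and q: "r + \<sigma> > real CARD('d) / 2" and f: "H_bound (r + \<sigma>) f B"
  shows "wnorm r (modes K) (\<lambda>k. dft K f k - fc f k) \<le> interp_const TYPE('d) r (r + \<sigma>) * real K powr (- \<sigma>) * B"
proof -
  define \<rho> where "\<rho> = r + \<sigma>"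
  have \<rho>: "\<rho> > 0" "\<rho> > real CARD('d) / 2" using q unfolding \<rho>_def by (smt (verit) divide_nonneg_nonneg of_nat_0_le_iff)+
  let ?Z = "weight_const TYPE('d) \<rho>"
  define cc where "cc = (real CARD('d) * real K) powr r * (real K powr (- \<rho>) * ?Z)"
  have Z: "?Z \<ge> 1" by (rule weight_const[OF \<rho>(2)])
  have bound: "wnorm r (modes K) (\<lambda>k. dft K (synth n (fc f)) k - fc f k) \<le> cc * B" if n: "n \<ge> K" for n
  proof -
    have mn: "(modes K :: (int ^ 'd) set) \<subseteq> modes n" using n unfolding modes_def by auto (smt (verit) of_nat_mono)+
    \<comment> \<open>the frequencies that the grid mistakes for \<open>k\<close>\<close>
    define S where "S = (\<lambda>k :: int ^ 'd. {j \<in> modes n. mode_cong K j k \<and> j \<noteq> k})"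
    have fS: "finite (S k)" for k by (simp add: S_def)
    have err: "dft K (synth n (fc f)) k - fc f k = (\<Sum>j\<in>S k. fc f j)" if k: "k \<in> modes K" for k
    proof -
      have "dft K (synth n (fc f)) k = (\<Sum>j\<in>modes n. fc f j * dft K (expi j) k)"
        unfolding synth_def dft_sum dft_cmult ..
      also have "\<dots> = (\<Sum>j\<in>modes n. if mode_cong K j k then fc f j else 0)"
        by (intro sum.cong refl) (auto simp: dft_expi[OF K])
      also have "\<dots> = (\<Sum>j\<in>{j\<in>modes n. mode_cong K j k}. fc f j)" by (simp add: sum.If_cases Int_def)
      also have "{j\<in>modes n. mode_cong K j k} = insert k (S k)" using mn k by (auto simp: S_def)
      also have "(\<Sum>j\<in>insert k (S k). fc f j) = fc f k + (\<Sum>j\<in>S k. fc f j)"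
        using fS by (subst sum.insert) (auto simp: S_def)
      finally show ?thesis by simp
    qed
    have SZ: "L2_set (\<lambda>j. wt j powr (- \<rho>)) (S k) \<le> real K powr (- \<rho>) * ?Z" if k: "k \<in> modes K" for k
    proof -
      define mm where "mm = (\<lambda>j :: int ^ 'd. \<chi> i. (j $ i - k $ i) div (2 * int K))"
      have j: "j $ i = k $ i + 2 * int K * (mm j $ i)" if "j \<in> S k" for j i
        using that unfolding S_def mode_cong_def mm_def by auto
      have inj: "inj_on mm (S k)"
        by (rule inj_onI) (metis j vec_eq_iff)
      \<comment> \<open>For \<open>m = (j - k) / (2 K) \<noteq> 0\<close> the components satisfy \<open>\<bar>2 K m\<^sub>i\<bar> - K \<le> \<bar>j\<^sub>i\<bar>\<close>,
        which is at least \<open>K \<bar>m\<^sub>i\<bar>\<close> if \<open>m\<^sub>i \<noteq> 0\<close>.\<close>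
      have wj: "real K * wt (mm j) \<le> wt j" if jS: "j \<in> S k" for j
      proof -
        have "mm j \<noteq> 0"
        proof
          assume "mm j = 0"
          then have "j = k" using j[OF jS] by (simp add: vec_eq_iff)
          then show False using jS by (simp add: S_def)
        qed
        have "norm (real K *\<^sub>R freq (mm j)) \<le> norm (freq j)"
        proof (rule norm_le_componentwise_cart)
          fix i
          have ki: "- int K \<le> k $ i" "k $ i < int K" using k by (auto simp: modes_def)
          have "int K * \<bar>mm j $ i\<bar> \<le> \<bar>j $ i\<bar>"
          proof (cases "mm j $ i = 0")
            case False
            then have "int K * 1 \<le> int K * \<bar>mm j $ i\<bar>" by (intro mult_left_mono) auto
            moreover have "\<bar>2 * int K * (mm j $ i)\<bar> = 2 * (int K * \<bar>mm j $ i\<bar>)" by (simp add: abs_mult)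
            ultimately show ?thesis using ki unfolding j[OF jS] by linarith
          qed auto
          then have "real_of_int (int K * \<bar>mm j $ i\<bar>) \<le> real_of_int \<bar>j $ i\<bar>" by (simp only: of_int_le_iff)
          then show "norm ((real K *\<^sub>R freq (mm j)) $ i) \<le> norm (freq j $ i)" by (simp add: freq_def abs_mult)
        qed
        then show ?thesis using wt_eq_norm[OF \<open>mm j \<noteq> 0\<close>] by (simp add: wt_def)
      qed
      have "L2_set (\<lambda>j. wt j powr (- \<rho>)) (S k) \<le> L2_set (\<lambda>j. real K powr (- \<rho>) * wt (mm j) powr (- \<rho>)) (S k)"
      proof (rule L2_set_mono)
        fix j assume "j \<in> S k"
        from wj[OF this] have "wt j powr (- \<rho>) \<le> (real K * wt (mm j)) powr (- \<rho>)"
          using K \<rho> by (intro powr_mono2') (auto intro!: mult_pos_pos)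
        then show "wt j powr (- \<rho>) \<le> real K powr (- \<rho>) * wt (mm j) powr (- \<rho>)" by (simp add: powr_mult less_imp_le)
      qed auto
      also have "\<dots> = real K powr (- \<rho>) * L2_set (\<lambda>j. wt (mm j) powr (- \<rho>)) (S k)" by (subst L2_set_right_distrib) auto
      also have "L2_set (\<lambda>j. wt (mm j) powr (- \<rho>)) (S k) = L2_set (\<lambda>m. wt m powr (- \<rho>)) (mm ` S k)"
        using inj by (simp add: L2_set_def sum.reindex)
      also have "\<dots> \<le> ?Z" by (rule weight_const[OF \<rho>(2)]) (simp add: fS)
      finally show ?thesis by (simp add: mult_left_mono)
    qed
    have "wnorm r (modes K) (\<lambda>k. dft K (synth n (fc f)) k - fc f k) \<le> L2_set (\<lambda>k. cc * wnorm \<rho> (S k) (fc f)) (modes K)"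
      unfolding wnorm_def[of r]
    proof (rule L2_set_mono)
      fix k :: "int ^ 'd" assume k: "k \<in> modes K"
      have "cmod (dft K (synth n (fc f)) k - fc f k) \<le> (\<Sum>j\<in>S k. cmod (fc f j))"
        unfolding err[OF k] by (rule norm_sum)
      also have "\<dots> = (\<Sum>j\<in>S k. \<bar>wt j powr (- \<rho>)\<bar> * \<bar>wt j powr \<rho> * cmod (fc f j)\<bar>)"
        by (intro sum.cong refl) (simp add: abs_mult powr_minus field_simps)
      also have "\<dots> \<le> L2_set (\<lambda>j. wt j powr (- \<rho>)) (S k) * wnorm \<rho> (S k) (fc f)" unfolding wnorm_def by (rule L2_set_mult_ineq)
      also have "\<dots> \<le> (real K powr (- \<rho>) * ?Z) * wnorm \<rho> (S k) (fc f)" by (intro mult_right_mono SZ k) auto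
      finally have 1: "cmod (dft K (synth n (fc f)) k - fc f k) \<le> (real K powr (- \<rho>) * ?Z) * wnorm \<rho> (S k) (fc f)" .
      have 2: "wt k powr r \<le> (real CARD('d) * real K) powr r"
        using wt_modes_le[OF K k] r by (intro powr_mono2) (auto intro: less_imp_le)
      show "wt k powr r * cmod (dft K (synth n (fc f)) k - fc f k) \<le> cc * wnorm \<rho> (S k) (fc f)"
        using mult_mono[OF 2 1] by (simp add: cc_def mult_ac)
    qed auto
    also have "\<dots> = cc * L2_set (\<lambda>k. wnorm \<rho> (S k) (fc f)) (modes K)"
      using Z by (subst L2_set_right_distrib) (auto simp: cc_def)
    also have "L2_set (\<lambda>k. wnorm \<rho> (S k) (fc f)) (modes K) = wnorm \<rho> (\<Union>k\<in>modes K. S k) (fc f)"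
    proof -
      have disj: "\<forall>k\<in>modes K. \<forall>k'\<in>modes K. k \<noteq> k' \<longrightarrow> S k \<inter> S k' = {}"
        unfolding S_def using modes_mode_cong_eq mode_cong_sym mode_cong_trans by blast
      show ?thesis unfolding wnorm_def L2_set_def
        by (subst sum.UNION_disjoint[OF _ _ disj]) (auto simp: fS sum_nonneg)
    qed
    also have "cc * \<dots> \<le> cc * B"
      using f Z by (intro mult_left_mono) (auto simp: H_bound_def \<rho>_def fS cc_def)
    finally show ?thesis .
  qed
  have "(\<lambda>n. wnorm r (modes K) (\<lambda>k. dft K (synth n (fc f)) k - fc f k)) \<longlonglongrightarrow> wnorm r (modes K) (\<lambda>k. dft K f k - fc f k)"
    unfolding dft_def
    by (intro wnorm_tendsto tendsto_intros fourier_partial_sums(1)[OF f q])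
       (use modes_nonempty[OF K, where 'd='d] in auto)
  then have "wnorm r (modes K) (\<lambda>k. dft K f k - fc f k) \<le> cc * B"
    by (rule tendsto_upperbound) (use bound in \<open>auto simp: eventually_sequentially\<close>)
  also have "cc = interp_const TYPE('d) r (r + \<sigma>) * real K powr (- \<sigma>)"
    using K by (simp add: cc_def interp_const_def \<rho>_def powr_mult powr_add[symmetric] mult_ac)
  finally show ?thesis .
qed

text \<open>The case of order \<open>0\<close> of the interpolation error: interpolation is bounded on \<open>H\<^sup>r\<close>.\<close>

lemma gnorm_le_H_bound:
  fixes f :: "real ^ 'd::finite \<Rightarrow> complex"
  assumes K: "K \<ge> 1" and r: "r > real CARD('d) / 2" and f: "H_bound r f B"
  shows "gnorm K r f \<le> (1 + interp_const TYPE('d) r r) * B"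
proof -
  have r0: "0 \<le> r" using r by (smt (verit) divide_nonneg_nonneg of_nat_0_le_iff)
  have "gnorm K r f = wnorm r (modes K) (\<lambda>k. (dft K f k - fc f k) + fc f k)" by (simp add: gnorm_def)
  also have "\<dots> \<le> wnorm r (modes K) (\<lambda>k. dft K f k - fc f k) + wnorm r (modes K) (fc f)" by (rule wnorm_add)
  also have "\<dots> \<le> interp_const TYPE('d) r r * B + B"
    using interpolation_error[OF K r0, of 0 f B] r f K H_bound_wnorm[OF f] by (intro add_mono) auto
  finally show ?thesis by (simp add: algebra_simps)
qed

lemma interp_const_nonneg: "q > real CARD('d::finite) / 2 \<Longrightarrow> 0 \<le> interp_const TYPE('d) r q"
  using weight_const(1)[where 'd='d, of q] by (simp add: interp_const_def)

section \<open>A mean value inequality\<close>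

text \<open>The inequality follows from the real mean value theorem for the weighted inner product of the
  path with its own increment.\<close>

lemma wnorm_mean_value:
  fixes x :: "real \<Rightarrow> int ^ 'd::finite \<Rightarrow> complex"
  assumes pq: "p \<le> q" and F: "finite F"
    and d: "\<And>j t. j \<in> F \<Longrightarrow> t \<in> {p..q} \<Longrightarrow> ((\<lambda>t. x t j) has_vector_derivative y t j) (at t within {p..q})"
    and B: "\<And>t. t \<in> {p..q} \<Longrightarrow> wnorm r F (y t) \<le> B"
  shows "wnorm r F (\<lambda>j. x q j - x p j) \<le> B * (q - p)"
proof (cases "p = q")
  case True
  then show ?thesis by (simp add: wnorm_def L2_set_0')
next
  case False
  with pq have pq: "p < q" by simp
  define b where "b = (\<lambda>j. x q j - x p j)"
  define v where "v = (\<lambda>j :: int ^ 'd. (wt j powr r)\<^sup>2)"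
  define \<phi> where "\<phi> = (\<lambda>t. \<Sum>j\<in>F. v j * (b j \<bullet> x t j))"
  have d\<phi>: "(\<phi> has_vector_derivative (\<Sum>j\<in>F. v j * (b j \<bullet> y t j))) (at t within {p..q})" if "t \<in> {p..q}" for t
    unfolding \<phi>_def
    by (intro has_vector_derivative_sum bounded_linear.has_vector_derivative[OF bounded_linear_mult_right]
        bounded_linear.has_vector_derivative[OF bounded_linear_inner_right] d that)
  have "\<exists>z\<in>{p..q}. \<phi> q - \<phi> p = (\<lambda>h. h * (\<Sum>j\<in>F. v j * (b j \<bullet> y z j))) (q - p)"
  proof (rule mvt_very_simple)
    fix z assume "p \<le> z" "z \<le> q"
    then show "(\<phi> has_derivative (\<lambda>h. h * (\<Sum>j\<in>F. v j * (b j \<bullet> y z j)))) (at z within {p..q})"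
      using d\<phi>[of z] by (simp add: has_vector_derivative_def)
  qed (use pq in simp)
  then obtain z where z: "p \<le> z" "z \<le> q" and eq: "\<phi> q - \<phi> p = (q - p) * (\<Sum>j\<in>F. v j * (b j \<bullet> y z j))" by auto
  have "\<phi> q - \<phi> p = (\<Sum>j\<in>F. v j * (b j \<bullet> b j))"
    by (simp add: \<phi>_def sum_subtractf[symmetric] b_def inner_diff_right algebra_simps)
  also have "\<dots> = (wnorm r F b)\<^sup>2"
    by (simp add: wnorm_def L2_set_def sum_nonneg v_def power_mult_distrib power2_norm_eq_inner)
  finally have sq: "(wnorm r F b)\<^sup>2 = (q - p) * (\<Sum>j\<in>F. v j * (b j \<bullet> y z j))" using eq by simp
  have "(\<Sum>j\<in>F. v j * (b j \<bullet> y z j)) \<le> (\<Sum>j\<in>F. \<bar>wt j powr r * cmod (b j)\<bar> * \<bar>wt j powr r * cmod (y z j)\<bar>)"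
  proof (rule sum_mono)
    fix j
    have "v j * (b j \<bullet> y z j) \<le> v j * (norm (b j) * norm (y z j))"
      by (intro mult_left_mono norm_cauchy_schwarz) (auto simp: v_def)
    then show "v j * (b j \<bullet> y z j) \<le> \<bar>wt j powr r * cmod (b j)\<bar> * \<bar>wt j powr r * cmod (y z j)\<bar>"
      by (simp add: v_def power2_eq_square abs_mult mult_ac)
  qed
  also have "\<dots> \<le> wnorm r F b * wnorm r F (y z)" unfolding wnorm_def by (rule L2_set_mult_ineq)
  also have "\<dots> \<le> wnorm r F b * B" using B[of z] z by (intro mult_left_mono) auto
  finally have "(q - p) * (\<Sum>j\<in>F. v j * (b j \<bullet> y z j)) \<le> (q - p) * (wnorm r F b * B)"
    using pq by (intro mult_left_mono) auto
  then have "wnorm r F b * wnorm r F b \<le> wnorm r F b * (B * (q - p))"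
    using sq by (simp add: power2_eq_square mult_ac)
  moreover have "0 \<le> B * (q - p)"
    using order_trans[OF wnorm_nonneg B[of z]] z pq by (intro mult_nonneg_nonneg) auto
  ultimately show ?thesis
    unfolding b_def[symmetric] by (cases "wnorm r F b = 0") (auto simp: mult_le_cancel_left less_le)
qed

lemma H_bound_mean_value:
  fixes f :: "real \<Rightarrow> real ^ 'd::finite \<Rightarrow> complex"
  assumes pq: "p \<le> q" and c: "\<And>t. t \<in> {p..q} \<Longrightarrow> ctorus (f t)"
    and d: "\<And>j t. t \<in> {p..q} \<Longrightarrow> ((\<lambda>t. fc (f t) j) has_vector_derivative y t j) (at t within {p..q})"
    and B: "\<And>t F. t \<in> {p..q} \<Longrightarrow> finite F \<Longrightarrow> wnorm r F (y t) \<le> B"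
  shows "H_bound r (\<lambda>x. f q x - f p x) (B * (q - p))"
  unfolding H_bound_def
proof (intro conjI allI impI)
  have ctq: "ctorus (f q)" "ctorus (f p)" using pq c by auto
  then show "ctorus (\<lambda>x. f q x - f p x)" by (rule ctorus_diff)
  fix F :: "(int ^ 'd) set" assume F: "finite F"
  have "fc (\<lambda>x. f q x - f p x) = (\<lambda>j. fc (f q) j - fc (f p) j)" using ctq by (auto simp: fc_diff)
  then show "wnorm r F (fc (\<lambda>x. f q x - f p x)) \<le> B * (q - p)"
    using wnorm_mean_value[OF pq F d B] F by auto
qed

lemma norm_freq_le_wt [simp]: "norm (freq j) \<le> wt j" by (simp add: wt_def)

lemma norm_freq_sq_le: "(norm (freq j))\<^sup>2 \<le> wt j powr 2"
  by (simp add: powr_numeral wt_def power_mono)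

lemma wnorm_laplacian_coeffs:
  assumes "H_bound (r + 2) f A" "finite F"
  shows "wnorm r F (\<lambda>j. (norm (freq j))\<^sup>2 * fc f j) \<le> A"
proof -
  have "wnorm r F (\<lambda>j. (norm (freq j))\<^sup>2 * fc f j) \<le> 1 * wnorm (r + 2) F (fc f)"
    by (rule wnorm_multiplier) (auto simp: norm_mult norm_power intro!: mult_right_mono norm_freq_sq_le)
  then show ?thesis using assms by (auto simp: H_bound_def intro: order_trans)
qed

section \<open>Time regularity of the exact solution\<close>

text \<open>The parameter \<open>dd\<close> fixes the dimension as a type variable of the locale.

  The constants of all estimates are explicit terms in the parameters, which makes visible that they
  depend neither on the solution nor on the discretization. A name starts with \<open>c\<close> for the bound of a
  quantity, with \<open>l\<close> for its Lipschitz constant in time, and with \<open>q\<close> for the constant of its second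
  differences in time.\<close>

locale regularity =
  fixes dd :: "'d::finite itself" and s \<sigma> M :: real
  assumes s: "s > real CARD('d) / 2" and \<sigma>: "\<sigma> \<ge> 2" and M: "M \<ge> 1"
begin

lemma s_pos: "s > 0" using s by (smt (verit) divide_nonneg_nonneg of_nat_0_le_iff)

definition "cG = alg_const TYPE('d) (s + 1 + \<sigma>) * M * M"
definition "cW = alg_const TYPE('d) (s + 2 + \<sigma>) * M * M"
definition "l\<psi> = M + cG"
definition "lU' = M + cW"
definition "lG = alg_const TYPE('d) (s + \<sigma>) * M * M + alg_const TYPE('d) (s + \<sigma>) * M * l\<psi>"
definition "lW = alg_const TYPE('d) (s + \<sigma>) * l\<psi> * M + alg_const TYPE('d) (s + \<sigma>) * M * l\<psi>"
definition "q\<psi> = l\<psi> + lG"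
definition "qG = alg_const TYPE('d) s * lU' * M + alg_const TYPE('d) s * M * l\<psi> + alg_const TYPE('d) s * M * l\<psi> + alg_const TYPE('d) s * M * q\<psi>"

lemma alg_const_nonneg: "r \<ge> s \<Longrightarrow> 0 \<le> alg_const TYPE('d) r"
  using alg_const_ge1[where 'd='d, of r] s by simp

lemma c_nonneg: "0 \<le> cG" "0 \<le> cW" "0 \<le> l\<psi>" "0 \<le> lU'" "0 \<le> lG" "0 \<le> lW" "0 \<le> q\<psi>" "0 \<le> qG"
proof -
  have a: "0 \<le> alg_const TYPE('d) s" "0 \<le> alg_const TYPE('d) (s + \<sigma>)" "0 \<le> alg_const TYPE('d) (s + 1 + \<sigma>)"
    "0 \<le> alg_const TYPE('d) (s + 2 + \<sigma>)" using \<sigma> by (auto intro!: alg_const_nonneg)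
  note [simp] = a
  have m [simp]: "0 \<le> M" using M by simp
  show 1 [simp]: "0 \<le> cG" "0 \<le> cW" by (simp_all add: cG_def cW_def)
  show 2 [simp]: "0 \<le> l\<psi>" "0 \<le> lU'" by (simp_all add: l\<psi>_def lU'_def)
  show 3 [simp]: "0 \<le> lG" "0 \<le> lW" by (simp_all add: lG_def lW_def)
  show 4 [simp]: "0 \<le> q\<psi>" by (simp add: q\<psi>_def)
  show "0 \<le> qG" by (simp add: qG_def)
qed

end

text \<open>The exact solution, described by its Fourier coefficients and Sobolev bounds. Only the existence
  of the first time derivatives of the coefficients is assumed; second differences replace second
  derivatives throughout.\<close>

locale zakharov_modes = regularity dd s \<sigma> M for dd :: "'d::finite itself" and s \<sigma> M +
  fixes a b :: real and \<psi> U U' :: "real \<Rightarrow> real ^ 'd \<Rightarrow> complex"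
  assumes psi_bound: "t \<in> {a..b} \<Longrightarrow> H_bound (s + 2 + \<sigma>) (\<psi> t) M"
    and U_bound: "t \<in> {a..b} \<Longrightarrow> H_bound (s + 1 + \<sigma>) (U t) M"
    and U'_bound: "t \<in> {a..b} \<Longrightarrow> H_bound (s + \<sigma>) (U' t) M"
    and d\<psi>: "t \<in> {a..b} \<Longrightarrow> ((\<lambda>t. fc (\<psi> t) j) has_vector_derivative
        - \<i> * ((norm (freq j))\<^sup>2 * fc (\<psi> t) j + fc (\<lambda>x. U t x * \<psi> t x) j)) (at t within {a..b})"
    and dU: "t \<in> {a..b} \<Longrightarrow> ((\<lambda>t. fc (U t) j) has_vector_derivative fc (U' t) j) (at t within {a..b})"
    and dU': "t \<in> {a..b} \<Longrightarrow> ((\<lambda>t. fc (U' t) j) has_vector_derivative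
        - ((norm (freq j))\<^sup>2 * (fc (U t) j + fc (\<lambda>x. \<psi> t x * cnj (\<psi> t x)) j))) (at t within {a..b})"
begin

definition "G t = (\<lambda>x. U t x * \<psi> t x)"
definition "W t = (\<lambda>x. \<psi> t x * cnj (\<psi> t x))"

lemma G_bound: "t \<in> {a..b} \<Longrightarrow> H_bound (s + 1 + \<sigma>) (G t) cG"
  unfolding G_def cG_def using s \<sigma> M by (intro H_bound_mult U_bound H_bound_mono[OF psi_bound]) auto

lemma W_bound: "t \<in> {a..b} \<Longrightarrow> H_bound (s + 2 + \<sigma>) (W t) cW"
  unfolding W_def cW_def using s \<sigma> M by (intro H_bound_mult psi_bound H_bound_cnj) auto

lemma ct: "t \<in> {a..b} \<Longrightarrow> ctorus (\<psi> t)" "t \<in> {a..b} \<Longrightarrow> ctorus (U t)" "t \<in> {a..b} \<Longrightarrow> ctorus (U' t)"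
    "t \<in> {a..b} \<Longrightarrow> ctorus (G t)" "t \<in> {a..b} \<Longrightarrow> ctorus (W t)"
  using H_bound_ctorus[OF psi_bound] H_bound_ctorus[OF U_bound] H_bound_ctorus[OF U'_bound] H_bound_ctorus[OF G_bound] H_bound_ctorus[OF W_bound] by auto

text \<open>The Laplacian in the equation costs two derivatives.\<close>

lemma psi_lipschitz:
  assumes "t \<in> {a..b}" "t + h \<in> {a..b}" "0 \<le> h"
  shows "H_bound (s + \<sigma>) (\<lambda>x. \<psi> (t + h) x - \<psi> t x) (l\<psi> * h)"
proof -
  have sub: "{t..t + h} \<subseteq> {a..b}" using assms by auto
  have "H_bound (s + \<sigma>) (\<lambda>x. \<psi> (t + h) x - \<psi> t x) (l\<psi> * (t + h - t))"
  proof (rule H_bound_mean_value)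
    fix r assume r: "r \<in> {t..t + h}"
    let ?A = "\<lambda>j. (norm (freq j))\<^sup>2 * fc (\<psi> r) j"
    have r': "r \<in> {a..b}" using r sub by auto
    show "wnorm (s + \<sigma>) F (\<lambda>j. - \<i> * (?A j + fc (G r) j)) \<le> l\<psi>" if F: "finite F" for F
    proof -
      have "wnorm (s + \<sigma>) F (\<lambda>j. - \<i> * (?A j + fc (G r) j)) = wnorm (s + \<sigma>) F (\<lambda>j. ?A j + fc (G r) j)"
        by (rule wnorm_cong) (simp add: norm_mult)
      also have "\<dots> \<le> wnorm (s + \<sigma>) F ?A + wnorm (s + \<sigma>) F (fc (G r))" by (rule wnorm_add)
      also have "\<dots> \<le> M + cG"
      proof (rule add_mono)
        show "wnorm (s + \<sigma>) F ?A \<le> M"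
          by (rule wnorm_laplacian_coeffs[OF H_bound_mono[OF psi_bound[OF r']] F]) auto
        have "H_bound (s + \<sigma>) (G r) cG" by (rule H_bound_mono[OF G_bound[OF r']]) auto
        then show "wnorm (s + \<sigma>) F (fc (G r)) \<le> cG" using F by (simp add: H_bound_def)
      qed
      finally show ?thesis by (simp add: l\<psi>_def)
    qed
    show "((\<lambda>t. fc (\<psi> t) j) has_vector_derivative - \<i> * ((norm (freq j))\<^sup>2 * fc (\<psi> r) j + fc (G r) j)) (at r within {t..t + h})" for j
      unfolding G_def by (rule has_vector_derivative_within_subset[OF d\<psi>[OF r'] sub])
    show "ctorus (\<psi> r)" by (rule ct[OF r'])
  qed (use assms in auto)
  then show ?thesis by simp
qed

lemma U_lipschitz:
  assumes "t \<in> {a..b}" "t + h \<in> {a..b}" "0 \<le> h"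
  shows "H_bound (s + \<sigma>) (\<lambda>x. U (t + h) x - U t x) (M * h)"
proof -
  have sub: "{t..t + h} \<subseteq> {a..b}" using assms by auto
  have "H_bound (s + \<sigma>) (\<lambda>x. U (t + h) x - U t x) (M * (t + h - t))"
  proof (rule H_bound_mean_value)
    fix r assume r: "r \<in> {t..t + h}"
    have r': "r \<in> {a..b}" using r sub by auto
    show "wnorm (s + \<sigma>) F (fc (U' r)) \<le> M" if F: "finite F" for F using U'_bound[OF r'] F by (simp add: H_bound_def)
    show "((\<lambda>t. fc (U t) j) has_vector_derivative fc (U' r) j) (at r within {t..t + h})" for j
      by (rule has_vector_derivative_within_subset[OF dU[OF r'] sub])
    show "ctorus (U r)" by (rule ct[OF r'])
  qed (use assms in auto)
  then show ?thesis by simp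
qed

text \<open>The equation gives \<open>\<Delta> (U + W)\<close> as time derivative, and \<open>U\<close> has one derivative less than
  \<open>W\<close>.\<close>

lemma U'_lipschitz:
  assumes "t \<in> {a..b}" "t + h \<in> {a..b}" "0 \<le> h"
  shows "H_bound (s + \<sigma> - 1) (\<lambda>x. U' (t + h) x - U' t x) (lU' * h)"
proof -
  have sub: "{t..t + h} \<subseteq> {a..b}" using assms by auto
  have "H_bound (s + \<sigma> - 1) (\<lambda>x. U' (t + h) x - U' t x) (lU' * (t + h - t))"
  proof (rule H_bound_mean_value)
    fix r assume r: "r \<in> {t..t + h}"
    have r': "r \<in> {a..b}" using r sub by auto
    have "H_bound (s + 1 + \<sigma>) (W r) cW" by (rule H_bound_mono[OF W_bound[OF r']]) auto
    then have UW: "H_bound (s + 1 + \<sigma>) (\<lambda>x. U r x + W r x) lU'"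
      unfolding lU'_def by (rule H_bound_add[OF U_bound[OF r']])
    have "H_bound (s + \<sigma> - 1 + 2) (\<lambda>x. U r x + W r x) lU'" using UW by (simp add: algebra_simps)
    note UW = this
    have fcUW: "fc (\<lambda>x. U r x + W r x) = (\<lambda>j. fc (U r) j + fc (W r) j)"
      using r' by (auto simp: fc_add ct)
    show "wnorm (s + \<sigma> - 1) F (\<lambda>j. - ((norm (freq j))\<^sup>2 * (fc (U r) j + fc (W r) j))) \<le> lU'" if F: "finite F" for F
      using wnorm_laplacian_coeffs[OF UW F] by (simp add: fcUW)
    show "((\<lambda>t. fc (U' t) j) has_vector_derivative - ((norm (freq j))\<^sup>2 * (fc (U r) j + fc (W r) j))) (at r within {t..t + h})" for j
      unfolding W_def by (rule has_vector_derivative_within_subset[OF dU'[OF r'] sub])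
    show "ctorus (U' r)" by (rule ct[OF r'])
  qed (use assms in auto)
  then show ?thesis by simp
qed

lemma G_lipschitz:
  assumes t: "t \<in> {a..b}" "t + h \<in> {a..b}" "0 \<le> h"
  shows "H_bound (s + \<sigma>) (\<lambda>x. G (t + h) x - G t x) (lG * h)"
proof -
  have eq: "G (t + h) x - G t x = (U (t + h) x - U t x) * \<psi> (t + h) x + U t x * (\<psi> (t + h) x - \<psi> t x)" for x
    by (simp add: G_def algebra_simps)
  have r: "s + \<sigma> > real CARD('d) / 2" using s \<sigma> by simp
  have 1: "H_bound (s + \<sigma>) (\<lambda>x. (U (t + h) x - U t x) * \<psi> (t + h) x) (alg_const TYPE('d) (s + \<sigma>) * (M * h) * M)"
    by (rule H_bound_mult[OF U_lipschitz[OF t] H_bound_mono[OF psi_bound[OF t(2)]] r]) auto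
  have 2: "H_bound (s + \<sigma>) (\<lambda>x. U t x * (\<psi> (t + h) x - \<psi> t x)) (alg_const TYPE('d) (s + \<sigma>) * M * (l\<psi> * h))"
    by (rule H_bound_mult[OF H_bound_mono[OF U_bound[OF t(1)]] psi_lipschitz[OF t] r]) auto
  show ?thesis unfolding eq by (rule H_bound_mono[OF H_bound_add[OF 1 2]]) (auto simp: lG_def algebra_simps)
qed

lemma W_lipschitz:
  assumes t: "t \<in> {a..b}" "t + h \<in> {a..b}" "0 \<le> h"
  shows "H_bound (s + \<sigma>) (\<lambda>x. W (t + h) x - W t x) (lW * h)"
proof -
  have eq: "W (t + h) x - W t x = (\<psi> (t + h) x - \<psi> t x) * cnj (\<psi> (t + h) x) + \<psi> t x * cnj (\<psi> (t + h) x - \<psi> t x)" for x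
    by (simp add: W_def algebra_simps)
  have r: "s + \<sigma> > real CARD('d) / 2" using s \<sigma> by simp
  have 1: "H_bound (s + \<sigma>) (\<lambda>x. (\<psi> (t + h) x - \<psi> t x) * cnj (\<psi> (t + h) x)) (alg_const TYPE('d) (s + \<sigma>) * (l\<psi> * h) * M)"
    by (rule H_bound_mult[OF psi_lipschitz[OF t] H_bound_cnj[OF H_bound_mono[OF psi_bound[OF t(2)]]] r]) auto
  have 2: "H_bound (s + \<sigma>) (\<lambda>x. \<psi> t x * cnj (\<psi> (t + h) x - \<psi> t x)) (alg_const TYPE('d) (s + \<sigma>) * M * (l\<psi> * h))"
    by (rule H_bound_mult[OF H_bound_mono[OF psi_bound[OF t(1)]] H_bound_cnj[OF psi_lipschitz[OF t]] r]) auto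
  show ?thesis unfolding eq by (rule H_bound_mono[OF H_bound_add[OF 1 2]]) (auto simp: lW_def algebra_simps)
qed

lemma has_vector_derivative_shift:
  assumes "(f has_vector_derivative y) (at (r + k) within {a..b})" "\<And>r. r \<in> S \<Longrightarrow> r + k \<in> {a..b}"
  shows "((\<lambda>t. f (t + k)) has_vector_derivative y) (at r within S)"
proof -
  have "((\<lambda>t. t + k) has_derivative (\<lambda>h. h)) (at r within S)" by (auto intro!: derivative_eq_intros)
  moreover have "(f has_derivative (\<lambda>h. h *\<^sub>R y)) (at (r + k) within (\<lambda>t. t + k) ` S)"
    using assms unfolding has_vector_derivative_def by (blast intro: has_derivative_subset)
  ultimately show ?thesis unfolding has_vector_derivative_def
    by (rule has_derivative_in_compose)
qed

text \<open>The increment \<open>\<psi>(t + k) - \<psi>(t)\<close> satisfies the equation with increments on the right-hand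
  side, so the Lipschitz estimates bound its derivative by a multiple of \<open>k\<close>. Two more derivatives
  are spent, and \<open>\<sigma> \<ge> 2\<close> leaves a bound in \<open>H\<^sup>s\<close>.\<close>

lemma psi_second_difference:
  assumes "t \<in> {a..b}" "t + h + k \<in> {a..b}" "0 \<le> h" "0 \<le> k"
  shows "H_bound s (\<lambda>x. (\<psi> (t + h + k) x - \<psi> (t + h) x) - (\<psi> (t + k) x - \<psi> t x)) (q\<psi> * k * h)"
proof -
  have sub: "{t..t + h} \<subseteq> {a..b}" and sub': "\<And>r. r \<in> {t..t + h} \<Longrightarrow> r + k \<in> {a..b}" using assms by auto
  let ?f = "\<lambda>t x. \<psi> (t + k) x - \<psi> t x"
  have "H_bound s (\<lambda>x. ?f (t + h) x - ?f t x) (q\<psi> * k * (t + h - t))"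
  proof (rule H_bound_mean_value)
    fix r assume r: "r \<in> {t..t + h}"
    have r': "r \<in> {a..b}" "r + k \<in> {a..b}" using r sub sub' by auto
    let ?D = "\<lambda>x. \<psi> (r + k) x - \<psi> r x" and ?DG = "\<lambda>x. G (r + k) x - G r x"
    let ?A = "\<lambda>j. (norm (freq j))\<^sup>2 * fc ?D j"
    let ?y = "\<lambda>j. - \<i> * ((norm (freq j))\<^sup>2 * fc (\<psi> (r + k)) j + fc (G (r + k)) j)
       - - \<i> * ((norm (freq j))\<^sup>2 * fc (\<psi> r) j + fc (G r) j)"
    have y: "?y j = - \<i> * (?A j + fc ?DG j)" for j
      using r' by (simp add: fc_diff ct algebra_simps)
    show "wnorm s F ?y \<le> q\<psi> * k" if F: "finite F" for F
    proof -
      have "wnorm s F ?y = wnorm s F (\<lambda>j. ?A j + fc ?DG j)"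
        unfolding y by (rule wnorm_cong) (simp add: norm_mult)
      also have "\<dots> \<le> wnorm s F ?A + wnorm s F (fc ?DG)" by (rule wnorm_add)
      also have "\<dots> \<le> l\<psi> * k + lG * k"
      proof (rule add_mono)
        show "wnorm s F ?A \<le> l\<psi> * k"
          by (rule wnorm_laplacian_coeffs[OF H_bound_mono[OF psi_lipschitz[OF r' assms(4)]] F]) (use \<sigma> in auto)
        have "H_bound s ?DG (lG * k)" by (rule H_bound_mono[OF G_lipschitz[OF r' assms(4)]]) (use \<sigma> in auto)
        then show "wnorm s F (fc ?DG) \<le> lG * k" using F by (simp add: H_bound_def)
      qed
      finally show ?thesis by (simp add: q\<psi>_def algebra_simps)
    qed
    have c: "((\<lambda>t. fc (\<psi> (t + k)) j - fc (\<psi> t) j) has_vector_derivative ?y j) (at r within {t..t + h})" for j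
      unfolding G_def
      by (rule has_vector_derivative_diff[OF has_vector_derivative_shift[OF d\<psi>[OF r'(2)] sub'] has_vector_derivative_within_subset[OF d\<psi>[OF r'(1)] sub]])
    have e: "fc (?f t) j = fc (\<psi> (t + k)) j - fc (\<psi> t) j" if "t \<in> {a..b} \<and> t + k \<in> {a..b}" for t j
      using that by (intro fc_diff ct) auto
    show "((\<lambda>t. fc (?f t) j) has_vector_derivative ?y j) (at r within {t..t + h})" for j
      by (rule has_vector_derivative_transform[OF r _ c]) (rule e, use sub sub' in auto)
    show "ctorus (?f r)" by (intro ctorus_diff ct r')
  qed (use assms in auto)
  then show ?thesis by simp
qed

lemma U_second_difference:
  assumes "t \<in> {a..b}" "t + h + k \<in> {a..b}" "0 \<le> h" "0 \<le> k"
  shows "H_bound s (\<lambda>x. (U (t + h + k) x - U (t + h) x) - (U (t + k) x - U t x)) (lU' * k * h)"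
proof -
  have sub: "{t..t + h} \<subseteq> {a..b}" and sub': "\<And>r. r \<in> {t..t + h} \<Longrightarrow> r + k \<in> {a..b}" using assms by auto
  let ?f = "\<lambda>t x. U (t + k) x - U t x"
  have "H_bound s (\<lambda>x. ?f (t + h) x - ?f t x) (lU' * k * (t + h - t))"
  proof (rule H_bound_mean_value)
    fix r assume r: "r \<in> {t..t + h}"
    have r': "r \<in> {a..b}" "r + k \<in> {a..b}" using r sub sub' by auto
    let ?y = "\<lambda>j. fc (U' (r + k)) j - fc (U' r) j"
    have y: "?y = fc (\<lambda>x. U' (r + k) x - U' r x)"
      using r' by (auto simp: fc_diff ct)
    have "H_bound s (\<lambda>x. U' (r + k) x - U' r x) (lU' * k)"
      by (rule H_bound_mono[OF U'_lipschitz[OF r' assms(4)]]) (use \<sigma> in auto)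
    then show "wnorm s F ?y \<le> lU' * k" if F: "finite F" for F unfolding y using F by (simp add: H_bound_def)
    have c: "((\<lambda>t. fc (U (t + k)) j - fc (U t) j) has_vector_derivative ?y j) (at r within {t..t + h})" for j
      by (rule has_vector_derivative_diff[OF has_vector_derivative_shift[OF dU[OF r'(2)] sub'] has_vector_derivative_within_subset[OF dU[OF r'(1)] sub]])
    have e: "fc (?f t) j = fc (U (t + k)) j - fc (U t) j" if "t \<in> {a..b} \<and> t + k \<in> {a..b}" for t j
      using that by (intro fc_diff ct) auto
    show "((\<lambda>t. fc (?f t) j) has_vector_derivative ?y j) (at r within {t..t + h})" for j
      by (rule has_vector_derivative_transform[OF r _ c]) (rule e, use sub sub' in auto)
    show "ctorus (?f r)" by (intro ctorus_diff ct r')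
  qed (use assms in auto)
  then show ?thesis by simp
qed

text \<open>A discrete Leibniz rule for second differences of a product, with the three types of terms of
  the second derivative.\<close>

lemma G_second_difference:
  assumes t: "t \<in> {a..b}" "t + h + k \<in> {a..b}" "0 \<le> h" "0 \<le> k"
  shows "H_bound s (\<lambda>x. (G (t + h + k) x - G (t + h) x) - (G (t + k) x - G t x)) (qG * k * h)"
proof -
  have th: "t + h \<in> {a..b}" "t + k \<in> {a..b}" "t + k + h \<in> {a..b}" using t by (auto simp: algebra_simps)
  have eq: "(G (t + h + k) x - G (t + h) x) - (G (t + k) x - G t x) =
     ((((U (t + h + k) x - U (t + h) x) - (U (t + k) x - U t x)) * \<psi> (t + h + k) x
    + (U (t + k) x - U t x) * (\<psi> (t + k + h) x - \<psi> (t + k) x))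
    + (U (t + h) x - U t x) * (\<psi> (t + h + k) x - \<psi> (t + h) x))
    + U t x * ((\<psi> (t + h + k) x - \<psi> (t + h) x) - (\<psi> (t + k) x - \<psi> t x))" for x
    by (simp add: G_def algebra_simps)
  let ?A = "alg_const TYPE('d) s"
  have m: "H_bound s f B" if "H_bound (s + \<sigma>) f B" for f B by (rule H_bound_mono[OF that]) (use \<sigma> in auto)
  have mp: "H_bound s (\<psi> t) M" "H_bound s (U t) M" if "t \<in> {a..b}" for t
    using \<sigma> that by (auto intro: H_bound_mono[OF psi_bound] H_bound_mono[OF U_bound])
  have "H_bound s (\<lambda>x. (G (t + h + k) x - G (t + h) x) - (G (t + k) x - G t x))
    (?A * (lU' * k * h) * M + ?A * (M * k) * (l\<psi> * h) + ?A * (M * h) * (l\<psi> * k) + ?A * M * (q\<psi> * k * h))"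
    unfolding eq
    by (intro H_bound_add H_bound_mult U_second_difference psi_second_difference mp m U_lipschitz psi_lipschitz s t th)
  then show ?thesis by (simp add: qG_def algebra_simps)
qed

end

section \<open>Exponentials in the discrete algebra\<close>

lemma gnorm_tendsto:
  assumes "\<And>x. (\<lambda>n. f n x) \<longlonglongrightarrow> g x" "K \<ge> 1"
  shows "(\<lambda>n. gnorm K r (f n)) \<longlonglongrightarrow> gnorm K r g"
  unfolding gnorm_def dft_def
  by (intro wnorm_tendsto tendsto_intros assms) (use assms modes_nonempty in auto)

lemma gnorm_power:
  fixes f :: "real ^ 'd::finite \<Rightarrow> complex"
  assumes K: "K \<ge> 1" and r: "r > real CARD('d) / 2"
  shows "gnorm K r (\<lambda>x. f x ^ Suc n) \<le> alg_const TYPE('d) r ^ n * gnorm K r f ^ Suc n"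
proof (induction n)
  case (Suc n)
  have "gnorm K r (\<lambda>x. f x ^ Suc (Suc n)) = gnorm K r (\<lambda>x. f x * f x ^ Suc n)" by simp
  also have "\<dots> \<le> alg_const TYPE('d) r * gnorm K r f * gnorm K r (\<lambda>x. f x ^ Suc n)" by (rule gnorm_mult[OF K r])
  also have "\<dots> \<le> alg_const TYPE('d) r * gnorm K r f * (alg_const TYPE('d) r ^ n * gnorm K r f ^ Suc n)"
    using alg_const_ge1[OF r] by (intro mult_left_mono Suc) auto
  finally show ?case by (simp add: mult_ac)
qed simp

lemma gnorm_sum_le: "gnorm K r (\<lambda>x. \<Sum>i\<in>I. f i x) \<le> (\<Sum>i\<in>I. gnorm K r (f i))"
proof (induction I rule: infinite_finite_induct)
  case (insert i I)
  then show ?case using gnorm_add[of K r "f i" "\<lambda>x. \<Sum>i\<in>I. f i x"] by simp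
qed (auto simp: gnorm_def wnorm_def L2_set_0')

text \<open>The exponential series converges at every grid point, and its terms are estimated in the
  discrete algebra.\<close>

lemma gnorm_exp_tail:
  fixes f :: "real ^ 'd::finite \<Rightarrow> complex"
  assumes K: "K \<ge> 1" and r: "r > real CARD('d) / 2"
  shows "gnorm K r (\<lambda>x. exp (f x) - (\<Sum>n<Suc m. f x ^ n /\<^sub>R fact n))
     \<le> alg_const TYPE('d) r ^ m * gnorm K r f ^ Suc m * exp (alg_const TYPE('d) r * gnorm K r f)"
proof (rule LIMSEQ_le_const2)
  let ?A = "alg_const TYPE('d) r" and ?p = "gnorm K r f"
  have A: "1 \<le> ?A" by (rule alg_const_ge1[OF r])
  let ?S = "\<lambda>N x. \<Sum>n<N. f x ^ (n + Suc m) /\<^sub>R fact (n + Suc m)"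
  show "(\<lambda>N. gnorm K r (?S N)) \<longlonglongrightarrow> gnorm K r (\<lambda>x. exp (f x) - (\<Sum>n<Suc m. f x ^ n /\<^sub>R fact n))"
  proof (rule gnorm_tendsto[OF _ K])
    fix x
    have "(\<lambda>n. f x ^ (n + Suc m) /\<^sub>R fact (n + Suc m)) sums (exp (f x) - (\<Sum>n<Suc m. f x ^ n /\<^sub>R fact n))"
      by (rule sums_split_initial_segment[OF exp_converges])
    then show "(\<lambda>N. ?S N x) \<longlonglongrightarrow> exp (f x) - (\<Sum>n<Suc m. f x ^ n /\<^sub>R fact n)" by (simp add: sums_def)
  qed
  have "gnorm K r (?S N) \<le> ?A ^ m * ?p ^ Suc m * exp (?A * ?p)" for N
  proof -
    have "gnorm K r (?S N) \<le> (\<Sum>n<N. gnorm K r (\<lambda>x. f x ^ (n + Suc m) /\<^sub>R fact (n + Suc m)))" by (rule gnorm_sum_le)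
    also have "\<dots> \<le> (\<Sum>n<N. ?A ^ m * ?p ^ Suc m * ((?A * ?p) ^ n /\<^sub>R fact n))"
    proof (rule sum_mono)
      fix n
      have "gnorm K r (\<lambda>x. f x ^ (n + Suc m) /\<^sub>R fact (n + Suc m)) = inverse (fact (n + Suc m)) * gnorm K r (\<lambda>x. f x ^ Suc (n + m))"
        using gnorm_cmult[of K r "of_real (inverse (fact (n + Suc m)))" "\<lambda>x. f x ^ Suc (n + m)"]
        by (simp add: scaleR_conv_of_real norm_inverse norm_mult mult_ac del: fact_Suc power_Suc of_real_inverse)
      also have "\<dots> \<le> inverse (fact n) * (?A ^ (n + m) * ?p ^ Suc (n + m))"
        using A by (intro mult_mono gnorm_power[OF K r] le_imp_inverse_le fact_mono) auto
      also have "\<dots> = ?A ^ m * ?p ^ Suc m * ((?A * ?p) ^ n /\<^sub>R fact n)"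
        by (simp add: power_add power_mult_distrib mult_ac)
      finally show "gnorm K r (\<lambda>x. f x ^ (n + Suc m) /\<^sub>R fact (n + Suc m)) \<le> ?A ^ m * ?p ^ Suc m * ((?A * ?p) ^ n /\<^sub>R fact n)" .
    qed
    also have "\<dots> = ?A ^ m * ?p ^ Suc m * (\<Sum>n<N. (?A * ?p) ^ n /\<^sub>R fact n)" by (simp add: sum_distrib_left)
    also have "(\<Sum>n<N. (?A * ?p) ^ n /\<^sub>R fact n) \<le> exp (?A * ?p)"
      unfolding exp_def using A by (intro sum_le_suminf summable_exp_generic) (auto intro!: mult_nonneg_nonneg)
    finally show ?thesis using A by (simp add: mult_left_mono)
  qed
  then show "\<exists>N. \<forall>n\<ge>N. gnorm K r (?S n) \<le> ?A ^ m * ?p ^ Suc m * exp (?A * ?p)" by blast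
qed

lemma gnorm_exp_minus_1:
  fixes f :: "real ^ 'd::finite \<Rightarrow> complex"
  assumes "K \<ge> 1" "r > real CARD('d) / 2"
  shows "gnorm K r (\<lambda>x. exp (f x) - 1) \<le> gnorm K r f * exp (alg_const TYPE('d) r * gnorm K r f)"
  using gnorm_exp_tail[OF assms, of f 0] by simp

lemma gnorm_exp_second_order:
  fixes f :: "real ^ 'd::finite \<Rightarrow> complex"
  assumes "K \<ge> 1" "r > real CARD('d) / 2"
  shows "gnorm K r (\<lambda>x. exp (f x) - 1 - f x) \<le> alg_const TYPE('d) r * (gnorm K r f)\<^sup>2 * exp (alg_const TYPE('d) r * gnorm K r f)"
  using gnorm_exp_tail[OF assms, of f 1] by (simp add: power2_eq_square algebra_simps)

lemma abs_cos_minus_1_le: "\<bar>cos x - 1\<bar> \<le> \<bar>x\<bar>" for x :: real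
proof -
  have "norm (cos x - cos 0) \<le> 1 * norm (x - 0)"
  proof (rule differentiable_bound[of UNIV cos "\<lambda>x h. - sin x * h" 1 x 0])
    show "onorm ((*) (- sin y)) \<le> 1" for y :: real
      by (rule onorm_le) (simp add: abs_mult mult_left_le_one_le)
  qed (auto intro!: derivative_eq_intros)
  then show ?thesis by simp
qed

lemma abs_sinc_minus_1_le: "\<bar>sinc x - 1\<bar> \<le> \<bar>x\<bar>"
proof (cases "x = 0")
  case False
  have "norm ((sin x - x) - (sin 0 - 0)) \<le> \<bar>x\<bar> * norm (x - 0)"
  proof (rule differentiable_bound[of "closed_segment 0 x" "\<lambda>x. sin x - x" "\<lambda>y h. (cos y - 1) * h" "\<bar>x\<bar>" x 0])
    fix y assume "y \<in> closed_segment 0 x"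
    then have "\<bar>y\<bar> \<le> \<bar>x\<bar>" by (auto simp: closed_segment_eq_real_ivl split: if_splits)
    then have y: "\<bar>cos y - 1\<bar> \<le> \<bar>x\<bar>" using abs_cos_minus_1_le[of y] by linarith
    show "onorm ((*) (cos y - 1)) \<le> \<bar>x\<bar>"
    proof (rule onorm_le)
      fix h
      show "norm ((cos y - 1) * h) \<le> \<bar>x\<bar> * norm h"
        using mult_right_mono[OF y, of "\<bar>h\<bar>"] by (simp add: abs_mult)
    qed
    show "((\<lambda>x. sin x - x) has_derivative (*) (cos y - 1)) (at y within closed_segment 0 x)"
      by (auto intro!: derivative_eq_intros simp: algebra_simps)
  qed auto
  then have "\<bar>sin x - x\<bar> \<le> \<bar>x\<bar> * \<bar>x\<bar>" by simp
  moreover have "\<bar>sinc x - 1\<bar> = \<bar>sin x - x\<bar> / \<bar>x\<bar>"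
    using False by (simp add: diff_divide_distrib flip: abs_divide)
  ultimately show ?thesis using False by (simp add: pos_divide_le_eq)
qed auto

lemma abs_sinc_le: "\<bar>sinc x\<bar> \<le> 1"
proof (cases "x = 0")
  case False
  then show ?thesis using abs_sin_x_le_abs_x[of x] by (simp add: divide_le_eq_1)
qed auto

section \<open>The phase factor of the potential\<close>

text \<open>The bound \<open>\<tau> \<le> 1\<close> is a normalization that keeps the constants free of powers of \<open>\<tau>\<close>.\<close>

locale discretization = regularity dd s \<sigma> M for dd :: "'d::finite itself" and s \<sigma> M +
  fixes K :: nat and \<tau> :: real
  assumes K: "K \<ge> 1" and \<tau>: "0 < \<tau>" "\<tau> \<le> 1"
begin

definition "space_err = real K powr (- \<sigma>)"
text \<open>The accuracy of the method. All defects and errors are measured in units of \<open>\<eta>\<close>.\<close>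

definition "\<eta> = \<tau> + space_err"

lemma \<eta>: "\<tau> \<le> \<eta>" "space_err \<le> \<eta>" "0 < \<eta>" "0 \<le> \<eta>" "0 \<le> space_err"
  using \<tau> by (auto simp: \<eta>_def space_err_def add_pos_nonneg)

abbreviation N :: "(real ^ 'd \<Rightarrow> complex) \<Rightarrow> real" where "N \<equiv> gnorm K s"
definition "Ca r = alg_const TYPE('d) r"

lemma Ca_s: "1 \<le> Ca s" "0 \<le> Ca s" using alg_const_ge1[OF s] by (auto simp: Ca_def)
lemma Ca_nn: "r \<ge> s \<Longrightarrow> 0 \<le> Ca r" by (simp add: Ca_def alg_const_nonneg)

lemma gnorm_mult_le:
  fixes f g :: "real ^ 'd \<Rightarrow> complex"
  assumes r: "r \<ge> s" and "gnorm K r f \<le> a" "gnorm K r g \<le> b"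
  shows "gnorm K r (\<lambda>x. f x * g x) \<le> Ca r * a * b"
proof -
  have r': "r > real CARD('d) / 2" using r s by simp
  have "gnorm K r (\<lambda>x. f x * g x) \<le> Ca r * gnorm K r f * gnorm K r g"
    unfolding Ca_def by (rule gnorm_mult[OF K r'])
  also have "\<dots> \<le> Ca r * a * b"
    using Ca_nn[OF r] assms order_trans[OF gnorm_nonneg assms(2)] by (intro mult_mono mult_nonneg_nonneg) auto
  finally show ?thesis .
qed

lemma gnorm_add_le: "gnorm K r f \<le> a \<Longrightarrow> gnorm K r g \<le> b \<Longrightarrow> gnorm K r (\<lambda>x. f x + g x) \<le> a + b"
  using gnorm_add[of K r f g] by linarith
lemma gnorm_diff_le: "gnorm K r f \<le> a \<Longrightarrow> gnorm K r g \<le> b \<Longrightarrow> gnorm K r (\<lambda>x. f x - g x) \<le> a + b"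
  using gnorm_diff[of K r f g] by linarith

lemma gnorm_mult_diff_le:
  fixes f g :: "real ^ 'd \<Rightarrow> complex"
  assumes r: "r \<ge> s" and "gnorm K r (\<lambda>x. f x - f' x) \<le> da" "gnorm K r g \<le> b" "gnorm K r f' \<le> a" "gnorm K r (\<lambda>x. g x - g' x) \<le> db"
  shows "gnorm K r (\<lambda>x. f x * g x - f' x * g' x) \<le> Ca r * da * b + Ca r * a * db"
proof -
  have "f x * g x - f' x * g' x = (f x - f' x) * g x + f' x * (g x - g' x)" for x by (simp add: algebra_simps)
  then show ?thesis
    using gnorm_add_le[OF gnorm_mult_le[OF assms(1,2,3)] gnorm_mult_le[OF assms(1,4,5)]] by simp
qed

text \<open>With \<open>phaseq\<close> the step of the Schroedinger part reads
  \<open>phase v x * \<psi> x = \<psi> x + \<tau> * (phaseq v x * \<psi> x)\<close>: the increment becomes \<open>\<tau>\<close> times a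
  nonlinearity with bounds uniform in \<open>\<tau>\<close>. The constant \<open>\<kappa>\<close> is taken at \<open>2 * R\<close>
  because it is applied to differences of two potentials of size at most \<open>R\<close>; \<open>qL\<close> is the resulting
  Lipschitz constant of \<open>phaseq\<close>.\<close>

definition "phase v = (\<lambda>x :: real ^ 'd. exp (- \<i> * of_real \<tau> * v x) :: complex)"
definition "phaseq v = (\<lambda>x. (phase v x - 1) / of_real \<tau>)"
definition "\<kappa> R = exp (Ca s * (2 * R))"
definition "qL R = Ca s * (\<kappa> R * R) * \<kappa> R + \<kappa> R"

lemma phase_diff: "phase v x = phase w x * phase (\<lambda>x. v x - w x) x"
  by (simp add: phase_def exp_add[symmetric] algebra_simps)

lemma \<kappa>_nn: "0 \<le> \<kappa> R" by (simp add: \<kappa>_def)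
lemma qL_nn: "0 \<le> R \<Longrightarrow> 0 \<le> qL R" using Ca_s by (simp add: qL_def \<kappa>_nn)

lemma N_tau: "N (\<lambda>x. - \<i> * of_real \<tau> * v x) = \<tau> * N v"
  using gnorm_cmult[of K s "- \<i> * of_real \<tau>" v] \<tau> by (simp add: norm_mult)

lemma tau_exp_le: "N v \<le> 2 * R \<Longrightarrow> exp (Ca s * (\<tau> * N v)) \<le> \<kappa> R"
proof -
  assume v: "N v \<le> 2 * R"
  have "\<tau> * N v \<le> 1 * N v" using \<tau> by (intro mult_right_mono) auto
  then show ?thesis unfolding \<kappa>_def using Ca_s v by (auto intro!: mult_left_mono)
qed

lemma phase_minus_1_bound: "N v \<le> 2 * R \<Longrightarrow> N (\<lambda>x. phase v x - 1) \<le> \<tau> * (\<kappa> R * N v)"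
proof -
  assume v: "N v \<le> 2 * R"
  have "N (\<lambda>x. phase v x - 1) \<le> (\<tau> * N v) * exp (Ca s * (\<tau> * N v))"
    using gnorm_exp_minus_1[OF K s, of "\<lambda>x. - \<i> * of_real \<tau> * v x"] unfolding N_tau phase_def Ca_def .
  also have "\<dots> \<le> (\<tau> * N v) * \<kappa> R" using \<tau> by (intro mult_left_mono tau_exp_le v) auto
  finally show ?thesis by (simp add: mult_ac)
qed

lemma phase_second_order_bound: "N v \<le> 2 * R \<Longrightarrow> N (\<lambda>x. phase v x - 1 + \<i> * of_real \<tau> * v x) \<le> \<tau> * (\<tau> * (Ca s * \<kappa> R * (N v)\<^sup>2))"
proof -
  assume v: "N v \<le> 2 * R"
  have "N (\<lambda>x. phase v x - 1 + \<i> * of_real \<tau> * v x) \<le> Ca s * (\<tau> * N v)\<^sup>2 * exp (Ca s * (\<tau> * N v))"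
    using gnorm_exp_second_order[OF K s, of "\<lambda>x. - \<i> * of_real \<tau> * v x"] unfolding N_tau phase_def Ca_def by simp
  also have "\<dots> \<le> Ca s * (\<tau> * N v)\<^sup>2 * \<kappa> R" using Ca_s by (intro mult_left_mono tau_exp_le v) auto
  finally show ?thesis by (simp add: mult_ac power2_eq_square)
qed

lemma N_div_tau: "N (\<lambda>x. f x / of_real \<tau>) = N f / \<tau>"
  using gnorm_cmult[of K s "1 / of_real \<tau>" f] \<tau> by (simp add: norm_divide)

lemma phaseq_bound: "N v \<le> 2 * R \<Longrightarrow> N (phaseq v) \<le> \<kappa> R * N v"
  unfolding phaseq_def N_div_tau using phase_minus_1_bound[of v R] \<tau> by (simp add: pos_divide_le_eq mult_ac)

lemma phaseq_bound_le: "0 \<le> R \<Longrightarrow> N v \<le> R \<Longrightarrow> N (phaseq v) \<le> \<kappa> R * R"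
  using phaseq_bound[of v R] mult_left_mono[of "N v" R "\<kappa> R"] \<kappa>_nn by fastforce

lemma phaseq_diff_eq: "phaseq v x - phaseq w x = phaseq w x * (phase (\<lambda>x. v x - w x) x - 1) + phaseq (\<lambda>x. v x - w x) x"
  using \<tau> by (simp add: phaseq_def phase_diff[of v x w] field_simps)

text \<open>The exponential is a homomorphism, so the difference reduces to \<open>phase\<close> and \<open>phaseq\<close> of the
  difference of the potentials.\<close>

lemma phaseq_lipschitz:
  assumes R: "0 \<le> R" and v: "N v \<le> R" and w: "N w \<le> R"
  shows "N (\<lambda>x. phaseq v x - phaseq w x) \<le> qL R * N (\<lambda>x. v x - w x)"
proof -
  let ?\<delta> = "\<lambda>x. v x - w x"
  have d: "N ?\<delta> \<le> 2 * R" using gnorm_diff_le[OF v w] by simp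
  have "N (\<lambda>x. phaseq v x - phaseq w x) \<le> Ca s * (\<kappa> R * R) * (\<tau> * (\<kappa> R * N ?\<delta>)) + \<kappa> R * N ?\<delta>"
    unfolding phaseq_diff_eq by (intro gnorm_add_le gnorm_mult_le phaseq_bound_le phase_minus_1_bound phaseq_bound R w d) auto
  also have "\<dots> \<le> Ca s * (\<kappa> R * R) * (1 * (\<kappa> R * N ?\<delta>)) + \<kappa> R * N ?\<delta>"
    using \<tau> R Ca_s \<kappa>_nn by (intro add_mono mult_left_mono mult_right_mono) auto
  also have "\<dots> = qL R * N ?\<delta>" by (simp add: qL_def algebra_simps)
  finally show ?thesis .
qed

text \<open>The increments of \<open>phaseq\<close> along two pairs of potentials differ by a product of first differences and by the second difference. The product comes
  with an additional factor \<open>\<tau>\<close> because \<open>phase\<close> of an increment is that close to \<open>1\<close>.\<close>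

lemma phaseq_double_difference:
  assumes R: "0 \<le> R" and v: "N v1 \<le> R" "N v2 \<le> R" and w: "N w1 \<le> R" "N w2 \<le> R"
  shows "N (\<lambda>x. (phaseq w2 x - phaseq w1 x) - (phaseq v2 x - phaseq v1 x)) \<le>
      Ca s * (qL R * N (\<lambda>x. w1 x - v1 x)) * (\<tau> * (\<kappa> R * N (\<lambda>x. w2 x - w1 x)))
    + (Ca s * (\<kappa> R * R) + 1) * (qL (2 * R) * N (\<lambda>x. (w2 x - w1 x) - (v2 x - v1 x)))"
proof -
  let ?a = "\<lambda>x. w2 x - w1 x" and ?b = "\<lambda>x. v2 x - v1 x"
  have eq: "(phaseq w2 x - phaseq w1 x) - (phaseq v2 x - phaseq v1 x) =
     (phaseq w1 x - phaseq v1 x) * (phase ?a x - 1) + ((phase v1 x - 1) * (phaseq ?a x - phaseq ?b x) + (phaseq ?a x - phaseq ?b x))" for x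
    using \<tau> by (simp add: phaseq_def phase_diff[of w2 x w1] phase_diff[of v2 x v1] field_simps)
  have a: "N ?a \<le> 2 * R" and b: "N ?b \<le> 2 * R"
    using gnorm_diff_le[OF w(2,1)] gnorm_diff_le[OF v(2,1)] by simp_all
  have R2: "0 \<le> 2 * R" using R by simp
  have v1: "N (\<lambda>x. phase v1 x - 1) \<le> \<kappa> R * R"
  proof -
    have "N (\<lambda>x. phase v1 x - 1) \<le> \<tau> * (\<kappa> R * N v1)" using v R by (intro phase_minus_1_bound) auto
    also have "\<dots> \<le> 1 * (\<kappa> R * R)" using \<tau> v R \<kappa>_nn by (intro mult_mono) auto
    finally show ?thesis by simp
  qed
  have "N (\<lambda>x. (phaseq w2 x - phaseq w1 x) - (phaseq v2 x - phaseq v1 x)) \<le>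
      Ca s * (qL R * N (\<lambda>x. w1 x - v1 x)) * (\<tau> * (\<kappa> R * N ?a))
    + (Ca s * (\<kappa> R * R) * (qL (2 * R) * N (\<lambda>x. ?a x - ?b x)) + qL (2 * R) * N (\<lambda>x. ?a x - ?b x))"
    unfolding eq by (intro gnorm_add_le gnorm_mult_le phaseq_lipschitz phase_minus_1_bound R R2 v w a b v1) auto
  then show ?thesis by (simp add: algebra_simps)
qed

text \<open>To first order \<open>phaseq v\<close> is \<open>- \<i> * v\<close>, the factor in the differential equation.\<close>

lemma phaseq_remainder:
  assumes "0 \<le> R" "N v \<le> R"
  shows "N (\<lambda>x. phaseq v x + \<i> * v x) \<le> \<tau> * (Ca s * \<kappa> R * R\<^sup>2)"
proof -
  have eq: "phaseq v x + \<i> * v x = (phase v x - 1 + \<i> * of_real \<tau> * v x) / of_real \<tau>" for x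
    using \<tau> by (simp add: phaseq_def field_simps)
  have "N (\<lambda>x. phaseq v x + \<i> * v x) \<le> \<tau> * (Ca s * \<kappa> R * (N v)\<^sup>2)"
    unfolding eq N_div_tau using phase_second_order_bound[of v R] \<tau> assms by (simp add: pos_divide_le_eq mult_ac)
  also have "\<dots> \<le> \<tau> * (Ca s * \<kappa> R * R\<^sup>2)"
    using \<tau> assms Ca_s \<kappa>_nn by (intro mult_left_mono power_mono) auto
  finally show ?thesis .
qed

lemma phaseq_remainder_lipschitz:
  assumes R: "0 \<le> R" and v: "N v \<le> R" and w: "N w \<le> R"
  shows "N (\<lambda>x. (phaseq v x + \<i> * v x) - (phaseq w x + \<i> * w x)) \<le> \<tau> * (Ca s * (\<kappa> R * R) * \<kappa> R + Ca s * \<kappa> R * (2 * R)) * N (\<lambda>x. v x - w x)"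
proof -
  let ?\<delta> = "\<lambda>x. v x - w x"
  have d: "N ?\<delta> \<le> 2 * R" using gnorm_diff_le[OF v w] by simp
  have eq: "(phaseq v x + \<i> * v x) - (phaseq w x + \<i> * w x) = phaseq w x * (phase ?\<delta> x - 1) + (phase ?\<delta> x - 1 + \<i> * of_real \<tau> * ?\<delta> x) / of_real \<tau>" for x
    using \<tau> phaseq_diff_eq[of v x w] by (simp add: phaseq_def field_simps)
  have "N (\<lambda>x. (phase ?\<delta> x - 1 + \<i> * of_real \<tau> * ?\<delta> x) / of_real \<tau>) \<le> \<tau> * (Ca s * \<kappa> R * (N ?\<delta>)\<^sup>2)"
    unfolding N_div_tau using phase_second_order_bound[OF d] \<tau> by (simp add: pos_divide_le_eq mult_ac)
  also have "\<dots> \<le> \<tau> * (Ca s * \<kappa> R * (2 * R * N ?\<delta>))"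
    unfolding power2_eq_square using \<tau> Ca_s \<kappa>_nn d by (intro mult_left_mono mult_right_mono) auto
  finally have 2: "N (\<lambda>x. (phase ?\<delta> x - 1 + \<i> * of_real \<tau> * ?\<delta> x) / of_real \<tau>) \<le> \<tau> * (Ca s * \<kappa> R * (2 * R * N ?\<delta>))" .
  have "N (\<lambda>x. (phaseq v x + \<i> * v x) - (phaseq w x + \<i> * w x)) \<le> Ca s * (\<kappa> R * R) * (\<tau> * (\<kappa> R * N ?\<delta>)) + \<tau> * (Ca s * \<kappa> R * (2 * R * N ?\<delta>))"
    unfolding eq by (intro gnorm_add_le gnorm_mult_le phaseq_bound_le phase_minus_1_bound 2 R w d) auto
  then show ?thesis by (simp add: algebra_simps)
qed

section \<open>The averaged potential and spectral truncation\<close>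

abbreviation om :: "int ^ 'd \<Rightarrow> real" where "om j \<equiv> norm (freq j)"

text \<open>The symbols of the multipliers in the potential of the method; \<open>sq j\<close> equals
  \<open>(1 - cos(\<tau> |j|)) / (\<tau> |j|\<^sup>2)\<close> for \<open>j \<noteq> 0\<close>.\<close>

definition "sc j = sinc (\<tau> * om j)"
definition "sq j = \<tau> / 2 * (sinc (\<tau> * om j / 2))\<^sup>2"

lemma sc_le: "\<bar>sc j\<bar> \<le> 1" unfolding sc_def by (rule abs_sinc_le)
lemma sc_minus_1_le: "\<bar>sc j - 1\<bar> \<le> \<tau> * wt j"
proof -
  have "\<bar>sc j - 1\<bar> \<le> \<tau> * om j"
    using abs_sinc_minus_1_le[of "\<tau> * om j"] \<tau> unfolding sc_def by (simp only: abs_mult) simp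
  also have "\<dots> \<le> \<tau> * wt j" using \<tau> by (intro mult_left_mono) auto
  finally show ?thesis .
qed
lemma sq_le: "\<bar>sq j\<bar> \<le> \<tau> / 2"
proof -
  have "(sinc (\<tau> * om j / 2))\<^sup>2 \<le> 1" using abs_sinc_le[of "\<tau> * om j / 2"] by (simp only: abs_square_le_1)
  from mult_left_mono[OF this, of "\<tau> / 2"] show ?thesis
    unfolding sq_def using \<tau> by (simp only: abs_mult abs_power2) simp
qed

lemma sq_mult_le: "cmod (of_real (sq j) * z) \<le> \<tau> / 2 * cmod z"
  unfolding norm_mult norm_of_real by (intro mult_right_mono sq_le) auto

text \<open>The mean value over one time step of the solution of the wave equation with initial values
  \<open>u\<close>, \<open>u'\<close> and frozen density \<open>w\<close>. The method uses it as potential.\<close>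

definition "avg_pot u u' w = synth K (\<lambda>j. of_real (sc j) * dft K u j
   + of_real (sq j) * dft K u' j + of_real (sc j - 1) * dft K w j)"

lemma dft_avg_pot: "j \<in> modes K \<Longrightarrow> dft K (avg_pot u u' w) j = of_real (sc j) * dft K u j
   + of_real (sq j) * dft K u' j + of_real (sc j - 1) * dft K w j"
  unfolding avg_pot_def by (rule dft_synth[OF K])

lemma gnorm_eqI: "(\<And>j. j \<in> modes K \<Longrightarrow> dft K f j = dft K g j) \<Longrightarrow> gnorm K r f = gnorm K r g"
  unfolding gnorm_def by (rule wnorm_cong) simp

lemma avg_pot_diff: "gnorm K r (\<lambda>x. avg_pot u u' w x - avg_pot z z' y x) = gnorm K r (avg_pot (\<lambda>x. u x - z x) (\<lambda>x. u' x - z' x) (\<lambda>x. w x - y x))"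
  by (rule gnorm_eqI) (simp add: dft_avg_pot dft_diff algebra_simps)

lemma avg_pot_bound: "N (avg_pot u u' w) \<le> N u + \<tau> / 2 * N u' + 2 * N w"
proof -
  have 1: "wnorm s (modes K) (\<lambda>j. of_real (sc j) * dft K u j) \<le> 1 * N u"
    unfolding gnorm_def by (rule wnorm_multiplier0) (auto simp: norm_mult sc_le intro!: mult_left_le_one_le)
  have 2: "wnorm s (modes K) (\<lambda>j. of_real (sq j) * dft K u' j) \<le> \<tau> / 2 * N u'"
    unfolding gnorm_def by (intro wnorm_multiplier0 sq_mult_le) (use \<tau> in auto)
  have 3: "wnorm s (modes K) (\<lambda>j. of_real (sc j - 1) * dft K w j) \<le> 2 * N w"
  proof -
    have m: "cmod (of_real (sc j - 1) * z) \<le> 2 * cmod z" for j z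
      using sc_le[of j] unfolding norm_mult norm_of_real by (intro mult_right_mono) auto
    show ?thesis unfolding gnorm_def by (rule wnorm_multiplier0) (use m in auto)
  qed
  have "N (avg_pot u u' w) = wnorm s (modes K) (\<lambda>j. of_real (sc j) * dft K u j
   + of_real (sq j) * dft K u' j + of_real (sc j - 1) * dft K w j)"
    unfolding gnorm_def by (rule wnorm_cong) (simp add: dft_avg_pot)
  also have "\<dots> \<le> (1 * N u + \<tau> / 2 * N u') + 2 * N w"
    by (rule order_trans[OF wnorm_add add_mono[OF order_trans[OF wnorm_add add_mono[OF 1 2]] 3]])
  finally show ?thesis by simp
qed

text \<open>The symbols differ from their values at \<open>\<tau> = 0\<close> by at most \<open>\<tau> * wt j\<close>, which costs one
  derivative.\<close>

lemma avg_pot_consistency: "N (\<lambda>x. u x - avg_pot u u' w x) \<le> \<tau> * (gnorm K (s + 1) u + gnorm K (s + 1) w + N u')"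
proof -
  let ?m = "\<lambda>j. of_real (sc j - 1) :: complex"
  have m: "cmod (?m j * z) \<le> \<tau> * wt j powr 1 * cmod z" for j z
    unfolding norm_mult norm_of_real powr_one[OF wt_nonneg] by (intro mult_right_mono sc_minus_1_le) auto
  have 1: "wnorm s (modes K) (\<lambda>j. ?m j * dft K u j) \<le> \<tau> * gnorm K (s + 1) u"
    unfolding gnorm_def using m \<tau> by (intro wnorm_multiplier) auto
  have 3: "wnorm s (modes K) (\<lambda>j. ?m j * dft K w j) \<le> \<tau> * gnorm K (s + 1) w"
    unfolding gnorm_def using m \<tau> by (intro wnorm_multiplier) auto
  have 2: "wnorm s (modes K) (\<lambda>j. of_real (sq j) * dft K u' j) \<le> \<tau> / 2 * N u'"
    unfolding gnorm_def by (intro wnorm_multiplier0 sq_mult_le) (use \<tau> in auto)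
  have "N (\<lambda>x. u x - avg_pot u u' w x) = wnorm s (modes K) (\<lambda>j. - ((?m j * dft K u j
   + of_real (sq j) * dft K u' j) + ?m j * dft K w j))"
    unfolding gnorm_def by (rule wnorm_cong) (simp add: dft_avg_pot dft_diff algebra_simps norm_minus_commute)
  also have "\<dots> \<le> (\<tau> * gnorm K (s + 1) u + \<tau> / 2 * N u') + \<tau> * gnorm K (s + 1) w"
    unfolding wnorm_minus by (rule order_trans[OF wnorm_add add_mono[OF order_trans[OF wnorm_add add_mono[OF 1 2]] 3]])
  also have "\<dots> \<le> \<tau> * (gnorm K (s + 1) u + gnorm K (s + 1) w + N u')"
    using \<tau> gnorm_nonneg[of K s u'] by (simp add: algebra_simps)
  finally show ?thesis .
qed

text \<open>The reference for the numerical solution is the truncation of the exact solution, not its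
  interpolant: truncation commutes with the Laplacian, so the coefficients of the reference satisfy
  the differential equations of the exact ones, and aliasing appears only in the nonlinear terms.\<close>

definition "trunc f = synth K (fc f)"

lemma dft_trunc: "j \<in> modes K \<Longrightarrow> dft K (trunc f) j = fc f j" unfolding trunc_def by (rule dft_synth[OF K])

lemma gnorm_trunc: "H_bound q f B \<Longrightarrow> r \<le> q \<Longrightarrow> gnorm K r (trunc f) \<le> B"
proof -
  assume h: "H_bound q f B" "r \<le> q"
  have "gnorm K r (trunc f) = wnorm r (modes K) (fc f)" unfolding gnorm_def by (rule wnorm_cong) (simp add: dft_trunc)
  also have "\<dots> \<le> B" by (rule H_bound_wnorm[OF H_bound_mono[OF h order_refl]])
  finally show ?thesis .
qed

lemma trunc_diff: "ctorus f \<Longrightarrow> ctorus g \<Longrightarrow> trunc (\<lambda>x. f x - g x) x = trunc f x - trunc g x"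
  by (simp add: trunc_def synth_def fc_diff left_diff_distrib sum_subtractf)

definition "ci r = interp_const TYPE('d) r (r + \<sigma>)"
definition "cb r = 1 + interp_const TYPE('d) r r"

lemma ci_nn: "r \<ge> s \<Longrightarrow> 0 \<le> ci r" "r \<ge> s \<Longrightarrow> 0 \<le> cb r"
  unfolding ci_def cb_def using s \<sigma> interp_const_nonneg[where 'd='d, of "r + \<sigma>" r] interp_const_nonneg[where 'd='d, of r r] by auto

text \<open>On the grid, a function minus its truncation is the interpolation error.\<close>

lemma gnorm_interpolation_error:
  fixes f :: "real ^ 'd \<Rightarrow> complex"
  assumes r: "r \<ge> s" and f: "H_bound q f B" "r + \<sigma> \<le> q"
  shows "gnorm K r (\<lambda>x. f x - trunc f x) \<le> ci r * B * \<eta>"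
proof -
  have "gnorm K r (\<lambda>x. f x - trunc f x) = wnorm r (modes K) (\<lambda>k. dft K f k - fc f k)"
    unfolding gnorm_def by (rule wnorm_cong) (simp add: dft_diff dft_trunc)
  also have "\<dots> \<le> ci r * real K powr (- \<sigma>) * B"
    unfolding ci_def by (rule interpolation_error[OF K _ _ H_bound_mono[OF f order_refl]]) (use r s s_pos \<sigma> in auto)
  also have "\<dots> \<le> ci r * \<eta> * B"
    using ci_nn[OF r] \<eta> H_bound_nonneg[OF f(1)] by (intro mult_right_mono mult_left_mono) (auto simp: space_err_def)
  finally show ?thesis by (simp add: mult_ac)
qed

lemma gnorm_of_H_bound: fixes f :: "real ^ 'd \<Rightarrow> complex" shows "r \<ge> s \<Longrightarrow> H_bound q f B \<Longrightarrow> r \<le> q \<Longrightarrow> gnorm K r f \<le> cb r * B"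
  unfolding cb_def using s by (intro gnorm_le_H_bound[OF K _ H_bound_mono]) auto

end

text \<open>The prefix \<open>h\<close> marks quantities formed from the truncated exact solution; \<open>hW\<close> and \<open>hv\<close> are the
  density and the potential that the method would compute from it.\<close>

locale discretized_solution = zakharov_modes dd s \<sigma> M a b \<psi> U U' + discretization dd s \<sigma> M K \<tau>
  for dd :: "'d::finite itself" and s \<sigma> M a b :: real and \<psi> U U' :: "real \<Rightarrow> real ^ 'd \<Rightarrow> complex"
    and K :: nat and \<tau> :: real
begin

definition "h\<psi> t = trunc (\<psi> t)"
definition "hU t = trunc (U t)"
definition "hU' t = trunc (U' t)"
definition "hW t = (\<lambda>x. h\<psi> t x * cnj (h\<psi> t x))"
definition "hv t = avg_pot (hU t) (hU' t) (hW t)"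

definition "cWl r = Ca r * l\<psi> * M + Ca r * M * l\<psi>"
definition "Rv = M + M / 2 + 2 * (Ca s * M * M)"
definition "lv = M + lU' / 2 + 2 * cWl s"

lemma M0: "0 \<le> M" using M by simp

lemma h\<psi>_bound: "t \<in> {a..b} \<Longrightarrow> r \<le> s + 2 + \<sigma> \<Longrightarrow> gnorm K r (h\<psi> t) \<le> M"
  unfolding h\<psi>_def by (rule gnorm_trunc[OF psi_bound])
lemma hU_bound: "t \<in> {a..b} \<Longrightarrow> r \<le> s + 1 + \<sigma> \<Longrightarrow> gnorm K r (hU t) \<le> M"
  unfolding hU_def by (rule gnorm_trunc[OF U_bound])
lemma hU'_bound: "t \<in> {a..b} \<Longrightarrow> r \<le> s + \<sigma> \<Longrightarrow> gnorm K r (hU' t) \<le> M"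
  unfolding hU'_def by (rule gnorm_trunc[OF U'_bound])

lemma h\<psi>_lipschitz: "t \<in> {a..b} \<Longrightarrow> t + \<tau> \<in> {a..b} \<Longrightarrow> r \<le> s + \<sigma> \<Longrightarrow> gnorm K r (\<lambda>x. h\<psi> (t + \<tau>) x - h\<psi> t x) \<le> l\<psi> * \<tau>"
  using gnorm_trunc[OF psi_lipschitz[of t \<tau>], of r] \<tau> by (simp add: h\<psi>_def trunc_diff[symmetric] ct)
lemma hU_lipschitz: "t \<in> {a..b} \<Longrightarrow> t + \<tau> \<in> {a..b} \<Longrightarrow> r \<le> s + \<sigma> \<Longrightarrow> gnorm K r (\<lambda>x. hU (t + \<tau>) x - hU t x) \<le> M * \<tau>"
  using gnorm_trunc[OF U_lipschitz[of t \<tau>], of r] \<tau> by (simp add: hU_def trunc_diff[symmetric] ct)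
lemma hU'_lipschitz: "t \<in> {a..b} \<Longrightarrow> t + \<tau> \<in> {a..b} \<Longrightarrow> r \<le> s + \<sigma> - 1 \<Longrightarrow> gnorm K r (\<lambda>x. hU' (t + \<tau>) x - hU' t x) \<le> lU' * \<tau>"
  using gnorm_trunc[OF U'_lipschitz[of t \<tau>], of r] \<tau> by (simp add: hU'_def trunc_diff[symmetric] ct)

lemma gnorm_cnj_diff: "gnorm K r (\<lambda>x. cnj (f x) - cnj (g x)) = gnorm K r (\<lambda>x. f x - g x)"
  using gnorm_cnj[OF K, of r "\<lambda>x. f x - g x"] by simp

lemma hW_bound: "t \<in> {a..b} \<Longrightarrow> s \<le> r \<Longrightarrow> r \<le> s + 2 + \<sigma> \<Longrightarrow> gnorm K r (hW t) \<le> Ca r * M * M"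
  unfolding hW_def by (rule gnorm_mult_le) (auto simp: gnorm_cnj[OF K] h\<psi>_bound)

lemma hW_lipschitz:
  assumes "t \<in> {a..b}" "t + \<tau> \<in> {a..b}" "s \<le> r" "r \<le> s + \<sigma>"
  shows "gnorm K r (\<lambda>x. hW (t + \<tau>) x - hW t x) \<le> cWl r * \<tau>"
proof -
  have "gnorm K r (\<lambda>x. hW (t + \<tau>) x - hW t x) \<le> Ca r * (l\<psi> * \<tau>) * M + Ca r * M * (l\<psi> * \<tau>)"
    unfolding hW_def using assms
    by (intro gnorm_mult_diff_le) (auto simp: gnorm_cnj[OF K] gnorm_cnj_diff h\<psi>_bound h\<psi>_lipschitz)
  then show ?thesis by (simp add: cWl_def algebra_simps)
qed

lemma hv_bound: "t \<in> {a..b} \<Longrightarrow> N (hv t) \<le> Rv"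
proof -
  assume t: "t \<in> {a..b}"
  have "N (hv t) \<le> N (hU t) + \<tau> / 2 * N (hU' t) + 2 * N (hW t)" unfolding hv_def by (rule avg_pot_bound)
  also have "\<dots> \<le> M + 1 / 2 * M + 2 * (Ca s * M * M)"
    using t \<sigma> \<tau> M0 by (intro add_mono mult_mono mult_left_mono hU_bound hU'_bound hW_bound) auto
  finally show ?thesis by (simp add: Rv_def)
qed

lemma hv_lipschitz: "t \<in> {a..b} \<Longrightarrow> t + \<tau> \<in> {a..b} \<Longrightarrow> N (\<lambda>x. hv (t + \<tau>) x - hv t x) \<le> lv * \<tau>"
proof -
  assume t: "t \<in> {a..b}" "t + \<tau> \<in> {a..b}"
  have "N (\<lambda>x. hv (t + \<tau>) x - hv t x) \<le> N (\<lambda>x. hU (t + \<tau>) x - hU t x)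
     + \<tau> / 2 * N (\<lambda>x. hU' (t + \<tau>) x - hU' t x) + 2 * N (\<lambda>x. hW (t + \<tau>) x - hW t x)"
    unfolding hv_def avg_pot_diff by (rule avg_pot_bound)
  also have "\<dots> \<le> M * \<tau> + 1 / 2 * (lU' * \<tau>) + 2 * (cWl s * \<tau>)"
    using t \<sigma> \<tau> c_nonneg by (intro add_mono mult_mono mult_left_mono hU_lipschitz hU'_lipschitz hW_lipschitz) auto
  finally show ?thesis by (simp add: lv_def algebra_simps)
qed

lemma Rv_nn: "0 \<le> Rv" using M0 Ca_s by (simp add: Rv_def)
lemma cWl_nn: "r \<ge> s \<Longrightarrow> 0 \<le> cWl r" using M0 c_nonneg Ca_nn by (simp add: cWl_def)
lemma lv_nn: "0 \<le> lv" using M0 c_nonneg cWl_nn[of s] by (simp add: lv_def)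

section \<open>Defects of the potential and of the nonlinearity\<close>

lemma interpolation_error_difference:
  fixes f g :: "real ^ 'd \<Rightarrow> complex"
  assumes "ctorus f" "ctorus g" "H_bound q (\<lambda>x. f x - g x) B" "r + \<sigma> \<le> q" "s \<le> r"
  shows "gnorm K r (\<lambda>x. (f x - trunc f x) - (g x - trunc g x)) \<le> ci r * B * \<eta>"
proof -
  have eq: "(f x - trunc f x) - (g x - trunc g x) = (f x - g x) - trunc (\<lambda>x. f x - g x) x" for x
    using assms by (simp add: trunc_diff)
  show ?thesis unfolding eq by (rule gnorm_interpolation_error[OF assms(5,3,4)])
qed

definition "pot_err t = (\<lambda>x. U t x - hv t x)"
definition "cv1 = M + Ca (s + 1) * M * M + M"
definition "cv2 = M + cWl (s + 1) + lU'"
definition "c_pot = ci s * M + cv1"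
definition "c_pot' = ci s * M + cv2"

lemma cv_nn: "0 \<le> cv1" "0 \<le> cv2"
  using M0 Ca_nn[of "s + 1"] c_nonneg cWl_nn[of "s + 1"] by (auto simp: cv1_def cv2_def)

text \<open>Replacing \<open>U\<close> by its truncation costs \<open>K\<^sup>-\<^sup>\<sigma>\<close>, replacing the truncation by a mean value in
  time costs \<open>\<tau>\<close>.\<close>

lemma pot_err_bound: "t \<in> {a..b} \<Longrightarrow> N (pot_err t) \<le> c_pot * \<eta>"
proof -
  assume t: "t \<in> {a..b}"
  have eq: "pot_err t = (\<lambda>x. (U t x - trunc (U t) x) + (hU t x - hv t x))" by (simp add: pot_err_def hU_def)
  have 1: "N (\<lambda>x. U t x - trunc (U t) x) \<le> ci s * M * \<eta>" by (rule gnorm_interpolation_error[OF _ U_bound[OF t]]) auto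
  have "N (\<lambda>x. hU t x - hv t x) \<le> \<tau> * (gnorm K (s + 1) (hU t) + gnorm K (s + 1) (hW t) + N (hU' t))"
    unfolding hv_def by (rule avg_pot_consistency)
  also have "\<dots> \<le> \<tau> * cv1"
    unfolding cv1_def using t \<sigma> \<tau> by (intro mult_left_mono add_mono hU_bound hU'_bound hW_bound) auto
  also have "\<dots> \<le> \<eta> * cv1" using \<eta> cv_nn by (intro mult_right_mono) auto
  finally show ?thesis unfolding eq using gnorm_add_le[OF 1] by (fastforce simp: c_pot_def algebra_simps)
qed

text \<open>The averaged potential is linear in its three arguments, so the estimates of \<open>pot_err_bound\<close>
  apply to increments in time, which are small by Lipschitz continuity.\<close>

lemma pot_err_difference: "t \<in> {a..b} \<Longrightarrow> t + \<tau> \<in> {a..b} \<Longrightarrow> N (\<lambda>x. pot_err (t + \<tau>) x - pot_err t x) \<le> c_pot' * \<tau> * \<eta>"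
proof -
  assume t: "t \<in> {a..b}" "t + \<tau> \<in> {a..b}"
  let ?D = "\<lambda>x. hU (t + \<tau>) x - hU t x" and ?D' = "\<lambda>x. hU' (t + \<tau>) x - hU' t x" and ?DW = "\<lambda>x. hW (t + \<tau>) x - hW t x"
  have eq: "pot_err (t + \<tau>) x - pot_err t x = ((U (t + \<tau>) x - trunc (U (t + \<tau>)) x) - (U t x - trunc (U t) x))
     + ((hU (t + \<tau>) x - hv (t + \<tau>) x) - (hU t x - hv t x))" for x by (simp add: pot_err_def hU_def)
  have 1: "N (\<lambda>x. (U (t + \<tau>) x - trunc (U (t + \<tau>)) x) - (U t x - trunc (U t) x)) \<le> ci s * (M * \<tau>) * \<eta>"
    using t \<tau> by (intro interpolation_error_difference[OF ct(2) ct(2) U_lipschitz]) auto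
  have "N (\<lambda>x. (hU (t + \<tau>) x - hv (t + \<tau>) x) - (hU t x - hv t x)) = N (\<lambda>x. ?D x - avg_pot ?D ?D' ?DW x)"
    by (rule gnorm_eqI) (simp only: hv_def dft_diff dft_avg_pot, simp add: algebra_simps)
  also have "\<dots> \<le> \<tau> * (gnorm K (s + 1) ?D + gnorm K (s + 1) ?DW + N ?D')"
    by (rule avg_pot_consistency)
  also have "\<dots> \<le> \<tau> * (M * \<tau> + cWl (s + 1) * \<tau> + lU' * \<tau>)"
    using t \<sigma> \<tau> by (intro mult_left_mono add_mono hU_lipschitz hU'_lipschitz hW_lipschitz) auto
  also have "\<dots> = \<tau> * (cv2 * \<tau>)" by (simp add: cv2_def algebra_simps)
  also have "\<dots> \<le> \<tau> * (cv2 * \<eta>)" using \<eta> \<tau> cv_nn by (intro mult_left_mono) auto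
  finally have 2: "N (\<lambda>x. (hU (t + \<tau>) x - hv (t + \<tau>) x) - (hU t x - hv t x)) \<le> \<tau> * (cv2 * \<eta>)" .
  show ?thesis unfolding eq using gnorm_add_le[OF 1 2] by (simp add: c_pot'_def algebra_simps)
qed

definition "c_exp = Ca s * \<kappa> Rv * Rv\<^sup>2"
definition "c_exp' = Ca s * (\<kappa> Rv * Rv) * \<kappa> Rv + Ca s * \<kappa> Rv * (2 * Rv)"

text \<open>The difference between the nonlinearity of the method, evaluated at the truncated exact
  solution, and the truncation of \<open>- \<i> * G\<close> has three sources: the aliasing of the product, the
  replacement of both factors, and the linearization of the exponential.\<close>

definition "alias_defect t = (\<lambda>x. G t x - trunc (G t) x)"
definition "prod_defect t = (\<lambda>x. U t x * \<psi> t x - hv t x * h\<psi> t x)"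
definition "exp_defect t = (\<lambda>x. (phaseq (hv t) x + \<i> * hv t x) * h\<psi> t x)"
definition "nl_defect t = (\<lambda>x. (\<i> * alias_defect t x - \<i> * prod_defect t x) - exp_defect t x)"

definition "c_nl = ci s * cG + (Ca s * c_pot * (cb s * M) + Ca s * Rv * (ci s * M)) + Ca s * c_exp * M"
definition "c_nl' = ci s * lG + ((Ca s * c_pot' * (cb s * M) + Ca s * c_pot * (cb s * l\<psi>))
   + (Ca s * lv * (ci s * M) + Ca s * Rv * (ci s * l\<psi>))) + (Ca s * (c_exp' * lv) * M + Ca s * c_exp * l\<psi>)"

lemma c_exp_nn: "0 \<le> c_exp" "0 \<le> c_exp'"
  using Ca_s Rv_nn by (simp_all add: c_exp_def c_exp'_def \<kappa>_nn)

lemma nl_defect_bound: "t \<in> {a..b} \<Longrightarrow> N (nl_defect t) \<le> c_nl * \<eta>"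
proof -
  assume t: "t \<in> {a..b}"
  have 1: "N (\<lambda>x. \<i> * alias_defect t x) \<le> ci s * cG * \<eta>"
    unfolding gnorm_cmult alias_defect_def using gnorm_interpolation_error[OF _ G_bound[OF t], of s] by simp
  have "N (\<lambda>x. \<i> * prod_defect t x) \<le> Ca s * (c_pot * \<eta>) * (cb s * M) + Ca s * Rv * (ci s * M * \<eta>)"
  proof -
    have "N (prod_defect t) \<le> Ca s * (c_pot * \<eta>) * (cb s * M) + Ca s * Rv * (ci s * M * \<eta>)"
      unfolding prod_defect_def
    proof (rule gnorm_mult_diff_le)
      show "N (\<lambda>x. U t x - hv t x) \<le> c_pot * \<eta>" using pot_err_bound[OF t] by (simp add: pot_err_def)
      show "N (\<psi> t) \<le> cb s * M" by (rule gnorm_of_H_bound[OF _ psi_bound[OF t]]) (use \<sigma> in auto)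
      show "N (\<lambda>x. \<psi> t x - h\<psi> t x) \<le> ci s * M * \<eta>" unfolding h\<psi>_def
        by (rule gnorm_interpolation_error[OF _ psi_bound[OF t]]) auto
    qed (use t hv_bound in auto)
    then show ?thesis unfolding gnorm_cmult by simp
  qed
  note 2 = this
  have "N (exp_defect t) \<le> Ca s * (\<tau> * c_exp) * M"
    unfolding exp_defect_def
  proof (rule gnorm_mult_le)
    show "N (\<lambda>x. phaseq (hv t) x + \<i> * hv t x) \<le> \<tau> * c_exp" unfolding c_exp_def by (rule phaseq_remainder[OF Rv_nn hv_bound[OF t]])
    show "N (h\<psi> t) \<le> M" by (rule h\<psi>_bound[OF t]) (use \<sigma> in auto)
  qed auto
  also have "\<dots> \<le> Ca s * (\<eta> * c_exp) * M"
    using \<eta> Ca_s c_exp_nn M0 by (intro mult_right_mono mult_left_mono) auto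
  finally have 3: "N (exp_defect t) \<le> Ca s * (\<eta> * c_exp) * M" .
  show ?thesis unfolding nl_defect_def using gnorm_diff_le[OF gnorm_diff_le[OF 1 2] 3] by (simp add: c_nl_def algebra_simps)
qed

lemma nl_defect_difference: "t \<in> {a..b} \<Longrightarrow> t + \<tau> \<in> {a..b} \<Longrightarrow> N (\<lambda>x. nl_defect (t + \<tau>) x - nl_defect t x) \<le> c_nl' * \<tau> * \<eta>"
proof -
  assume t: "t \<in> {a..b}" "t + \<tau> \<in> {a..b}"
  let ?t = "t + \<tau>"
  have \<tau>0: "0 \<le> \<tau>" using \<tau> by simp
  have 1: "N (\<lambda>x. \<i> * (alias_defect ?t x - alias_defect t x)) \<le> ci s * (lG * \<tau>) * \<eta>"
    unfolding gnorm_cmult alias_defect_def using interpolation_error_difference[OF ct(4)[OF t(2)] ct(4)[OF t(1)] G_lipschitz[OF t \<tau>0], of s] by simp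
  have b\<psi>: "N (\<psi> ?t) \<le> cb s * M" by (rule gnorm_of_H_bound[OF _ psi_bound[OF t(2)]]) (use \<sigma> in auto)
  have l\<psi>: "N (\<lambda>x. \<psi> ?t x - \<psi> t x) \<le> cb s * (l\<psi> * \<tau>)" by (rule gnorm_of_H_bound[OF _ psi_lipschitz[OF t \<tau>0]]) (use \<sigma> in auto)
  have d\<psi>: "N (\<lambda>x. \<psi> t' x - h\<psi> t' x) \<le> ci s * M * \<eta>" if "t' \<in> {a..b}" for t' unfolding h\<psi>_def
        by (rule gnorm_interpolation_error[OF _ psi_bound[OF that]]) auto
  have dd\<psi>: "N (\<lambda>x. (\<psi> ?t x - h\<psi> ?t x) - (\<psi> t x - h\<psi> t x)) \<le> ci s * (l\<psi> * \<tau>) * \<eta>" unfolding h\<psi>_def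
    by (rule interpolation_error_difference[OF ct(1)[OF t(2)] ct(1)[OF t(1)] psi_lipschitz[OF t \<tau>0]]) auto
  have "N (\<lambda>x. pot_err ?t x * \<psi> ?t x - pot_err t x * \<psi> t x) \<le> Ca s * (c_pot' * \<tau> * \<eta>) * (cb s * M) + Ca s * (c_pot * \<eta>) * (cb s * (l\<psi> * \<tau>))"
    by (intro gnorm_mult_diff_le pot_err_bound pot_err_difference b\<psi> l\<psi> t) auto
  moreover have "N (\<lambda>x. hv ?t x * (\<psi> ?t x - h\<psi> ?t x) - hv t x * (\<psi> t x - h\<psi> t x))
      \<le> Ca s * (lv * \<tau>) * (ci s * M * \<eta>) + Ca s * Rv * (ci s * (l\<psi> * \<tau>) * \<eta>)"
    by (intro gnorm_mult_diff_le hv_lipschitz hv_bound dd\<psi> d\<psi> t) auto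
  ultimately have "N (\<lambda>x. (pot_err ?t x * \<psi> ?t x - pot_err t x * \<psi> t x) + (hv ?t x * (\<psi> ?t x - h\<psi> ?t x) - hv t x * (\<psi> t x - h\<psi> t x)))
      \<le> (Ca s * (c_pot' * \<tau> * \<eta>) * (cb s * M) + Ca s * (c_pot * \<eta>) * (cb s * (l\<psi> * \<tau>)))
       + (Ca s * (lv * \<tau>) * (ci s * M * \<eta>) + Ca s * Rv * (ci s * (l\<psi> * \<tau>) * \<eta>))"
    by (rule gnorm_add_le)
  moreover have "(pot_err ?t x * \<psi> ?t x - pot_err t x * \<psi> t x) + (hv ?t x * (\<psi> ?t x - h\<psi> ?t x) - hv t x * (\<psi> t x - h\<psi> t x)) = prod_defect ?t x - prod_defect t x" for x
    by (simp add: pot_err_def prod_defect_def algebra_simps)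
  ultimately have 2: "N (\<lambda>x. \<i> * (prod_defect ?t x - prod_defect t x)) \<le> (Ca s * (c_pot' * \<tau> * \<eta>) * (cb s * M) + Ca s * (c_pot * \<eta>) * (cb s * (l\<psi> * \<tau>)))
       + (Ca s * (lv * \<tau>) * (ci s * M * \<eta>) + Ca s * Rv * (ci s * (l\<psi> * \<tau>) * \<eta>))"
    unfolding gnorm_cmult by simp
  have "N (\<lambda>x. exp_defect ?t x - exp_defect t x) \<le> Ca s * (\<tau> * c_exp' * (lv * \<tau>)) * M + Ca s * (\<tau> * c_exp) * (l\<psi> * \<tau>)"
    unfolding exp_defect_def
  proof (rule gnorm_mult_diff_le)
    have "N (\<lambda>x. (phaseq (hv ?t) x + \<i> * hv ?t x) - (phaseq (hv t) x + \<i> * hv t x)) \<le> \<tau> * c_exp' * N (\<lambda>x. hv ?t x - hv t x)"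
      unfolding c_exp'_def by (rule phaseq_remainder_lipschitz[OF Rv_nn hv_bound[OF t(2)] hv_bound[OF t(1)]])
    also have "\<dots> \<le> \<tau> * c_exp' * (lv * \<tau>)" using \<tau> c_exp_nn by (intro mult_left_mono hv_lipschitz t) auto
    finally show "N (\<lambda>x. (phaseq (hv ?t) x + \<i> * hv ?t x) - (phaseq (hv t) x + \<i> * hv t x)) \<le> \<tau> * c_exp' * (lv * \<tau>)" .
    show "N (\<lambda>x. phaseq (hv t) x + \<i> * hv t x) \<le> \<tau> * c_exp" unfolding c_exp_def by (rule phaseq_remainder[OF Rv_nn hv_bound[OF t(1)]])
    show "N (h\<psi> ?t) \<le> M" by (rule h\<psi>_bound[OF t(2)]) (use \<sigma> in auto)
    show "N (\<lambda>x. h\<psi> ?t x - h\<psi> t x) \<le> l\<psi> * \<tau>" by (rule h\<psi>_lipschitz[OF t]) (use \<sigma> in auto)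
  qed auto
  also have "\<dots> = (Ca s * (c_exp' * lv) * M + Ca s * c_exp * l\<psi>) * \<tau> * \<tau>" by (simp add: algebra_simps)
  also have "\<dots> \<le> (Ca s * (c_exp' * lv) * M + Ca s * c_exp * l\<psi>) * \<tau> * \<eta>"
    using \<eta> \<tau> Ca_s c_exp_nn lv_nn M0 c_nonneg by (intro mult_left_mono) auto
  finally have 3: "N (\<lambda>x. exp_defect ?t x - exp_defect t x) \<le> (Ca s * (c_exp' * lv) * M + Ca s * c_exp * l\<psi>) * \<tau> * \<eta>" .
  have eq: "nl_defect ?t x - nl_defect t x = (\<i> * (alias_defect ?t x - alias_defect t x) - \<i> * (prod_defect ?t x - prod_defect t x)) - (exp_defect ?t x - exp_defect t x)" for x
    by (simp add: nl_defect_def algebra_simps)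
  show ?thesis unfolding eq using gnorm_diff_le[OF gnorm_diff_le[OF 1 2] 3] by (simp add: c_nl'_def algebra_simps)
qed

section \<open>Defect of the Schroedinger component\<close>

text \<open>The inverse of the Schroedinger group in Fourier space; multiplication by it passes to rotated
  variables in which only the nonlinearity remains.\<close>

definition "ee r j = exp (\<i> * of_real (r * (om j)\<^sup>2))"

lemma norm_ee [simp]: "cmod (ee r j) = 1" by (simp add: ee_def norm_exp_imaginary)
lemma ee_cnj [simp]: "cnj (ee r j) * ee r j = 1" "ee r j * cnj (ee r j) = 1"
  by (simp_all add: complex_norm_square[symmetric] mult.commute[of "cnj (ee r j)"])
lemma ee_0 [simp]: "ee 0 j = 1" by (simp add: ee_def)

lemma norm_exp_i_minus_1_le: "cmod (exp (\<i> * of_real x) - 1) \<le> \<bar>x\<bar>"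
proof -
  have "cmod (exp (\<i> * of_real x) - exp (\<i> * of_real 0)) \<le> 1 * norm (x - 0)"
  proof (rule differentiable_bound[of UNIV "\<lambda>x. exp (\<i> * of_real x)" "\<lambda>x h. h *\<^sub>R (\<i> * exp (\<i> * of_real x))" 1 x 0])
    fix y :: real
    have "((\<lambda>z. exp (\<i> * z)) has_field_derivative \<i> * exp (\<i> * of_real y)) (at (of_real y))"
      by (auto intro!: derivative_eq_intros)
    from has_vector_derivative_real_field[OF this, of UNIV]
    show "((\<lambda>x. exp (\<i> * of_real x)) has_derivative (\<lambda>h. h *\<^sub>R (\<i> * exp (\<i> * of_real y)))) (at y within UNIV)"
      by (simp add: has_vector_derivative_def)
    show "onorm (\<lambda>h. h *\<^sub>R (\<i> * exp (\<i> * complex_of_real y))) \<le> 1"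
      by (rule onorm_le) (simp add: norm_mult norm_exp_imaginary)
  qed auto
  then show ?thesis by simp
qed

lemma ee_minus_1_le: "0 \<le> r \<Longrightarrow> cmod (ee r j - 1) \<le> r * wt j powr 2"
proof -
  assume r: "0 \<le> r"
  have "cmod (ee r j - 1) \<le> \<bar>r * (om j)\<^sup>2\<bar>" unfolding ee_def by (rule norm_exp_i_minus_1_le)
  also have "\<dots> \<le> r * wt j powr 2" using r norm_freq_sq_le[of j] by (simp add: abs_mult mult_left_mono)
  finally show ?thesis .
qed

text \<open>The derivative in \<open>r\<close> of \<open>ee r j * fc (p r) j + \<i> * r * fc (g 0) j\<close> is
  \<open>- \<i> * (ee r j * fc (g r) j - fc (g 0) j)\<close>, which is small since \<open>ee r j\<close> is close to \<open>1\<close>, at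
  the price of two derivatives, and \<open>g\<close> varies slowly. The functions \<open>p\<close> and \<open>g\<close> are kept general
  because the lemma is also applied to increments in time of a solution.\<close>

lemma duhamel_bound:
  fixes p g :: "real \<Rightarrow> real ^ 'd \<Rightarrow> complex"
  assumes d: "\<And>r j. r \<in> {0..\<tau>} \<Longrightarrow> ((\<lambda>r. fc (p r) j) has_vector_derivative - \<i> * ((om j)\<^sup>2 * fc (p r) j + fc (g r) j)) (at r within {0..\<tau>})"
    and B1: "\<And>r. r \<in> {0..\<tau>} \<Longrightarrow> H_bound (s + 2) (g r) B1"
    and B2: "\<And>r. r \<in> {0..\<tau>} \<Longrightarrow> H_bound s (\<lambda>x. g r x - g 0 x) B2"
  shows "wnorm s (modes K) (\<lambda>j. ee \<tau> j * fc (p \<tau>) j - fc (p 0) j + \<i> * of_real \<tau> * fc (g 0) j) \<le> (\<tau> * B1 + B2) * \<tau>"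
proof -
  let ?x = "\<lambda>r j. ee r j * fc (p r) j + \<i> * of_real r * fc (g 0) j"
  let ?y = "\<lambda>r j. - \<i> * (ee r j * fc (g r) j - fc (g 0) j)"
  have c: "ctorus (g r)" if "r \<in> {0..\<tau>}" for r using H_bound_ctorus[OF B1[OF that]] .
  have "wnorm s (modes K) (\<lambda>j. ?x \<tau> j - ?x 0 j) \<le> (\<tau> * B1 + B2) * (\<tau> - 0)"
  proof (rule wnorm_mean_value)
    show "0 \<le> \<tau>" using \<tau> by simp
    fix r assume r: "r \<in> {0..\<tau>}"
    show "((\<lambda>r. ?x r j) has_vector_derivative ?y r j) (at r within {0..\<tau>})" for j
    proof -
      have "((\<lambda>z. exp (\<i> * (of_real ((om j)\<^sup>2) * z))) has_field_derivative \<i> * of_real ((om j)\<^sup>2) * exp (\<i> * (of_real ((om j)\<^sup>2) * of_real r))) (at (of_real r))"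
        by (auto intro!: derivative_eq_intros)
      from has_vector_derivative_real_field[OF this, of "{0..\<tau>}"]
      have e: "((\<lambda>r. ee r j) has_vector_derivative \<i> * of_real ((om j)\<^sup>2) * ee r j) (at r within {0..\<tau>})"
        by (simp add: ee_def mult_ac)
      have "((\<lambda>z. \<i> * z * fc (g 0) j) has_field_derivative \<i> * fc (g 0) j) (at (of_real r))"
        by (auto intro!: derivative_eq_intros)
      from has_vector_derivative_real_field[OF this, of "{0..\<tau>}"]
      have "((\<lambda>r. \<i> * of_real r * fc (g 0) j) has_vector_derivative \<i> * fc (g 0) j) (at r within {0..\<tau>})" .
      from has_vector_derivative_add[OF has_vector_derivative_mult[OF e d[OF r]] this]
      show ?thesis by (rule has_vector_derivative_eq_rhs) (simp add: algebra_simps)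
    qed
    show "wnorm s (modes K) (?y r) \<le> \<tau> * B1 + B2"
    proof -
      have "wnorm s (modes K) (?y r) = wnorm s (modes K) (\<lambda>j. (ee r j - 1) * fc (g r) j + (fc (g r) j - fc (g 0) j))"
        by (rule wnorm_cong) (simp only: norm_mult, simp add: algebra_simps)
      also have "\<dots> \<le> wnorm s (modes K) (\<lambda>j. (ee r j - 1) * fc (g r) j) + wnorm s (modes K) (\<lambda>j. fc (g r) j - fc (g 0) j)"
        by (rule wnorm_add)
      also have "\<dots> \<le> \<tau> * B1 + B2"
      proof (rule add_mono)
        have "wnorm s (modes K) (\<lambda>j. (ee r j - 1) * fc (g r) j) \<le> \<tau> * wnorm (s + 2) (modes K) (fc (g r))"
        proof (rule wnorm_multiplier)
          fix j :: "int ^ 'd"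
          have "cmod (ee r j - 1) \<le> r * wt j powr 2" using r by (intro ee_minus_1_le) auto
          also have "\<dots> \<le> \<tau> * wt j powr 2" using r by (intro mult_right_mono) auto
          finally show "cmod ((ee r j - 1) * fc (g r) j) \<le> \<tau> * wt j powr 2 * cmod (fc (g r) j)"
            unfolding norm_mult by (rule mult_right_mono) auto
        qed (use \<tau> in auto)
        also have "\<dots> \<le> \<tau> * B1" using \<tau> by (intro mult_left_mono H_bound_wnorm B1 r) auto
        finally show "wnorm s (modes K) (\<lambda>j. (ee r j - 1) * fc (g r) j) \<le> \<tau> * B1" .
        have "(\<lambda>j. fc (g r) j - fc (g 0) j) = fc (\<lambda>x. g r x - g 0 x)"
          using r \<tau> by (auto simp: fc_diff c)
        then show "wnorm s (modes K) (\<lambda>j. fc (g r) j - fc (g 0) j) \<le> B2" using H_bound_wnorm[OF B2[OF r]] by simp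
      qed
      finally show ?thesis .
    qed
  qed simp
  then show ?thesis by (simp add: algebra_simps)
qed

text \<open>The error of freezing the nonlinearity over one time step, in rotated variables and without
  discretization in space.\<close>

definition "time_defect t j = ee \<tau> j * fc (\<psi> (t + \<tau>)) j - fc (\<psi> t) j + \<i> * of_real \<tau> * fc (G t) j"

lemma time_defect_bound: "t \<in> {a..b} \<Longrightarrow> t + \<tau> \<in> {a..b} \<Longrightarrow> wnorm s (modes K) (time_defect t) \<le> (cG + lG) * \<tau> * \<tau>"
proof -
  assume t: "t \<in> {a..b}" "t + \<tau> \<in> {a..b}"
  have I: "t + r \<in> {a..b}" "r + t \<in> {a..b}" if "r \<in> {0..\<tau>}" for r using t that by auto
  have "wnorm s (modes K) (\<lambda>j. ee \<tau> j * fc (\<psi> (\<tau> + t)) j - fc (\<psi> (0 + t)) j + \<i> * of_real \<tau> * fc (G (0 + t)) j) \<le> (\<tau> * cG + lG * \<tau>) * \<tau>"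
  proof (rule duhamel_bound)
    fix r assume r: "r \<in> {0..\<tau>}"
    show "((\<lambda>r. fc (\<psi> (r + t)) j) has_vector_derivative - \<i> * ((om j)\<^sup>2 * fc (\<psi> (r + t)) j + fc (G (r + t)) j)) (at r within {0..\<tau>})" for j
      unfolding G_def by (rule has_vector_derivative_shift[OF d\<psi>[OF I(2)[OF r]] I(2)])
    show "H_bound (s + 2) (G (r + t)) cG" by (rule H_bound_mono[OF G_bound[OF I(2)[OF r]]]) (use \<sigma> in auto)
    show "H_bound s (\<lambda>x. G (r + t) x - G (0 + t) x) (lG * \<tau>)"
      using r \<sigma> c_nonneg by (simp add: add.commute[of r t]) (rule H_bound_mono[OF G_lipschitz[OF t(1) I(1)[OF r]]], auto intro: mult_left_mono)
  qed
  then show ?thesis by (simp add: time_defect_def[abs_def] algebra_simps)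
qed

text \<open>The increment of a solution in time solves the same linear equation with the increment of
  \<open>G\<close> as inhomogeneity, and second differences of \<open>G\<close> are bounded.\<close>

lemma time_defect_difference: "t \<in> {a..b} \<Longrightarrow> t + \<tau> + \<tau> \<in> {a..b} \<Longrightarrow> wnorm s (modes K) (\<lambda>j. time_defect (t + \<tau>) j - time_defect t j) \<le> (lG + qG) * \<tau> * \<tau> * \<tau>"
proof -
  assume t: "t \<in> {a..b}" "t + \<tau> + \<tau> \<in> {a..b}"
  have \<tau>0: "0 \<le> \<tau>" using \<tau> by simp
  have I: "t + r \<in> {a..b}" "r + t \<in> {a..b}" "r + (t + \<tau>) \<in> {a..b}" "r + t + \<tau> \<in> {a..b}" "t + r + \<tau> \<in> {a..b}" if "r \<in> {0..\<tau>}" for r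
    using t that \<tau>0 by auto
  let ?p = "\<lambda>r x. \<psi> (r + (t + \<tau>)) x - \<psi> (r + t) x" and ?g = "\<lambda>r x. G (r + (t + \<tau>)) x - G (r + t) x"
  have fcd: "fc (?p r) j = fc (\<psi> (r + (t + \<tau>))) j - fc (\<psi> (r + t)) j" "fc (?g r) j = fc (G (r + (t + \<tau>))) j - fc (G (r + t)) j"
    if "r \<in> {0..\<tau>}" for r j using I[OF that] by (auto intro!: fc_diff ct)
  have L: "wnorm s (modes K) (\<lambda>j. ee \<tau> j * fc (?p \<tau>) j - fc (?p 0) j + \<i> * of_real \<tau> * fc (?g 0) j) \<le> (\<tau> * (lG * \<tau>) + qG * \<tau> * \<tau>) * \<tau>"
  proof (rule duhamel_bound)
    fix r assume r: "r \<in> {0..\<tau>}"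
    have c: "((\<lambda>r. fc (\<psi> (r + (t + \<tau>))) j - fc (\<psi> (r + t)) j) has_vector_derivative
       - \<i> * ((om j)\<^sup>2 * fc (\<psi> (r + (t + \<tau>))) j + fc (G (r + (t + \<tau>))) j) - - \<i> * ((om j)\<^sup>2 * fc (\<psi> (r + t)) j + fc (G (r + t)) j)) (at r within {0..\<tau>})" for j
      unfolding G_def
      by (intro has_vector_derivative_diff has_vector_derivative_shift[OF d\<psi>] I r)
    have "((\<lambda>r. fc (?p r) j) has_vector_derivative - \<i> * ((om j)\<^sup>2 * fc (\<psi> (r + (t + \<tau>))) j + fc (G (r + (t + \<tau>))) j) - - \<i> * ((om j)\<^sup>2 * fc (\<psi> (r + t)) j + fc (G (r + t)) j)) (at r within {0..\<tau>})" for j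
      by (rule has_vector_derivative_transform[OF r _ c]) (rule fcd)
    then show "((\<lambda>r. fc (?p r) j) has_vector_derivative - \<i> * ((om j)\<^sup>2 * fc (?p r) j + fc (?g r) j)) (at r within {0..\<tau>})" for j
      by (rule has_vector_derivative_eq_rhs) (simp only: fcd[OF r], simp add: algebra_simps)
    have "H_bound (s + 2) (\<lambda>x. G (r + t + \<tau>) x - G (r + t) x) (lG * \<tau>)"
      by (rule H_bound_mono[OF G_lipschitz[OF I(2,4)[OF r] \<tau>0]]) (use \<sigma> in auto)
    then show "H_bound (s + 2) (?g r) (lG * \<tau>)" by (simp add: add.assoc)
    have "H_bound s (\<lambda>x. (G (t + r + \<tau>) x - G (t + r) x) - (G (t + \<tau>) x - G t x)) (qG * \<tau> * \<tau>)"
      using r c_nonneg \<tau> by (intro H_bound_mono[OF G_second_difference[OF t(1) I(5)[OF r] _ \<tau>0]]) (auto intro: mult_left_mono)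
    then show "H_bound s (\<lambda>x. ?g r x - ?g 0 x) (qG * \<tau> * \<tau>)" by (simp add: add_ac)
  qed
  have e: "ee \<tau> j * fc (?p \<tau>) j - fc (?p 0) j + \<i> * of_real \<tau> * fc (?g 0) j = time_defect (t + \<tau>) j - time_defect t j" for j
    using \<tau>0 by (simp only: fcd atLeastAtMost_iff order_refl) (simp add: time_defect_def algebra_simps)
  show ?thesis using L unfolding e by (simp add: algebra_simps)
qed

text \<open>The residual of the exact coefficients in the recursion of the method, evaluated at the
  truncated exact solution.\<close>

definition "psi_defect t j = fc (\<psi> (t + \<tau>)) j - cnj (ee \<tau> j) * (fc (\<psi> t) j + of_real \<tau> * dft K (\<lambda>x. phaseq (hv t) x * h\<psi> t x) j)"

lemma psi_defect_eq: "t \<in> {a..b} \<Longrightarrow> j \<in> modes K \<Longrightarrow> psi_defect t j = cnj (ee \<tau> j) * (time_defect t j + of_real \<tau> * dft K (nl_defect t) j)"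
proof -
  assume t: "t \<in> {a..b}" and j: "j \<in> modes K"
  have DY: "dft K (nl_defect t) j = - \<i> * fc (G t) j - dft K (\<lambda>x. phaseq (hv t) x * h\<psi> t x) j"
    by (simp only: nl_defect_def alias_defect_def prod_defect_def exp_defect_def dft_diff dft_cmult dft_trunc[OF j] dft_add distrib_right mult.assoc)
       (simp add: G_def right_diff_distrib)
  have XY: "time_defect t j + of_real \<tau> * dft K (nl_defect t) j = ee \<tau> j * fc (\<psi> (t + \<tau>)) j - fc (\<psi> t) j - of_real \<tau> * dft K (\<lambda>x. phaseq (hv t) x * h\<psi> t x) j"
    unfolding time_defect_def DY by (simp add: right_diff_distrib distrib_left)
  show ?thesis
    unfolding XY psi_defect_def by (simp add: right_diff_distrib distrib_left flip: mult.assoc)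
qed

definition "c_psi = (cG + lG) + c_nl"
definition "c_psi' = (lG + qG) + c_nl'"

lemma psi_defect_bound: "t \<in> {a..b} \<Longrightarrow> t + \<tau> \<in> {a..b} \<Longrightarrow> wnorm s (modes K) (psi_defect t) \<le> c_psi * \<tau> * \<eta>"
proof -
  assume t: "t \<in> {a..b}" "t + \<tau> \<in> {a..b}"
  have "wnorm s (modes K) (psi_defect t) = wnorm s (modes K) (\<lambda>j. time_defect t j + of_real \<tau> * dft K (nl_defect t) j)"
  proof (rule wnorm_cong)
    fix j :: "int ^ 'd" assume j: "j \<in> modes K"
    show "cmod (psi_defect t j) = cmod (time_defect t j + of_real \<tau> * dft K (nl_defect t) j)"
      unfolding psi_defect_eq[OF t(1) j] norm_mult by simp
  qed
  also have "\<dots> \<le> wnorm s (modes K) (time_defect t) + \<tau> * N (nl_defect t)"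
    using wnorm_add[of s "modes K" "time_defect t" "\<lambda>j. of_real \<tau> * dft K (nl_defect t) j"] \<tau> by (simp add: wnorm_cmult gnorm_def)
  also have "\<dots> \<le> (cG + lG) * \<tau> * \<tau> + \<tau> * (c_nl * \<eta>)"
    using \<tau> by (intro add_mono mult_left_mono time_defect_bound nl_defect_bound t) auto
  also have "\<dots> \<le> (cG + lG) * \<tau> * \<eta> + \<tau> * (c_nl * \<eta>)"
    using \<tau> \<eta> c_nonneg by (intro add_right_mono mult_left_mono) auto
  finally show ?thesis by (simp add: c_psi_def algebra_simps)
qed

text \<open>One more power of \<open>\<tau>\<close> than in \<open>psi_defect_bound\<close>: both parts of the defect are Lipschitz in
  time.\<close>

lemma psi_defect_difference: "t \<in> {a..b} \<Longrightarrow> t + \<tau> + \<tau> \<in> {a..b} \<Longrightarrow> wnorm s (modes K) (\<lambda>j. psi_defect (t + \<tau>) j - psi_defect t j) \<le> c_psi' * \<tau> * \<tau> * \<eta>"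
proof -
  assume t: "t \<in> {a..b}" "t + \<tau> + \<tau> \<in> {a..b}"
  then have t': "t + \<tau> \<in> {a..b}" using \<tau> by auto
  have "wnorm s (modes K) (\<lambda>j. psi_defect (t + \<tau>) j - psi_defect t j) = wnorm s (modes K) (\<lambda>j. (time_defect (t + \<tau>) j - time_defect t j) + of_real \<tau> * dft K (\<lambda>x. nl_defect (t + \<tau>) x - nl_defect t x) j)"
  proof (rule wnorm_cong)
    fix j :: "int ^ 'd" assume j: "j \<in> modes K"
    have "psi_defect (t + \<tau>) j - psi_defect t j = cnj (ee \<tau> j) * ((time_defect (t + \<tau>) j - time_defect t j) + of_real \<tau> * dft K (\<lambda>x. nl_defect (t + \<tau>) x - nl_defect t x) j)"
      using t t' j by (simp add: psi_defect_eq dft_diff algebra_simps)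
    then show "cmod (psi_defect (t + \<tau>) j - psi_defect t j) = cmod ((time_defect (t + \<tau>) j - time_defect t j) + of_real \<tau> * dft K (\<lambda>x. nl_defect (t + \<tau>) x - nl_defect t x) j)"
      by (simp add: norm_mult)
  qed
  also have "\<dots> \<le> wnorm s (modes K) (\<lambda>j. time_defect (t + \<tau>) j - time_defect t j) + \<tau> * N (\<lambda>x. nl_defect (t + \<tau>) x - nl_defect t x)"
    using wnorm_add[of s "modes K" "\<lambda>j. time_defect (t + \<tau>) j - time_defect t j" "\<lambda>j. of_real \<tau> * dft K (\<lambda>x. nl_defect (t + \<tau>) x - nl_defect t x) j"] \<tau>
    by (simp add: wnorm_cmult gnorm_def)
  also have "\<dots> \<le> (lG + qG) * \<tau> * \<tau> * \<tau> + \<tau> * (c_nl' * \<tau> * \<eta>)"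
    using \<tau> by (intro add_mono mult_left_mono time_defect_difference nl_defect_difference t t') auto
  also have "\<dots> \<le> (lG + qG) * \<tau> * \<tau> * \<eta> + \<tau> * (c_nl' * \<tau> * \<eta>)"
    using \<tau> \<eta> c_nonneg by (intro add_right_mono mult_left_mono) auto
  finally show ?thesis by (simp add: c_psi'_def algebra_simps)
qed

section \<open>Defect of the wave component\<close>

definition "c_wave = lW + (ci (s + 2) * cW + (Ca (s + 2) * (ci (s + 2) * M) * (cb (s + 2) * M) + Ca (s + 2) * M * (ci (s + 2) * M)))"

text \<open>The density that the method freezes at the beginning of a step, compared with the exact one
  during the step.\<close>

lemma density_deviation:
  assumes t: "t \<in> {a..b}" "t + r \<in> {a..b}" and r: "0 \<le> r" "r \<le> \<tau>"
  shows "wnorm (s + 2) (modes K) (\<lambda>j. fc (W (t + r)) j - dft K (hW t) j) \<le> c_wave * \<eta>"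
proof -
  have "wnorm (s + 2) (modes K) (fc (\<lambda>x. W (t + r) x - W t x)) \<le> lW * r"
    by (rule H_bound_wnorm[OF H_bound_mono[OF W_lipschitz[OF t r(1)]]]) (use \<sigma> in auto)
  also have "\<dots> \<le> lW * \<eta>" using r \<eta> c_nonneg by (intro mult_left_mono) auto
  finally have 1: "wnorm (s + 2) (modes K) (fc (\<lambda>x. W (t + r) x - W t x)) \<le> lW * \<eta>" .
  have 2: "gnorm K (s + 2) (\<lambda>x. W t x - trunc (W t) x) \<le> ci (s + 2) * cW * \<eta>"
    by (rule gnorm_interpolation_error[OF _ W_bound[OF t(1)]]) auto
  have i: "gnorm K (s + 2) (\<lambda>x. \<psi> t x - h\<psi> t x) \<le> ci (s + 2) * M * \<eta>"
    unfolding h\<psi>_def by (rule gnorm_interpolation_error[OF _ psi_bound[OF t(1)]]) auto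
  have 3: "gnorm K (s + 2) (\<lambda>x. W t x - hW t x) \<le> Ca (s + 2) * (ci (s + 2) * M * \<eta>) * (cb (s + 2) * M) + Ca (s + 2) * M * (ci (s + 2) * M * \<eta>)"
    unfolding W_def hW_def
  proof (rule gnorm_mult_diff_le)
    show "gnorm K (s + 2) (\<lambda>x. cnj (\<psi> t x)) \<le> cb (s + 2) * M"
      unfolding gnorm_cnj[OF K] by (rule gnorm_of_H_bound[OF _ psi_bound[OF t(1)]]) (use \<sigma> in auto)
    show "gnorm K (s + 2) (h\<psi> t) \<le> M" by (rule h\<psi>_bound[OF t(1)]) (use \<sigma> in auto)
  qed (auto simp: i gnorm_cnj_diff)
  let ?c = "\<lambda>j. dft K (\<lambda>x. W t x - trunc (W t) x) j" and ?e = "\<lambda>j. dft K (\<lambda>x. W t x - hW t x) j"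
  have "wnorm (s + 2) (modes K) (\<lambda>j. fc (W (t + r)) j - dft K (hW t) j)
     = wnorm (s + 2) (modes K) (\<lambda>j. fc (\<lambda>x. W (t + r) x - W t x) j + (?e j - ?c j))"
    by (rule wnorm_cong) (simp add: fc_diff[OF ct(5)[OF t(2)] ct(5)[OF t(1)]] dft_diff dft_trunc)
  also have "\<dots> \<le> wnorm (s + 2) (modes K) (fc (\<lambda>x. W (t + r) x - W t x)) + (wnorm (s + 2) (modes K) ?e + wnorm (s + 2) (modes K) ?c)"
    by (rule order_trans[OF wnorm_add add_left_mono[OF wnorm_diff]])
  also have "\<dots> \<le> lW * \<eta> + ((Ca (s + 2) * (ci (s + 2) * M * \<eta>) * (cb (s + 2) * M) + Ca (s + 2) * M * (ci (s + 2) * M * \<eta>)) + ci (s + 2) * cW * \<eta>)"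
    using 1 2 3 by (intro add_mono) (auto simp: gnorm_def)
  finally show ?thesis by (simp add: c_wave_def algebra_simps)
qed

definition "u_defect t j = fc (U (t + \<tau>)) j - (of_real (cos (\<tau> * om j)) * fc (U t) j + of_real (\<tau> * sc j) * fc (U' t) j
    + of_real (cos (\<tau> * om j) - 1) * dft K (hW t) j)"
definition "u'_defect t j = fc (U' (t + \<tau>)) j - (of_real (- om j * sin (\<tau> * om j)) * fc (U t) j + of_real (cos (\<tau> * om j)) * fc (U' t) j
    + of_real (- om j * sin (\<tau> * om j)) * dft K (hW t) j)"

text \<open>The symbol of \<open>sin(r \<Omega>) / \<Omega>\<close>; its value \<open>r\<close> at frequency \<open>0\<close> makes it the primitive of
  \<open>cos(r \<Omega>)\<close> for all frequencies.\<close>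

definition "sinr r x = (if x = 0 then r else sin (r * x) / x)" for r x :: real

lemma sinr_deriv: "((\<lambda>r. sinr r x) has_real_derivative cos (r * x)) (at r within S)"
  unfolding sinr_def by (cases "x = 0") (auto intro!: derivative_eq_intros)
lemma sinr_mult: "sinr r x * x = sin (r * x)" by (simp add: sinr_def)
lemma sinr_sc: "sinr \<tau> (om j) = \<tau> * sc j" using \<tau> by (simp add: sinr_def sc_def)
text \<open>Dividing by the frequency gains one derivative; at frequency \<open>0\<close>, where the weight is \<open>1\<close>,
  the value is \<open>\<tau> \<le> 1\<close>.\<close>

lemma sinr_wt: "\<bar>sinr \<tau> (om j)\<bar> * wt j \<le> 1"
proof (cases "j = 0")
  case True
  then show ?thesis using \<tau> by (simp add: sinr_def wt_def)
next
  case False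
  then have w: "wt j = om j" "om j > 0" using wt_eq_norm[of j] wt_pos[of j] by auto
  then have "\<bar>sinr \<tau> (om j)\<bar> * wt j = \<bar>sin (\<tau> * om j)\<bar>" by (simp add: sinr_def)
  then show ?thesis by simp
qed

text \<open>If the density were frozen, the exact solution would be propagated without error. Rotated back
  by the wave group, with the frozen density added to \<open>U\<close>, the solution has a time derivative that contains
  only the deviation \<open>D\<close> of the density from its frozen value; in the energy norm this costs two
  derivatives of \<open>D\<close>.\<close>

lemma wave_defect:
  assumes t: "t \<in> {a..b}" "t + \<tau> \<in> {a..b}"
  shows "wnorm (s + 1) (modes K) (u_defect t) \<le> 2 * c_wave * \<tau> * \<eta>" "wnorm s (modes K) (u'_defect t) \<le> 2 * c_wave * \<tau> * \<eta>"
proof -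
  define y1 where "y1 = (\<lambda>r j. of_real (cos (r * om j)) * (fc (U (t + r)) j + dft K (hW t) j) - of_real (sinr r (om j)) * fc (U' (t + r)) j)"
  define y2 where "y2 = (\<lambda>r j. of_real (om j * sin (r * om j)) * (fc (U (t + r)) j + dft K (hW t) j) + of_real (cos (r * om j)) * fc (U' (t + r)) j)"
  define D where "D = (\<lambda>r j. fc (W (t + r)) j - dft K (hW t) j)"
  have I: "t + r \<in> {a..b}" if "r \<in> {0..\<tau>}" for r using t that by auto
  have sh: "((\<lambda>r. fc (U (t + r)) j) has_vector_derivative fc (U' (t + r)) j) (at r within {0..\<tau>})"
    "((\<lambda>r. fc (U' (t + r)) j) has_vector_derivative - ((om j)\<^sup>2 * (fc (U (t + r)) j + fc (W (t + r)) j))) (at r within {0..\<tau>})"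
    if "r \<in> {0..\<tau>}" for r j
    using has_vector_derivative_shift[OF dU, of r t "{0..\<tau>}" j] has_vector_derivative_shift[OF dU', of r t "{0..\<tau>}" j] I that
    unfolding W_def by (auto simp: add.commute)
  have vc: "((\<lambda>r. complex_of_real (cos (r * x))) has_vector_derivative of_real (- x * sin (r * x))) (at r within S)"
    "((\<lambda>r. complex_of_real (x * sin (r * x))) has_vector_derivative of_real (x\<^sup>2 * cos (r * x))) (at r within S)"
    "((\<lambda>r. complex_of_real (sinr r x)) has_vector_derivative of_real (cos (r * x))) (at r within S)" for x r S
  proof -
    have "((\<lambda>r. cos (r * x)) has_real_derivative - x * sin (r * x)) (at r within S)"
      "((\<lambda>r. x * sin (r * x)) has_real_derivative x\<^sup>2 * cos (r * x)) (at r within S)"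
      by (auto intro!: derivative_eq_intros simp: power2_eq_square)
    from this(1)[THEN has_vector_derivative_of_real]
      this(2)[THEN has_vector_derivative_of_real]
      sinr_deriv[THEN has_vector_derivative_of_real]
    show "((\<lambda>r. complex_of_real (cos (r * x))) has_vector_derivative of_real (- x * sin (r * x))) (at r within S)"
    "((\<lambda>r. complex_of_real (x * sin (r * x))) has_vector_derivative of_real (x\<^sup>2 * cos (r * x))) (at r within S)"
    "((\<lambda>r. complex_of_real (sinr r x)) has_vector_derivative of_real (cos (r * x))) (at r within S)" by auto
  qed
  have d1: "((\<lambda>r. y1 r j) has_vector_derivative of_real (om j * sin (r * om j)) * D r j) (at r within {0..\<tau>})" if r: "r \<in> {0..\<tau>}" for r j
  proof -
    have s: "of_real (sinr r (om j)) * ((of_real (om j))\<^sup>2 * z) = of_real (om j * sin (r * om j)) * z" for z :: complex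
    proof -
      have e: "complex_of_real (sinr r (om j)) * of_real (om j) = of_real (sin (r * om j))"
        unfolding of_real_mult[symmetric] sinr_mult ..
      have "of_real (sinr r (om j)) * ((of_real (om j))\<^sup>2 * z) = (complex_of_real (sinr r (om j)) * of_real (om j)) * (of_real (om j) * z)"
        by (simp only: power2_eq_square mult_ac)
      then show ?thesis unfolding e by (simp add: mult_ac)
    qed
    have "((\<lambda>r. y1 r j) has_vector_derivative
       (of_real (cos (r * om j)) * fc (U' (t + r)) j + of_real (- om j * sin (r * om j)) * (fc (U (t + r)) j + dft K (hW t) j))
      - (of_real (sinr r (om j)) * - ((om j)\<^sup>2 * (fc (U (t + r)) j + fc (W (t + r)) j)) + of_real (cos (r * om j)) * fc (U' (t + r)) j)) (at r within {0..\<tau>})"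
      unfolding y1_def
      by (intro has_vector_derivative_diff has_vector_derivative_mult vc sh r has_vector_derivative_add_const[THEN iffD2])
    then show ?thesis
      by (rule has_vector_derivative_eq_rhs) (simp only: mult_minus_right of_real_power s, simp add: D_def algebra_simps)
  qed
  have d2: "((\<lambda>r. y2 r j) has_vector_derivative - (of_real ((om j)\<^sup>2 * cos (r * om j)) * D r j)) (at r within {0..\<tau>})" if r: "r \<in> {0..\<tau>}" for r j
  proof -
    have "((\<lambda>r. y2 r j) has_vector_derivative
       (of_real (om j * sin (r * om j)) * fc (U' (t + r)) j + of_real ((om j)\<^sup>2 * cos (r * om j)) * (fc (U (t + r)) j + dft K (hW t) j))
      + (of_real (cos (r * om j)) * - ((om j)\<^sup>2 * (fc (U (t + r)) j + fc (W (t + r)) j)) + of_real (- om j * sin (r * om j)) * fc (U' (t + r)) j)) (at r within {0..\<tau>})"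
      unfolding y2_def
      by (intro has_vector_derivative_add has_vector_derivative_mult vc sh r has_vector_derivative_add_const[THEN iffD2])
    then show ?thesis
      by (rule has_vector_derivative_eq_rhs) (simp add: D_def algebra_simps)
  qed
  have Db: "wnorm (s + 2) (modes K) (D r) \<le> c_wave * \<eta>" if "r \<in> {0..\<tau>}" for r
    unfolding D_def using density_deviation[OF t(1) I[OF that]] that by simp
  have b1: "wnorm (s + 1) (modes K) (\<lambda>j. of_real (om j * sin (r * om j)) * D r j) \<le> c_wave * \<eta>" if "r \<in> {0..\<tau>}" for r
  proof -
    have "wnorm (s + 1) (modes K) (\<lambda>j. of_real (om j * sin (r * om j)) * D r j) \<le> 1 * wnorm (s + 1 + 1) (modes K) (D r)"
    proof (rule wnorm_multiplier)
      fix j :: "int ^ 'd"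
      have "\<bar>om j * sin (r * om j)\<bar> \<le> wt j * 1" unfolding abs_mult by (intro mult_mono) auto
      then show "cmod (of_real (om j * sin (r * om j)) * D r j) \<le> 1 * wt j powr 1 * cmod (D r j)"
        unfolding norm_mult norm_of_real by (intro mult_right_mono) auto
    qed auto
    then show ?thesis using Db[OF that] by (simp add: add.assoc)
  qed
  have b2: "wnorm s (modes K) (\<lambda>j. - (of_real ((om j)\<^sup>2 * cos (r * om j)) * D r j)) \<le> c_wave * \<eta>" if "r \<in> {0..\<tau>}" for r
  proof -
    have "wnorm s (modes K) (\<lambda>j. - (of_real ((om j)\<^sup>2 * cos (r * om j)) * D r j)) \<le> 1 * wnorm (s + 2) (modes K) (D r)"
    proof (rule wnorm_multiplier)
      fix j :: "int ^ 'd"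
      have "\<bar>(om j)\<^sup>2 * cos (r * om j)\<bar> \<le> wt j powr 2 * 1"
        unfolding abs_mult using norm_freq_sq_le[of j] by (intro mult_mono) (auto simp del: abs_power2 simp: abs_power2)
      then show "cmod (- (of_real ((om j)\<^sup>2 * cos (r * om j)) * D r j)) \<le> 1 * wt j powr 2 * cmod (D r j)"
        unfolding norm_minus_cancel norm_mult norm_of_real by (intro mult_right_mono) auto
    qed auto
    then show ?thesis using Db[OF that] by simp
  qed
  define z1 where "z1 = (\<lambda>j. y1 \<tau> j - y1 0 j)"
  define z2 where "z2 = (\<lambda>j. y2 \<tau> j - y2 0 j)"
  have Z1: "wnorm (s + 1) (modes K) z1 \<le> c_wave * \<eta> * \<tau>"
    unfolding z1_def using wnorm_mean_value[of 0 \<tau> "modes K" y1, OF _ _ d1 b1] \<tau> by simp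
  have Z2: "wnorm s (modes K) z2 \<le> c_wave * \<eta> * \<tau>"
    unfolding z2_def using wnorm_mean_value[of 0 \<tau> "modes K" y2, OF _ _ d2 b2] \<tau> by simp
  have cs: "cos (\<tau> * om j) * cos (\<tau> * om j) + sinr \<tau> (om j) * (om j * sin (\<tau> * om j)) = 1" for j :: "int ^ 'd"
    using sin_cos_squared_add3[of "\<tau> * om j"] sinr_mult[of \<tau> "om j"] by (simp flip: mult.assoc)
  have csC: "complex_of_real (cos (\<tau> * om j)) * of_real (cos (\<tau> * om j)) = 1 - of_real (sinr \<tau> (om j)) * (of_real (om j) * of_real (sin (\<tau> * om j)))" for j :: "int ^ 'd"
    using arg_cong[OF cs[of j], of complex_of_real] by (simp add: algebra_simps)
  have srC: "complex_of_real (sinr \<tau> (om j)) * of_real (om j) = of_real (sin (\<tau> * om j))" for j :: "int ^ 'd"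
    unfolding of_real_mult[symmetric] sinr_mult ..
  \<comment> \<open>Rotating forward again recovers the defects, by \<open>cos\<^sup>2 + sin\<^sup>2 = 1\<close>.\<close>
  have e1: "u_defect t j = of_real (cos (\<tau> * om j)) * z1 j + of_real (sinr \<tau> (om j)) * z2 j" for j
  proof -
    let ?c = "complex_of_real (cos (\<tau> * om j))" and ?sn = "complex_of_real (sin (\<tau> * om j))" and ?r = "complex_of_real (sinr \<tau> (om j))" and ?o = "complex_of_real (om j)"
    let ?A = "fc (U (t + \<tau>)) j + dft K (hW t) j" and ?B = "fc (U' (t + \<tau>)) j" and ?a = "fc (U t) j + dft K (hW t) j" and ?b = "fc (U' t) j"
    have "?c * z1 j + ?r * z2 j = ?c * (?c * ?A - ?r * ?B - ?a) + ?r * (?o * ?sn * ?A + ?c * ?B - ?b)"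
      by (simp add: z1_def z2_def y1_def y2_def sinr_def)
    also have "\<dots> = (?c * ?c + ?r * (?o * ?sn)) * ?A - (?c * ?a + ?r * ?b)" by (simp add: algebra_simps)
    also have "?c * ?c + ?r * (?o * ?sn) = 1" using csC[of j] by simp
    finally show ?thesis by (simp add: u_defect_def sinr_sc algebra_simps)
  qed
  have e2: "u'_defect t j = of_real (- (om j * sin (\<tau> * om j))) * z1 j + of_real (cos (\<tau> * om j)) * z2 j" for j
  proof -
    let ?c = "complex_of_real (cos (\<tau> * om j))" and ?sn = "complex_of_real (sin (\<tau> * om j))" and ?r = "complex_of_real (sinr \<tau> (om j))" and ?o = "complex_of_real (om j)"
    let ?A = "fc (U (t + \<tau>)) j + dft K (hW t) j" and ?B = "fc (U' (t + \<tau>)) j" and ?a = "fc (U t) j + dft K (hW t) j" and ?b = "fc (U' t) j"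
    have "- (?o * ?sn) * z1 j + ?c * z2 j = - (?o * ?sn) * (?c * ?A - ?r * ?B - ?a) + ?c * (?o * ?sn * ?A + ?c * ?B - ?b)"
      by (simp add: z1_def z2_def y1_def y2_def sinr_def)
    also have "\<dots> = (?c * ?c + ?r * (?o * ?sn)) * ?B - (- (?o * ?sn) * ?a + ?c * ?b)" by (simp add: algebra_simps)
    also have "?c * ?c + ?r * (?o * ?sn) = 1" using csC[of j] by simp
    finally show ?thesis by (simp add: u'_defect_def algebra_simps)
  qed
  have "wnorm (s + 1) (modes K) (u_defect t) \<le> wnorm (s + 1) (modes K) (\<lambda>j. of_real (cos (\<tau> * om j)) * z1 j) + wnorm (s + 1) (modes K) (\<lambda>j. of_real (sinr \<tau> (om j)) * z2 j)"
    unfolding e1[abs_def] by (rule wnorm_add)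
  also have "\<dots> \<le> 1 * wnorm (s + 1) (modes K) z1 + 1 * wnorm (s + 1 + -1) (modes K) z2"
  proof (intro add_mono wnorm_multiplier0 wnorm_multiplier)
    fix j :: "int ^ 'd"
    show "cmod (of_real (cos (\<tau> * om j)) * z1 j) \<le> 1 * cmod (z1 j)"
      unfolding norm_mult norm_of_real by (intro mult_right_mono) auto
    have "\<bar>sinr \<tau> (om j)\<bar> \<le> wt j powr -1" using sinr_wt[of j] by (simp add: powr_minus pos_le_divide_eq inverse_eq_divide)
    then show "cmod (of_real (sinr \<tau> (om j)) * z2 j) \<le> 1 * wt j powr -1 * cmod (z2 j)"
      unfolding norm_mult norm_of_real by (intro mult_right_mono) auto
  qed auto
  finally show "wnorm (s + 1) (modes K) (u_defect t) \<le> 2 * c_wave * \<tau> * \<eta>" using Z1 Z2 by (simp add: algebra_simps)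
  have "wnorm s (modes K) (u'_defect t) \<le> wnorm s (modes K) (\<lambda>j. of_real (- (om j * sin (\<tau> * om j))) * z1 j) + wnorm s (modes K) (\<lambda>j. of_real (cos (\<tau> * om j)) * z2 j)"
    unfolding e2[abs_def] by (rule wnorm_add)
  also have "\<dots> \<le> 1 * wnorm (s + 1) (modes K) z1 + 1 * wnorm s (modes K) z2"
  proof (intro add_mono wnorm_multiplier0 wnorm_multiplier)
    fix j :: "int ^ 'd"
    show "cmod (of_real (cos (\<tau> * om j)) * z2 j) \<le> 1 * cmod (z2 j)"
      unfolding norm_mult norm_of_real by (intro mult_right_mono) auto
    have "\<bar>- (om j * sin (\<tau> * om j))\<bar> \<le> wt j * 1" unfolding abs_minus_cancel abs_mult by (intro mult_mono) auto
    then show "cmod (of_real (- (om j * sin (\<tau> * om j))) * z1 j) \<le> 1 * wt j powr 1 * cmod (z1 j)"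
      unfolding norm_mult norm_of_real by (intro mult_right_mono) auto
  qed auto
  finally show "wnorm s (modes K) (u'_defect t) \<le> 2 * c_wave * \<tau> * \<eta>" using Z1 Z2 by (simp add: algebra_simps)
qed

end

text \<open>Numerical solutions, characterized by the recursions of their coefficients on the grid. The
  assumption \<open>cfl\<close> excludes resonances: the group of one time step differs from the identity on each
  mode by at least a multiple of \<open>\<tau> |j|\<^sup>2\<close>.\<close>

locale splitting_run = discretized_solution dd s \<sigma> M a b \<psi> U U' K \<tau>
  for dd :: "'d::finite itself" and s \<sigma> M a b :: real and \<psi> U U' :: "real \<Rightarrow> real ^ 'd \<Rightarrow> complex"
    and K :: nat and \<tau> :: real +
  fixes p u u' :: "nat \<Rightarrow> real ^ 'd \<Rightarrow> complex" and c1 :: real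
  assumes c1: "c1 > 0" and cfl: "\<And>j :: int ^ 'd. j \<in> modes K \<Longrightarrow> c1 * (\<tau> * (norm (freq j))\<^sup>2) \<le> cmod (exp (\<i> * of_real (\<tau> * (norm (freq j))\<^sup>2)) - 1)"
    and p0: "\<And>j. j \<in> modes K \<Longrightarrow> dft K (p 0) j = dft K (\<psi> a) j"
    and u0: "\<And>j. j \<in> modes K \<Longrightarrow> dft K (u 0) j = dft K (U a) j"
    and u'0: "\<And>j. j \<in> modes K \<Longrightarrow> dft K (u' 0) j = dft K (U' a) j"
    and pS: "\<And>n j. j \<in> modes K \<Longrightarrow> dft K (p (Suc n)) j = exp (- \<i> * of_real (\<tau> * (norm (freq j))\<^sup>2)) *
        dft K (\<lambda>x. exp (- \<i> * of_real \<tau> * discretization.avg_pot K \<tau> (u n) (u' n) (\<lambda>x. p n x * cnj (p n x)) x) * p n x) j"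
    and uS: "\<And>n j. j \<in> modes K \<Longrightarrow> dft K (u (Suc n)) j = of_real (cos (\<tau> * norm (freq j))) * dft K (u n) j
        + of_real (\<tau> * sinc (\<tau> * norm (freq j))) * dft K (u' n) j
        + of_real (cos (\<tau> * norm (freq j)) - 1) * dft K (\<lambda>x. p n x * cnj (p n x)) j"
    and u'S: "\<And>n j. j \<in> modes K \<Longrightarrow> dft K (u' (Suc n)) j = of_real (- norm (freq j) * sin (\<tau> * norm (freq j))) * dft K (u n) j
        + of_real (cos (\<tau> * norm (freq j))) * dft K (u' n) j
        + of_real (- norm (freq j) * sin (\<tau> * norm (freq j))) * dft K (\<lambda>x. p n x * cnj (p n x)) j"
begin

text \<open>The letters are those of the analysis: \<open>e\<close>, \<open>f\<close>, \<open>f'\<close> and \<open>\<omega>\<close> are the errors of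
  \<open>\<psi>\<close>, \<open>u\<close>, \<open>u'\<close> and of the density, \<open>g\<close> is the error of the nonlinearity and \<open>V\<close> the
  numerical potential. \<open>D\<close> measures the discrete time derivative of \<open>e\<close>, in units that do not depend on
  \<open>\<tau>\<close>. The estimates close for \<open>eps\<close>, whereas they do not for \<open>\<delta>\<close>, which lacks this
  derivative.\<close>

definition "tt n = a + real n * \<tau>"
definition "w n = (\<lambda>x. p n x * cnj (p n x))"
definition "V n = avg_pot (u n) (u' n) (w n)"
definition "e n = (\<lambda>x. h\<psi> (tt n) x - p n x)"
definition "f n = (\<lambda>x. hU (tt n) x - u n x)"
definition "f' n = (\<lambda>x. hU' (tt n) x - u' n x)"
definition "\<omega> n = (\<lambda>x. hW (tt n) x - w n x)"
definition "g n = (\<lambda>x. phaseq (hv (tt n)) x * h\<psi> (tt n) x - phaseq (V n) x * p n x)"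
definition "de n = (\<lambda>x. e (Suc n) x - e n x)"
definition "En n = sqrt ((gnorm K (s + 1) (f n))\<^sup>2 + (N (f' n))\<^sup>2)"
definition "\<delta> n = N (e n) + En n"
definition "D n = N (de n) / \<tau>"
definition "eps n = D n + \<delta> n"

lemma tt_Suc: "tt (Suc n) = tt n + \<tau>" by (simp add: tt_def algebra_simps)

lemma error_nonneg: "0 \<le> En n" "0 \<le> \<delta> n" "0 \<le> D n" "0 \<le> eps n" "\<delta> n \<le> eps n" "D n \<le> eps n" "N (e n) \<le> \<delta> n" "En n \<le> \<delta> n"
  using \<tau> by (auto simp: En_def \<delta>_def D_def eps_def)

lemma wave_error_le: "gnorm K (s + 1) (f n) \<le> En n" "N (f' n) \<le> En n" "N (f n) \<le> En n"
proof -
  show 1: "gnorm K (s + 1) (f n) \<le> En n" unfolding En_def by (rule real_sqrt_sum_squares_ge1)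
  show "N (f' n) \<le> En n" unfolding En_def by (rule real_sqrt_sum_squares_ge2)
  show "N (f n) \<le> En n" using gnorm_le_exp[of s "s + 1" K "f n"] 1 by simp
qed

lemma N_de: "N (de n) = \<tau> * D n" using \<tau> by (simp add: D_def)

lemma N_e_Suc: "N (e (Suc n)) \<le> eps n"
proof -
  have "e (Suc n) = (\<lambda>x. de n x + e n x)" by (simp add: de_def)
  then have "N (e (Suc n)) \<le> N (de n) + N (e n)" using gnorm_add[of K s "de n" "e n"] by simp
  also have "\<dots> \<le> 1 * D n + N (e n)" unfolding N_de using \<tau> error_nonneg by (intro add_right_mono mult_right_mono) auto
  finally show ?thesis using error_nonneg[of n] by (simp add: eps_def \<delta>_def)
qed

lemma p_rec: "j \<in> modes K \<Longrightarrow> dft K (p (Suc n)) j = cnj (ee \<tau> j) * (dft K (p n) j + of_real \<tau> * dft K (\<lambda>x. phaseq (V n) x * p n x) j)"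
proof -
  assume j: "j \<in> modes K"
  have "phase (V n) x * p n x = p n x + of_real \<tau> * (phaseq (V n) x * p n x)" for x
    using \<tau> by (simp add: phaseq_def field_simps)
  then have "dft K (\<lambda>x. phase (V n) x * p n x) j = dft K (p n) j + of_real \<tau> * dft K (\<lambda>x. phaseq (V n) x * p n x) j"
    by (simp add: dft_add dft_cmult)
  moreover have "exp (- \<i> * of_real (\<tau> * (om j)\<^sup>2)) = cnj (ee \<tau> j)"
    by (simp add: ee_def exp_cnj)
  ultimately show ?thesis using pS[OF j, of n] by (simp add: V_def w_def phase_def)
qed

lemma e_rec: "j \<in> modes K \<Longrightarrow> dft K (e (Suc n)) j = cnj (ee \<tau> j) * (dft K (e n) j + of_real \<tau> * dft K (g n) j) + psi_defect (tt n) j"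
proof -
  assume j: "j \<in> modes K"
  have h: "dft K (h\<psi> t) j = fc (\<psi> t) j" for t unfolding h\<psi>_def by (rule dft_trunc[OF j])
  show ?thesis
    unfolding e_def g_def dft_diff p_rec[OF j] h psi_defect_def tt_Suc by (simp add: algebra_simps)
qed

lemma f_rec: "j \<in> modes K \<Longrightarrow> dft K (f (Suc n)) j = of_real (cos (\<tau> * om j)) * dft K (f n) j + of_real (\<tau> * sc j) * dft K (f' n) j
    + of_real (cos (\<tau> * om j) - 1) * dft K (\<omega> n) j + u_defect (tt n) j"
  unfolding f_def f'_def \<omega>_def dft_diff hU_def hU'_def
  by (simp only: dft_trunc uS w_def[symmetric] sc_def[symmetric] u_defect_def tt_Suc) (simp add: algebra_simps)

lemma f'_rec: "j \<in> modes K \<Longrightarrow> dft K (f' (Suc n)) j = of_real (- om j * sin (\<tau> * om j)) * dft K (f n) j + of_real (cos (\<tau> * om j)) * dft K (f' n) j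
    + of_real (- om j * sin (\<tau> * om j)) * dft K (\<omega> n) j + u'_defect (tt n) j"
  unfolding f_def f'_def \<omega>_def dft_diff hU_def hU'_def
  by (simp only: dft_trunc u'S w_def[symmetric] u'_defect_def tt_Suc) (simp add: algebra_simps)

text \<open>Constants of one step in the order of their use. \<open>R1\<close> bounds the numerical potential at step
  \<open>n\<close>, where \<open>eps n \<le> 1\<close> is known. The potential at step \<open>n + 1\<close> is bounded by \<open>R2\<close>, which is
  obtained from the increment of its error, with the constant \<open>c\<nu>\<close> that involves step \<open>n\<close> only; in this
  way no smallness of \<open>eps (Suc n)\<close> is presupposed.\<close>

definition "c\<omega> = Ca s * M + Ca s * (M + 1)"
definition "cV = 2 + 2 * c\<omega>"
definition "R1 = Rv + cV"
definition "cg = Ca s * (qL R1 * cV) * M + Ca s * (\<kappa> R1 * R1)"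
definition "c_strong = 1 + (1 + cg + c_psi) / c1"
definition "c_strong_Suc = 1 + (3 + cg + c_psi) / c1"
definition "c\<omega>2 = Ca (s + 2) * M + Ca (s + 2) * (M + 3 * c_strong)"
definition "cW2 = c\<omega>2 * c_strong"
definition "cE = 1 + 2 * cW2 + 4 * c_wave"
definition "cdw = Ca s * M + Ca s * (l\<psi> + 1) + Ca s * l\<psi> + Ca s * (M + 1)"
definition "c\<nu> = 3 + cW2 + 2 * c_wave + cE + 2 * cdw"
definition "R2 = R1 + 3 * c\<nu>"
definition "c\<Delta> = Ca s * (Ca s * (qL R2 * cV) * (\<kappa> R2 * lv) + (Ca s * (\<kappa> R2 * R2) + 1) * (qL (2 * R2) * c\<nu>)) * M
   + Ca s * (qL R2 * (lv + 3 * c\<nu>)) + Ca s * (qL R2 * cV) * l\<psi> + Ca s * (\<kappa> R2 * R2)"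
definition "c_step = c\<Delta> + c_psi' + 1 + cE"

lemma consts_nonneg: "0 \<le> c\<omega>" "0 \<le> cV" "0 \<le> R1" "0 \<le> cg" "0 \<le> c_psi" "0 \<le> c_psi'" "0 \<le> c_wave" "1 \<le> c_strong" "0 \<le> c_strong_Suc" "0 \<le> c\<omega>2" "0 \<le> cW2" "0 \<le> cE" "0 \<le> cdw" "0 \<le> c\<nu>" "0 \<le> R2" "0 \<le> c\<Delta>" "0 \<le> c_step"
proof -
  have ca2nn: "0 \<le> c_pot" "0 \<le> c_pot'" using cv_nn ci_nn(1)[of s] M0 by (auto simp: c_pot_def c_pot'_def)
  note [simp] = Ca_s M0 c_nonneg Ca_nn ci_nn c_exp_nn lv_nn Rv_nn \<kappa>_nn qL_nn ca2nn
  show 1 [simp]: "0 \<le> c\<omega>" by (simp add: c\<omega>_def)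
  show 2 [simp]: "0 \<le> cV" by (simp add: cV_def)
  show 3 [simp]: "0 \<le> R1" by (simp add: R1_def)
  show 4 [simp]: "0 \<le> cg" by (simp add: cg_def)
  show 5 [simp]: "0 \<le> c_psi" by (simp add: c_psi_def c_nl_def)
  show 6 [simp]: "0 \<le> c_psi'" by (simp add: c_psi'_def c_nl'_def)
  show 7 [simp]: "0 \<le> c_wave" by (simp add: c_wave_def)
  show 8 [simp]: "1 \<le> c_strong" using c1 by (simp add: c_strong_def)
  then have 8 [simp]: "0 \<le> c_strong" by linarith
  show 9 [simp]: "0 \<le> c_strong_Suc" using c1 by (simp add: c_strong_Suc_def)
  show 10 [simp]: "0 \<le> c\<omega>2" by (simp add: c\<omega>2_def)
  show 11 [simp]: "0 \<le> cW2" by (simp add: cW2_def)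
  show 12 [simp]: "0 \<le> cE" by (simp add: cE_def)
  show 13 [simp]: "0 \<le> cdw" by (simp add: cdw_def)
  show 14 [simp]: "0 \<le> c\<nu>" by (simp add: c\<nu>_def)
  show 15 [simp]: "0 \<le> R2" by (simp add: R2_def)
  show 16 [simp]: "0 \<le> c\<Delta>" by (simp add: c\<Delta>_def)
  show "0 \<le> c_step" by (simp add: c_step_def)
qed

lemma \<eta>_le2: "\<eta> \<le> 2"
proof -
  have "space_err \<le> 1" unfolding space_err_def using K \<sigma> by (simp add: powr_minus inverse_le_1_iff ge_one_powr_ge_zero)
  then show ?thesis using \<tau> by (simp add: \<eta>_def)
qed

section \<open>Error propagation over one step\<close>

context
  fixes n :: nat
  assumes tn: "tt n \<in> {a..b}"
begin

lemma density_error: "gnorm K r (\<omega> n) \<le> Ca r * gnorm K r (e n) * M + Ca r * (M + gnorm K r (e n)) * gnorm K r (e n)" if r: "s \<le> r" "r \<le> s + 2"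
  unfolding \<omega>_def hW_def w_def
proof (rule gnorm_mult_diff_le[OF r(1)])
  show "gnorm K r (\<lambda>x. h\<psi> (tt n) x - p n x) \<le> gnorm K r (e n)" by (simp add: e_def)
  show "gnorm K r (\<lambda>x. cnj (h\<psi> (tt n) x)) \<le> M" unfolding gnorm_cnj[OF K] by (rule h\<psi>_bound[OF tn]) (use r \<sigma> in auto)
  have "p n = (\<lambda>x. h\<psi> (tt n) x - e n x)" by (simp add: e_def)
  then show "gnorm K r (p n) \<le> M + gnorm K r (e n)"
    using gnorm_diff_le[OF h\<psi>_bound[OF tn] order_refl, of r "e n"] r \<sigma> by simp
  show "gnorm K r (\<lambda>x. cnj (h\<psi> (tt n) x) - cnj (p n x)) \<le> gnorm K r (e n)"
    unfolding gnorm_cnj_diff by (simp add: e_def)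
qed

lemma N_p: "\<delta> n \<le> 1 \<Longrightarrow> N (p n) \<le> M + 1"
proof -
  assume d: "\<delta> n \<le> 1"
  have "p n = (\<lambda>x. h\<psi> (tt n) x - e n x)" by (simp add: e_def)
  then have "N (p n) \<le> M + N (e n)"
    using gnorm_diff_le[OF h\<psi>_bound[OF tn] order_refl, of s "e n"] \<sigma> by simp
  then show ?thesis using d error_nonneg[of n] by linarith
qed

lemma density_error_weak: assumes d: "\<delta> n \<le> 1" shows "N (\<omega> n) \<le> c\<omega> * \<delta> n"
proof -
  have "N (\<omega> n) \<le> Ca s * N (e n) * M + Ca s * (M + N (e n)) * N (e n)" by (rule density_error) auto
  also have "\<dots> \<le> Ca s * \<delta> n * M + Ca s * (M + 1) * \<delta> n"
    using error_nonneg[of n] d Ca_s M0 by (intro add_mono mult_mono mult_left_mono mult_right_mono add_left_mono mult_nonneg_nonneg) auto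
  finally show ?thesis by (simp add: c\<omega>_def algebra_simps)
qed

lemma potential_error: assumes d: "\<delta> n \<le> 1" shows "N (\<lambda>x. hv (tt n) x - V n x) \<le> cV * \<delta> n"
proof -
  have "N (\<lambda>x. hv (tt n) x - V n x) \<le> N (f n) + \<tau> / 2 * N (f' n) + 2 * N (\<omega> n)"
    unfolding hv_def V_def avg_pot_diff f_def[symmetric] f'_def[symmetric] \<omega>_def[symmetric] by (rule avg_pot_bound)
  also have "\<dots> \<le> \<delta> n + 1 * \<delta> n + 2 * (c\<omega> * \<delta> n)"
    using error_nonneg[of n] wave_error_le[of n] density_error_weak[OF d] \<tau> by (intro add_mono mult_mono) (auto intro: order_trans)
  finally show ?thesis by (simp add: cV_def algebra_simps)
qed

lemma potential_bound: assumes d: "\<delta> n \<le> 1" shows "N (V n) \<le> R1"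
proof -
  have "V n = (\<lambda>x. hv (tt n) x - (hv (tt n) x - V n x))" by simp
  then have "N (V n) \<le> Rv + cV * \<delta> n"
    using gnorm_diff_le[OF hv_bound[OF tn] potential_error[OF d]] by simp
  also have "\<dots> \<le> Rv + cV * 1" using d consts_nonneg by (intro add_left_mono mult_left_mono) auto
  finally show ?thesis by (simp add: R1_def)
qed

lemma N_hv: "N (hv (tt n)) \<le> R1" using hv_bound[OF tn] consts_nonneg by (simp add: R1_def)

lemma nonlinearity_error: assumes d: "\<delta> n \<le> 1" shows "N (g n) \<le> cg * \<delta> n"
proof -
  have "N (g n) \<le> Ca s * (qL R1 * (cV * \<delta> n)) * M + Ca s * (\<kappa> R1 * R1) * \<delta> n"
    unfolding g_def
  proof (rule gnorm_mult_diff_le)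
    have "N (\<lambda>x. phaseq (hv (tt n)) x - phaseq (V n) x) \<le> qL R1 * N (\<lambda>x. hv (tt n) x - V n x)"
      by (rule phaseq_lipschitz[OF _ N_hv potential_bound[OF d]]) (rule consts_nonneg)
    also have "\<dots> \<le> qL R1 * (cV * \<delta> n)" by (intro mult_left_mono potential_error d qL_nn consts_nonneg)
    finally show "N (\<lambda>x. phaseq (hv (tt n)) x - phaseq (V n) x) \<le> qL R1 * (cV * \<delta> n)" .
    show "N (phaseq (V n)) \<le> \<kappa> R1 * R1" by (rule phaseq_bound_le[OF _ potential_bound[OF d]]) (rule consts_nonneg)
    show "N (h\<psi> (tt n)) \<le> M" by (rule h\<psi>_bound[OF tn]) (use \<sigma> in auto)
    show "N (\<lambda>x. h\<psi> (tt n) x - p n x) \<le> \<delta> n" using error_nonneg[of n] by (simp add: e_def)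
  qed auto
  then show ?thesis by (simp add: cg_def algebra_simps)
qed

text \<open>The lower bound for the symbol of the group increment converts two derivatives into one
  difference in time.\<close>

lemma gnorm_cfl: "gnorm K (s + 2) y \<le> N y + wnorm s (modes K) (\<lambda>j. (cnj (ee \<tau> j) - 1) * dft K y j) / (c1 * \<tau>)"
proof -
  let ?m = "\<lambda>j. (cnj (ee \<tau> j) - 1) * dft K y j"
  have c: "0 < c1 * \<tau>" using c1 \<tau> by simp
  have "gnorm K (s + 2) y \<le> L2_set (\<lambda>j. wt j powr s * cmod (dft K y j) + wt j powr s * cmod (?m j) / (c1 * \<tau>)) (modes K)"
    unfolding gnorm_def wnorm_def
  proof (rule L2_set_mono)
    fix j :: "int ^ 'd" assume j: "j \<in> modes K"
    have "cmod (cnj (ee \<tau> j) - 1) = cmod (ee \<tau> j - 1)"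
      using complex_mod_cnj[of "ee \<tau> j - 1"] by simp
    then have "c1 * \<tau> * (om j)\<^sup>2 \<le> cmod (cnj (ee \<tau> j) - 1)" using cfl[OF j] by (simp add: ee_def mult.assoc)
    then have "(om j)\<^sup>2 \<le> cmod (cnj (ee \<tau> j) - 1) / (c1 * \<tau>)" using c by (simp add: pos_le_divide_eq mult_ac)
    moreover have "wt j powr 2 \<le> 1 + (om j)\<^sup>2" by (auto simp: wt_def max_def powr_numeral)
    ultimately have "wt j powr 2 \<le> 1 + cmod (cnj (ee \<tau> j) - 1) / (c1 * \<tau>)" by linarith
    then have "wt j powr s * cmod (dft K y j) * wt j powr 2 \<le> wt j powr s * cmod (dft K y j) * (1 + cmod (cnj (ee \<tau> j) - 1) / (c1 * \<tau>))"
      by (intro mult_left_mono) auto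
    then show "wt j powr (s + 2) * cmod (dft K y j) \<le> wt j powr s * cmod (dft K y j) + wt j powr s * cmod (?m j) / (c1 * \<tau>)"
      by (simp add: powr_add norm_mult distrib_left mult_ac)
  qed auto
  also have "\<dots> \<le> N y + L2_set (\<lambda>j. wt j powr s * cmod (?m j) / (c1 * \<tau>)) (modes K)"
    unfolding gnorm_def wnorm_def by (rule L2_set_triangle_ineq)
  also have "L2_set (\<lambda>j. wt j powr s * cmod (?m j) / (c1 * \<tau>)) (modes K) = wnorm s (modes K) ?m / (c1 * \<tau>)"
    unfolding wnorm_def divide_inverse using c1 \<tau> by (subst L2_set_left_distrib) auto
  finally show ?thesis .
qed

context
  assumes tn': "tt n + \<tau> \<in> {a..b}"
begin

lemma tt_Suc_in: "tt (Suc n) \<in> {a..b}" using tn' by (simp add: tt_Suc)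

text \<open>The recursion of \<open>e\<close>, solved for \<open>(exp(i \<tau> \<Delta>) - 1) e\<^sub>n\<close>.\<close>

lemma group_increment_of_error: assumes d: "\<delta> n \<le> 1" shows "wnorm s (modes K) (\<lambda>j. (cnj (ee \<tau> j) - 1) * dft K (e n) j) \<le> \<tau> * (D n + cg * \<delta> n + c_psi * \<eta>)"
proof -
  have "wnorm s (modes K) (\<lambda>j. (cnj (ee \<tau> j) - 1) * dft K (e n) j)
     = wnorm s (modes K) (\<lambda>j. (dft K (de n) j - cnj (ee \<tau> j) * of_real \<tau> * dft K (g n) j) - psi_defect (tt n) j)"
    by (rule wnorm_cong) (simp add: de_def dft_diff e_rec algebra_simps)
  also have "\<dots> \<le> (wnorm s (modes K) (dft K (de n)) + wnorm s (modes K) (\<lambda>j. cnj (ee \<tau> j) * of_real \<tau> * dft K (g n) j)) + wnorm s (modes K) (psi_defect (tt n))"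
    by (rule order_trans[OF wnorm_diff add_right_mono[OF wnorm_diff]])
  also have "wnorm s (modes K) (\<lambda>j. cnj (ee \<tau> j) * of_real \<tau> * dft K (g n) j) = \<tau> * N (g n)"
    unfolding gnorm_def using \<tau> wnorm_cmult[of s "modes K" "of_real \<tau>" "dft K (g n)"]
    by (simp add: norm_mult wnorm_def)
  also have "wnorm s (modes K) (dft K (de n)) = \<tau> * D n" using N_de by (simp add: gnorm_def)
  also have "\<tau> * D n + \<tau> * N (g n) + wnorm s (modes K) (psi_defect (tt n)) \<le> \<tau> * D n + \<tau> * (cg * \<delta> n) + c_psi * \<tau> * \<eta>"
    using \<tau> by (intro add_mono mult_left_mono nonlinearity_error d psi_defect_bound tn tn') auto
  finally show ?thesis by (simp add: algebra_simps)
qed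

lemma div_c1tau: "wnorm s A y \<le> \<tau> * B \<Longrightarrow> wnorm s A y / (c1 * \<tau>) \<le> B / c1"
  using \<tau> c1 by (simp add: field_simps)

lemma psi_error_strong: assumes ep: "eps n \<le> 1" shows "gnorm K (s + 2) (e n) \<le> c_strong * (eps n + \<eta>)"
proof -
  have d: "\<delta> n \<le> 1" using ep error_nonneg[of n] by linarith
  have "gnorm K (s + 2) (e n) \<le> N (e n) + (D n + cg * \<delta> n + c_psi * \<eta>) / c1"
    using gnorm_cfl[of "e n"] div_c1tau[OF group_increment_of_error[OF d]] by linarith
  also have "\<dots> \<le> (eps n + \<eta>) + (1 * (eps n + \<eta>) + cg * (eps n + \<eta>) + c_psi * (eps n + \<eta>)) / c1"
    using error_nonneg[of n] \<eta> consts_nonneg c1 by (intro add_mono divide_right_mono mult_left_mono) auto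
  also have "\<dots> = c_strong * (eps n + \<eta>)" using c1 by (simp add: c_strong_def field_simps)
  finally show ?thesis .
qed

text \<open>The bound on \<open>e (Suc n)\<close> by \<open>eps n\<close> instead of \<open>eps (Suc n)\<close> serves the last time step:
  \<open>eps (Suc n)\<close> refers to a further step, which may lie beyond the time interval of the exact solution.\<close>

lemma psi_error_strong_Suc: assumes ep: "eps n \<le> 1" shows "gnorm K (s + 2) (e (Suc n)) \<le> c_strong_Suc * (eps n + \<eta>)"
proof -
  have d: "\<delta> n \<le> 1" using ep error_nonneg[of n] by linarith
  \<comment> \<open>\<open>e (Suc n)\<close> is split into \<open>e n\<close> and an increment, for which no smoothing is needed since it
    carries a factor \<open>\<tau>\<close>.\<close>
  have "wnorm s (modes K) (\<lambda>j. (cnj (ee \<tau> j) - 1) * dft K (e (Suc n)) j)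
    = wnorm s (modes K) (\<lambda>j. (cnj (ee \<tau> j) * dft K (de n) j + (cnj (ee \<tau> j) - 1) * dft K (e n) j) - dft K (de n) j)"
    by (rule wnorm_cong) (simp add: de_def dft_diff algebra_simps)
  also have "\<dots> \<le> (wnorm s (modes K) (\<lambda>j. cnj (ee \<tau> j) * dft K (de n) j) + wnorm s (modes K) (\<lambda>j. (cnj (ee \<tau> j) - 1) * dft K (e n) j)) + wnorm s (modes K) (dft K (de n))"
    by (rule order_trans[OF wnorm_diff add_right_mono[OF wnorm_add]])
  also have "wnorm s (modes K) (\<lambda>j. cnj (ee \<tau> j) * dft K (de n) j) = wnorm s (modes K) (dft K (de n))"
    by (rule wnorm_cong) (simp add: norm_mult)
  also have "wnorm s (modes K) (dft K (de n)) = \<tau> * D n" using N_de by (simp add: gnorm_def)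
  also have "\<tau> * D n + wnorm s (modes K) (\<lambda>j. (cnj (ee \<tau> j) - 1) * dft K (e n) j) + \<tau> * D n \<le> \<tau> * (3 * D n + cg * \<delta> n + c_psi * \<eta>)"
    using group_increment_of_error[OF d] by (simp add: algebra_simps)
  finally have "gnorm K (s + 2) (e (Suc n)) \<le> N (e (Suc n)) + (3 * D n + cg * \<delta> n + c_psi * \<eta>) / c1"
    using gnorm_cfl[of "e (Suc n)"] div_c1tau by fastforce
  also have "\<dots> \<le> (eps n + \<eta>) + (3 * (eps n + \<eta>) + cg * (eps n + \<eta>) + c_psi * (eps n + \<eta>)) / c1"
    using error_nonneg[of n] \<eta> consts_nonneg c1 N_e_Suc[of n] by (intro add_mono divide_right_mono mult_left_mono) auto
  also have "\<dots> = c_strong_Suc * (eps n + \<eta>)" using c1 by (simp add: c_strong_Suc_def field_simps)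
  finally show ?thesis .
qed

text \<open>The quadratic term is absorbed by the a priori bound \<open>3 * c_strong\<close> for the error, since
  \<open>eps n + \<eta> \<le> 3\<close>.\<close>

lemma density_error_strong: assumes ep: "eps n \<le> 1" shows "gnorm K (s + 2) (\<omega> n) \<le> cW2 * (eps n + \<eta>)"
proof -
  have al: "eps n + \<eta> \<le> 3" using ep \<eta>_le2 by linarith
  have "gnorm K (s + 2) (e n) \<le> c_strong * 3" using psi_error_strong[OF ep] mult_left_mono[OF al, of c_strong] consts_nonneg by linarith
  then have e3: "gnorm K (s + 2) (e n) \<le> 3 * c_strong" by simp
  have "gnorm K (s + 2) (\<omega> n) \<le> Ca (s + 2) * gnorm K (s + 2) (e n) * M + Ca (s + 2) * (M + gnorm K (s + 2) (e n)) * gnorm K (s + 2) (e n)"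
    by (rule density_error) auto
  also have "\<dots> \<le> Ca (s + 2) * gnorm K (s + 2) (e n) * M + Ca (s + 2) * (M + 3 * c_strong) * gnorm K (s + 2) (e n)"
    using Ca_nn[of "s + 2"] e3 by (intro add_left_mono mult_right_mono mult_left_mono) auto
  also have "\<dots> = c\<omega>2 * gnorm K (s + 2) (e n)" by (simp add: c\<omega>2_def algebra_simps)
  also have "\<dots> \<le> c\<omega>2 * (c_strong * (eps n + \<eta>))" by (intro mult_left_mono psi_error_strong ep consts_nonneg)
  finally show ?thesis by (simp add: cW2_def mult.assoc)
qed

lemma rot_isometry:
  fixes x y :: complex and c s' :: real
  assumes "c\<^sup>2 + s'\<^sup>2 = 1"
  shows "(cmod (of_real c * x + of_real s' * y))\<^sup>2 + (cmod (- of_real s' * x + of_real c * y))\<^sup>2 = (cmod x)\<^sup>2 + (cmod y)\<^sup>2"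
proof -
  have "(cmod (of_real c * x + of_real s' * y))\<^sup>2 + (cmod (- of_real s' * x + of_real c * y))\<^sup>2 = (c\<^sup>2 + s'\<^sup>2) * ((cmod x)\<^sup>2 + (cmod y)\<^sup>2)"
    unfolding cmod_power2 by (simp add: power2_eq_square algebra_simps)
  then show ?thesis using assms by simp
qed

text \<open>In the variables \<open>(\<Omega> u, u')\<close> the wave group is a rotation. At frequency \<open>0\<close>, where the weight
  is \<open>1\<close> and not \<open>|j|\<close>, it is the shear by \<open>\<tau>\<close>; this is the reason for the factor \<open>1 + \<tau>\<close>.\<close>

lemma wave_group:
  fixes x y :: "int ^ 'd \<Rightarrow> complex"
  shows "(wnorm (s + 1) (modes K) (\<lambda>j. of_real (cos (\<tau> * om j)) * x j + of_real (\<tau> * sc j) * y j))\<^sup>2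
    + (wnorm s (modes K) (\<lambda>j. of_real (- om j * sin (\<tau> * om j)) * x j + of_real (cos (\<tau> * om j)) * y j))\<^sup>2
    \<le> (1 + \<tau>)\<^sup>2 * ((wnorm (s + 1) (modes K) x)\<^sup>2 + (wnorm s (modes K) y)\<^sup>2)"
proof -
  have sq: "(wnorm r (modes K) z)\<^sup>2 = (\<Sum>j\<in>modes K. (wt j powr r)\<^sup>2 * (cmod (z j))\<^sup>2)" for r and z :: "int ^ 'd \<Rightarrow> complex"
    by (simp add: wnorm_def L2_set_def sum_nonneg power_mult_distrib)
  have pt: "(wt j powr (s + 1))\<^sup>2 * (cmod (of_real (cos (\<tau> * om j)) * x j + of_real (\<tau> * sc j) * y j))\<^sup>2
     + (wt j powr s)\<^sup>2 * (cmod (of_real (- om j * sin (\<tau> * om j)) * x j + of_real (cos (\<tau> * om j)) * y j))\<^sup>2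
     \<le> (1 + \<tau>)\<^sup>2 * ((wt j powr (s + 1))\<^sup>2 * (cmod (x j))\<^sup>2 + (wt j powr s)\<^sup>2 * (cmod (y j))\<^sup>2)" for j
  proof (cases "j = 0")
    case True
    have "wt j = 1" using True by (simp add: wt_def)
    moreover have "cmod (x j + of_real \<tau> * y j) \<le> cmod (x j) + \<tau> * cmod (y j)"
      using norm_triangle_ineq[of "x j" "of_real \<tau> * y j"] \<tau> by (simp add: norm_mult)
    then have "(cmod (x j + of_real \<tau> * y j))\<^sup>2 \<le> (cmod (x j) + \<tau> * cmod (y j))\<^sup>2" by (intro power_mono) auto
    moreover have "(A + \<tau> * B)\<^sup>2 + B\<^sup>2 \<le> (1 + \<tau>)\<^sup>2 * (A\<^sup>2 + B\<^sup>2)" for A B :: real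
    proof -
      have "0 \<le> \<tau> * (A - B)\<^sup>2 + \<tau> * (A\<^sup>2 + B\<^sup>2) + \<tau>\<^sup>2 * A\<^sup>2" using \<tau> by (intro add_nonneg_nonneg mult_nonneg_nonneg) auto
      then show ?thesis by (simp add: power2_eq_square algebra_simps)
    qed
    ultimately show ?thesis using True by (simp add: sc_def) (smt (verit))
  next
    case False
    then have w: "wt j = om j" "om j > 0" using wt_eq_norm[of j] wt_pos[of j] by auto
    let ?c = "cos (\<tau> * om j)" and ?s = "sin (\<tau> * om j)"
    have tsc: "om j * (\<tau> * sc j) = ?s" using w sinr_mult[of \<tau> "om j"] by (simp add: sinr_sc mult_ac)
    have 1: "wt j powr (s + 1) * cmod (of_real ?c * x j + of_real (\<tau> * sc j) * y j) = wt j powr s * cmod (of_real ?c * (of_real (om j) * x j) + of_real ?s * y j)"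
    proof -
      have "of_real ?c * (of_real (om j) * x j) + of_real ?s * y j = of_real (om j) * (of_real ?c * x j + of_real (\<tau> * sc j) * y j)"
        unfolding tsc[symmetric] by (simp add: algebra_simps)
      then show ?thesis using w by (simp add: norm_mult powr_add)
    qed
    have 2: "of_real (- om j * ?s) * x j + of_real ?c * y j = - of_real ?s * (of_real (om j) * x j) + of_real ?c * y j" by simp
    have 3: "wt j powr (s + 1) * cmod (x j) = wt j powr s * cmod (of_real (om j) * x j)" using w by (simp add: norm_mult powr_add)
    have "(wt j powr (s + 1) * cmod (of_real ?c * x j + of_real (\<tau> * sc j) * y j))\<^sup>2 + (wt j powr s * cmod (of_real (- om j * ?s) * x j + of_real ?c * y j))\<^sup>2
      = (wt j powr s)\<^sup>2 * ((cmod (of_real ?c * (of_real (om j) * x j) + of_real ?s * y j))\<^sup>2 + (cmod (- of_real ?s * (of_real (om j) * x j) + of_real ?c * y j))\<^sup>2)"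
      unfolding 1 2 by (simp add: power_mult_distrib distrib_left)
    also have "\<dots> = (wt j powr (s + 1) * cmod (x j))\<^sup>2 + (wt j powr s * cmod (y j))\<^sup>2"
      unfolding 3 by (subst rot_isometry) (auto simp: power_mult_distrib distrib_left)
    also have "\<dots> \<le> (1 + \<tau>)\<^sup>2 * ((wt j powr (s + 1) * cmod (x j))\<^sup>2 + (wt j powr s * cmod (y j))\<^sup>2)"
      using \<tau> mult_right_mono[of 1 "(1 + \<tau>)\<^sup>2" "(wt j powr (s + 1) * cmod (x j))\<^sup>2 + (wt j powr s * cmod (y j))\<^sup>2"]
      by (simp add: one_le_power)
    finally show ?thesis by (simp add: power_mult_distrib)
  qed
  show ?thesis
    unfolding sq sum.distrib[symmetric] sum_distrib_left by (intro sum_mono pt)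
qed

text \<open>The error of the density enters with \<open>(cos(\<tau> \<Omega>) - 1, - \<Omega> sin(\<tau> \<Omega>))\<close>. Each symbol supplies a
  factor \<open>\<tau>\<close> and lands in the energy norm at the expense of the norm in \<open>H\<^sup>s\<^sup>+\<^sup>2\<close>, which
  \<open>density_error_strong\<close> controls.\<close>

lemma En_Suc: assumes ep: "eps n \<le> 1" shows "En (Suc n) \<le> En n + \<tau> * (cE * (eps n + \<eta>))"
proof -
  let ?x = "dft K (f n)" and ?y = "dft K (f' n)" and ?z = "dft K (\<omega> n)"
  define A where "A = wnorm (s + 1) (modes K) (\<lambda>j. of_real (cos (\<tau> * om j)) * ?x j + of_real (\<tau> * sc j) * ?y j)"
  define B where "B = wnorm s (modes K) (\<lambda>j. of_real (- om j * sin (\<tau> * om j)) * ?x j + of_real (cos (\<tau> * om j)) * ?y j)"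
  have \<tau>0: "0 \<le> \<tau>" using \<tau> by simp
  have w2: "gnorm K (s + 2) (\<omega> n) \<le> cW2 * (eps n + \<eta>)" by (rule density_error_strong[OF ep])
  have z1: "wnorm (s + 1) (modes K) (\<lambda>j. of_real (cos (\<tau> * om j) - 1) * ?z j) \<le> \<tau> * wnorm (s + 1 + 1) (modes K) ?z"
  proof (rule wnorm_multiplier[OF _ \<tau>0])
    fix j :: "int ^ 'd"
    have "\<bar>cos (\<tau> * om j) - 1\<bar> \<le> \<tau> * om j" using abs_cos_minus_1_le[of "\<tau> * om j"] \<tau>0 by (simp add: abs_mult)
    also have "\<dots> \<le> \<tau> * wt j powr 1" using \<tau>0 by (intro mult_left_mono) auto
    finally show "cmod (of_real (cos (\<tau> * om j) - 1) * ?z j) \<le> \<tau> * wt j powr 1 * cmod (?z j)"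
      unfolding norm_mult norm_of_real by (rule mult_right_mono) auto
  qed
  have z2: "wnorm s (modes K) (\<lambda>j. of_real (- om j * sin (\<tau> * om j)) * ?z j) \<le> \<tau> * wnorm (s + 2) (modes K) ?z"
  proof (rule wnorm_multiplier[OF _ \<tau>0])
    fix j :: "int ^ 'd"
    have "\<bar>- om j * sin (\<tau> * om j)\<bar> \<le> om j * (\<tau> * om j)"
      using abs_sin_x_le_abs_x[of "\<tau> * om j"] \<tau>0 unfolding abs_mult by (intro mult_mono) (auto simp: abs_mult)
    also have "\<dots> = \<tau> * (om j)\<^sup>2" by (simp add: power2_eq_square)
    also have "\<dots> \<le> \<tau> * wt j powr 2" using \<tau>0 by (intro mult_left_mono norm_freq_sq_le) auto
    finally show "cmod (of_real (- om j * sin (\<tau> * om j)) * ?z j) \<le> \<tau> * wt j powr 2 * cmod (?z j)"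
      unfolding norm_mult norm_of_real by (rule mult_right_mono) auto
  qed
  have a1: "gnorm K (s + 1) (f (Suc n)) \<le> A + (\<tau> * gnorm K (s + 2) (\<omega> n) + 2 * c_wave * \<tau> * \<eta>)"
  proof -
    have "gnorm K (s + 1) (f (Suc n)) = wnorm (s + 1) (modes K) (\<lambda>j. (of_real (cos (\<tau> * om j)) * ?x j + of_real (\<tau> * sc j) * ?y j)
       + (of_real (cos (\<tau> * om j) - 1) * ?z j + u_defect (tt n) j))"
      unfolding gnorm_def by (rule wnorm_cong) (simp only: f_rec add.assoc)
    also have "\<dots> \<le> A + (wnorm (s + 1) (modes K) (\<lambda>j. of_real (cos (\<tau> * om j) - 1) * ?z j) + wnorm (s + 1) (modes K) (u_defect (tt n)))"
      unfolding A_def by (rule order_trans[OF wnorm_add add_left_mono[OF wnorm_add]])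
    also have "\<dots> \<le> A + (\<tau> * gnorm K (s + 2) (\<omega> n) + 2 * c_wave * \<tau> * \<eta>)"
      using z1 wave_defect(1)[OF tn tn'] by (intro add_left_mono add_mono) (auto simp: gnorm_def add.assoc)
    finally show ?thesis .
  qed
  have b1: "N (f' (Suc n)) \<le> B + (\<tau> * gnorm K (s + 2) (\<omega> n) + 2 * c_wave * \<tau> * \<eta>)"
  proof -
    have "N (f' (Suc n)) = wnorm s (modes K) (\<lambda>j. (of_real (- om j * sin (\<tau> * om j)) * ?x j + of_real (cos (\<tau> * om j)) * ?y j)
       + (of_real (- om j * sin (\<tau> * om j)) * ?z j + u'_defect (tt n) j))"
      unfolding gnorm_def by (rule wnorm_cong) (simp only: f'_rec add.assoc)
    also have "\<dots> \<le> B + (wnorm s (modes K) (\<lambda>j. of_real (- om j * sin (\<tau> * om j)) * ?z j) + wnorm s (modes K) (u'_defect (tt n)))"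
      unfolding B_def by (rule order_trans[OF wnorm_add add_left_mono[OF wnorm_add]])
    also have "\<dots> \<le> B + (\<tau> * gnorm K (s + 2) (\<omega> n) + 2 * c_wave * \<tau> * \<eta>)"
      using z2 wave_defect(2)[OF tn tn'] by (intro add_left_mono add_mono) (auto simp: gnorm_def)
    finally show ?thesis .
  qed
  define q where "q = \<tau> * gnorm K (s + 2) (\<omega> n) + 2 * c_wave * \<tau> * \<eta>"
  have q0: "0 \<le> q" using \<tau>0 \<eta> consts_nonneg by (simp add: q_def)
  have AB: "0 \<le> A" "0 \<le> B" by (simp_all add: A_def B_def)
  have "En (Suc n) \<le> sqrt ((A + q)\<^sup>2 + (B + q)\<^sup>2)"
    unfolding En_def using a1 b1 by (intro real_sqrt_le_mono add_mono power_mono) (auto simp: q_def)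
  also have "\<dots> \<le> sqrt (A\<^sup>2 + B\<^sup>2) + sqrt (q\<^sup>2 + q\<^sup>2)" by (rule real_sqrt_sum_squares_triangle_ineq)
  also have "sqrt (q\<^sup>2 + q\<^sup>2) \<le> q + q" using q0 by (rule_tac sqrt_sum_squares_le_sum) auto
  also have "sqrt (A\<^sup>2 + B\<^sup>2) \<le> sqrt ((1 + \<tau>)\<^sup>2 * ((gnorm K (s + 1) (f n))\<^sup>2 + (N (f' n))\<^sup>2))"
    unfolding A_def B_def gnorm_def by (intro real_sqrt_le_mono wave_group)
  also have "\<dots> = (1 + \<tau>) * En n" using \<tau>0 by (simp add: real_sqrt_mult En_def)
  finally have "En (Suc n) \<le> (1 + \<tau>) * En n + (q + q)" by simp
  moreover have "q \<le> \<tau> * (cW2 * (eps n + \<eta>)) + 2 * c_wave * \<tau> * \<eta>"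
    unfolding q_def using w2 \<tau>0 by (intro add_right_mono mult_left_mono) auto
  moreover have "2 * c_wave * \<tau> * \<eta> \<le> \<tau> * (2 * c_wave * (eps n + \<eta>))"
    using \<tau>0 consts_nonneg error_nonneg[of n] by (simp add: algebra_simps)
  moreover have "\<tau> * En n \<le> \<tau> * (eps n + \<eta>)" using \<tau>0 error_nonneg[of n] \<eta> by (intro mult_left_mono) auto
  ultimately show ?thesis by (simp add: cE_def algebra_simps)
qed

lemma psi_increment: "eps n \<le> 1 \<Longrightarrow> N (\<lambda>x. p (Suc n) x - p n x) \<le> \<tau> * (l\<psi> + 1)"
proof -
  assume ep: "eps n \<le> 1"
  have eq: "p (Suc n) x - p n x = (h\<psi> (tt n + \<tau>) x - h\<psi> (tt n) x) - de n x" for x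
    by (simp add: de_def e_def tt_Suc)
  have "N (\<lambda>x. p (Suc n) x - p n x) \<le> l\<psi> * \<tau> + \<tau> * D n"
    unfolding eq by (rule gnorm_diff_le[OF h\<psi>_lipschitz[OF tn tn']]) (use \<sigma> N_de in auto)
  also have "\<dots> \<le> l\<psi> * \<tau> + \<tau> * 1" using ep error_nonneg[of n] \<tau> by (intro add_left_mono mult_left_mono) auto
  finally show ?thesis by (simp add: algebra_simps)
qed

text \<open>Discrete Leibniz rule for the increment of the difference of two products.\<close>

lemma bilinear_increment:
  fixes A1 A2 B1 B2 P1 P2 Q1 Q2 :: "real ^ 'd \<Rightarrow> complex"
  assumes "N (\<lambda>x. (A2 x - A1 x) - (B2 x - B1 x)) \<le> x1" "N P2 \<le> x2" "N (\<lambda>x. B2 x - B1 x) \<le> x3" "N (\<lambda>x. P2 x - Q2 x) \<le> x4"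
    "N (\<lambda>x. A1 x - B1 x) \<le> x5" "N (\<lambda>x. P2 x - P1 x) \<le> x6" "N B1 \<le> x7" "N (\<lambda>x. (P2 x - P1 x) - (Q2 x - Q1 x)) \<le> x8"
  shows "N (\<lambda>x. (A2 x * P2 x - A1 x * P1 x) - (B2 x * Q2 x - B1 x * Q1 x)) \<le>
    Ca s * x1 * x2 + Ca s * x3 * x4 + Ca s * x5 * x6 + Ca s * x7 * x8"
proof -
  have eq: "(A2 x * P2 x - A1 x * P1 x) - (B2 x * Q2 x - B1 x * Q1 x) =
    ((A2 x - A1 x) - (B2 x - B1 x)) * P2 x + (B2 x - B1 x) * (P2 x - Q2 x) + (A1 x - B1 x) * (P2 x - P1 x) + B1 x * ((P2 x - P1 x) - (Q2 x - Q1 x))" for x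
    by (simp add: algebra_simps)
  show ?thesis unfolding eq by (intro gnorm_add_le gnorm_mult_le assms order_refl)
qed

lemma N_de_eq: "N (\<lambda>x. (h\<psi> (tt (Suc n)) x - h\<psi> (tt n) x) - (p (Suc n) x - p n x)) = \<tau> * D n"
proof -
  have "(h\<psi> (tt (Suc n)) x - h\<psi> (tt n) x) - (p (Suc n) x - p n x) = de n x" for x by (simp add: de_def e_def)
  then show ?thesis using N_de by simp
qed

lemma density_error_increment: assumes ep: "eps n \<le> 1" shows "N (\<lambda>x. \<omega> (Suc n) x - \<omega> n x) \<le> \<tau> * (cdw * eps n)"
proof -
  have d: "\<delta> n \<le> 1" using ep error_nonneg[of n] by linarith
  let ?t = "tt n" and ?t' = "tt (Suc n)"
  have tt: "?t \<in> {a..b}" "?t + \<tau> \<in> {a..b}" using tn tn' by auto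
  have lp: "N (\<lambda>x. h\<psi> ?t' x - h\<psi> ?t x) \<le> l\<psi> * \<tau>" unfolding tt_Suc by (rule h\<psi>_lipschitz[OF tt]) (use \<sigma> in auto)
  have cdd: "(cnj (h\<psi> ?t' x) - cnj (h\<psi> ?t x)) - (cnj (p (Suc n) x) - cnj (p n x)) = cnj ((h\<psi> ?t' x - h\<psi> ?t x) - (p (Suc n) x - p n x))" for x by simp
  have D1: "\<tau> * D n \<le> \<tau> * eps n" using \<tau> error_nonneg[of n] by (intro mult_left_mono) auto
  have "\<omega> (Suc n) x - \<omega> n x = (h\<psi> ?t' x * cnj (h\<psi> ?t' x) - h\<psi> ?t x * cnj (h\<psi> ?t x)) - (p (Suc n) x * cnj (p (Suc n) x) - p n x * cnj (p n x))" for x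
    by (simp add: \<omega>_def hW_def w_def)
  then have "N (\<lambda>x. \<omega> (Suc n) x - \<omega> n x) = N (\<lambda>x. (h\<psi> ?t' x * cnj (h\<psi> ?t' x) - h\<psi> ?t x * cnj (h\<psi> ?t x)) - (p (Suc n) x * cnj (p (Suc n) x) - p n x * cnj (p n x)))"
    by simp
  also have "\<dots> \<le> Ca s * (\<tau> * eps n) * M + Ca s * (\<tau> * (l\<psi> + 1)) * eps n + Ca s * eps n * (l\<psi> * \<tau>) + Ca s * (M + 1) * (\<tau> * eps n)"
  proof (rule bilinear_increment)
    show "N (\<lambda>x. (h\<psi> ?t' x - h\<psi> ?t x) - (p (Suc n) x - p n x)) \<le> \<tau> * eps n" unfolding N_de_eq by (rule D1)
    show "N (\<lambda>x. cnj (h\<psi> ?t' x)) \<le> M" unfolding gnorm_cnj[OF K] by (rule h\<psi>_bound[OF tt_Suc_in]) (use \<sigma> in auto)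
    show "N (\<lambda>x. p (Suc n) x - p n x) \<le> \<tau> * (l\<psi> + 1)" by (rule psi_increment[OF ep])
    show "N (\<lambda>x. cnj (h\<psi> ?t' x) - cnj (p (Suc n) x)) \<le> eps n" unfolding gnorm_cnj_diff using N_e_Suc[of n] by (simp add: e_def)
    show "N (\<lambda>x. h\<psi> ?t x - p n x) \<le> eps n" using error_nonneg[of n] by (simp add: e_def)
    show "N (\<lambda>x. cnj (h\<psi> ?t' x) - cnj (h\<psi> ?t x)) \<le> l\<psi> * \<tau>" unfolding gnorm_cnj_diff by (rule lp)
    show "N (p n) \<le> M + 1" by (rule N_p[OF d])
    show "N (\<lambda>x. (cnj (h\<psi> ?t' x) - cnj (h\<psi> ?t x)) - (cnj (p (Suc n) x) - cnj (p n x))) \<le> \<tau> * eps n"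
      unfolding cdd gnorm_cnj[OF K] N_de_eq by (rule D1)
  qed
  finally show ?thesis by (simp add: cdw_def algebra_simps)
qed

text \<open>The increment is needed in \<open>H\<^sup>s\<close> and the error is controlled in \<open>H\<^sup>s\<^sup>+\<^sup>1\<close>; this derivative
  pays for the factor \<open>\<tau>\<close>.\<close>

lemma wave_error_increment: assumes ep: "eps n \<le> 1" shows "N (\<lambda>x. f (Suc n) x - f n x) \<le> \<tau> * ((2 + cW2 + 2 * c_wave) * (eps n + \<eta>))"
proof -
  let ?x = "dft K (f n)" and ?y = "dft K (f' n)" and ?z = "dft K (\<omega> n)"
  have \<tau>0: "0 \<le> \<tau>" using \<tau> by simp
  have c1: "wnorm s (modes K) (\<lambda>j. of_real (cos (\<tau> * om j) - 1) * y j) \<le> \<tau> * wnorm (s + 1) (modes K) y" for y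
  proof (rule wnorm_multiplier[OF _ \<tau>0])
    fix j :: "int ^ 'd"
    have "\<bar>cos (\<tau> * om j) - 1\<bar> \<le> \<tau> * om j" using abs_cos_minus_1_le[of "\<tau> * om j"] \<tau>0 by (simp add: abs_mult)
    also have "\<dots> \<le> \<tau> * wt j powr 1" using \<tau>0 by (intro mult_left_mono) auto
    finally show "cmod (of_real (cos (\<tau> * om j) - 1) * y j) \<le> \<tau> * wt j powr 1 * cmod (y j)"
      unfolding norm_mult norm_of_real by (rule mult_right_mono) auto
  qed
  have sc1: "wnorm s (modes K) (\<lambda>j. of_real (\<tau> * sc j) * ?y j) \<le> \<tau> * wnorm s (modes K) ?y"
  proof (rule wnorm_multiplier0[OF _ \<tau>0])
    fix j :: "int ^ 'd"
    have "\<bar>\<tau> * sc j\<bar> \<le> \<tau> * 1" unfolding abs_mult using \<tau>0 sc_le by (intro mult_mono) auto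
    then show "cmod (of_real (\<tau> * sc j) * ?y j) \<le> \<tau> * cmod (?y j)"
      unfolding norm_mult norm_of_real by (intro mult_right_mono) auto
  qed
  have du: "wnorm s (modes K) (u_defect (tt n)) \<le> 2 * c_wave * \<tau> * \<eta>"
    using wave_defect(1)[OF tn tn'] wnorm_le_exp[of s "s + 1" "modes K" "u_defect (tt n)"] by simp
  have w: "gnorm K (s + 1) (\<omega> n) \<le> cW2 * (eps n + \<eta>)"
    using density_error_strong[OF ep] gnorm_le_exp[of "s + 1" "s + 2" K "\<omega> n"] by simp
  have "N (\<lambda>x. f (Suc n) x - f n x) = wnorm s (modes K) (\<lambda>j. ((of_real (cos (\<tau> * om j) - 1) * ?x j + of_real (\<tau> * sc j) * ?y j) + of_real (cos (\<tau> * om j) - 1) * ?z j) + u_defect (tt n) j)"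
    unfolding gnorm_def by (rule wnorm_cong) (simp only: dft_diff f_rec, simp add: algebra_simps)
  also have "\<dots> \<le> ((wnorm s (modes K) (\<lambda>j. of_real (cos (\<tau> * om j) - 1) * ?x j) + wnorm s (modes K) (\<lambda>j. of_real (\<tau> * sc j) * ?y j))
      + wnorm s (modes K) (\<lambda>j. of_real (cos (\<tau> * om j) - 1) * ?z j)) + wnorm s (modes K) (u_defect (tt n))"
    by (intro order_trans[OF wnorm_add] add_right_mono order_refl)
  also have "\<dots> \<le> ((\<tau> * (eps n + \<eta>) + \<tau> * (eps n + \<eta>)) + \<tau> * (cW2 * (eps n + \<eta>))) + \<tau> * (2 * c_wave * (eps n + \<eta>))"
  proof (intro add_mono)
    have E: "gnorm K (s + 1) (f n) \<le> eps n + \<eta>" "N (f' n) \<le> eps n + \<eta>" using wave_error_le[of n] error_nonneg[of n] \<eta> by linarith+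
    show "wnorm s (modes K) (\<lambda>j. of_real (cos (\<tau> * om j) - 1) * ?x j) \<le> \<tau> * (eps n + \<eta>)"
      using order_trans[OF c1 mult_left_mono[OF E(1)[unfolded gnorm_def] \<tau>0]] .
    show "wnorm s (modes K) (\<lambda>j. of_real (\<tau> * sc j) * ?y j) \<le> \<tau> * (eps n + \<eta>)"
      using order_trans[OF sc1 mult_left_mono[OF E(2)[unfolded gnorm_def] \<tau>0]] .
    show "wnorm s (modes K) (\<lambda>j. of_real (cos (\<tau> * om j) - 1) * ?z j) \<le> \<tau> * (cW2 * (eps n + \<eta>))"
      using order_trans[OF c1 mult_left_mono[OF w[unfolded gnorm_def] \<tau>0]] .
    have "2 * c_wave * \<tau> * \<eta> \<le> \<tau> * (2 * c_wave * (eps n + \<eta>))" using \<tau>0 consts_nonneg error_nonneg[of n] by (simp add: algebra_simps)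
    then show "wnorm s (modes K) (u_defect (tt n)) \<le> \<tau> * (2 * c_wave * (eps n + \<eta>))" using du by linarith
  qed
  finally show ?thesis by (simp add: algebra_simps)
qed

text \<open>The increment of the error of \<open>u'\<close> has no factor \<open>\<tau>\<close> in \<open>H\<^sup>s\<close>, but \<open>u'\<close> enters the
  averaged potential with a factor \<open>\<tau> / 2\<close>.\<close>

lemma potential_error_increment: assumes ep: "eps n \<le> 1"
  shows "N (\<lambda>x. (hv (tt (Suc n)) x - hv (tt n) x) - (V (Suc n) x - V n x)) \<le> \<tau> * (c\<nu> * (eps n + \<eta>))"
proof -
  have \<tau>0: "0 \<le> \<tau>" using \<tau> by simp
  have "N (\<lambda>x. (hv (tt (Suc n)) x - hv (tt n) x) - (V (Suc n) x - V n x))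
     = N (avg_pot (\<lambda>x. f (Suc n) x - f n x) (\<lambda>x. f' (Suc n) x - f' n x) (\<lambda>x. \<omega> (Suc n) x - \<omega> n x))"
    by (rule gnorm_eqI) (simp only: hv_def V_def dft_diff dft_avg_pot f_def f'_def \<omega>_def, simp add: algebra_simps)
  also have "\<dots> \<le> N (\<lambda>x. f (Suc n) x - f n x) + \<tau> / 2 * N (\<lambda>x. f' (Suc n) x - f' n x) + 2 * N (\<lambda>x. \<omega> (Suc n) x - \<omega> n x)"
    by (rule avg_pot_bound)
  also have "\<dots> \<le> \<tau> * ((2 + cW2 + 2 * c_wave) * (eps n + \<eta>)) + \<tau> / 2 * (2 * (eps n + \<eta>) + cE * (eps n + \<eta>)) + 2 * (\<tau> * (cdw * (eps n + \<eta>)))"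
  proof (intro add_mono mult_left_mono)
    show "N (\<lambda>x. f (Suc n) x - f n x) \<le> \<tau> * ((2 + cW2 + 2 * c_wave) * (eps n + \<eta>))" by (rule wave_error_increment[OF ep])
    have "\<tau> * (cE * (eps n + \<eta>)) \<le> 1 * (cE * (eps n + \<eta>))" using \<tau> consts_nonneg error_nonneg[of n] \<eta> by (intro mult_right_mono) auto
    then have E1: "En (Suc n) \<le> En n + cE * (eps n + \<eta>)" using En_Suc[OF ep] by linarith
    have E2: "En n \<le> eps n + \<eta>" using error_nonneg[of n] \<eta> by linarith
    have lin: "x \<le> 2 * y + z" if "q \<le> r + z" "r \<le> y" "x \<le> q + r" for x y z q r :: real using that by linarith
    show "N (\<lambda>x. f' (Suc n) x - f' n x) \<le> 2 * (eps n + \<eta>) + cE * (eps n + \<eta>)"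
      by (rule lin[OF E1 E2 order_trans[OF gnorm_diff add_mono[OF wave_error_le(2)[of "Suc n"] wave_error_le(2)[of n]]]])
    have "\<tau> * (cdw * eps n) \<le> \<tau> * (cdw * (eps n + \<eta>))" using \<tau>0 consts_nonneg \<eta> by (intro mult_left_mono) auto
    then show "N (\<lambda>x. \<omega> (Suc n) x - \<omega> n x) \<le> \<tau> * (cdw * (eps n + \<eta>))" using density_error_increment[OF ep] by linarith
  qed (use \<tau>0 in auto)
  also have "\<dots> \<le> \<tau> * (c\<nu> * (eps n + \<eta>))"
    using mult_nonneg_nonneg[OF \<tau>0 mult_nonneg_nonneg[OF consts_nonneg(12), of "eps n + \<eta>"]] error_nonneg[of n] \<eta>
    by (simp add: c\<nu>_def algebra_simps)
  finally show ?thesis .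
qed

text \<open>Together with \<open>potential_error_increment\<close>, this step shows that the differenced
  recursion closes in \<open>H\<^sup>s\<close>.\<close>

lemma nonlinearity_error_increment: assumes ep: "eps n \<le> 1" shows "N (\<lambda>x. g (Suc n) x - g n x) \<le> \<tau> * (c\<Delta> * (eps n + \<eta>))"
proof -
  have d: "\<delta> n \<le> 1" using ep error_nonneg[of n] by linarith
  have \<tau>0: "0 \<le> \<tau>" using \<tau> by simp
  define \<alpha> where "\<alpha> = eps n + \<eta>"
  have al: "0 \<le> \<alpha>" "eps n \<le> \<alpha>" "\<delta> n \<le> \<alpha>" "\<alpha> \<le> 3" "D n \<le> \<alpha>" using error_nonneg[of n] \<eta> ep \<eta>_le2 by (auto simp: \<alpha>_def)
  let ?w1 = "hv (tt n)" and ?w2 = "hv (tt (Suc n))" and ?v1 = "V n" and ?v2 = "V (Suc n)"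
  have dV: "N (\<lambda>x. (?w2 x - ?w1 x) - (?v2 x - ?v1 x)) \<le> \<tau> * (c\<nu> * \<alpha>)" using potential_error_increment[OF ep] by (simp add: \<alpha>_def)
  have "\<tau> * (c\<nu> * \<alpha>) \<le> \<tau> * (c\<nu> * 3)" using \<tau>0 consts_nonneg al by (intro mult_left_mono) auto
  then have dV3: "N (\<lambda>x. (?w2 x - ?w1 x) - (?v2 x - ?v1 x)) \<le> \<tau> * (3 * c\<nu>)" using dV by simp
  have lw: "N (\<lambda>x. ?w2 x - ?w1 x) \<le> lv * \<tau>" unfolding tt_Suc by (rule hv_lipschitz[OF tn tn'])
  have R12: "Rv \<le> R2" "R1 \<le> R2" using consts_nonneg by (simp_all add: R2_def R1_def)
  have w: "N ?w1 \<le> R2" "N ?w2 \<le> R2" using hv_bound[OF tn] hv_bound[OF tt_Suc_in] R12 by linarith+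
  have v1: "N ?v1 \<le> R2" using potential_bound[OF d] R12 by linarith
  have wv1: "N (\<lambda>x. ?w1 x - ?v1 x) \<le> cV * \<alpha>"
    using potential_error[OF d] mult_left_mono[OF al(3) consts_nonneg(2)] by linarith
  \<comment> \<open>The numerical potential at the next step is bounded through its increment, see \<open>R2\<close>.\<close>
  have v2: "N ?v2 \<le> R2"
  proof -
    have "?v2 = (\<lambda>x. ?w2 x - (((?w2 x - ?w1 x) - (?v2 x - ?v1 x)) + (?w1 x - ?v1 x)))" by (simp add: fun_eq_iff)
    moreover have "N (\<lambda>x. ?w2 x - (((?w2 x - ?w1 x) - (?v2 x - ?v1 x)) + (?w1 x - ?v1 x))) \<le> Rv + (\<tau> * (3 * c\<nu>) + cV * \<delta> n)"
      by (intro gnorm_diff_le[OF hv_bound[OF tt_Suc_in] gnorm_add_le[OF dV3 potential_error[OF d]]])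
    moreover have "\<tau> * (3 * c\<nu>) \<le> 1 * (3 * c\<nu>)" using \<tau> consts_nonneg by (intro mult_right_mono) auto
    moreover have "cV * \<delta> n \<le> cV * 1" using d consts_nonneg by (intro mult_left_mono) auto
    ultimately have "N ?v2 \<le> Rv + (1 * (3 * c\<nu>) + cV * 1)" by (simp only:)
    then show ?thesis by (simp add: R2_def R1_def)
  qed
  have R2: "0 \<le> R2" "0 \<le> 2 * R2" using consts_nonneg by auto
  have x1: "N (\<lambda>x. (phaseq ?w2 x - phaseq ?w1 x) - (phaseq ?v2 x - phaseq ?v1 x)) \<le> \<tau> * ((Ca s * (qL R2 * cV) * (\<kappa> R2 * lv) + (Ca s * (\<kappa> R2 * R2) + 1) * (qL (2 * R2) * c\<nu>)) * \<alpha>)"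
  proof -
    have "N (\<lambda>x. (phaseq ?w2 x - phaseq ?w1 x) - (phaseq ?v2 x - phaseq ?v1 x)) \<le>
        Ca s * (qL R2 * N (\<lambda>x. ?w1 x - ?v1 x)) * (\<tau> * (\<kappa> R2 * N (\<lambda>x. ?w2 x - ?w1 x)))
      + (Ca s * (\<kappa> R2 * R2) + 1) * (qL (2 * R2) * N (\<lambda>x. (?w2 x - ?w1 x) - (?v2 x - ?v1 x)))"
      by (rule phaseq_double_difference[OF R2(1) v1 v2 w])
    also have "\<dots> \<le> Ca s * (qL R2 * (cV * \<alpha>)) * (\<tau> * (\<kappa> R2 * (lv * 1))) + (Ca s * (\<kappa> R2 * R2) + 1) * (qL (2 * R2) * (\<tau> * (c\<nu> * \<alpha>)))"
    proof (intro add_mono mult_mono mult_left_mono wv1 dV)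
      show "N (\<lambda>x. ?w2 x - ?w1 x) \<le> lv * 1" using lw mult_left_mono[OF \<tau>(2) lv_nn] by linarith
    qed (use Ca_s R2 consts_nonneg \<tau>0 al qL_nn[OF R2(1)] qL_nn[OF R2(2)] \<kappa>_nn[of R2] lv_nn in \<open>auto intro!: mult_nonneg_nonneg add_nonneg_nonneg\<close>)
    finally show ?thesis by (simp add: algebra_simps)
  qed
  have x3: "N (\<lambda>x. phaseq ?v2 x - phaseq ?v1 x) \<le> \<tau> * (qL R2 * (lv + 3 * c\<nu>))"
  proof -
    have eq: "?v2 x - ?v1 x = (?w2 x - ?w1 x) - ((?w2 x - ?w1 x) - (?v2 x - ?v1 x))" for x by simp
    have "N (\<lambda>x. ?v2 x - ?v1 x) \<le> lv * \<tau> + \<tau> * (3 * c\<nu>)" by (subst eq) (rule gnorm_diff_le[OF lw dV3])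
    then have "qL R2 * N (\<lambda>x. ?v2 x - ?v1 x) \<le> qL R2 * (lv * \<tau> + \<tau> * (3 * c\<nu>))"
      by (rule mult_left_mono) (rule qL_nn[OF R2(1)])
    then show ?thesis using phaseq_lipschitz[OF R2(1) v2 v1] by (simp add: algebra_simps)
  qed
  have x5: "N (\<lambda>x. phaseq ?w1 x - phaseq ?v1 x) \<le> qL R2 * (cV * \<alpha>)"
    using phaseq_lipschitz[OF R2(1) w(1) v1] mult_left_mono[OF wv1 qL_nn[OF R2(1)]] by linarith
  have eq: "g (Suc n) x - g n x = (phaseq ?w2 x * h\<psi> (tt (Suc n)) x - phaseq ?w1 x * h\<psi> (tt n) x) - (phaseq ?v2 x * p (Suc n) x - phaseq ?v1 x * p n x)" for x
    by (simp add: g_def)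
  have "N (\<lambda>x. g (Suc n) x - g n x) \<le> Ca s * (\<tau> * ((Ca s * (qL R2 * cV) * (\<kappa> R2 * lv) + (Ca s * (\<kappa> R2 * R2) + 1) * (qL (2 * R2) * c\<nu>)) * \<alpha>)) * M
     + Ca s * (\<tau> * (qL R2 * (lv + 3 * c\<nu>))) * \<alpha> + Ca s * (qL R2 * (cV * \<alpha>)) * (l\<psi> * \<tau>) + Ca s * (\<kappa> R2 * R2) * (\<tau> * \<alpha>)"
    unfolding eq
  proof (rule bilinear_increment[OF x1 _ x3 _ x5])
    show "N (h\<psi> (tt (Suc n))) \<le> M" by (rule h\<psi>_bound[OF tt_Suc_in]) (use \<sigma> in auto)
    show "N (\<lambda>x. h\<psi> (tt (Suc n)) x - p (Suc n) x) \<le> \<alpha>" using N_e_Suc[of n] al by (simp add: e_def)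
    show "N (\<lambda>x. h\<psi> (tt (Suc n)) x - h\<psi> (tt n) x) \<le> l\<psi> * \<tau>" unfolding tt_Suc by (rule h\<psi>_lipschitz[OF tn tn']) (use \<sigma> in auto)
    show "N (phaseq ?v1) \<le> \<kappa> R2 * R2" by (rule phaseq_bound_le[OF R2(1) v1])
    show "N (\<lambda>x. (h\<psi> (tt (Suc n)) x - h\<psi> (tt n) x) - (p (Suc n) x - p n x)) \<le> \<tau> * \<alpha>"
      unfolding N_de_eq using \<tau>0 al by (intro mult_left_mono) auto
  qed
  then show ?thesis by (simp add: c\<Delta>_def \<alpha>_def algebra_simps)
qed

text \<open>The group is isometric, so \<open>D\<close> changes over one step only by the increments of the nonlinearity
  error and of the defect.\<close>

lemma error_recursion:
  assumes ep: "eps n \<le> 1" and t2: "tt n + \<tau> + \<tau> \<in> {a..b}"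
  shows "eps (Suc n) \<le> eps n + \<tau> * (c_step * (eps n + \<eta>))"
proof -
  have \<tau>0: "0 \<le> \<tau>" using \<tau> by simp
  have "N (de (Suc n)) = wnorm s (modes K) (\<lambda>j. (cnj (ee \<tau> j) * dft K (de n) j + cnj (ee \<tau> j) * (of_real \<tau> * dft K (\<lambda>x. g (Suc n) x - g n x) j)) + (psi_defect (tt n + \<tau>) j - psi_defect (tt n) j))"
    unfolding gnorm_def by (rule wnorm_cong) (simp only: de_def dft_diff e_rec tt_Suc, simp add: algebra_simps)
  also have "\<dots> \<le> (wnorm s (modes K) (\<lambda>j. cnj (ee \<tau> j) * dft K (de n) j) + wnorm s (modes K) (\<lambda>j. cnj (ee \<tau> j) * (of_real \<tau> * dft K (\<lambda>x. g (Suc n) x - g n x) j)))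
     + wnorm s (modes K) (\<lambda>j. psi_defect (tt n + \<tau>) j - psi_defect (tt n) j)"
    by (rule order_trans[OF wnorm_add add_right_mono[OF wnorm_add]])
  also have "wnorm s (modes K) (\<lambda>j. cnj (ee \<tau> j) * dft K (de n) j) = N (de n)" unfolding gnorm_def by (rule wnorm_cong) (simp add: norm_mult)
  also have "wnorm s (modes K) (\<lambda>j. cnj (ee \<tau> j) * (of_real \<tau> * dft K (\<lambda>x. g (Suc n) x - g n x) j)) = \<tau> * N (\<lambda>x. g (Suc n) x - g n x)"
    unfolding gnorm_def using \<tau> wnorm_cmult[of s "modes K" "of_real \<tau>" "dft K (\<lambda>x. g (Suc n) x - g n x)"] by (simp add: norm_mult wnorm_def)
  also have "N (de n) + \<tau> * N (\<lambda>x. g (Suc n) x - g n x) + wnorm s (modes K) (\<lambda>j. psi_defect (tt n + \<tau>) j - psi_defect (tt n) j)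
     \<le> \<tau> * D n + \<tau> * (\<tau> * (c\<Delta> * (eps n + \<eta>))) + c_psi' * \<tau> * \<tau> * \<eta>"
    using \<tau>0 by (intro add_mono mult_left_mono nonlinearity_error_increment ep psi_defect_difference tn t2) (auto simp: N_de)
  also have "\<dots> = \<tau> * (D n + \<tau> * (c\<Delta> * (eps n + \<eta>)) + \<tau> * (c_psi' * \<eta>))" by (simp add: algebra_simps)
  finally have "D (Suc n) \<le> D n + \<tau> * (c\<Delta> * (eps n + \<eta>)) + \<tau> * (c_psi' * \<eta>)"
    unfolding D_def[of "Suc n"] using \<tau> by (simp add: pos_divide_le_eq mult.commute)
  moreover have "\<tau> * (c_psi' * \<eta>) \<le> \<tau> * (c_psi' * (eps n + \<eta>))" using \<tau>0 consts_nonneg error_nonneg[of n] by (intro mult_left_mono) auto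
  moreover have "N (e (Suc n)) \<le> N (e n) + \<tau> * (eps n + \<eta>)"
  proof -
    have "e (Suc n) = (\<lambda>x. de n x + e n x)" by (simp add: de_def)
    then have "N (e (Suc n)) \<le> N (de n) + N (e n)" using gnorm_add[of K s "de n" "e n"] by simp
    moreover have "\<tau> * D n \<le> \<tau> * (eps n + \<eta>)" using \<tau>0 error_nonneg[of n] \<eta> by (intro mult_left_mono) auto
    ultimately show ?thesis using N_de[of n] by linarith
  qed
  moreover note En_Suc[OF ep]
  ultimately have "eps (Suc n) \<le> (D n + \<tau> * (c\<Delta> * (eps n + \<eta>)) + \<tau> * (c_psi' * (eps n + \<eta>))) + ((N (e n) + \<tau> * (eps n + \<eta>)) + (En n + \<tau> * (cE * (eps n + \<eta>))))"
    unfolding eps_def[of "Suc n"] \<delta>_def[of "Suc n"] by linarith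
  also have "\<dots> = eps n + \<tau> * (c_step * (eps n + \<eta>))" by (simp add: eps_def \<delta>_def c_step_def algebra_simps)
  finally show ?thesis .
qed

end
end

section \<open>Initial error and Gronwall argument\<close>

definition "c\<delta>0 = ci s * M + (ci (s + 1) * M + ci s * M)"
definition "c_init = (ci (s + 2) * M + cg * c\<delta>0 + c_psi) + c\<delta>0"

lemma c_init_nn: "0 \<le> c\<delta>0" "0 \<le> c_init" using ci_nn M0 consts_nonneg by (auto simp: c\<delta>0_def c_init_def)

lemma init_errors:
  assumes "a \<le> b"
  shows "gnorm K (s + 2) (e 0) \<le> ci (s + 2) * M * \<eta>" "N (e 0) \<le> ci s * M * \<eta>" "En 0 \<le> (ci (s + 1) * M + ci s * M) * \<eta>"
proof -
  have ta: "tt 0 = a" "a \<in> {a..b}" using assms by (auto simp: tt_def)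
  have pe: "gnorm K r (e 0) = gnorm K r (\<lambda>x. \<psi> a x - trunc (\<psi> a) x)" for r
  proof -
    have "gnorm K r (e 0) = gnorm K r (\<lambda>x. - (\<psi> a x - trunc (\<psi> a) x))"
      by (rule gnorm_eqI) (simp add: e_def h\<psi>_def ta dft_diff dft_minus p0)
    then show ?thesis by (simp only: gnorm_minus)
  qed
  have pf: "gnorm K r (f 0) = gnorm K r (\<lambda>x. U a x - trunc (U a) x)" for r
  proof -
    have "gnorm K r (f 0) = gnorm K r (\<lambda>x. - (U a x - trunc (U a) x))"
      by (rule gnorm_eqI) (simp add: f_def hU_def ta dft_diff dft_minus u0)
    then show ?thesis by (simp only: gnorm_minus)
  qed
  have pf': "gnorm K r (f' 0) = gnorm K r (\<lambda>x. U' a x - trunc (U' a) x)" for r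
  proof -
    have "gnorm K r (f' 0) = gnorm K r (\<lambda>x. - (U' a x - trunc (U' a) x))"
      by (rule gnorm_eqI) (simp add: f'_def hU'_def ta dft_diff dft_minus u'0)
    then show ?thesis by (simp only: gnorm_minus)
  qed
  show "gnorm K (s + 2) (e 0) \<le> ci (s + 2) * M * \<eta>" unfolding pe by (rule gnorm_interpolation_error[OF _ psi_bound[OF ta(2)]]) auto
  show "N (e 0) \<le> ci s * M * \<eta>" unfolding pe by (rule gnorm_interpolation_error[OF _ psi_bound[OF ta(2)]]) auto
  have 1: "gnorm K (s + 1) (f 0) \<le> ci (s + 1) * M * \<eta>" unfolding pf by (rule gnorm_interpolation_error[OF _ U_bound[OF ta(2)]]) auto
  have 2: "N (f' 0) \<le> ci s * M * \<eta>" unfolding pf' by (rule gnorm_interpolation_error[OF _ U'_bound[OF ta(2)]]) auto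
  have "En 0 \<le> gnorm K (s + 1) (f 0) + N (f' 0)" unfolding En_def by (rule sqrt_sum_squares_le_sum) auto
  then show "En 0 \<le> (ci (s + 1) * M + ci s * M) * \<eta>" using 1 2 by (simp add: algebra_simps)
qed

text \<open>The initial values are interpolants, so \<open>e 0\<close> is an interpolation error, small even in
  \<open>H\<^sup>s\<^sup>+\<^sup>2\<close>; the first difference \<open>D 0\<close> uses two of these derivatives.\<close>

lemma initial_error:
  assumes ab: "a + \<tau> \<le> b" and sm: "c_init * \<eta> \<le> 1"
  shows "eps 0 \<le> c_init * \<eta>"
proof -
  have \<tau>0: "0 \<le> \<tau>" using \<tau> by simp
  have ab': "a \<le> b" using ab \<tau>0 by linarith
  have ta: "tt 0 \<in> {a..b}" "tt 0 + \<tau> \<in> {a..b}" using ab ab' \<tau>0 by (auto simp: tt_def)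
  note i = init_errors[OF ab']
  have d: "\<delta> 0 \<le> c\<delta>0 * \<eta>" using i(2,3) by (simp add: \<delta>_def c\<delta>0_def algebra_simps)
  also have "\<dots> \<le> c_init * \<eta>" using \<eta> consts_nonneg c_init_nn ci_nn M0 by (intro mult_right_mono) (auto simp: c_init_def)
  finally have d1: "\<delta> 0 \<le> 1" using sm by linarith
  have "N (de 0) = wnorm s (modes K) (\<lambda>j. ((cnj (ee \<tau> j) - 1) * dft K (e 0) j + cnj (ee \<tau> j) * (of_real \<tau> * dft K (g 0) j)) + psi_defect (tt 0) j)"
    unfolding gnorm_def by (rule wnorm_cong) (simp add: de_def dft_diff e_rec algebra_simps)
  also have "\<dots> \<le> (wnorm s (modes K) (\<lambda>j. (cnj (ee \<tau> j) - 1) * dft K (e 0) j) + wnorm s (modes K) (\<lambda>j. cnj (ee \<tau> j) * (of_real \<tau> * dft K (g 0) j))) + wnorm s (modes K) (psi_defect (tt 0))"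
    by (rule order_trans[OF wnorm_add add_right_mono[OF wnorm_add]])
  also have "wnorm s (modes K) (\<lambda>j. cnj (ee \<tau> j) * (of_real \<tau> * dft K (g 0) j)) = \<tau> * N (g 0)"
    unfolding gnorm_def using \<tau> wnorm_cmult[of s "modes K" "of_real \<tau>" "dft K (g 0)"] by (simp add: norm_mult wnorm_def)
  also have "wnorm s (modes K) (\<lambda>j. (cnj (ee \<tau> j) - 1) * dft K (e 0) j) + \<tau> * N (g 0) + wnorm s (modes K) (psi_defect (tt 0))
     \<le> \<tau> * (ci (s + 2) * M * \<eta>) + \<tau> * (cg * (c\<delta>0 * \<eta>)) + c_psi * \<tau> * \<eta>"
  proof (intro add_mono mult_left_mono)
    have "wnorm s (modes K) (\<lambda>j. (cnj (ee \<tau> j) - 1) * dft K (e 0) j) \<le> \<tau> * wnorm (s + 2) (modes K) (dft K (e 0))"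
    proof (rule wnorm_multiplier[OF _ \<tau>0])
      fix j :: "int ^ 'd"
      have "cmod (cnj (ee \<tau> j) - 1) = cmod (ee \<tau> j - 1)" using complex_mod_cnj[of "ee \<tau> j - 1"] by simp
      then show "cmod ((cnj (ee \<tau> j) - 1) * dft K (e 0) j) \<le> \<tau> * wt j powr 2 * cmod (dft K (e 0) j)"
        using ee_minus_1_le[OF \<tau>0, of j] unfolding norm_mult by (intro mult_right_mono) auto
    qed
    also have "\<dots> \<le> \<tau> * (ci (s + 2) * M * \<eta>)" using i(1) \<tau>0 by (intro mult_left_mono) (auto simp: gnorm_def)
    finally show "wnorm s (modes K) (\<lambda>j. (cnj (ee \<tau> j) - 1) * dft K (e 0) j) \<le> \<tau> * (ci (s + 2) * M * \<eta>)" .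
    show "N (g 0) \<le> cg * (c\<delta>0 * \<eta>)" using nonlinearity_error[OF ta(1) d1] mult_left_mono[OF d consts_nonneg(4)] by linarith
    show "wnorm s (modes K) (psi_defect (tt 0)) \<le> c_psi * \<tau> * \<eta>" by (rule psi_defect_bound[OF ta])
  qed (use \<tau>0 in auto)
  also have "\<dots> = \<tau> * ((ci (s + 2) * M + cg * c\<delta>0 + c_psi) * \<eta>)" by (simp add: algebra_simps)
  finally have "D 0 \<le> (ci (s + 2) * M + cg * c\<delta>0 + c_psi) * \<eta>"
    unfolding D_def using \<tau> by (simp add: pos_divide_le_eq mult.commute)
  then show ?thesis using d by (simp add: eps_def c_init_def algebra_simps)
qed

text \<open>Gronwall's argument. The bound that it yields is at most \<open>1\<close> by the smallness assumption on \<open>\<eta>\<close>,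
  which permits the next application of \<open>error_recursion\<close>. The index \<open>Suc n\<close> in the premise reflects
  that \<open>eps n\<close> involves the error at step \<open>n + 1\<close>.\<close>

lemma error_bootstrap:
  assumes T: "b = a + T" and sm: "exp (c_step * T) * (c_init + 1) * \<eta> \<le> 1" and T0: "0 \<le> T"
  shows "a + real (Suc n) * \<tau> \<le> b \<Longrightarrow> eps n + \<eta> \<le> (1 + \<tau> * c_step) ^ n * ((c_init + 1) * \<eta>) \<and> eps n + \<eta> \<le> exp (c_step * T) * (c_init + 1) * \<eta>"
proof (induction n)
  case 0
  have "1 \<le> exp (c_step * T)" using consts_nonneg T0 by simp
  then have ge: "(c_init + 1) * \<eta> \<le> exp (c_step * T) * ((c_init + 1) * \<eta>)"
    using c_init_nn \<eta> mult_right_mono[of 1 "exp (c_step * T)" "(c_init + 1) * \<eta>"] by simp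
  then have "c_init * \<eta> \<le> 1" using sm \<eta> by (simp add: algebra_simps)
  then have "eps 0 \<le> c_init * \<eta>" using 0 by (intro initial_error) auto
  then show ?case using ge by (simp add: algebra_simps)
next
  case (Suc n)
  have \<tau>0: "0 \<le> \<tau>" using \<tau> by simp
  have le: "a + real (Suc n) * \<tau> \<le> b" using Suc.prems \<tau>0 by (simp add: algebra_simps)
  note IH = Suc.IH[OF le]
  have ep: "eps n \<le> 1" using IH sm \<eta> by linarith
  have t: "tt n \<in> {a..b}" "tt n + \<tau> \<in> {a..b}" "tt n + \<tau> + \<tau> \<in> {a..b}"
    using Suc.prems \<tau>0 by (auto simp: tt_def algebra_simps add_increasing2 intro: order_trans[rotated])
  have "eps (Suc n) + \<eta> \<le> (1 + \<tau> * c_step) * (eps n + \<eta>)"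
    using error_recursion[OF t(1,2) ep t(3)] by (simp add: algebra_simps)
  also have "\<dots> \<le> (1 + \<tau> * c_step) * ((1 + \<tau> * c_step) ^ n * ((c_init + 1) * \<eta>))"
    using IH \<tau>0 consts_nonneg by (intro mult_left_mono) auto
  finally have 1: "eps (Suc n) + \<eta> \<le> (1 + \<tau> * c_step) ^ Suc n * ((c_init + 1) * \<eta>)" by (simp add: mult_ac)
  have "(1 + \<tau> * c_step) ^ Suc n \<le> exp (\<tau> * c_step) ^ Suc n"
    using \<tau>0 consts_nonneg by (intro power_mono exp_ge_add_one_self) auto
  also have "\<dots> = exp (c_step * (real (Suc n) * \<tau>))" by (simp add: exp_of_nat_mult[symmetric] mult_ac del: of_nat_Suc power_Suc)
  also have "\<dots> \<le> exp (c_step * T)"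
  proof -
    have "real (Suc n) * \<tau> \<le> T" using le T by linarith
    then show ?thesis using consts_nonneg by (simp add: mult_left_mono del: of_nat_Suc)
  qed
  finally have "(1 + \<tau> * c_step) ^ Suc n * ((c_init + 1) * \<eta>) \<le> exp (c_step * T) * ((c_init + 1) * \<eta>)"
    using c_init_nn \<eta> by (intro mult_right_mono) auto
  then show ?case using 1 by (simp add: mult_ac)
qed

definition "c_final T = (ci (s + 2) * M + (ci (s + 1) * M + ci s * M)) + (c_strong_Suc + 1 + cE) * (exp (c_step * T) * (c_init + 1))"

text \<open>For \<open>n = Suc m\<close> the error at step \<open>n\<close> is bounded by \<open>eps m\<close>, which looks no further ahead
  than step \<open>n\<close>.\<close>

lemma grid_error_bound:
  assumes T: "b = a + T" and sm: "exp (c_step * T) * (c_init + 1) * \<eta> \<le> 1" and T0: "0 \<le> T" and n: "real n * \<tau> \<le> T"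
  shows "gnorm K (s + 2) (e n) + En n \<le> c_final T * \<eta>"
proof (cases n)
  case 0
  have i: "gnorm K (s + 2) (e 0) + En 0 \<le> (ci (s + 2) * M + (ci (s + 1) * M + ci s * M)) * \<eta>"
    using init_errors[of] T T0 by (simp add: algebra_simps)
  also have "\<dots> \<le> c_final T * \<eta>" using \<eta> consts_nonneg c_init_nn by (intro mult_right_mono) (auto simp: c_final_def)
  finally show ?thesis using 0 by simp
next
  case (Suc m)
  have \<tau>0: "0 \<le> \<tau>" using \<tau> by simp
  have le: "a + real (Suc m) * \<tau> \<le> b" using n T Suc by simp
  let ?B = "exp (c_step * T) * (c_init + 1) * \<eta>"
  have b: "eps m + \<eta> \<le> ?B" using error_bootstrap[OF T sm T0 le] by blast
  have ep: "eps m \<le> 1" using b sm \<eta> by linarith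
  have t: "tt m \<in> {a..b}" "tt m + \<tau> \<in> {a..b}"
    using le \<tau>0 by (auto simp: tt_def algebra_simps add_increasing2 intro: order_trans[rotated])
  have "gnorm K (s + 2) (e (Suc m)) \<le> c_strong_Suc * ?B"
    using psi_error_strong_Suc[OF t ep] mult_left_mono[OF b consts_nonneg(9)] by linarith
  moreover have "En (Suc m) \<le> ?B + cE * ?B"
  proof -
    have "\<tau> * (cE * (eps m + \<eta>)) \<le> 1 * (cE * (eps m + \<eta>))" using \<tau> consts_nonneg error_nonneg[of m] \<eta> by (intro mult_right_mono) auto
    also have "\<dots> \<le> cE * ?B" using b consts_nonneg by (simp add: mult_left_mono)
    finally show ?thesis using En_Suc[OF t ep] error_nonneg[of m] b \<eta> by linarith
  qed
  ultimately have "gnorm K (s + 2) (e n) + En n \<le> (c_strong_Suc + 1 + cE) * ?B" using Suc by (simp add: algebra_simps)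
  also have "\<dots> \<le> c_final T * \<eta>"
    using \<eta> ci_nn[of s] ci_nn[of "s + 1"] ci_nn[of "s + 2"] M0 by (simp add: c_final_def algebra_simps)
  finally show ?thesis .
qed

end

section \<open>Classical solutions in Fourier space\<close>

text \<open>Differentiation under the integral by dominated convergence of difference quotients, with
  one-sided derivatives at the ends of the interval.\<close>

lemma fc_time_derivative:
  fixes f :: "real \<Rightarrow> real ^ 'd::finite \<Rightarrow> complex"
  assumes c: "\<And>t. t \<in> {a..b} \<Longrightarrow> ctorus (f t)" and cy: "\<And>t. t \<in> {a..b} \<Longrightarrow> ctorus (y t)"
    and d: "\<And>t x. t \<in> {a..b} \<Longrightarrow> ((\<lambda>r. f r x) has_vector_derivative y t x) (at t within {a..b})"
    and B: "\<And>t x. t \<in> {a..b} \<Longrightarrow> cmod (y t x) \<le> B" and t: "t \<in> {a..b}"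
  shows "((\<lambda>t. fc (f t) j) has_vector_derivative fc (y t) j) (at t within {a..b})"
  unfolding has_vector_derivative_iff_slope tendsto_at_iff_sequentially
proof (intro allI impI)
  fix X :: "nat \<Rightarrow> real" assume X: "\<forall>i. X i \<in> {a..b} - {t}" and lim: "X \<longlonglongrightarrow> t"
  define q where "q = (\<lambda>n x. of_real (1 / (X n - t)) * (f (X n) x - f t x))"
  have Xn: "X n \<in> {a..b}" "X n \<noteq> t" for n using X by auto
  have q: "q n x = (f (X n) x - f t x) /\<^sub>R (X n - t)" for n x by (simp add: q_def scaleR_conv_of_real divide_inverse)
  have "(\<lambda>n. fc (q n) j) \<longlonglongrightarrow> fc (y t) j"
  proof (rule fc_tendsto[OF _ cy[OF t]])
    show "ctorus (q n)" for n unfolding q_def by (intro ctorus_mult ctorus_const ctorus_diff c Xn t)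
    show "(\<lambda>n. q n x) \<longlonglongrightarrow> y t x" for x
    proof -
      have "((\<lambda>r. (f r x - f t x) /\<^sub>R (r - t)) \<circ> X) \<longlonglongrightarrow> y t x"
        using d[OF t, of x] X lim unfolding has_vector_derivative_iff_slope tendsto_at_iff_sequentially by blast
      then show ?thesis by (simp add: q o_def)
    qed
    show "cmod (q n x) \<le> B" for n x
    proof -
      have "norm (f (X n) x - f t x) \<le> B * norm (X n - t)"
      proof (rule differentiable_bound[of "{a..b}" "\<lambda>r. f r x" "\<lambda>r h. h *\<^sub>R y r x"])
        fix r assume r: "r \<in> {a..b}"
        show "((\<lambda>r. f r x) has_derivative (\<lambda>h. h *\<^sub>R y r x)) (at r within {a..b})"
          using d[OF r, of x] by (simp add: has_vector_derivative_def)
        show "onorm (\<lambda>h. h *\<^sub>R y r x) \<le> B"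
          by (rule onorm_le) (simp add: mult.commute[of B] mult_left_mono B[OF r])
      qed (use Xn t in auto)
      then have "norm (f (X n) x - f t x) / \<bar>X n - t\<bar> \<le> B" using Xn[of n] by (simp add: pos_divide_le_eq)
      then show ?thesis unfolding q norm_scaleR by (simp add: divide_inverse mult.commute)
    qed
  qed
  moreover have "fc (q n) j = (fc (f (X n)) j - fc (f t) j) /\<^sub>R (X n - t)" for n
    unfolding q_def fc_cmult fc_diff[OF c[OF Xn(1)] c[OF t]] by (simp add: scaleR_conv_of_real divide_inverse)
  ultimately show "((\<lambda>r. (fc (f r) j - fc (f t) j) /\<^sub>R (r - t)) \<circ> X) \<longlonglongrightarrow> fc (y t) j" by (simp add: o_def)
qed

lemma partial_eqI: "(f has_derivative D) (at x) \<Longrightarrow> partial i f x = D (axis i 1)"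
  unfolding partial_def by (simp flip: frechet_derivative_at)

lemma partial_bounded_linear:
  fixes f :: "real ^ 'd::finite \<Rightarrow> 'a::real_normed_vector"
  assumes "bounded_linear L" "\<And>x. f differentiable at x"
  shows "(\<lambda>x. L (f x)) differentiable at x" "partial i (\<lambda>x. L (f x)) = (\<lambda>x. L (partial i f x))"
proof -
  have d: "((\<lambda>x. L (f x)) has_derivative (\<lambda>h. L (frechet_derivative f (at x) h))) (at x)" for x
    using bounded_linear.has_derivative[OF assms(1)] assms(2) frechet_derivative_works by blast
  then show "(\<lambda>x. L (f x)) differentiable at x" unfolding differentiable_def by blast
  show "partial i (\<lambda>x. L (f x)) = (\<lambda>x. L (partial i f x))"
    using partial_eqI[OF d] by (auto simp: partial_def)
qed

lemma C_2_bounded_linear: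
  fixes f :: "real ^ 'd::finite \<Rightarrow> 'a::real_normed_vector"
  assumes L: "bounded_linear L" and f: "C_k 2 f"
  shows "C_k 2 (\<lambda>x. L (f x))" "laplacian (\<lambda>x. L (f x)) = (\<lambda>x. L (laplacian f x))"
proof -
  note C = f[unfolded C_2_iff]
  have d1: "f differentiable at x" for x using C by blast
  have d2: "partial i f differentiable at x" for i x using C by blast
  have c: "continuous_on UNIV (partial j (partial i f))" for i j using C by blast
  note p1 = partial_bounded_linear[OF L d1] and p2 = partial_bounded_linear[OF L d2]
  show "C_k 2 (\<lambda>x. L (f x))"
    unfolding C_2_iff p1(2) p2(2)
    using p1(1) p2(1) c bounded_linear.continuous_on[OF L] by blast
  show "laplacian (\<lambda>x. L (f x)) = (\<lambda>x. L (laplacian f x))"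
    unfolding laplacian_def p1(2) p2(2) by (simp add: linear_sum[OF bounded_linear.linear[OF L]])
qed

lemma C_2_mult:
  fixes f g :: "real ^ 'd::finite \<Rightarrow> complex"
  assumes "C_k 2 f" "C_k 2 g"
  shows "C_k 2 (\<lambda>x. f x * g x)"
proof -
  have prod: "(\<lambda>x. f x * g x) differentiable at x \<and> partial i (\<lambda>x. f x * g x) = (\<lambda>x. f x * partial i g x + partial i f x * g x)"
    if "\<And>x. f differentiable at x" "\<And>x. g differentiable at x" for f g :: "real ^ 'd \<Rightarrow> complex" and i x
  proof -
    have d: "((\<lambda>x. f x * g x) has_derivative (\<lambda>h. f x * frechet_derivative g (at x) h + frechet_derivative f (at x) h * g x)) (at x)" for x
      using that frechet_derivative_works by (blast intro: has_derivative_mult)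
    then show ?thesis using partial_eqI[OF d] unfolding differentiable_def by (auto simp: partial_def)
  qed
  note Cf = assms(1)[unfolded C_2_iff] and Cg = assms(2)[unfolded C_2_iff]
  have df: "f differentiable at x" "partial i f differentiable at x" and dg: "g differentiable at x" "partial i g differentiable at x" for i x
    using Cf Cg by blast+
  have cf: "continuous_on UNIV f" "continuous_on UNIV (partial i f)" "continuous_on UNIV (partial j (partial i f))"
    and cg: "continuous_on UNIV g" "continuous_on UNIV (partial i g)" "continuous_on UNIV (partial j (partial i g))" for i j
    using Cf Cg differentiable_imp_continuous_UNIV by blast+
  have p: "(\<lambda>x. f x * g x) differentiable at x" "partial i (\<lambda>x. f x * g x) = (\<lambda>x. f x * partial i g x + partial i f x * g x)" for i x
    using prod[OF df(1) dg(1)] by blast+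
  have q1: "(\<lambda>x. f x * partial i g x) differentiable at x" "partial j (\<lambda>x. f x * partial i g x) = (\<lambda>x. f x * partial j (partial i g) x + partial j f x * partial i g x)"
    and q2: "(\<lambda>x. partial i f x * g x) differentiable at x" "partial j (\<lambda>x. partial i f x * g x) = (\<lambda>x. partial i f x * partial j g x + partial j (partial i f) x * g x)" for i j x
    using prod[OF df(1) dg(2)] prod[OF df(2) dg(1)] by blast+
  have pa: "partial j (\<lambda>x. F x + H x) = (\<lambda>x. partial j F x + partial j H x)"
    if "\<And>x. F differentiable at x" "\<And>x. H differentiable at x" for F H :: "real ^ 'd \<Rightarrow> complex" and j
  proof
    fix x
    have "((\<lambda>x. F x + H x) has_derivative (\<lambda>h. frechet_derivative F (at x) h + frechet_derivative H (at x) h)) (at x)"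
      using that frechet_derivative_works by (blast intro: has_derivative_add)
    from partial_eqI[OF this] show "partial j (\<lambda>x. F x + H x) x = partial j F x + partial j H x" by (simp add: partial_def)
  qed
  have "continuous_on UNIV (partial j (\<lambda>x. f x * partial i g x + partial i f x * g x))" for i j
    unfolding pa[OF q1(1) q2(1)] q1(2) q2(2) by (intro continuous_intros cf cg)
  moreover have "(\<lambda>x. f x * partial i g x + partial i f x * g x) differentiable at x" for i x
    by (intro differentiable_add q1 q2)
  ultimately show ?thesis unfolding C_2_iff p(2) using p(1) by blast
qed

lemma H_bound_laplacian:
  assumes "H_bound (r + 2) f A" "C_k 2 f"
  shows "H_bound r (laplacian f) A"
proof -
  have t: "torus_fun f" using assms(1) by (simp add: H_bound_def ctorus_def)
  have "wnorm r F (fc (laplacian f)) = wnorm r F (\<lambda>j. (norm (freq j))\<^sup>2 * fc f j)" for F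
    by (rule wnorm_cong) (simp add: fc_laplacian[OF t assms(2)] norm_mult)
  then show ?thesis
    using wnorm_laplacian_coeffs[OF assms(1)] fc_laplacian(1)[OF t assms(2)] by (simp add: H_bound_def)
qed

text \<open>The right-hand sides of the equations are continuous in space and bounded uniformly in time,
  because \<open>\<sigma> \<ge> 2\<close> leaves more than \<open>d/2\<close> derivatives after an application of the Laplacian.
  Differentiation under the integral then gives the equations for the coefficients.\<close>

lemma (in regularity) zakharov_modes_of_solution:
  assumes sol: "zakharov_solution a b \<psi> u u'"
    and psi_bound: "\<And>t. t \<in> {a..b} \<Longrightarrow> H_bound (s + 2 + \<sigma>) (\<psi> t) M"
    and U_bound: "\<And>t. t \<in> {a..b} \<Longrightarrow> H_bound (s + 1 + \<sigma>) (\<lambda>x :: real ^ 'd. complex_of_real (u t x)) M"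
    and U'_bound: "\<And>t. t \<in> {a..b} \<Longrightarrow> H_bound (s + \<sigma>) (\<lambda>x. complex_of_real (u' t x)) M"
  shows "zakharov_modes s \<sigma> M a b \<psi> (\<lambda>t x. of_real (u t x)) (\<lambda>t x. of_real (u' t x))"
proof -
  let ?U = "\<lambda>t x. complex_of_real (u t x)" and ?U' = "\<lambda>t x. complex_of_real (u' t x)"
  let ?W = "\<lambda>t x. \<psi> t x * cnj (\<psi> t x)" and ?G = "\<lambda>t x. ?U t x * \<psi> t x"
  note sol' = sol[unfolded zakharov_solution_def, rule_format]
  have C: "C_k 2 (\<psi> t)" "C_k 2 (u t)" if "t \<in> {a..b}" for t using sol'[OF that] by blast+
  have blr: "bounded_linear complex_of_real" by (rule bounded_linear_of_real)
  have CU: "C_k 2 (?U t)" and lapU: "laplacian (?U t) = (\<lambda>x. of_real (laplacian (u t) x))" if "t \<in> {a..b}" for t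
    using C_2_bounded_linear[OF blr C(2)[OF that]] by blast+
  have CW: "C_k 2 (?W t)" if "t \<in> {a..b}" for t
    by (intro C_2_mult C_2_bounded_linear(1)[OF bounded_linear_cnj] C that)
  have lapW: "laplacian (?W t) = (\<lambda>x. of_real (laplacian (\<lambda>y. (cmod (\<psi> t y))\<^sup>2) x))" if "t \<in> {a..b}" for t
  proof -
    have re: "(\<lambda>y. (cmod (\<psi> t y))\<^sup>2) = (\<lambda>y. Re (?W t y))" by (simp add: complex_norm_square[symmetric] del: Re_complex_of_real)
      (simp add: cmod_power2 power2_eq_square)
    have "C_k 2 (\<lambda>y. (cmod (\<psi> t y))\<^sup>2)" unfolding re by (rule C_2_bounded_linear(1)[OF bounded_linear_Re CW[OF that]])
    from C_2_bounded_linear(2)[OF blr this] show ?thesis by (simp only: complex_norm_square)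
  qed
  have G_bound: "H_bound (s + 1 + \<sigma>) (?G t) cG" if "t \<in> {a..b}" for t
    unfolding cG_def using s \<sigma> M that by (intro H_bound_mult U_bound H_bound_mono[OF psi_bound]) auto
  have W_bound: "H_bound (s + 2 + \<sigma>) (?W t) cW" if "t \<in> {a..b}" for t
    unfolding cW_def using s \<sigma> M that by (intro H_bound_mult psi_bound H_bound_cnj) auto
  have Hl\<psi>: "H_bound (s + \<sigma>) (laplacian (\<psi> t)) M" if "t \<in> {a..b}" for t
    by (rule H_bound_laplacian[OF _ C(1)[OF that]]) (rule H_bound_mono[OF psi_bound[OF that]], auto)
  have HlU: "H_bound (s + \<sigma> - 1) (laplacian (?U t)) M" if "t \<in> {a..b}" for t
    by (rule H_bound_laplacian[OF _ CU[OF that]]) (rule H_bound_mono[OF U_bound[OF that]], auto)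
  have HlW: "H_bound (s + \<sigma>) (laplacian (?W t)) cW" if "t \<in> {a..b}" for t
    by (rule H_bound_laplacian[OF _ CW[OF that]]) (rule H_bound_mono[OF W_bound[OF that]], auto)
  have r: "s + \<sigma> > real CARD('d) / 2" "s + 1 + \<sigma> > real CARD('d) / 2" "s + \<sigma> - 1 > real CARD('d) / 2" using s \<sigma> by auto
  show ?thesis
  proof (unfold_locales)
    fix t and j :: "int ^ 'd" assume t: "t \<in> {a..b}"
    note tor = t
    let ?y = "\<lambda>t x. \<i> * laplacian (\<psi> t) x - \<i> * ?G t x"
    have "((\<lambda>t. fc (\<psi> t) j) has_vector_derivative fc (?y t) j) (at t within {a..b})"
    proof (rule fc_time_derivative[OF _ _ _ _ t])
      fix t assume t: "t \<in> {a..b}"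
      show "ctorus (\<psi> t)" by (rule H_bound_ctorus[OF psi_bound[OF t]])
      show "ctorus (?y t)"
        using H_bound_ctorus[OF Hl\<psi>[OF t]] H_bound_ctorus[OF G_bound[OF t]] by (intro ctorus_diff ctorus_mult[OF ctorus_const])
      fix x
      show "((\<lambda>r. \<psi> r x) has_vector_derivative ?y t x) (at t within {a..b})"
      proof -
        let ?d = "vector_derivative (\<lambda>r. \<psi> r x) (at t within {a..b})"
        have "(\<lambda>r. \<psi> r x) differentiable at t within {a..b}" "\<i> * ?d = - laplacian (\<psi> t) x + ?G t x"
          using sol'[OF t] by auto
        then have "((\<lambda>r. \<psi> r x) has_vector_derivative ?d) (at t within {a..b})" by (simp add: vector_derivative_works)
        moreover have "?d = ?y t x"
        proof -
          have "?d = - \<i> * (\<i> * ?d)" by (simp flip: mult.assoc)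
          then show ?thesis unfolding \<open>\<i> * ?d = _\<close> by (simp add: algebra_simps)
        qed
        ultimately show ?thesis by simp
      qed
      have "cmod (?y t x) \<le> cmod (\<i> * laplacian (\<psi> t) x) + cmod (\<i> * ?G t x)" by (rule norm_triangle_ineq4)
      also have "\<dots> \<le> weight_const TYPE('d) (s + \<sigma>) * M + weight_const TYPE('d) (s + 1 + \<sigma>) * cG"
        using fourier_partial_sums(3)[OF Hl\<psi>[OF t] r(1), of x] fourier_partial_sums(3)[OF G_bound[OF t] r(2), of x]
        by (intro add_mono) (auto simp: norm_mult)
      finally show "cmod (?y t x) \<le> weight_const TYPE('d) (s + \<sigma>) * M + weight_const TYPE('d) (s + 1 + \<sigma>) * cG" .
    qed
    moreover have "fc (?y t) j = - \<i> * ((norm (freq j))\<^sup>2 * fc (\<psi> t) j + fc (?G t) j)"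
    proof -
      have eq: "fc (?y t) j = \<i> * fc (laplacian (\<psi> t)) j - \<i> * fc (?G t) j"
        using H_bound_ctorus[OF Hl\<psi>[OF t]] H_bound_ctorus[OF G_bound[OF t]] by (subst fc_diff) (auto simp only: fc_cmult intro!: ctorus_mult[OF ctorus_const])
      have "torus_fun (\<psi> t)" using sol'[OF t] by blast
      then show ?thesis unfolding eq fc_laplacian(2)[OF \<open>torus_fun (\<psi> t)\<close> C(1)[OF t]] by (simp add: algebra_simps)
    qed
    ultimately show "((\<lambda>t. fc (\<psi> t) j) has_vector_derivative
        - \<i> * ((norm (freq j))\<^sup>2 * fc (\<psi> t) j + fc (\<lambda>x. ?U t x * \<psi> t x) j)) (at t within {a..b})" by simp
    show "((\<lambda>t. fc (?U t) j) has_vector_derivative fc (?U' t) j) (at t within {a..b})"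
    proof (rule fc_time_derivative[OF _ _ _ _ t])
      fix t assume t: "t \<in> {a..b}"
      show "ctorus (?U t)" "ctorus (?U' t)" by (rule H_bound_ctorus[OF U_bound[OF t]] H_bound_ctorus[OF U'_bound[OF t]])+
      fix x
      show "((\<lambda>r. ?U r x) has_vector_derivative ?U' t x) (at t within {a..b})"
        using sol'[OF t] by (intro has_vector_derivative_of_real) auto
      show "cmod (?U' t x) \<le> weight_const TYPE('d) (s + \<sigma>) * M" by (rule fourier_partial_sums(3)[OF U'_bound[OF t] r(1)])
    qed
    let ?z = "\<lambda>t x. laplacian (?U t) x + laplacian (?W t) x"
    have "((\<lambda>t. fc (?U' t) j) has_vector_derivative fc (?z t) j) (at t within {a..b})"
    proof (rule fc_time_derivative[OF _ _ _ _ t])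
      fix t assume t: "t \<in> {a..b}"
      show "ctorus (?U' t)" by (rule H_bound_ctorus[OF U'_bound[OF t]])
      show "ctorus (?z t)" by (rule ctorus_add[OF H_bound_ctorus[OF HlU[OF t]] H_bound_ctorus[OF HlW[OF t]]])
      fix x
      have "((\<lambda>r. u' r x) has_real_derivative laplacian (u t) x + laplacian (\<lambda>y. (cmod (\<psi> t y))\<^sup>2) x) (at t within {a..b})"
        using sol'[OF t] by blast
      from has_vector_derivative_of_real[OF this]
      show "((\<lambda>r. ?U' r x) has_vector_derivative ?z t x) (at t within {a..b})"
        by (simp add: lapU[OF t] lapW[OF t])
      show "cmod (?z t x) \<le> weight_const TYPE('d) (s + \<sigma> - 1) * M + weight_const TYPE('d) (s + \<sigma>) * cW"
        using fourier_partial_sums(3)[OF HlU[OF t] r(3), of x] fourier_partial_sums(3)[OF HlW[OF t] r(1), of x]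
        by (intro order_trans[OF norm_triangle_ineq] add_mono) auto
    qed
    moreover have "fc (?z t) j = - ((norm (freq j))\<^sup>2 * (fc (?U t) j + fc (?W t) j))"
    proof -
      have "fc (?z t) j = fc (laplacian (?U t)) j + fc (laplacian (?W t)) j"
        by (rule fc_add[OF H_bound_ctorus[OF HlU[OF t]] H_bound_ctorus[OF HlW[OF t]]])
      moreover have "torus_fun (?U t)" "torus_fun (?W t)"
        using H_bound_ctorus[OF U_bound[OF t]] H_bound_ctorus[OF W_bound[OF t]] by (auto simp: ctorus_def)
      ultimately show ?thesis by (simp add: fc_laplacian CU[OF t] CW[OF t] algebra_simps)
    qed
    ultimately show "((\<lambda>t. fc (?U' t) j) has_vector_derivative
        - ((norm (freq j))\<^sup>2 * (fc (?U t) j + fc (\<lambda>x. \<psi> t x * cnj (\<psi> t x)) j))) (at t within {a..b})" by simp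
  qed (use psi_bound U_bound U'_bound in auto)
qed

section \<open>Sobolev norms and uniform bounds\<close>

lemma sobolev_density_eq: "sobolev_density r f j = (wt j powr r * cmod (fc f j))\<^sup>2"
  by (simp add: sobolev_density_def wt_def[symmetric] power_mult_distrib powr_power mult.commute)

lemma H_bound_of_sobolev:
  assumes "f \<in> sobolev_space r" "ctorus f" "sobolev_norm r f \<le> B"
  shows "H_bound r f B"
  unfolding H_bound_def
proof (intro conjI allI impI)
  fix F :: "(int ^ 'a) set" assume F: "finite F"
  have "wnorm r F (fc f) = sqrt (\<Sum>j\<in>F. sobolev_density r f j)" by (simp add: wnorm_def L2_set_def sobolev_density_eq)
  also have "\<dots> \<le> sobolev_norm r f"
    unfolding sobolev_norm_def
  proof (intro real_sqrt_le_mono finite_sum_le_infsum)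
    show "sobolev_density r f summable_on UNIV" using assms(1) by (simp add: sobolev_space_def)
  qed (use F in \<open>auto simp: sobolev_density_eq\<close>)
  finally show "wnorm r F (fc f) \<le> B" using assms(3) by simp
qed (rule assms)

text \<open>Uniform bounds on finite sums give summability, so that the infinite sum in \<open>sobolev_norm\<close> is the
  norm.\<close>

lemma sobolev_of_H_bound:
  fixes f :: "real ^ 'd::finite \<Rightarrow> complex"
  assumes h: "H_bound r f B"
  shows "f \<in> sobolev_space r" "sobolev_norm r f \<le> B"
proof -
  have c: "ctorus f" by (rule H_bound_ctorus[OF h])
  have B0: "0 \<le> B" by (rule H_bound_nonneg[OF h])
  have fin: "(\<Sum>j\<in>F. sobolev_density r f j) \<le> B\<^sup>2" if "finite F" for F
  proof -
    have "wnorm r F (fc f) \<le> B" using h that by (simp add: H_bound_def)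
    then have "sqrt (\<Sum>j\<in>F. sobolev_density r f j) \<le> B" by (simp add: wnorm_def L2_set_def sobolev_density_eq)
    then show ?thesis using B0 by (simp add: sqrt_le_D real_sqrt_le_iff' sum_nonneg sobolev_density_eq)
  qed
  have sm: "sobolev_density r f summable_on UNIV"
    by (rule nonneg_bdd_above_summable_on) (auto simp: sobolev_density_eq[of r f] simp del: power_mult_distrib intro!: bdd_aboveI2 fin[unfolded sobolev_density_eq])
  have "infsum (sobolev_density r f) UNIV \<le> B\<^sup>2"
    by (rule infsum_le_finite_sums[OF sm]) (use fin in auto)
  then show "sobolev_norm r f \<le> B" unfolding sobolev_norm_def using B0 by (simp add: real_le_lsqrt)
  have "continuous_on UNIV f" "torus_fun f" using c by (auto simp: ctorus_def)
  moreover from this(1) have "f \<in> borel_measurable lebesgue"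
    by (intro measurable_completion) (simp add: borel_measurable_continuous_onI)
  moreover have "set_integrable lebesgue torus_cell (\<lambda>x. (cmod (f x))\<^sup>2)"
    unfolding torus_cell_def
    by (intro absolutely_integrable_continuous continuous_intros continuous_on_subset[OF \<open>continuous_on UNIV f\<close>]) auto
  ultimately show "f \<in> sobolev_space r" using sm by (simp add: sobolev_space_def)
qed

section \<open>The splitting method in Fourier space\<close>

lemma multiplier_synth: "multiplier \<phi> (synth K a) = synth K (\<lambda>j. \<phi> (norm (freq j)) * a j)"
proof
  fix x
  have "multiplier \<phi> (synth K a) x = (\<Sum>\<^sub>\<infinity>j\<in>modes K. \<phi> (norm (freq j)) * a j * expi j x)"
    unfolding multiplier_def by (rule infsum_cong_neutral) (auto simp: fc_synth)
  then show "multiplier \<phi> (synth K a) x = synth K (\<lambda>j. \<phi> (norm (freq j)) * a j) x" by (simp add: synth_def)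
qed

lemma multiplier_0: "multiplier \<phi> (\<lambda>x. 0) = (\<lambda>x. 0)"
  by (simp add: multiplier_def fun_eq_iff)

lemma synth_add: "synth K a x + synth K b x = synth K (\<lambda>j. a j + b j) x"
  by (simp add: synth_def sum.distrib distrib_right)
lemma synth_diff: "synth K a x - synth K b x = synth K (\<lambda>j. a j - b j) x"
  by (simp add: synth_def sum_subtractf left_diff_distrib)
lemma synth_cmult: "c * synth K a x = synth K (\<lambda>j. c * a j) x"
  by (simp add: synth_def sum_distrib_left mult.assoc)

context discretization
begin

text \<open>Trigonometric polynomials of degree \<open>K\<close>. All components of the numerical solution are of this
  form, so their coefficients can be read off the grid.\<close>

definition "trig f \<longleftrightarrow> f = synth K (dft K f)"

lemma trig_synth: "trig (synth K a)"
  unfolding trig_def by (rule synth_cong) (simp add: dft_synth[OF K])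

lemma multiplier_trig: "trig f \<Longrightarrow> multiplier \<phi> f = synth K (\<lambda>j. \<phi> (om j) * dft K f j)"
  using multiplier_synth[of \<phi> K "dft K f"] by (simp flip: trig_def add: trig_def[THEN iffD1, symmetric])

text \<open>On trigonometric polynomials Fourier multipliers act on the coefficients of the grid, and
  interpolation of a product is \<open>synth\<close> of its discrete coefficients.\<close>

lemma lt_step_eq:
  fixes \<psi> u u' :: "real ^ 'd \<Rightarrow> complex"
  assumes "trig u" "trig u'"
  defines "w \<equiv> \<lambda>x. \<psi> x * cnj (\<psi> x)"
  shows "lt_step \<tau> K (\<psi>, u, u') =
    (synth K (\<lambda>j. exp (- \<i> * of_real (\<tau> * (om j)\<^sup>2)) * dft K (\<lambda>x. exp (- \<i> * of_real \<tau> * avg_pot u u' w x) * \<psi> x) j),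
     synth K (\<lambda>j. of_real (cos (\<tau> * om j)) * dft K u j + of_real (\<tau> * sc j) * dft K u' j + of_real (cos (\<tau> * om j) - 1) * dft K w j),
     synth K (\<lambda>j. of_real (- om j * sin (\<tau> * om j)) * dft K u j + of_real (cos (\<tau> * om j)) * dft K u' j
        + of_real (- om j * sin (\<tau> * om j)) * dft K w j))"
proof -
  have w: "interp K (\<lambda>x. complex_of_real ((cmod (\<psi> x))\<^sup>2)) = synth K (dft K w)"
    unfolding interp_eq_synth[OF K] w_def by (simp only: complex_norm_square)
  have dw: "multiplier \<phi> (synth K (dft K w)) = synth K (\<lambda>j. \<phi> (om j) * dft K w j)" for \<phi> by (rule multiplier_synth)
  have v: "multiplier (\<lambda>x. complex_of_real (sinc (\<tau> * x))) u x + complex_of_real \<tau> / 2 * multiplier (\<lambda>x. complex_of_real ((sinc (\<tau> * x / 2))\<^sup>2)) u' x +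
             multiplier (\<lambda>x. complex_of_real (sinc (\<tau> * x) - 1)) (synth K (dft K w)) x = avg_pot u u' w x" for x
  proof -
    have sqc: "complex_of_real \<tau> / 2 * (of_real ((sinc (\<tau> * om j / 2))\<^sup>2) * z) = of_real (sq j) * z" for j z
      by (simp add: sq_def)
    show ?thesis
      unfolding multiplier_trig[OF assms(1)] multiplier_trig[OF assms(2)] dw avg_pot_def synth_cmult synth_add
        sc_def[symmetric] sqc ..
  qed
  show ?thesis
    unfolding lt_step_def wave_R_def Let_def case_prod_conv w
    unfolding v
    unfolding multiplier_trig[OF assms(1)] multiplier_trig[OF assms(2)] dw multiplier_0
      interp_eq_synth[OF K] multiplier_synth mult_zero_right add_0_right synth_cmult synth_add synth_diff
      sc_def[symmetric] prod.inject
    by (intro conjI arg_cong[where f = "synth K"] ext) (simp_all add: algebra_simps)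
qed

definition "run z n = lie_trotter \<tau> K z n"

lemma run_trig:
  fixes z :: "(real ^ 'd \<Rightarrow> complex) \<times> (real ^ 'd \<Rightarrow> complex) \<times> (real ^ 'd \<Rightarrow> complex)"
  shows "trig (fst (run z n)) \<and> trig (fst (snd (run z n))) \<and> trig (snd (snd (run z n)))"
proof (induction n)
  case 0
  obtain f g h where "z = (f, g, h)" by (cases z)
  then show ?case by (simp add: run_def interp_eq_synth[OF K] trig_synth)
next
  case (Suc n)
  obtain f g h where z: "run z n = (f, g, h)" by (cases "run z n")
  have "run z (Suc n) = lt_step \<tau> K (f, g, h)" using z by (simp add: run_def)
  then show ?case using Suc unfolding z by (simp add: lt_step_eq trig_synth)
qed

text \<open>Inside \<open>modes K\<close> the coefficients of \<open>f - g\<close> are those of \<open>trunc f - g\<close>; outside they are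
  coefficients of \<open>f\<close> with weight at least \<open>K\<close>.\<close>

lemma trunc_error:
  fixes f :: "real ^ 'd \<Rightarrow> complex"
  assumes f: "H_bound q f B" "r + \<sigma> \<le> q" and g: "trig g"
  shows "H_bound r (\<lambda>x. f x - g x) (gnorm K r (\<lambda>x. trunc f x - g x) + B * \<eta>)"
  unfolding H_bound_def
proof (intro conjI allI impI)
  have gs: "g = synth K (dft K g)" using g by (simp add: trig_def)
  have cg: "ctorus g" by (subst gs) simp
  show "ctorus (\<lambda>x. f x - g x)" by (rule ctorus_diff[OF H_bound_ctorus[OF f(1)] cg])
  fix F :: "(int ^ 'd) set" assume F: "finite F"
  have fg: "fc g j = (if j \<in> modes K then dft K g j else 0)" for j by (subst gs) (rule fc_synth)
  let ?a = "\<lambda>j. if j \<in> modes K then fc f j - dft K g j else 0" and ?b = "\<lambda>j. if j \<in> modes K then 0 else fc f j"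
  have "wnorm r F (fc (\<lambda>x. f x - g x)) = wnorm r F (\<lambda>j. ?a j + ?b j)"
    by (rule wnorm_cong) (simp add: fc_diff H_bound_ctorus[OF f(1)] cg fg)
  also have "\<dots> \<le> wnorm r F ?a + wnorm r F ?b" by (rule wnorm_add)
  also have "wnorm r F ?a \<le> gnorm K r (\<lambda>x. trunc f x - g x)"
  proof -
    have "wnorm r F ?a \<le> wnorm r (F \<union> modes K) ?a" using F by (intro wnorm_subset) auto
    also have "\<dots> = wnorm r (modes K) ?a"
      unfolding wnorm_def L2_set_def using F by (intro arg_cong[where f = sqrt] sum.mono_neutral_right) auto
    also have "\<dots> = gnorm K r (\<lambda>x. trunc f x - g x)" unfolding gnorm_def by (rule wnorm_cong) (simp add: dft_diff dft_trunc)
    finally show ?thesis .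
  qed
  also have "wnorm r F ?b \<le> space_err * wnorm (r + \<sigma>) F (fc f)"
  proof (rule wnorm_multiplier)
    fix j :: "int ^ 'd"
    show "cmod (?b j) \<le> space_err * wt j powr \<sigma> * cmod (fc f j)"
    proof (cases "j \<in> modes K")
      case False
      then obtain i where "\<not> (- int K \<le> j $ i \<and> j $ i < int K)" by (auto simp: modes_def)
      then have "int K \<le> \<bar>j $ i\<bar>" by linarith
      then have "real_of_int (int K) \<le> real_of_int \<bar>j $ i\<bar>" by (simp only: of_int_le_iff)
      also have "\<dots> \<le> norm (freq j)" using component_le_norm_cart[of "freq j" i] by (simp add: freq_def)
      also have "\<dots> \<le> wt j" by simp
      finally have "real K powr \<sigma> \<le> wt j powr \<sigma>" using \<sigma> by (intro powr_mono2) auto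
      then have "1 \<le> space_err * wt j powr \<sigma>" using K by (simp add: space_err_def powr_minus pos_le_divide_eq inverse_eq_divide)
      from mult_right_mono[OF this, of "cmod (fc f j)"] show ?thesis using False by simp
    qed (use \<eta> in auto)
  qed (use \<eta> in auto)
  also have "space_err * wnorm (r + \<sigma>) F (fc f) \<le> \<eta> * B"
    using H_bound_mono[OF f order_refl] F \<eta> by (intro mult_mono) (auto simp: H_bound_def)
  finally show "wnorm r F (fc (\<lambda>x. f x - g x)) \<le> gnorm K r (\<lambda>x. trunc f x - g x) + B * \<eta>" by (simp add: mult.commute)
qed

end

lemma (in splitting_run) sobolev_error:
  assumes trig: "trig (p n)" "trig (u n)" "trig (u' n)"
    and T: "b = a + T" and sm: "exp (c_step * T) * (c_init + 1) * \<eta> \<le> 1" and T0: "0 \<le> T" and n: "real n * \<tau> \<le> T"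
  defines "E \<equiv> \<lambda>x. \<psi> (a + real n * \<tau>) x - p n x"
    and "F \<equiv> (\<lambda>x. U (a + real n * \<tau>) x - u n x, \<lambda>x. U' (a + real n * \<tau>) x - u' n x)"
  shows "E \<in> sobolev_space (s + 2) \<and> F \<in> energy_space s \<and> sobolev_norm (s + 2) E + energy_norm s F \<le> (c_final T + 3 * M) * \<eta>"
proof -
  let ?t = "a + real n * \<tau>"
  have t: "?t \<in> {a..b}" using T n \<tau> by auto
  have 1: "H_bound (s + 2) E (gnorm K (s + 2) (e n) + M * \<eta>)"
    unfolding E_def e_def h\<psi>_def tt_def by (rule trunc_error[OF psi_bound[OF t] _ trig(1)]) simp
  have 2: "H_bound (s + 1) (fst F) (gnorm K (s + 1) (f n) + M * \<eta>)"
    unfolding F_def f_def hU_def tt_def fst_conv by (rule trunc_error[OF U_bound[OF t] _ trig(2)]) simp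
  have 3: "H_bound s (snd F) (N (f' n) + M * \<eta>)"
    unfolding F_def f'_def hU'_def tt_def snd_conv by (rule trunc_error[OF U'_bound[OF t] _ trig(3)]) simp
  have "energy_norm s F \<le> sqrt ((gnorm K (s + 1) (f n) + M * \<eta>)\<^sup>2 + (N (f' n) + M * \<eta>)\<^sup>2)"
    unfolding energy_norm_def case_prod_unfold
    using sobolev_of_H_bound(2)[OF 2] sobolev_of_H_bound(2)[OF 3]
    by (intro real_sqrt_le_mono add_mono power_mono) (auto simp: sobolev_norm_def infsum_nonneg sobolev_density_eq)
  also have "\<dots> \<le> En n + sqrt ((M * \<eta>)\<^sup>2 + (M * \<eta>)\<^sup>2)" unfolding En_def by (rule real_sqrt_sum_squares_triangle_ineq)
  also have "sqrt ((M * \<eta>)\<^sup>2 + (M * \<eta>)\<^sup>2) \<le> M * \<eta> + M * \<eta>"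
    using M0 \<eta> by (intro sqrt_sum_squares_le_sum) auto
  finally have "sobolev_norm (s + 2) E + energy_norm s F \<le> (gnorm K (s + 2) (e n) + En n) + 3 * (M * \<eta>)"
    using sobolev_of_H_bound(2)[OF 1] by linarith
  also have "\<dots> \<le> c_final T * \<eta> + 3 * (M * \<eta>)" by (intro add_right_mono grid_error_bound T sm T0 n)
  finally show ?thesis
    using sobolev_of_H_bound(1)[OF 1] sobolev_of_H_bound(1)[OF 2] sobolev_of_H_bound(1)[OF 3]
    by (simp add: energy_space_def mem_Times_iff algebra_simps)
qed

section \<open>The CFL constant and the convergence theorem\<close>

text \<open>The modulus equals \<open>2 \<bar>sin (x / 2)\<bar>\<close>, that is \<open>x \<bar>sinc (x / 2)\<bar>\<close>, and \<open>sinc\<close> has no zero on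
  \<open>[0, c / 2]\<close> because \<open>c < 2 \<pi>\<close>. It attains a positive minimum there.\<close>

lemma cfl_constant:
  assumes "0 < c" "c < 2 * pi"
  obtains c1 :: real where "c1 > 0" "\<And>x. 0 \<le> x \<Longrightarrow> x \<le> c \<Longrightarrow> c1 * x \<le> cmod (exp (\<i> * of_real x) - 1)"
proof -
  have "continuous_on {0..c} (\<lambda>x. \<bar>sinc (x / 2)\<bar>)"
  proof (intro continuous_at_imp_continuous_on ballI)
    fix x
    have "isCont (\<lambda>x. sinc (x / 2)) x"
      by (rule isCont_o2[OF _ isCont_sinc]) auto
    then show "isCont (\<lambda>x. \<bar>sinc (x / 2)\<bar>) x" by (rule isCont_rabs)
  qed
  then obtain z where z: "z \<in> {0..c}" "\<And>x. x \<in> {0..c} \<Longrightarrow> \<bar>sinc (z / 2)\<bar> \<le> \<bar>sinc (x / 2)\<bar>"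
    using continuous_attains_inf[of "{0..c}" "\<lambda>x. \<bar>sinc (x / 2)\<bar>"] assms by fastforce
  have "\<bar>sinc (z / 2)\<bar> > 0"
    using z(1) assms sin_gt_zero[of "z / 2"] by (cases "z = 0") (auto simp: less_le)
  moreover have "\<bar>sinc (z / 2)\<bar> * x \<le> cmod (exp (\<i> * of_real x) - 1)" if x: "0 \<le> x" "x \<le> c" for x
  proof -
    have "\<bar>sinc (z / 2)\<bar> * x \<le> \<bar>sinc (x / 2)\<bar> * x" using z(2)[of x] x by (intro mult_right_mono) auto
    also have "\<dots> = 2 * \<bar>sin (x / 2)\<bar>" using x by (cases "x = 0") (auto simp: abs_mult)
    also have "\<dots> = cmod (exp (\<i> * of_real x) - 1)" using dist_exp_i_1[of x] by simp
    finally show ?thesis .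
  qed
  ultimately show ?thesis using that by blast
qed

theorem theorem2p3:
  fixes s \<sigma> M T c :: real
  assumes "s > real CARD('d::finite) / 2" and "\<sigma> \<ge> 2" and "M \<ge> 1" and "T > 0"
    and "0 < c" and "c < 2 * pi"
  shows "\<exists>(C :: real) (K\<^sub>0 :: nat) (\<tau>\<^sub>0 :: real). C > 0 \<and> K\<^sub>0 \<ge> 1 \<and> \<tau>\<^sub>0 > 0 \<and>
    (\<forall>(t\<^sub>0 :: real) (\<psi> :: real \<Rightarrow> real ^ 'd \<Rightarrow> complex) (u :: real \<Rightarrow> real ^ 'd \<Rightarrow> real)
        (u' :: real \<Rightarrow> real ^ 'd \<Rightarrow> real).
      zakharov_solution t\<^sub>0 (t\<^sub>0 + T) \<psi> u u' \<and>
      (\<forall>t\<in>{t\<^sub>0..t\<^sub>0 + T}.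
         \<psi> t \<in> sobolev_space (s + 2 + \<sigma>) \<and>
         (\<lambda>x. complex_of_real (u t x), \<lambda>x. complex_of_real (u' t x)) \<in> energy_space (s + \<sigma>) \<and>
         sobolev_norm (s + 2 + \<sigma>) (\<psi> t) +
           energy_norm (s + \<sigma>) (\<lambda>x. complex_of_real (u t x), \<lambda>x. complex_of_real (u' t x)) \<le> M)
      \<longrightarrow>
      (\<forall>(\<tau> :: real) (K :: nat) (n :: nat).
         0 < \<tau> \<and> \<tau> \<le> \<tau>\<^sub>0 \<and> K \<ge> K\<^sub>0 \<and> real CARD('d) * \<tau> * (real K)\<^sup>2 \<le> c \<and> real n * \<tau> \<le> T \<longrightarrow>
         (let t\<^sub>n = t\<^sub>0 + real n * \<tau>;
              (\<psi>\<^sub>n, u\<^sub>n, u'\<^sub>n) = lie_trotter \<tau> K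
                (\<psi> t\<^sub>0, \<lambda>x. complex_of_real (u t\<^sub>0 x), \<lambda>x. complex_of_real (u' t\<^sub>0 x)) n;
              e = (\<lambda>x. \<psi> t\<^sub>n x - \<psi>\<^sub>n x);
              f = (\<lambda>x. complex_of_real (u t\<^sub>n x) - u\<^sub>n x, \<lambda>x. complex_of_real (u' t\<^sub>n x) - u'\<^sub>n x)
          in e \<in> sobolev_space (s + 2) \<and> f \<in> energy_space s \<and>
             sobolev_norm (s + 2) e + energy_norm s f \<le> C * (\<tau> + real K powr (- \<sigma>)))))"
proof -
  interpret regularity "TYPE('d)" s \<sigma> M using assms by unfold_locales
  obtain c1 :: real where c1: "c1 > 0" "\<And>x. 0 \<le> x \<Longrightarrow> x \<le> c \<Longrightarrow> c1 * x \<le> cmod (exp (\<i> * of_real x) - 1)"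
    using cfl_constant[OF assms(5,6)] by blast
  define C where "C = max 1 (splitting_run.c_final TYPE('d) s \<sigma> M c1 T + 3 * M)"
  \<comment> \<open>The argument needs \<open>B * (\<tau> + K powr (- \<sigma>)) \<le> 1\<close>; the bounds \<open>\<tau>\<^sub>0\<close> and \<open>K\<^sub>0\<close> give one half
    to each term.\<close>
  define B where "B = max 1 (exp (splitting_run.c_step TYPE('d) s \<sigma> M c1 * T) * (splitting_run.c_init TYPE('d) s \<sigma> M + 1))"
  have B: "B \<ge> 1" by (simp add: B_def)
  define K\<^sub>0 where "K\<^sub>0 = nat \<lceil>(2 * B) powr (1 / \<sigma>)\<rceil> + 1"
  define \<tau>\<^sub>0 where "\<tau>\<^sub>0 = 1 / (2 * B)"
  have \<tau>\<^sub>0: "\<tau>\<^sub>0 > 0" "\<tau>\<^sub>0 \<le> 1" using B by (simp_all add: \<tau>\<^sub>0_def)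
  have K\<^sub>0: "real K powr (- \<sigma>) \<le> 1 / (2 * B)" if "K \<ge> K\<^sub>0" for K
  proof -
    have "(2 * B) powr (1 / \<sigma>) \<le> real K" using that unfolding K\<^sub>0_def by linarith
    then have "((2 * B) powr (1 / \<sigma>)) powr \<sigma> \<le> real K powr \<sigma>" using assms(2) by (intro powr_mono2) auto
    then have "2 * B \<le> real K powr \<sigma>" using assms(2) B by (simp add: powr_powr)
    then show ?thesis using B by (simp add: powr_minus divide_inverse le_imp_inverse_le flip: inverse_mult_distrib)
  qed
  show ?thesis
  proof (intro exI conjI allI impI)
    show "C > 0" "K\<^sub>0 \<ge> 1" "\<tau>\<^sub>0 > 0" using \<tau>\<^sub>0 by (auto simp: C_def K\<^sub>0_def)
    fix t\<^sub>0 :: real and \<psi> :: "real \<Rightarrow> real ^ 'd \<Rightarrow> complex" and u u' :: "real \<Rightarrow> real ^ 'd \<Rightarrow> real"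
      and \<tau> :: real and K n :: nat
    let ?U = "\<lambda>t x. complex_of_real (u t x)" and ?U' = "\<lambda>t x. complex_of_real (u' t x)"
    assume hyp: "zakharov_solution t\<^sub>0 (t\<^sub>0 + T) \<psi> u u' \<and>
      (\<forall>t\<in>{t\<^sub>0..t\<^sub>0 + T}.
         \<psi> t \<in> sobolev_space (s + 2 + \<sigma>) \<and> (?U t, ?U' t) \<in> energy_space (s + \<sigma>) \<and>
         sobolev_norm (s + 2 + \<sigma>) (\<psi> t) + energy_norm (s + \<sigma>) (?U t, ?U' t) \<le> M)"
      and par: "0 < \<tau> \<and> \<tau> \<le> \<tau>\<^sub>0 \<and> K \<ge> K\<^sub>0 \<and> real CARD('d) * \<tau> * (real K)\<^sup>2 \<le> c \<and> real n * \<tau> \<le> T"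
    have sol: "zakharov_solution t\<^sub>0 (t\<^sub>0 + T) \<psi> u u'" using hyp by blast
    have K1: "K \<ge> 1" using par by (simp add: K\<^sub>0_def)
    have H: "H_bound (s + 2 + \<sigma>) (\<psi> t) M" "H_bound (s + 1 + \<sigma>) (?U t) M" "H_bound (s + \<sigma>) (?U' t) M" if t: "t \<in> {t\<^sub>0..t\<^sub>0 + T}" for t
    proof -
      have reg: "torus_fun (\<psi> t)" "torus_fun (u t)" "torus_fun (u' t)" "C_k 2 (\<psi> t)" "C_k 2 (u t)" "C_k 0 (u' t)"
        using sol t unfolding zakharov_solution_def by blast+
      have cont: "continuous_on UNIV (\<psi> t)" "continuous_on UNIV (u t)" "continuous_on UNIV (u' t)"
        using reg differentiable_imp_continuous_UNIV unfolding C_2_iff by auto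
      have ct: "ctorus (\<psi> t)" "ctorus (?U t)" "ctorus (?U' t)"
        using reg cont by (auto simp: ctorus_def torus_fun_def intro!: continuous_intros)
      have mem: "\<psi> t \<in> sobolev_space (s + 2 + \<sigma>)" "?U t \<in> sobolev_space (s + \<sigma> + 1)" "?U' t \<in> sobolev_space (s + \<sigma>)"
        using hyp t by (auto simp: energy_space_def)
      have en: "sobolev_norm (s + 2 + \<sigma>) (\<psi> t) + sqrt ((sobolev_norm (s + \<sigma> + 1) (?U t))\<^sup>2 + (sobolev_norm (s + \<sigma>) (?U' t))\<^sup>2) \<le> M"
        using hyp t by (auto simp: energy_norm_def)
      have sn: "0 \<le> sobolev_norm r f" for r and f :: "real ^ 'd \<Rightarrow> complex"
        by (simp add: sobolev_norm_def infsum_nonneg sobolev_density_eq)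
      have "sobolev_norm (s + \<sigma> + 1) (?U t) \<le> sqrt ((sobolev_norm (s + \<sigma> + 1) (?U t))\<^sup>2 + (sobolev_norm (s + \<sigma>) (?U' t))\<^sup>2)"
        by (rule real_sqrt_sum_squares_ge1)
      moreover have "sobolev_norm (s + \<sigma>) (?U' t) \<le> sqrt ((sobolev_norm (s + \<sigma> + 1) (?U t))\<^sup>2 + (sobolev_norm (s + \<sigma>) (?U' t))\<^sup>2)"
        by (rule real_sqrt_sum_squares_ge2)
      moreover have "0 \<le> sqrt ((sobolev_norm (s + \<sigma> + 1) (?U t))\<^sup>2 + (sobolev_norm (s + \<sigma>) (?U' t))\<^sup>2)" by simp
      ultimately have b: "sobolev_norm (s + 2 + \<sigma>) (\<psi> t) \<le> M" "sobolev_norm (s + \<sigma> + 1) (?U t) \<le> M" "sobolev_norm (s + \<sigma>) (?U' t) \<le> M"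
        using en sn[of "s + 2 + \<sigma>" "\<psi> t"] by linarith+
      show "H_bound (s + 2 + \<sigma>) (\<psi> t) M" by (rule H_bound_of_sobolev[OF mem(1) ct(1) b(1)])
      show "H_bound (s + 1 + \<sigma>) (?U t) M" using H_bound_of_sobolev[OF mem(2) ct(2) b(2)] by (simp add: add_ac)
      show "H_bound (s + \<sigma>) (?U' t) M" by (rule H_bound_of_sobolev[OF mem(3) ct(3) b(3)])
    qed
    interpret G: discretization "TYPE('d)" s \<sigma> M K \<tau>
      by unfold_locales (use K1 par \<tau>\<^sub>0 in auto)
    interpret Z: zakharov_modes "TYPE('d)" s \<sigma> M t\<^sub>0 "t\<^sub>0 + T" \<psi> ?U ?U'
      by (rule zakharov_modes_of_solution[OF sol H])
    interpret discretized_solution "TYPE('d)" s \<sigma> M t\<^sub>0 "t\<^sub>0 + T" \<psi> ?U ?U' K \<tau> ..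
    define z where "z = (\<psi> t\<^sub>0, ?U t\<^sub>0, ?U' t\<^sub>0)"
    define pn where "pn n = fst (G.run z n)" for n
    define un where "un n = fst (snd (G.run z n))" for n
    define un' where "un' n = snd (snd (G.run z n))" for n
    have run: "lie_trotter \<tau> K z n = (pn n, un n, un' n)" for n by (simp add: pn_def un_def un'_def G.run_def)
    have trig: "G.trig (pn n)" "G.trig (un n)" "G.trig (un' n)" for n
      using G.run_trig[of z n] by (auto simp: pn_def un_def un'_def)
    have step: "(pn (Suc n), un (Suc n), un' (Suc n)) = lt_step \<tau> K (pn n, un n, un' n)" for n
      using run[of "Suc n"] run[of n] by simp
    note step' = step[unfolded G.lt_step_eq[OF trig(2) trig(3)] prod.inject, THEN conjunct1]
      step[unfolded G.lt_step_eq[OF trig(2) trig(3)] prod.inject, THEN conjunct2, THEN conjunct1]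
      step[unfolded G.lt_step_eq[OF trig(2) trig(3)] prod.inject, THEN conjunct2, THEN conjunct2]
    have init: "pn 0 = interp K (\<psi> t\<^sub>0)" "un 0 = interp K (?U t\<^sub>0)" "un' 0 = interp K (?U' t\<^sub>0)"
      using run[of 0] by (simp_all add: z_def)
    interpret X: splitting_run "TYPE('d)" s \<sigma> M t\<^sub>0 "t\<^sub>0 + T" \<psi> ?U ?U' K \<tau> pn un un' c1
    proof unfold_locales
      fix j :: "int ^ 'd" assume j: "j \<in> modes K"
      \<comment> \<open>On the modes \<open>|j|\<^sup>2 \<le> d K\<^sup>2\<close>, so the restriction \<open>d \<tau> K\<^sup>2 \<le> c\<close> puts \<open>\<tau> |j|\<^sup>2\<close> into \<open>[0, c]\<close>.\<close>
      show "c1 * (\<tau> * (norm (freq j))\<^sup>2) \<le> cmod (exp (\<i> * of_real (\<tau> * (norm (freq j))\<^sup>2)) - 1)"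
      proof (rule c1(2))
        have "(norm (freq j))\<^sup>2 \<le> real CARD('d) * (real K)\<^sup>2"
        proof -
          have "(norm (freq j))\<^sup>2 = (\<Sum>i\<in>UNIV. (real_of_int (j $ i))\<^sup>2)"
            by (simp only: power2_norm_eq_inner freq_inner) (simp add: freq_def power2_eq_square)
          also have "\<dots> \<le> (\<Sum>i\<in>(UNIV::'d set). (real K)\<^sup>2)"
          proof (rule sum_mono)
            fix i
            have "- int K \<le> j $ i" "j $ i < int K" using j by (auto simp: modes_def)
            then have "\<bar>j $ i\<bar> \<le> int K" by linarith
            then have "real_of_int \<bar>j $ i\<bar> \<le> real_of_int (int K)" by (simp only: of_int_le_iff)
            then show "(real_of_int (j $ i))\<^sup>2 \<le> (real K)\<^sup>2" by (simp add: abs_le_square_iff[symmetric])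
          qed
          finally show ?thesis by simp
        qed
        then have "\<tau> * (norm (freq j))\<^sup>2 \<le> \<tau> * (real CARD('d) * (real K)\<^sup>2)" using par by (intro mult_left_mono) auto
        also have "\<dots> \<le> c" using par by (simp add: mult_ac)
        finally show "\<tau> * (norm (freq j))\<^sup>2 \<le> c" .
      qed (use par in auto)
      show "dft K (pn 0) j = dft K (\<psi> t\<^sub>0) j" "dft K (un 0) j = dft K (?U t\<^sub>0) j" "dft K (un' 0) j = dft K (?U' t\<^sub>0) j"
        unfolding init interp_eq_synth[OF K1] by (simp_all add: dft_synth[OF K1 j])
      fix n
      show "dft K (pn (Suc n)) j = exp (- \<i> * of_real (\<tau> * (norm (freq j))\<^sup>2)) *
        dft K (\<lambda>x. exp (- \<i> * of_real \<tau> * G.avg_pot (un n) (un' n) (\<lambda>x. pn n x * cnj (pn n x)) x) * pn n x) j"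
        unfolding step' by (rule dft_synth[OF K1 j])
      show "dft K (un (Suc n)) j = of_real (cos (\<tau> * norm (freq j))) * dft K (un n) j
        + of_real (\<tau> * sinc (\<tau> * norm (freq j))) * dft K (un' n) j
        + of_real (cos (\<tau> * norm (freq j)) - 1) * dft K (\<lambda>x. pn n x * cnj (pn n x)) j"
        unfolding step' G.sc_def[symmetric] by (rule dft_synth[OF K1 j])
      show "dft K (un' (Suc n)) j = of_real (- norm (freq j) * sin (\<tau> * norm (freq j))) * dft K (un n) j
        + of_real (cos (\<tau> * norm (freq j))) * dft K (un' n) j
        + of_real (- norm (freq j) * sin (\<tau> * norm (freq j))) * dft K (\<lambda>x. pn n x * cnj (pn n x)) j"
        unfolding step' by (rule dft_synth[OF K1 j])
    qed (rule c1(1))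
    have \<eta>: "G.\<eta> = \<tau> + real K powr (- \<sigma>)" by (simp add: G.\<eta>_def G.space_err_def)
    have "G.\<eta> \<le> 1 / B"
    proof -
      have "\<tau> \<le> 1 / (2 * B)" "real K powr (- \<sigma>) \<le> 1 / (2 * B)" using par K\<^sub>0[of K] by (auto simp: \<tau>\<^sub>0_def)
      then have "G.\<eta> \<le> 1 / (2 * B) + 1 / (2 * B)" unfolding \<eta> by (rule add_mono)
      then show ?thesis using B by (simp add: field_simps)
    qed
    then have "B * G.\<eta> \<le> 1" using B by (simp add: field_simps)
    moreover have "exp (X.c_step * T) * (X.c_init + 1) * G.\<eta> \<le> B * G.\<eta>"
      using G.\<eta> by (intro mult_right_mono) (auto simp: B_def)
    ultimately have sm: "exp (X.c_step * T) * (X.c_init + 1) * G.\<eta> \<le> 1" by linarith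
    have T0: "0 \<le> T" using assms(4) by simp
    have nT: "real n * \<tau> \<le> T" using par by simp
    note X.sobolev_error[OF trig refl sm T0 nT]
    moreover have "(X.c_final T + 3 * M) * G.\<eta> \<le> C * (\<tau> + real K powr (- \<sigma>))"
      unfolding \<eta>[symmetric] using G.\<eta> by (intro mult_right_mono) (auto simp: C_def)
    ultimately show "let t\<^sub>n = t\<^sub>0 + real n * \<tau>;
              (\<psi>\<^sub>n, u\<^sub>n, u'\<^sub>n) = lie_trotter \<tau> K (\<psi> t\<^sub>0, ?U t\<^sub>0, ?U' t\<^sub>0) n;
              e = (\<lambda>x. \<psi> t\<^sub>n x - \<psi>\<^sub>n x);
              f = (\<lambda>x. complex_of_real (u t\<^sub>n x) - u\<^sub>n x, \<lambda>x. complex_of_real (u' t\<^sub>n x) - u'\<^sub>n x)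
          in e \<in> sobolev_space (s + 2) \<and> f \<in> energy_space s \<and>
             sobolev_norm (s + 2) e + energy_norm s f \<le> C * (\<tau> + real K powr (- \<sigma>))"
      unfolding Let_def run[unfolded z_def] case_prod_conv by linarith
  qed
qed

end
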